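(* Let $\mathfrak{M}=(\mathcal{Q},\mathcal{W},\mathcal{R})$ be an hereditary abelian model structure on an abelian category $\mathcal{A}$. For each $n\in\mathbb{Z}$, $r\mathrm{Ext}^n_{\mathfrak{M}}(A,B)$ is a covariant additive functor in the variable $B\in\mathcal{A}$ and a contravariant additive functor in the variable $A\in\mathcal{A}$. It satisfies the following properties: (1) If $B$ is fibrant, then each cofibration $f:A\to A'$ induces a long exact cohomology sequence $$\cdots\to r\mathrm{Ext}^{n-1}_{\mathfrak{M}}(A,B)\to r\mathrm{Ext}^{n}_{\mathfrak{M}}(\mathrm{cok} f,B)\to r\mathrm{Ext}^{n}_{\mathfrak{M}}(A',B)\to r\mathrm{Ext}^{n}_{\mathfrak{M}}(A,B)\to r\mathrm{Ext}^{n+1}_{\mathfrak{M}}(\mathrm{cok} f,B)\to\cdots$$ Moreover, each functor $r\mathrm{Ext}^n_{\mathfrak{M}}(-,B)$ identifies right homotopic maps whenever $B$ is fibrant; in particular it factors through $\gamma_\omega:\mathcal{A}\to \mathrm{St}_\omega(\mathcal{A})$. (2) If $A$ is cofibrant, then each fibration $g:B\to B'$ induces a long exact cohomology sequence $$\cdots\to r\mathrm{Ext}^{n-1}_{\mathfrak{M}}(A,B')\to r\mathrm{Ext}^{n}_{\mathfrak{M}}(A,\ker g)\to r\mathrm{Ext}^{n}_{\mathfrak{M}}(A,B)\to r\mathrm{Ext}^{n}_{\mathfrak{M}}(A,B')\to r\mathrm{Ext}^{n+1}_{\mathfrak{M}}(A,\ker g)\to\cdots$$ Moreover, for any $A$,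 $r\mathrm{Ext}^n_{\mathfrak{M}}(A,-)$ factors through $\gamma_\omega:\mathcal{A}\to \mathrm{St}_\omega(\mathcal{A})$.
   Context: $\mathrm{Ext}^n_{\mathcal{A}}$ denotes the Yoneda Ext groups of the abelian category $\mathcal{A}$ (no enough projectives or injectives assumed). For a class $\mathcal{C}$ of objects, $\mathcal{C}^\perp=\{X:\mathrm{Ext}^1_{\mathcal{A}}(C,X)=0\ \forall C\in\mathcal{C}\}$, and ${}^\perp\mathcal{C}$ is defined dually. A cotorsion pair is a pair of classes $(\mathcal{X},\mathcal{Y})$ with $\mathcal{Y}=\mathcal{X}^\perp$ and $\mathcal{X}={}^\perp\mathcal{Y}$. It is complete if every object $A$ admits short exact sequences $0\to Y\to X\to A\to0$ and $0\to A\to Y'\to X'\to 0$ with $X,X'\in\mathcal{X}$, $Y,Y'\in\mathcal{Y}$; it is hereditary if $\mathrm{Ext}^i_{\mathcal{A}}(X,Y)=0$ for all $X\in\mathcal{X}$, $Y\in\mathcal{Y}$, $i\ge1$. An hereditary abelian model structure is a triple $\mathfrak{M}=(\mathcal{Q},\mathcal{W},\mathcal{R})$ of classes of objects such that $\mathcal{W}$ is thick (2 out of 3 property on short exact sequences) and, with $\mathcal{Q}_{\mathcal{W}}=\mathcal{Q}\cap\mathcal{W}$ and $\mathcal{R}_{\mathcal{W}}=\mathcal{W}\cap\mathcal{R}$, both $(\mathcal{Q},\mathcal{R}_{\mathcal{W}})$ and $(\mathcal{Q}_{\mathcal{W}},\mathcal{R})$ are complete hereditary cotorsion pairs. Objects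 of $\mathcal{Q},\mathcal{R},\mathcal{Q}_{\mathcal{W}},\mathcal{R}_{\mathcal{W}}$ are called cofibrant, fibrant, trivially cofibrant, trivially fibrant, respectively. A cofibration is a monomorphism with cofibrant cokernel; a fibration is an epimorphism with fibrant kernel. The core is $\omega=\mathcal{Q}\cap\mathcal{W}\cap\mathcal{R}$. Two parallel morphisms $f,g$ are right homotopic if $g-f$ factors through an object of $\mathcal{Q}_{\mathcal{W}}$, and homotopic ($f\sim^\omega g$) if $g-f$ factors through an object of $\omega$. $\mathrm{St}_\omega(\mathcal{A})$ is the additive category with the objects of $\mathcal{A}$ and morphism groups $\mathrm{Hom}_{\mathcal{A}}(A,B)/\sim^\omega$; $\gamma_\omega$ is the canonical functor. An $\mathfrak{M}$-coresolution of $B$ is an exact cochain complex $W^B\equiv\cdots\to Q^{-2}\xrightarrow{d^{-2}}Q^{-1}\xrightarrow{d^{-1}}R^{0}\xrightarrow{d^0}R^{1}\to\cdots$ (superscripts are degrees) with $d^{-1}=\eta_B\epsilon_B$, where $\cdots\to Q^{-2}\to Q^{-1}\xrightarrow{\epsilon_B}B\to0$ is exact with each $Q^i\in\mathcal{Q}_{\mathcal{W}}$ and $\ker\epsilon_B$, $\ker d^i$ ($i\le-2$) in $\mathcal{R}$, and $0\to B\xrightarrow{\eta_B}R^{0}\to R^{1}\to\cdots$ is exact with each $R^i\in\mathcal{R}_{\mathcal{W}}$ and $\mathrm{cok}\,\eta_B$, $\mathrm{cok}\, d^i$ ($i\ge0$) in $\mathcal{Q}$. One defines $r\mathrm{Ext}^n_{\mathfrak{M}}(A,B):=H^n[\mathrm{Hom}_{\mathcal{A}}(A,W^B)]$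 for any $\mathfrak{M}$-coresolution $W^B$ of $B$; a different choice of $W^B$ gives a canonically isomorphic group. A morphism $g:B\to B'$ acts through a cochain map $W^B\to W^{B'}$ extending $g$ (compatible with the maps $\epsilon$ and $\eta$), which exists and is unique up to homotopy. *)

theory Defs
  imports "HOL-Algebra.Exact_Sequence"
begin

section \<open>Abelian categories\<close>

text \<open>
  Every arrow determines its domain and codomain. \<open>Add\<close> is meaningful only for parallel
  arrows, and \<open>g \<odot> f\<close> (first \<open>f\<close>, then \<open>g\<close>) only for composable ones.
\<close>

record ('o, 'm) precat =
  Ob :: "'o set"
  Arr :: "'m set"
  Dom :: "'m \<Rightarrow> 'o"
  Cod :: "'m \<Rightarrow> 'o"
  Id :: "'o \<Rightarrow> 'm"
  Comp :: "'m \<Rightarrow> 'm \<Rightarrow> 'm" (infixl \<open>\<odot>\<index>\<close> 70)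
  Add :: "'m \<Rightarrow> 'm \<Rightarrow> 'm"
  Zero :: "'o \<Rightarrow> 'o \<Rightarrow> 'm"

definition homs :: "('o, 'm) precat \<Rightarrow> 'o \<Rightarrow> 'o \<Rightarrow> 'm set" where
  "homs C A B = {f \<in> Arr C. Dom C f = A \<and> Cod C f = B}"

definition hom_group :: "('o, 'm) precat \<Rightarrow> 'o \<Rightarrow> 'o \<Rightarrow> 'm monoid" where
  "hom_group C A B = \<lparr>carrier = homs C A B, monoid.mult = Add C, one = Zero C A B\<rparr>"

definition Minus :: "('o, 'm) precat \<Rightarrow> 'm \<Rightarrow> 'm \<Rightarrow> 'm" where
  "Minus C g f = Add C g (inv\<^bsub>hom_group C (Dom C f) (Cod C f)\<^esub> f)"

locale preadditive_category =
  fixes C :: "('o, 'm) precat"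
  assumes Dom_in: "f \<in> Arr C \<Longrightarrow> Dom C f \<in> Ob C"
    and Cod_in: "f \<in> Arr C \<Longrightarrow> Cod C f \<in> Ob C"
    and Id_in: "A \<in> Ob C \<Longrightarrow> Id C A \<in> homs C A A"
    and Comp_in: "\<lbrakk>f \<in> homs C A B; g \<in> homs C B D\<rbrakk> \<Longrightarrow> g \<odot>\<^bsub>C\<^esub> f \<in> homs C A D"
    and Comp_Id_right: "f \<in> homs C A B \<Longrightarrow> f \<odot>\<^bsub>C\<^esub> Id C A = f"
    and Comp_Id_left: "f \<in> homs C A B \<Longrightarrow> Id C B \<odot>\<^bsub>C\<^esub> f = f"
    and Comp_assoc: "\<lbrakk>f \<in> homs C A B; g \<in> homs C B D; h \<in> homs C D E\<rbrakk>
        \<Longrightarrow> (h \<odot>\<^bsub>C\<^esub> g) \<odot>\<^bsub>C\<^esub> f = h \<odot>\<^bsub>C\<^esub> (g \<odot>\<^bsub>C\<^esub> f)"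
    and hom_comm_group: "\<lbrakk>A \<in> Ob C; B \<in> Ob C\<rbrakk> \<Longrightarrow> comm_group (hom_group C A B)"
    and Comp_Add_right: "\<lbrakk>f \<in> homs C A B; f' \<in> homs C A B; g \<in> homs C B D\<rbrakk>
        \<Longrightarrow> g \<odot>\<^bsub>C\<^esub> Add C f f' = Add C (g \<odot>\<^bsub>C\<^esub> f) (g \<odot>\<^bsub>C\<^esub> f')"
    and Comp_Add_left: "\<lbrakk>f \<in> homs C A B; g \<in> homs C B D; g' \<in> homs C B D\<rbrakk>
        \<Longrightarrow> Add C g g' \<odot>\<^bsub>C\<^esub> f = Add C (g \<odot>\<^bsub>C\<^esub> f) (g' \<odot>\<^bsub>C\<^esub> f)"

definition op_category :: "('o, 'm) precat \<Rightarrow> ('o, 'm) precat" where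
  "op_category C = C\<lparr>Dom := Cod C, Cod := Dom C, Comp := (\<lambda>g f. f \<odot>\<^bsub>C\<^esub> g),
     Zero := (\<lambda>A B. Zero C B A)\<rparr>"

definition is_mono :: "('o, 'm) precat \<Rightarrow> 'm \<Rightarrow> bool" where
  "is_mono C f \<longleftrightarrow> f \<in> Arr C \<and>
     (\<forall>X u v. u \<in> homs C X (Dom C f) \<longrightarrow> v \<in> homs C X (Dom C f) \<longrightarrow> f \<odot>\<^bsub>C\<^esub> u = f \<odot>\<^bsub>C\<^esub> v \<longrightarrow> u = v)"

definition is_epi :: "('o, 'm) precat \<Rightarrow> 'm \<Rightarrow> bool" where
  "is_epi C f \<longleftrightarrow> f \<in> Arr C \<and>
     (\<forall>X u v. u \<in> homs C (Cod C f) X \<longrightarrow> v \<in> homs C (Cod C f) X \<longrightarrow> u \<odot>\<^bsub>C\<^esub> f = v \<odot>\<^bsub>C\<^esub> f \<longrightarrow> u = v)"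

definition is_kernel :: "('o, 'm) precat \<Rightarrow> 'm \<Rightarrow> 'm \<Rightarrow> bool" where
  "is_kernel C k f \<longleftrightarrow> f \<in> Arr C \<and> k \<in> Arr C \<and> Cod C k = Dom C f \<and>
     f \<odot>\<^bsub>C\<^esub> k = Zero C (Dom C k) (Cod C f) \<and>
     (\<forall>X h. h \<in> homs C X (Dom C f) \<longrightarrow> f \<odot>\<^bsub>C\<^esub> h = Zero C X (Cod C f) \<longrightarrow>
        (\<exists>!u. u \<in> homs C X (Dom C k) \<and> k \<odot>\<^bsub>C\<^esub> u = h))"

definition is_cokernel :: "('o, 'm) precat \<Rightarrow> 'm \<Rightarrow> 'm \<Rightarrow> bool" where
  "is_cokernel C c f \<longleftrightarrow> f \<in> Arr C \<and> c \<in> Arr C \<and> Dom C c = Cod C f \<and>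
     c \<odot>\<^bsub>C\<^esub> f = Zero C (Dom C f) (Cod C c) \<and>
     (\<forall>X h. h \<in> homs C (Cod C f) X \<longrightarrow> h \<odot>\<^bsub>C\<^esub> f = Zero C (Dom C f) X \<longrightarrow>
        (\<exists>!u. u \<in> homs C (Cod C c) X \<and> u \<odot>\<^bsub>C\<^esub> c = h))"

definition is_zero_object :: "('o, 'm) precat \<Rightarrow> 'o \<Rightarrow> bool" where
  "is_zero_object C Z \<longleftrightarrow> Z \<in> Ob C \<and>
     (\<forall>A\<in>Ob C. (\<exists>!f. f \<in> homs C A Z) \<and> (\<exists>!f. f \<in> homs C Z A))"

definition is_biproduct :: "('o, 'm) precat \<Rightarrow> 'o \<Rightarrow> 'o \<Rightarrow> 'o \<Rightarrow> 'm \<Rightarrow> 'm \<Rightarrow> 'm \<Rightarrow> 'm \<Rightarrow> bool" where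
  "is_biproduct C A B P i\<^sub>A i\<^sub>B p\<^sub>A p\<^sub>B \<longleftrightarrow>
     i\<^sub>A \<in> homs C A P \<and> i\<^sub>B \<in> homs C B P \<and> p\<^sub>A \<in> homs C P A \<and> p\<^sub>B \<in> homs C P B \<and>
     p\<^sub>A \<odot>\<^bsub>C\<^esub> i\<^sub>A = Id C A \<and> p\<^sub>B \<odot>\<^bsub>C\<^esub> i\<^sub>B = Id C B \<and>
     p\<^sub>B \<odot>\<^bsub>C\<^esub> i\<^sub>A = Zero C A B \<and> p\<^sub>A \<odot>\<^bsub>C\<^esub> i\<^sub>B = Zero C B A \<and>
     Add C (i\<^sub>A \<odot>\<^bsub>C\<^esub> p\<^sub>A) (i\<^sub>B \<odot>\<^bsub>C\<^esub> p\<^sub>B) = Id C P"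

locale abelian_category = preadditive_category C for C :: "('o, 'm) precat" +
  assumes zero_object: "\<exists>Z. is_zero_object C Z"
    and biproducts: "\<lbrakk>A \<in> Ob C; B \<in> Ob C\<rbrakk> \<Longrightarrow> \<exists>P i\<^sub>A i\<^sub>B p\<^sub>A p\<^sub>B. is_biproduct C A B P i\<^sub>A i\<^sub>B p\<^sub>A p\<^sub>B"
    and kernels: "f \<in> Arr C \<Longrightarrow> \<exists>k. is_kernel C k f"
    and cokernels: "f \<in> Arr C \<Longrightarrow> \<exists>c. is_cokernel C c f"
    and mono_normal: "is_mono C f \<Longrightarrow> \<exists>g. is_kernel C f g"
    and epi_normal: "is_epi C f \<Longrightarrow> \<exists>g. is_cokernel C f g"

definition is_image :: "('o, 'm) precat \<Rightarrow> 'm \<Rightarrow> 'm \<Rightarrow> bool" where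
  "is_image C m f \<longleftrightarrow> (\<exists>c. is_cokernel C c f \<and> is_kernel C m c)"

text \<open>Exactness of \<open>\<bullet> \<rightarrow> \<bullet> \<rightarrow> \<bullet>\<close> (first \<open>f\<close>, then \<open>g\<close>) at the middle object: the image of \<open>f\<close> is the kernel of \<open>g\<close>.\<close>

definition exact_at :: "('o, 'm) precat \<Rightarrow> 'm \<Rightarrow> 'm \<Rightarrow> bool" where
  "exact_at C f g \<longleftrightarrow> (\<exists>m. is_image C m f \<and> is_kernel C m g)"

definition short_exact :: "('o, 'm) precat \<Rightarrow> 'm \<Rightarrow> 'm \<Rightarrow> bool" where
  "short_exact C f g \<longleftrightarrow> is_mono C f \<and> exact_at C f g \<and> is_epi C g"

definition kernel_in :: "('o, 'm) precat \<Rightarrow> 'm \<Rightarrow> 'o set \<Rightarrow> bool" where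
  "kernel_in C f S \<longleftrightarrow> (\<exists>k. is_kernel C k f \<and> Dom C k \<in> S)"

definition cokernel_in :: "('o, 'm) precat \<Rightarrow> 'm \<Rightarrow> 'o set \<Rightarrow> bool" where
  "cokernel_in C f S \<longleftrightarrow> (\<exists>c. is_cokernel C c f \<and> Cod C c \<in> S)"


section \<open>Yoneda Ext and cotorsion pairs\<close>

text \<open>
  For \<open>n \<ge> 1\<close>, an \<open>n\<close>-extension \<open>0 \<rightarrow> B \<rightarrow> E 1 \<rightarrow> \<dots> \<rightarrow> E n \<rightarrow> A \<rightarrow> 0\<close> of \<open>A\<close> by \<open>B\<close> is stored with
  \<open>E 0 = B\<close>, \<open>E (n + 1) = A\<close> and \<open>d i : E i \<rightarrow> E (i + 1)\<close>. The values of \<open>E\<close> above \<open>n + 1\<close> and of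
  \<open>d\<close> above \<open>n\<close> are irrelevant: morphisms of extensions ignore them, so two extensions that
  differ only there are equivalent.
\<close>

definition extensions ::
  "('o, 'm) precat \<Rightarrow> nat \<Rightarrow> 'o \<Rightarrow> 'o \<Rightarrow> ((nat \<Rightarrow> 'o) \<times> (nat \<Rightarrow> 'm)) set" where
  "extensions C n A B = {(E, d). E 0 = B \<and> E (n + 1) = A \<and>
     (\<forall>i\<le>n. d i \<in> homs C (E i) (E (i + 1))) \<and>
     is_mono C (d 0) \<and> (\<forall>i<n. exact_at C (d i) (d (i + 1))) \<and> is_epi C (d n)}"

definition extension_arrows ::
  "('o, 'm) precat \<Rightarrow> nat \<Rightarrow> 'o \<Rightarrow> 'o \<Rightarrow> ((nat \<Rightarrow> 'o) \<times> (nat \<Rightarrow> 'm)) rel" where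
  "extension_arrows C n A B = {((E, d), (E', d')).
     (E, d) \<in> extensions C n A B \<and> (E', d') \<in> extensions C n A B \<and>
     (\<exists>u. (\<forall>i\<le>n + 1. u i \<in> homs C (E i) (E' i)) \<and> u 0 = Id C B \<and> u (n + 1) = Id C A \<and>
          (\<forall>i\<le>n. u (i + 1) \<odot>\<^bsub>C\<^esub> d i = d' i \<odot>\<^bsub>C\<^esub> u i))}"

definition yoneda_Ext ::
  "('o, 'm) precat \<Rightarrow> nat \<Rightarrow> 'o \<Rightarrow> 'o \<Rightarrow> ((nat \<Rightarrow> 'o) \<times> (nat \<Rightarrow> 'm)) set set" where
  "yoneda_Ext C n A B =
     extensions C n A B // ((extension_arrows C n A B \<union> (extension_arrows C n A B)\<inverse>)\<^sup>*)"

text \<open>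
  Only the vanishing of Yoneda Ext is used, so the Baer sum is not needed: a group is zero
  exactly if its underlying set has a single element.
\<close>

definition Ext_zero :: "('o, 'm) precat \<Rightarrow> nat \<Rightarrow> 'o \<Rightarrow> 'o \<Rightarrow> bool" where
  "Ext_zero C n A B \<longleftrightarrow> is_singleton (yoneda_Ext C n A B)"

definition right_orth :: "('o, 'm) precat \<Rightarrow> 'o set \<Rightarrow> 'o set" where
  "right_orth C S = {X \<in> Ob C. \<forall>A\<in>S. Ext_zero C 1 A X}"

definition left_orth :: "('o, 'm) precat \<Rightarrow> 'o set \<Rightarrow> 'o set" where
  "left_orth C S = {X \<in> Ob C. \<forall>A\<in>S. Ext_zero C 1 X A}"

definition cotorsion_pair :: "('o, 'm) precat \<Rightarrow> 'o set \<Rightarrow> 'o set \<Rightarrow> bool" where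
  "cotorsion_pair C X Y \<longleftrightarrow> Y = right_orth C X \<and> X = left_orth C Y"

definition complete_pair :: "('o, 'm) precat \<Rightarrow> 'o set \<Rightarrow> 'o set \<Rightarrow> bool" where
  "complete_pair C X Y \<longleftrightarrow> (\<forall>A\<in>Ob C.
     (\<exists>f g. short_exact C f g \<and> Cod C g = A \<and> Dom C g \<in> X \<and> Dom C f \<in> Y) \<and>
     (\<exists>f g. short_exact C f g \<and> Dom C f = A \<and> Cod C f \<in> Y \<and> Cod C g \<in> X))"

definition hereditary_pair :: "('o, 'm) precat \<Rightarrow> 'o set \<Rightarrow> 'o set \<Rightarrow> bool" where
  "hereditary_pair C X Y \<longleftrightarrow> (\<forall>A\<in>X. \<forall>B\<in>Y. \<forall>i\<ge>1. Ext_zero C i A B)"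

definition thick :: "('o, 'm) precat \<Rightarrow> 'o set \<Rightarrow> bool" where
  "thick C S \<longleftrightarrow> S \<subseteq> Ob C \<and> (\<forall>f g. short_exact C f g \<longrightarrow>
     (Dom C f \<in> S \<and> Cod C f \<in> S \<longrightarrow> Cod C g \<in> S) \<and>
     (Dom C f \<in> S \<and> Cod C g \<in> S \<longrightarrow> Cod C f \<in> S) \<and>
     (Cod C f \<in> S \<and> Cod C g \<in> S \<longrightarrow> Dom C f \<in> S))"


section \<open>Hereditary abelian model structures\<close>

definition hereditary_abelian_model ::
  "('o, 'm) precat \<Rightarrow> 'o set \<Rightarrow> 'o set \<Rightarrow> 'o set \<Rightarrow> bool" where
  "hereditary_abelian_model C Q W R \<longleftrightarrow> thick C W \<and>
     cotorsion_pair C Q (W \<inter> R) \<and> complete_pair C Q (W \<inter> R) \<and> hereditary_pair C Q (W \<inter> R) \<and>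
     cotorsion_pair C (Q \<inter> W) R \<and> complete_pair C (Q \<inter> W) R \<and> hereditary_pair C (Q \<inter> W) R"

definition core :: "'o set \<Rightarrow> 'o set \<Rightarrow> 'o set \<Rightarrow> 'o set" where
  "core Q W R = Q \<inter> W \<inter> R"

definition cofibration :: "('o, 'm) precat \<Rightarrow> 'o set \<Rightarrow> 'm \<Rightarrow> bool" where
  "cofibration C Q f \<longleftrightarrow> is_mono C f \<and> cokernel_in C f Q"

definition fibration :: "('o, 'm) precat \<Rightarrow> 'o set \<Rightarrow> 'm \<Rightarrow> bool" where
  "fibration C R g \<longleftrightarrow> is_epi C g \<and> kernel_in C g R"

definition factors_through_class :: "('o, 'm) precat \<Rightarrow> 'o set \<Rightarrow> 'm \<Rightarrow> bool" where
  "factors_through_class C S h \<longleftrightarrow>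
     (\<exists>P\<in>S. \<exists>u\<in>homs C (Dom C h) P. \<exists>v\<in>homs C P (Cod C h). h = v \<odot>\<^bsub>C\<^esub> u)"

text \<open>Taking \<open>S = Q \<inter> W\<close> gives right homotopy, taking the core gives homotopy \<open>\<sim>\<^sup>\<omega>\<close>.\<close>

definition homotopic_via :: "('o, 'm) precat \<Rightarrow> 'o set \<Rightarrow> 'm \<Rightarrow> 'm \<Rightarrow> bool" where
  "homotopic_via C S f g \<longleftrightarrow> f \<in> Arr C \<and> g \<in> Arr C \<and> Dom C f = Dom C g \<and> Cod C f = Cod C g \<and>
     factors_through_class C S (Minus C g f)"

definition right_homotopic :: "('o, 'm) precat \<Rightarrow> 'o set \<Rightarrow> 'o set \<Rightarrow> 'm \<Rightarrow> 'm \<Rightarrow> bool" where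
  "right_homotopic C Q W f g \<longleftrightarrow> homotopic_via C (Q \<inter> W) f g"

text \<open>
  The arrow part of the canonical functor \<open>\<gamma>\<^sub>\<omega>\<close> (for \<open>S = \<omega>\<close>), which is the identity on objects,
  and the category \<open>St\<^sub>\<omega>\<close>, whose arrows are the classes of \<open>\<sim>\<^sup>\<omega>\<close>.
\<close>

definition stable_class :: "('o, 'm) precat \<Rightarrow> 'o set \<Rightarrow> 'm \<Rightarrow> 'm set" where
  "stable_class C S f = {g. homotopic_via C S f g}"

definition stable_category :: "('o, 'm) precat \<Rightarrow> 'o set \<Rightarrow> ('o, 'm set) precat" where
  "stable_category C S =
     \<lparr>Ob = Ob C,
      Arr = stable_class C S ` Arr C,
      Dom = (\<lambda>F. the_elem (Dom C ` F)),
      Cod = (\<lambda>F. the_elem (Cod C ` F)),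
      Id = (\<lambda>A. stable_class C S (Id C A)),
      Comp = (\<lambda>G F. \<Union>g\<in>G. \<Union>f\<in>F. stable_class C S (g \<odot>\<^bsub>C\<^esub> f)),
      Add = (\<lambda>F G. \<Union>f\<in>F. \<Union>g\<in>G. stable_class C S (Add C f g)),
      Zero = (\<lambda>A B. stable_class C S (Zero C A B))\<rparr>"


section \<open>Additive functors to abelian groups\<close>

text \<open>
  \<open>F\<close> is the object part and \<open>F'\<close> the arrow part; the latter is only considered on carriers.
  A contravariant functor on \<open>C\<close> is a functor on \<open>op_category C\<close>.
\<close>

definition additive_functor ::
  "('o, 'm) precat \<Rightarrow> ('o \<Rightarrow> 'a monoid) \<Rightarrow> ('m \<Rightarrow> 'a \<Rightarrow> 'a) \<Rightarrow> bool" where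
  "additive_functor C F F' \<longleftrightarrow>
     (\<forall>A\<in>Ob C. comm_group (F A)) \<and>
     (\<forall>f\<in>Arr C. F' f \<in> hom (F (Dom C f)) (F (Cod C f))) \<and>
     (\<forall>A\<in>Ob C. \<forall>x\<in>carrier (F A). F' (Id C A) x = x) \<and>
     (\<forall>f\<in>Arr C. \<forall>g\<in>Arr C. Cod C f = Dom C g \<longrightarrow>
        (\<forall>x\<in>carrier (F (Dom C f)). F' (g \<odot>\<^bsub>C\<^esub> f) x = F' g (F' f x))) \<and>
     (\<forall>f\<in>Arr C. \<forall>g\<in>Arr C. Dom C f = Dom C g \<and> Cod C f = Cod C g \<longrightarrow>
        (\<forall>x\<in>carrier (F (Dom C f)). F' (Add C f g) x = F' f x \<otimes>\<^bsub>F (Cod C f)\<^esub> F' g x))"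

text \<open>Factorization of \<open>(F, F')\<close> through a functor \<open>C \<rightarrow> D\<close> that is the identity on objects and \<open>\<gamma>\<close> on arrows.\<close>

definition factors_via ::
  "('o, 'm) precat \<Rightarrow> ('o, 'n) precat \<Rightarrow> ('m \<Rightarrow> 'n) \<Rightarrow> ('o \<Rightarrow> 'a monoid) \<Rightarrow> ('m \<Rightarrow> 'a \<Rightarrow> 'a) \<Rightarrow> bool" where
  "factors_via C D \<gamma> F F' \<longleftrightarrow> (\<exists>G G'. additive_functor D G G' \<and>
     (\<forall>A\<in>Ob C. G A = F A) \<and>
     (\<forall>f\<in>Arr C. \<forall>x\<in>carrier (F (Dom C f)). G' (\<gamma> f) x = F' f x))"

text \<open>
  \<open>\<cdots> \<rightarrow> X n \<rightarrow> Y n \<rightarrow> Z n \<rightarrow> X (n + 1) \<rightarrow> \<cdots>\<close>, with maps \<open>\<alpha> n\<close>, \<open>\<beta> n\<close>, \<open>\<delta> n\<close>. The window at \<open>n\<close>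
  expresses exactness at \<open>Y n\<close>, \<open>Z n\<close> and \<open>X (n + 1)\<close>; \<^const>\<open>exact_seq\<close> lists groups and maps
  from right to left.
\<close>

definition long_exact_sequence ::
  "(int \<Rightarrow> 'a monoid) \<Rightarrow> (int \<Rightarrow> 'a monoid) \<Rightarrow> (int \<Rightarrow> 'a monoid) \<Rightarrow>
   (int \<Rightarrow> 'a \<Rightarrow> 'a) \<Rightarrow> (int \<Rightarrow> 'a \<Rightarrow> 'a) \<Rightarrow> (int \<Rightarrow> 'a \<Rightarrow> 'a) \<Rightarrow> bool" where
  "long_exact_sequence X Y Z \<alpha> \<beta> \<delta> \<longleftrightarrow>
     (\<forall>n. exact_seq ([Y (n + 1), X (n + 1), Z n, Y n, X n], [\<alpha> (n + 1), \<delta> n, \<beta> n, \<alpha> n]))"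


section \<open>Cohomology and \<open>rExt\<close>\<close>

definition coboundaries :: "(int \<Rightarrow> 'a monoid) \<Rightarrow> (int \<Rightarrow> 'a \<Rightarrow> 'a) \<Rightarrow> int \<Rightarrow> 'a set" where
  "coboundaries G d n = d (n - 1) ` carrier (G (n - 1))"

definition cohomology :: "(int \<Rightarrow> 'a monoid) \<Rightarrow> (int \<Rightarrow> 'a \<Rightarrow> 'a) \<Rightarrow> int \<Rightarrow> 'a set monoid" where
  "cohomology G d n =
     (G n)\<lparr>carrier := kernel (G n) (G (n + 1)) (d n)\<rparr> Mod coboundaries G d n"

text \<open>
  The map induced in degree \<open>n\<close> by a cochain map \<open>\<phi>\<close> with target \<open>(G, d)\<close>: the class of a cocycle \<open>z\<close>
  is the coset of \<open>z\<close>, and the sum of the coboundaries with its image is the class of \<open>\<phi> n z\<close>.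
\<close>

definition cohomology_map ::
  "(int \<Rightarrow> 'a monoid) \<Rightarrow> (int \<Rightarrow> 'a \<Rightarrow> 'a) \<Rightarrow> (int \<Rightarrow> 'a \<Rightarrow> 'a) \<Rightarrow> int \<Rightarrow> 'a set \<Rightarrow> 'a set" where
  "cohomology_map G d \<phi> n X = coboundaries G d n <#>\<^bsub>G n\<^esub> (\<phi> n ` X)"

record ('o, 'm) coresolution =
  obj :: "int \<Rightarrow> 'o"
  diff :: "int \<Rightarrow> 'm"
  aug :: 'm  \<comment> \<open>\<open>\<epsilon>\<^sub>B : Q\<^sup>-\<^sup>1 \<rightarrow> B\<close>\<close>
  coaug :: 'm  \<comment> \<open>\<open>\<eta>\<^sub>B : B \<rightarrow> R\<^sup>0\<close>\<close>

text \<open>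
  Here \<open>obj K i\<close> is \<open>Q\<^sup>i\<close> for \<open>i < 0\<close> and \<open>R\<^sup>i\<close> for \<open>i \<ge> 0\<close>, and \<open>diff K i\<close> is \<open>d\<^sup>i\<close>, which goes from degree \<open>i\<close>
  to degree \<open>i + 1\<close>. Exactness of the spliced complex follows from exactness of its two halves.
\<close>

definition model_coresolution ::
  "('o, 'm) precat \<Rightarrow> 'o set \<Rightarrow> 'o set \<Rightarrow> 'o set \<Rightarrow> 'o \<Rightarrow> ('o, 'm) coresolution \<Rightarrow> bool" where
  "model_coresolution C Q W R B K \<longleftrightarrow>
     (\<forall>i. diff K i \<in> homs C (obj K i) (obj K (i + 1))) \<and>
     (\<forall>i. exact_at C (diff K i) (diff K (i + 1))) \<and>
     aug K \<in> homs C (obj K (-1)) B \<and> coaug K \<in> homs C B (obj K 0) \<and>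
     diff K (-1) = coaug K \<odot>\<^bsub>C\<^esub> aug K \<and>
     (\<forall>i\<le>-3. exact_at C (diff K i) (diff K (i + 1))) \<and>
     exact_at C (diff K (-2)) (aug K) \<and> is_epi C (aug K) \<and>
     (\<forall>i\<le>-1. obj K i \<in> Q \<inter> W) \<and>
     kernel_in C (aug K) R \<and> (\<forall>i\<le>-2. kernel_in C (diff K i) R) \<and>
     is_mono C (coaug K) \<and> exact_at C (coaug K) (diff K 0) \<and>
     (\<forall>i\<ge>0. exact_at C (diff K i) (diff K (i + 1))) \<and>
     (\<forall>i\<ge>0. obj K i \<in> W \<inter> R) \<and>
     cokernel_in C (coaug K) Q \<and> (\<forall>i\<ge>0. cokernel_in C (diff K i) Q)"

definition coresolution_choice ::
  "('o, 'm) precat \<Rightarrow> 'o set \<Rightarrow> 'o set \<Rightarrow> 'o set \<Rightarrow> ('o \<Rightarrow> ('o, 'm) coresolution) \<Rightarrow> bool" where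
  "coresolution_choice C Q W R K \<longleftrightarrow> (\<forall>B\<in>Ob C. model_coresolution C Q W R B (K B))"

definition extends_to ::
  "('o, 'm) precat \<Rightarrow> ('o, 'm) coresolution \<Rightarrow> ('o, 'm) coresolution \<Rightarrow> 'm \<Rightarrow> (int \<Rightarrow> 'm) \<Rightarrow> bool" where
  "extends_to C K K' g \<phi> \<longleftrightarrow>
     (\<forall>i. \<phi> i \<in> homs C (obj K i) (obj K' i)) \<and>
     (\<forall>i. \<phi> (i + 1) \<odot>\<^bsub>C\<^esub> diff K i = diff K' i \<odot>\<^bsub>C\<^esub> \<phi> i) \<and>
     aug K' \<odot>\<^bsub>C\<^esub> \<phi> (-1) = g \<odot>\<^bsub>C\<^esub> aug K \<and>
     \<phi> 0 \<odot>\<^bsub>C\<^esub> coaug K = coaug K' \<odot>\<^bsub>C\<^esub> g"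

text \<open>
  The complex \<open>Hom(A, W\<^sup>B)\<close>. Below, \<open>K B\<close> is the coresolution of \<open>B\<close> from which \<open>rExt\<close> is computed.
\<close>

definition hom_complex_obj ::
  "('o, 'm) precat \<Rightarrow> 'o \<Rightarrow> ('o, 'm) coresolution \<Rightarrow> int \<Rightarrow> 'm monoid" where
  "hom_complex_obj C A K i = hom_group C A (obj K i)"

definition hom_complex_diff ::
  "('o, 'm) precat \<Rightarrow> ('o, 'm) coresolution \<Rightarrow> int \<Rightarrow> 'm \<Rightarrow> 'm" where
  "hom_complex_diff C K i x = diff K i \<odot>\<^bsub>C\<^esub> x"

definition rExt ::
  "('o, 'm) precat \<Rightarrow> ('o \<Rightarrow> ('o, 'm) coresolution) \<Rightarrow> int \<Rightarrow> 'o \<Rightarrow> 'o \<Rightarrow> 'm set monoid" where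
  "rExt C K n A B = cohomology (hom_complex_obj C A (K B)) (hom_complex_diff C (K B)) n"

text \<open>
  The action of \<open>g : B \<rightarrow> B'\<close>, through some cochain map extending \<open>g\<close>. Such a map is unique
  up to homotopy, so the choice is immaterial; it depends neither on \<open>n\<close> nor on \<open>A\<close>.
\<close>

definition rExt_cov ::
  "('o, 'm) precat \<Rightarrow> ('o \<Rightarrow> ('o, 'm) coresolution) \<Rightarrow> int \<Rightarrow> 'o \<Rightarrow> 'm \<Rightarrow> 'm set \<Rightarrow> 'm set" where
  "rExt_cov C K n A g =
     (let K' = K (Cod C g); \<phi> = (SOME \<phi>. extends_to C (K (Dom C g)) K' g \<phi>)
      in cohomology_map (hom_complex_obj C A K') (hom_complex_diff C K') (\<lambda>i x. \<phi> i \<odot>\<^bsub>C\<^esub> x) n)"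

definition rExt_con ::
  "('o, 'm) precat \<Rightarrow> ('o \<Rightarrow> ('o, 'm) coresolution) \<Rightarrow> int \<Rightarrow> 'm \<Rightarrow> 'o \<Rightarrow> 'm set \<Rightarrow> 'm set" where
  "rExt_con C K n f B =
     cohomology_map (hom_complex_obj C (Dom C f) (K B)) (hom_complex_diff C (K B)) (\<lambda>i x. x \<odot>\<^bsub>C\<^esub> f) n"

end

theory Submission
  imports Defs
begin

text \<open>
  Vanishing of \<open>Ext\<^sup>1\<close> is a lifting property, and vanishing of \<open>Ext\<^sup>2\<close> makes fibrant objects closed under cokernels of
  monomorphisms and cofibrant objects closed under kernels of epimorphisms. Lifting gives chain maps between coresolutions, unique
  up to a homotopy that vanishes in degree 0, and hence the two functors.
  For fibrant \<open>B\<close> all entries of \<open>W\<^sup>B\<close> lie in \<open>W \<inter> R\<close> and all its cycles are fibrant. So \<open>Hom(-, W\<^sup>B)\<close> turns a cofibration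
  sequence into a short exact sequence of complexes and is acyclic on trivially cofibrant objects.
  A morphism through an object of the core extends to the null-homotopic cochain map given by a single map \<open>R\<^sup>0 \<rightarrow> Q\<^sup>-\<^sup>1\<close>.

  For a fibration \<open>g : B \<rightarrow> B'\<close> with kernel \<open>K\<close> there is in general no short exact sequence of coresolutions. Instead, the long exact
  sequence holds because \<open>Hom(A, T)\<close> is exact for cofibrant \<open>A\<close>, where \<open>T\<close> is the total complex of \<open>W\<^sup>K \<rightarrow> W\<^sup>B \<rightarrow> W\<^sup>B\<^sup>'\<close>, twisted
  by a null-homotopy of the composite. The nonnegative entries form a subcomplex of \<open>T\<close>; the quotient
  is contractible, and the subcomplex is exact with entries in \<open>W \<inter> R\<close> and bounded below, hence stays exact under \<open>Hom(A, -)\<close>.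
\<close>

section \<open>Calculus in preadditive categories\<close>

text \<open>The horseshoe construction would give a short exact sequence of left halves:
  \<open>ker g\<close> is fibrant, so maps out of trivially cofibrant objects lift along
  \<open>g\<close>. On the right it would have to extend the coaugmentation of \<open>ker g\<close>
  along the inclusion into \<open>B\<close>, whose cokernel is \<open>B'\<close>, and
  \<open>B'\<close> need not be cofibrant. This asymmetry decides how the total complex is treated:
  its negative part is split by lifting against fibrant kernels and is harmless for every test
  object, while its nonnegative part is merely exact, so there the cofibrancy of \<open>A\<close>
  has to enter. Without enough projectives, vanishing of Yoneda Ext is exploited through invariants:
  a property that morphisms of extensions preserve in both directions, and that the trivial
  extension has, holds for every extension when the Ext group is zero. Chases with elements become
  chases with arrows that may be pulled back along epimorphisms.\<close>

context preadditive_category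
begin

abbreviation comp_arr (infixr \<open>\<bullet>\<close> 70) where "g \<bullet> f \<equiv> g \<odot>\<^bsub>C\<^esub> f"
abbreviation add_arr (infixl \<open>\<uplus>\<close> 65) where "f \<uplus> g \<equiv> Add C f g"
abbreviation minus_arr (infixl \<open>\<setminus>\<close> 65) where "f \<setminus> g \<equiv> Minus C f g"
abbreviation zero_arr (\<open>\<zero>\<close>) where "\<zero> \<equiv> Zero C"

text \<open>Normal form for typing: membership in \<open>homs\<close> is always unfolded to
  conditions on \<open>Arr\<close>, \<open>Dom\<close> and \<open>Cod\<close>, which the simplifier
  then discharges as side conditions of the arrow identities.\<close>

lemma in_homs [simp]: "f \<in> homs C A B \<longleftrightarrow> f \<in> Arr C \<and> Dom C f = A \<and> Cod C f = B"
  by (auto simp: homs_def)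

lemma Dom_Ob [simp]: "f \<in> Arr C \<Longrightarrow> Dom C f \<in> Ob C" and Cod_Ob [simp]: "f \<in> Arr C \<Longrightarrow> Cod C f \<in> Ob C"
  by (auto intro: Dom_in Cod_in)

lemma comp_simps [simp]:
  assumes "f \<in> Arr C" "g \<in> Arr C" "Cod C f = Dom C g"
  shows "g \<bullet> f \<in> Arr C" "Dom C (g \<bullet> f) = Dom C f" "Cod C (g \<bullet> f) = Cod C g"
  using Comp_in[of f "Dom C f" "Dom C g" g "Cod C g"] assms by auto

lemma Id_simps [simp]:
  assumes "A \<in> Ob C" shows "Id C A \<in> Arr C" "Dom C (Id C A) = A" "Cod C (Id C A) = A"
  using Id_in[OF assms] by auto

lemma comp_Id [simp]: "f \<in> Arr C \<Longrightarrow> Dom C f = A \<Longrightarrow> f \<bullet> Id C A = f"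
  "f \<in> Arr C \<Longrightarrow> Cod C f = A \<Longrightarrow> Id C A \<bullet> f = f"
  using Comp_Id_right[of f] Comp_Id_left[of f] by auto

lemma comp_assoc [simp]:
  "\<lbrakk>f \<in> Arr C; g \<in> Arr C; h \<in> Arr C; Cod C f = Dom C g; Cod C g = Dom C h\<rbrakk> \<Longrightarrow> (h \<bullet> g) \<bullet> f = h \<bullet> (g \<bullet> f)"
  using Comp_assoc[of f _ _ g _ h] by auto

lemma hom_group_simps [simp]: "carrier (hom_group C A B) = homs C A B" "x \<otimes>\<^bsub>hom_group C A B\<^esub> y = x \<uplus> y"
  "\<one>\<^bsub>hom_group C A B\<^esub> = \<zero> A B"
  by (auto simp: hom_group_def)

lemma Zero_simps [simp]:
  assumes "A \<in> Ob C" "B \<in> Ob C" shows "\<zero> A B \<in> Arr C" "Dom C (\<zero> A B) = A" "Cod C (\<zero> A B) = B"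
proof -
  interpret comm_group "hom_group C A B" using hom_comm_group assms .
  show "\<zero> A B \<in> Arr C" "Dom C (\<zero> A B) = A" "Cod C (\<zero> A B) = B"
    using one_closed by auto
qed

lemma add_simps [simp]:
  assumes "f \<in> Arr C" "g \<in> Arr C" "Dom C f = Dom C g" "Cod C f = Cod C g"
  shows "f \<uplus> g \<in> Arr C" "Dom C (f \<uplus> g) = Dom C g" "Cod C (f \<uplus> g) = Cod C g"
proof -
  interpret comm_group "hom_group C (Dom C f) (Cod C f)" using hom_comm_group assms by auto
  show "f \<uplus> g \<in> Arr C" "Dom C (f \<uplus> g) = Dom C g" "Cod C (f \<uplus> g) = Cod C g"
    using m_closed[of f g] assms by auto
qed

lemma minus_simps [simp]:
  assumes "f \<in> Arr C" "g \<in> Arr C" "Dom C f = Dom C g" "Cod C f = Cod C g"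
  shows "f \<setminus> g \<in> Arr C" "Dom C (f \<setminus> g) = Dom C g" "Cod C (f \<setminus> g) = Cod C g"
proof -
  interpret comm_group "hom_group C (Dom C g) (Cod C g)" using hom_comm_group assms by auto
  have "inv\<^bsub>hom_group C (Dom C g) (Cod C g)\<^esub> g \<in> homs C (Dom C g) (Cod C g)"
    using inv_closed[of g] assms by auto
  then show "f \<setminus> g \<in> Arr C" "Dom C (f \<setminus> g) = Dom C g" "Cod C (f \<setminus> g) = Cod C g"
    using assms by (auto simp: Minus_def)
qed

lemma add_assoc: "\<lbrakk>f \<in> Arr C; g \<in> Arr C; h \<in> Arr C; Dom C f = Dom C g; Dom C g = Dom C h; Cod C f = Cod C g; Cod C g = Cod C h\<rbrakk>
    \<Longrightarrow> (f \<uplus> g) \<uplus> h = f \<uplus> (g \<uplus> h)"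
  and add_commute: "\<lbrakk>f \<in> Arr C; g \<in> Arr C; Dom C f = Dom C g; Cod C f = Cod C g\<rbrakk> \<Longrightarrow> f \<uplus> g = g \<uplus> f"
  and add_left_commute: "\<lbrakk>f \<in> Arr C; g \<in> Arr C; h \<in> Arr C; Dom C f = Dom C g; Dom C g = Dom C h; Cod C f = Cod C g; Cod C g = Cod C h\<rbrakk>
    \<Longrightarrow> f \<uplus> (g \<uplus> h) = g \<uplus> (f \<uplus> h)"
  and add_cancel [simp]: "\<lbrakk>f \<in> Arr C; g \<in> Arr C; h \<in> Arr C; Dom C f = Dom C g; Dom C g = Dom C h; Cod C f = Cod C g; Cod C g = Cod C h\<rbrakk>
    \<Longrightarrow> f \<uplus> g = f \<uplus> h \<longleftrightarrow> g = h"
proof -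
  assume *: "f \<in> Arr C" "g \<in> Arr C" "h \<in> Arr C" "Dom C f = Dom C g" "Dom C g = Dom C h" "Cod C f = Cod C g" "Cod C g = Cod C h"
  interpret comm_group "hom_group C (Dom C f) (Cod C f)" using hom_comm_group * by auto
  show "(f \<uplus> g) \<uplus> h = f \<uplus> (g \<uplus> h)" "f \<uplus> (g \<uplus> h) = g \<uplus> (f \<uplus> h)" "f \<uplus> g = f \<uplus> h \<longleftrightarrow> g = h"
    using m_assoc[of f g h] m_lcomm[of f g h] Units_l_cancel[of f g h] Units_eq * by auto
next
  assume *: "f \<in> Arr C" "g \<in> Arr C" "Dom C f = Dom C g" "Cod C f = Cod C g"
  interpret comm_group "hom_group C (Dom C f) (Cod C f)" using hom_comm_group * by auto
  show "f \<uplus> g = g \<uplus> f" using m_comm[of f g] * by auto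
qed

lemmas add_ac = add_assoc add_commute add_left_commute

lemma add_Zero [simp]: "\<lbrakk>f \<in> Arr C; Dom C f = A; Cod C f = B\<rbrakk> \<Longrightarrow> f \<uplus> \<zero> A B = f"
  "\<lbrakk>f \<in> Arr C; Dom C f = A; Cod C f = B\<rbrakk> \<Longrightarrow> \<zero> A B \<uplus> f = f"
proof -
  assume *: "f \<in> Arr C" "Dom C f = A" "Cod C f = B"
  interpret comm_group "hom_group C A B" using hom_comm_group * by auto
  show "f \<uplus> \<zero> A B = f" "\<zero> A B \<uplus> f = f"
    using r_one[of f] l_one[of f] * by auto
qed

lemma minus_add [simp]:
  assumes "f \<in> Arr C" "g \<in> Arr C" "Dom C f = Dom C g" "Cod C f = Cod C g"
  shows "f \<setminus> g \<uplus> g = f"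
proof -
  interpret comm_group "hom_group C (Dom C g) (Cod C g)" using hom_comm_group assms by auto
  show ?thesis using inv_closed[of g] m_assoc[of f "inv\<^bsub>hom_group C (Dom C g) (Cod C g)\<^esub> g" g] l_inv[of g] assms
    by (auto simp: Minus_def)
qed

lemma add_minus [simp]:
  assumes "f \<in> Arr C" "g \<in> Arr C" "Dom C f = Dom C g" "Cod C f = Cod C g"
  shows "g \<uplus> (f \<setminus> g) = f"
  by (metis assms add_commute minus_add minus_simps)

lemma minus_eq_iff:
  assumes "f \<in> Arr C" "g \<in> Arr C" "h \<in> Arr C" "Dom C f = Dom C g" "Dom C g = Dom C h" "Cod C f = Cod C g" "Cod C g = Cod C h"
  shows "f \<setminus> g = h \<longleftrightarrow> f = h \<uplus> g"
  using assms minus_add[of f g] add_cancel[of g "f \<setminus> g" h] add_commute[of g] by auto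

lemma eq_minus_iff:
  assumes "f \<in> Arr C" "g \<in> Arr C" "h \<in> Arr C" "Dom C f = Dom C g" "Dom C g = Dom C h" "Cod C f = Cod C g" "Cod C g = Cod C h"
  shows "h = f \<setminus> g \<longleftrightarrow> h \<uplus> g = f"
  using minus_eq_iff[OF assms] by auto

lemma minus_self [simp]: "f \<in> Arr C \<Longrightarrow> f \<setminus> f = \<zero> (Dom C f) (Cod C f)"
  by (simp add: minus_eq_iff)

lemma minus_zero [simp]: "\<lbrakk>f \<in> Arr C; Dom C f = A; Cod C f = B\<rbrakk> \<Longrightarrow> f \<setminus> \<zero> A B = f"
  by (auto simp: minus_eq_iff)

lemma minus_eq_zero: "\<lbrakk>f \<in> Arr C; g \<in> Arr C; Dom C f = Dom C g; Cod C f = Cod C g; Dom C g = A; Cod C g = B\<rbrakk> \<Longrightarrow> f \<setminus> g = \<zero> A B \<longleftrightarrow> f = g"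
  by (auto simp: minus_eq_iff)

lemma comp_add [simp]: "\<lbrakk>f \<in> Arr C; f' \<in> Arr C; g \<in> Arr C; Dom C f = Dom C f'; Cod C f = Cod C f'; Cod C f' = Dom C g\<rbrakk>
    \<Longrightarrow> g \<bullet> (f \<uplus> f') = g \<bullet> f \<uplus> g \<bullet> f'"
  "\<lbrakk>f \<in> Arr C; g \<in> Arr C; g' \<in> Arr C; Dom C g = Dom C g'; Cod C g = Cod C g'; Cod C f = Dom C g'\<rbrakk>
    \<Longrightarrow> (g \<uplus> g') \<bullet> f = g \<bullet> f \<uplus> g' \<bullet> f"
  using Comp_Add_right[of f _ _ f' g] Comp_Add_left[of f _ _ g _ g'] by auto

lemma comp_minus [simp]: "\<lbrakk>f \<in> Arr C; f' \<in> Arr C; g \<in> Arr C; Dom C f = Dom C f'; Cod C f = Cod C f'; Cod C f' = Dom C g\<rbrakk>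
    \<Longrightarrow> g \<bullet> (f \<setminus> f') = g \<bullet> f \<setminus> g \<bullet> f'"
  "\<lbrakk>f \<in> Arr C; g \<in> Arr C; g' \<in> Arr C; Dom C g = Dom C g'; Cod C g = Cod C g'; Cod C f = Dom C g'\<rbrakk>
    \<Longrightarrow> (g \<setminus> g') \<bullet> f = g \<bullet> f \<setminus> g' \<bullet> f"
proof -
  assume *: "f \<in> Arr C" "f' \<in> Arr C" "g \<in> Arr C" "Dom C f = Dom C f'" "Cod C f = Cod C f'" "Cod C f' = Dom C g"
  have "g \<bullet> (f \<setminus> f') \<uplus> g \<bullet> f' = g \<bullet> (f \<setminus> f' \<uplus> f')" using * by (subst comp_add) auto
  then show "g \<bullet> (f \<setminus> f') = g \<bullet> f \<setminus> g \<bullet> f'" using * by (simp add: eq_minus_iff)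
next
  assume *: "f \<in> Arr C" "g \<in> Arr C" "g' \<in> Arr C" "Dom C g = Dom C g'" "Cod C g = Cod C g'" "Cod C f = Dom C g'"
  have "(g \<setminus> g') \<bullet> f \<uplus> g' \<bullet> f = (g \<setminus> g' \<uplus> g') \<bullet> f" using * by (subst comp_add) auto
  then show "(g \<setminus> g') \<bullet> f = g \<bullet> f \<setminus> g' \<bullet> f" using * by (simp add: eq_minus_iff)
qed

lemma comp_Zero [simp]: "\<lbrakk>g \<in> Arr C; A \<in> Ob C; Dom C g = B\<rbrakk> \<Longrightarrow> g \<bullet> \<zero> A B = \<zero> A (Cod C g)"
  "\<lbrakk>f \<in> Arr C; B \<in> Ob C; Cod C f = A\<rbrakk> \<Longrightarrow> \<zero> A B \<bullet> f = \<zero> (Dom C f) B"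
proof -
  assume "g \<in> Arr C" "A \<in> Ob C" "Dom C g = B"
  then show "g \<bullet> \<zero> A B = \<zero> A (Cod C g)"
    using comp_minus(1)[of "\<zero> A B" "\<zero> A B" g] by (auto simp del: comp_minus)
next
  assume "f \<in> Arr C" "B \<in> Ob C" "Cod C f = A"
  then show "\<zero> A B \<bullet> f = \<zero> (Dom C f) B"
    using comp_minus(2)[of f "\<zero> A B" "\<zero> A B"] by (auto simp del: comp_minus)
qed

text \<open>Composites are normalized by associating to the right, so an equation for
  \<open>g \<bullet> f\<close> does not match inside \<open>g \<bullet> (f \<bullet> k)\<close>.
  This lemma applies the equation there.\<close>

lemma comp_reduce: "\<lbrakk>g \<bullet> f = h; f \<in> Arr C; g \<in> Arr C; k \<in> Arr C; Cod C f = Dom C g; Cod C k = Dom C f\<rbrakk> \<Longrightarrow> g \<bullet> (f \<bullet> k) = h \<bullet> k"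
  by (metis comp_assoc)

section \<open>Duality through the opposite category\<close>

lemma op_simps [simp]: "Ob (op_category C) = Ob C" "Arr (op_category C) = Arr C" "Dom (op_category C) = Cod C"
  "Cod (op_category C) = Dom C" "Id (op_category C) = Id C" "g \<odot>\<^bsub>op_category C\<^esub> f = f \<bullet> g"
  "Add (op_category C) = Add C" "Zero (op_category C) A B = \<zero> B A"
  by (simp_all add: op_category_def)

lemma op_homs [simp]: "homs (op_category C) A B = homs C B A"
  by (auto simp: homs_def)

lemma op_hom_group [simp]: "hom_group (op_category C) A B = hom_group C B A"
  by (simp add: hom_group_def)

lemma op_Minus [simp]: "Minus (op_category C) f g = f \<setminus> g"
  by (simp add: Minus_def)

lemma op_op [simp]: "op_category (op_category C) = C"
  by (simp add: op_category_def)

lemma op_preadditive: "preadditive_category (op_category C)"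
  by (rule preadditive_category.intro) (auto simp: hom_comm_group)

lemma op_mono [simp]: "is_mono (op_category C) = is_epi C"
  and op_epi [simp]: "is_epi (op_category C) = is_mono C"
  by (auto simp: is_mono_def is_epi_def fun_eq_iff)

lemma op_kernel [simp]: "is_kernel (op_category C) = is_cokernel C"
  and op_cokernel [simp]: "is_cokernel (op_category C) = is_kernel C"
  by (auto simp: is_kernel_def is_cokernel_def fun_eq_iff)

lemma op_kernel_in [simp]: "kernel_in (op_category C) = cokernel_in C"
  and op_cokernel_in [simp]: "cokernel_in (op_category C) = kernel_in C"
  by (auto simp: kernel_in_def cokernel_in_def fun_eq_iff)

section \<open>Monomorphisms, epimorphisms, kernels and cokernels\<close>

lemma monoD: "\<lbrakk>is_mono C f; f \<bullet> u = f \<bullet> v; u \<in> Arr C; v \<in> Arr C; Dom C u = Dom C v; Cod C u = Dom C f; Cod C v = Dom C f\<rbrakk> \<Longrightarrow> u = v"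
  unfolding is_mono_def in_homs by metis

lemma epiD: "\<lbrakk>is_epi C f; u \<bullet> f = v \<bullet> f; u \<in> Arr C; v \<in> Arr C; Cod C u = Cod C v; Dom C u = Cod C f; Dom C v = Cod C f\<rbrakk> \<Longrightarrow> u = v"
  unfolding is_epi_def in_homs by metis

lemma mono_arr [simp]: "is_mono C f \<Longrightarrow> f \<in> Arr C" by (simp add: is_mono_def)
lemma epi_arr [simp]: "is_epi C f \<Longrightarrow> f \<in> Arr C" by (simp add: is_epi_def)

text \<open>By additivity it suffices to test against zero: two arrows with the same composite are
  compared through their difference.\<close>

lemma monoI: assumes "f \<in> Arr C" "\<And>h. h \<in> Arr C \<Longrightarrow> Cod C h = Dom C f \<Longrightarrow> f \<bullet> h = \<zero> (Dom C h) (Cod C f) \<Longrightarrow> h = \<zero> (Dom C h) (Dom C f)"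
  shows "is_mono C f"
  unfolding is_mono_def
proof (intro conjI allI impI)
  fix X u v assume *: "u \<in> homs C X (Dom C f)" "v \<in> homs C X (Dom C f)" "f \<bullet> u = f \<bullet> v"
  have "u \<setminus> v = \<zero> (Dom C (u \<setminus> v)) (Dom C f)"
    by (rule assms(2)) (use * assms(1) in auto)
  then show "u = v" using * by (simp add: minus_eq_zero)
qed (rule assms(1))

lemma epiI: assumes "f \<in> Arr C" "\<And>h. h \<in> Arr C \<Longrightarrow> Dom C h = Cod C f \<Longrightarrow> h \<bullet> f = \<zero> (Dom C f) (Cod C h) \<Longrightarrow> h = \<zero> (Cod C f) (Cod C h)"
  shows "is_epi C f"
  using preadditive_category.monoI[OF op_preadditive, of f] assms by simp

lemma mono_zero: "\<lbrakk>is_mono C f; f \<bullet> h = \<zero> (Dom C h) (Cod C f); h \<in> Arr C; Cod C h = Dom C f\<rbrakk> \<Longrightarrow> h = \<zero> (Dom C h) (Dom C f)"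
  using monoD[of f h "\<zero> (Dom C h) (Dom C f)"] by simp

lemma epi_zero: "\<lbrakk>is_epi C f; h \<bullet> f = \<zero> (Dom C f) (Cod C h); h \<in> Arr C; Dom C h = Cod C f\<rbrakk> \<Longrightarrow> h = \<zero> (Cod C f) (Cod C h)"
  using epiD[of f h "\<zero> (Cod C f) (Cod C h)"] by simp

lemma comp_mono: "\<lbrakk>is_mono C f; is_mono C g; Cod C f = Dom C g\<rbrakk> \<Longrightarrow> is_mono C (g \<bullet> f)"
  apply (rule monoI)
   apply simp
  subgoal for h using mono_zero[of g "f \<bullet> h"] mono_zero[of f h] by simp
  done

lemma comp_epi: "\<lbrakk>is_epi C f; is_epi C g; Cod C f = Dom C g\<rbrakk> \<Longrightarrow> is_epi C (g \<bullet> f)"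
  using preadditive_category.comp_mono[OF op_preadditive, of g f] by simp

lemma mono_factor: "\<lbrakk>is_mono C (g \<bullet> f); f \<in> Arr C; g \<in> Arr C; Cod C f = Dom C g\<rbrakk> \<Longrightarrow> is_mono C f"
  apply (rule monoI)
   apply simp
  subgoal for h using mono_zero[of "g \<bullet> f" h] by simp
  done

lemma epi_factor: "\<lbrakk>is_epi C (g \<bullet> f); f \<in> Arr C; g \<in> Arr C; Cod C f = Dom C g\<rbrakk> \<Longrightarrow> is_epi C g"
  using preadditive_category.mono_factor[OF op_preadditive, of f g] by simp

lemma kernel_simps:
  assumes "is_kernel C k f"
  shows "f \<in> Arr C" "k \<in> Arr C" "Cod C k = Dom C f" "f \<bullet> k = \<zero> (Dom C k) (Cod C f)"
  using assms by (auto simp: is_kernel_def)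

lemma cokernel_simps:
  assumes "is_cokernel C c f"
  shows "f \<in> Arr C" "c \<in> Arr C" "Dom C c = Cod C f" "c \<bullet> f = \<zero> (Dom C f) (Cod C c)"
  using assms by (auto simp: is_cokernel_def)

lemma kernel_lift:
  assumes "is_kernel C k f" "h \<in> Arr C" "Cod C h = Dom C f" "f \<bullet> h = \<zero> (Dom C h) (Cod C f)"
  obtains u where "u \<in> Arr C" "Dom C u = Dom C h" "Cod C u = Dom C k" "k \<bullet> u = h"
proof -
  have "\<exists>!u. u \<in> homs C (Dom C h) (Dom C k) \<and> k \<bullet> u = h"
    using assms(1,2,3,4) unfolding is_kernel_def by simp
  then show thesis using that by auto
qed

lemma cokernel_desc:
  assumes "is_cokernel C c f" "h \<in> Arr C" "Dom C h = Cod C f" "h \<bullet> f = \<zero> (Dom C f) (Cod C h)"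
  obtains u where "u \<in> Arr C" "Cod C u = Cod C h" "Dom C u = Cod C c" "u \<bullet> c = h"
proof -
  have "\<exists>!u. u \<in> homs C (Cod C c) (Cod C h) \<and> u \<bullet> c = h"
    using assms(1,2,3,4) unfolding is_cokernel_def by simp
  then show thesis using that by auto
qed

lemma kernel_ex:
  assumes "is_kernel C k f" "h \<in> Arr C" "Cod C h = Dom C f" "f \<bullet> h = \<zero> (Dom C h) (Cod C f)"
  shows "\<exists>u\<in>homs C (Dom C h) (Dom C k). k \<bullet> u = h"
  using kernel_lift[OF assms] by (metis in_homs)

lemma cokernel_ex:
  assumes "is_cokernel C c f" "h \<in> Arr C" "Dom C h = Cod C f" "h \<bullet> f = \<zero> (Dom C f) (Cod C h)"
  shows "\<exists>u\<in>homs C (Cod C c) (Cod C h). u \<bullet> c = h"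
  using cokernel_desc[OF assms] by (metis in_homs)

lemma kernel_mono: assumes "is_kernel C k f" shows "is_mono C k"
  unfolding is_mono_def
proof (intro conjI allI impI)
  note k = kernel_simps[OF assms]
  fix X u v assume *: "u \<in> homs C X (Dom C k)" "v \<in> homs C X (Dom C k)" "k \<bullet> u = k \<bullet> v"
  have "f \<bullet> (k \<bullet> u) = \<zero> (Dom C k) (Cod C f) \<bullet> u" by (rule comp_reduce) (use k * in auto)
  then have "f \<bullet> (k \<bullet> u) = \<zero> X (Cod C f)" using * k by auto
  moreover have "k \<bullet> u \<in> homs C X (Dom C f)" using * k by auto
  ultimately have "\<exists>!w. w \<in> homs C X (Dom C k) \<and> k \<bullet> w = k \<bullet> u"
    using assms unfolding is_kernel_def by blast
  then show "u = v" using * by metis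
qed (use assms in \<open>auto simp: is_kernel_def\<close>)

lemma cokernel_epi: "is_cokernel C c f \<Longrightarrow> is_epi C c"
  using preadditive_category.kernel_mono[OF op_preadditive, of c f] by simp

lemma kernelI:
  assumes "is_mono C k" "f \<in> Arr C" "Cod C k = Dom C f" "f \<bullet> k = \<zero> (Dom C k) (Cod C f)"
    "\<And>h. h \<in> Arr C \<Longrightarrow> Cod C h = Dom C f \<Longrightarrow> f \<bullet> h = \<zero> (Dom C h) (Cod C f) \<Longrightarrow> \<exists>u\<in>homs C (Dom C h) (Dom C k). k \<bullet> u = h"
  shows "is_kernel C k f"
  unfolding is_kernel_def
proof (intro conjI allI impI)
  fix X h assume "h \<in> homs C X (Dom C f)" "f \<bullet> h = \<zero> X (Cod C f)"
  then obtain u where "u \<in> homs C X (Dom C k)" "k \<bullet> u = h" using assms(5)[of h] by auto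
  then show "\<exists>!u. u \<in> homs C X (Dom C k) \<and> k \<bullet> u = h"
    by (intro ex1I[of _ u]) (auto intro: monoD[OF assms(1)])
qed (use assms in auto)

lemma cokernelI:
  assumes "is_epi C c" "f \<in> Arr C" "Dom C c = Cod C f" "c \<bullet> f = \<zero> (Dom C f) (Cod C c)"
    "\<And>h. h \<in> Arr C \<Longrightarrow> Dom C h = Cod C f \<Longrightarrow> h \<bullet> f = \<zero> (Dom C f) (Cod C h) \<Longrightarrow> \<exists>u\<in>homs C (Cod C c) (Cod C h). u \<bullet> c = h"
  shows "is_cokernel C c f"
  using preadditive_category.kernelI[OF op_preadditive, of c f] assms by simp

lemma Id_mono: "A \<in> Ob C \<Longrightarrow> is_mono C (Id C A)"
  by (rule monoI) auto

lemma Id_epi: "A \<in> Ob C \<Longrightarrow> is_epi C (Id C A)"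
  by (rule epiI) auto

end

section \<open>Exactness, pushouts and pullbacks in abelian categories\<close>

context abelian_category
begin

lemma op_abelian: "abelian_category (op_category C)"
proof -
  interpret op: preadditive_category "op_category C" by (rule op_preadditive)
  show ?thesis
  proof
    show "\<exists>Z. is_zero_object (op_category C) Z"
      using zero_object by (simp add: is_zero_object_def conj_ac)
    fix A B assume "A \<in> Ob (op_category C)" "B \<in> Ob (op_category C)"
    then obtain P i j p q where "is_biproduct C A B P i j p q" using biproducts[of A B] by auto
    then have "is_biproduct (op_category C) A B P p q i j" by (simp add: is_biproduct_def)
    then show "\<exists>P i\<^sub>A i\<^sub>B p\<^sub>A p\<^sub>B. is_biproduct (op_category C) A B P i\<^sub>A i\<^sub>B p\<^sub>A p\<^sub>B" by blast
  qed (auto intro: kernels cokernels mono_normal epi_normal)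
qed

text \<open>A monomorphism is the kernel of some \<open>g\<close>, and \<open>g\<close> factors
  through the cokernel \<open>c\<close> because it kills \<open>f\<close>. Hence whatever
  \<open>c\<close> kills is killed by \<open>g\<close> and factors through \<open>f\<close>.\<close>

lemma mono_is_kernel:
  assumes "is_mono C f" "is_cokernel C c f" shows "is_kernel C f c"
proof -
  obtain g where g: "is_kernel C f g" using mono_normal assms(1) by auto
  note s = kernel_simps[OF g] cokernel_simps[OF assms(2)]
  obtain v where v: "v \<in> Arr C" "Dom C v = Cod C c" "Cod C v = Cod C g" "v \<bullet> c = g"
    using cokernel_desc[OF assms(2), of g] s by auto
  show ?thesis
  proof (rule kernelI)
    fix h assume h: "h \<in> Arr C" "Cod C h = Dom C c" "c \<bullet> h = \<zero> (Dom C h) (Cod C c)"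
    have "v \<bullet> (c \<bullet> h) = g \<bullet> h" by (rule comp_reduce[OF v(4)]) (use h v s in simp_all)
    then have "g \<bullet> h = \<zero> (Dom C h) (Cod C g)" using v(1-3) s h by simp
    then show "\<exists>u\<in>homs C (Dom C h) (Dom C f). f \<bullet> u = h"
      using kernel_ex[OF g, of h] h s by simp
  qed (use assms s in auto)
qed

lemma epi_is_cokernel:
  assumes "is_epi C f" "is_kernel C k f" shows "is_cokernel C f k"
  using abelian_category.mono_is_kernel[OF op_abelian, of f k] assms by simp

lemma kernel_is_cokernel_kernel: "\<lbrakk>is_kernel C m g; is_cokernel C c m\<rbrakk> \<Longrightarrow> is_kernel C m c"
  by (rule mono_is_kernel[OF kernel_mono])

text \<open>A symmetric form of exactness in which \<open>m\<close> and \<open>c\<close> change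
  places under duality, which is what makes exactness self-dual. The arrow \<open>c\<close>, being
  epi, is the cokernel of its kernel \<open>m\<close>.\<close>

lemma exact_at_dual: "exact_at C f g \<longleftrightarrow> (\<exists>m c. is_kernel C m g \<and> is_cokernel C c f \<and> is_kernel C m c \<and> is_cokernel C c m)"
  unfolding exact_at_def is_image_def using cokernel_epi epi_is_cokernel by blast

lemma op_exact_at [simp]: "exact_at (op_category C) f g = exact_at C g f"
  using exact_at_dual[of g f] abelian_category.exact_at_dual[OF op_abelian, of f g] by auto

lemma op_short_exact [simp]: "short_exact (op_category C) f g = short_exact C g f"
  by (auto simp: short_exact_def)

text \<open>To see that \<open>e\<close> is epi, suppose \<open>t \<bullet> e = 0\<close> and let
  \<open>n\<close> be the kernel of \<open>t\<close>. Then \<open>f\<close> factors through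
  \<open>m \<bullet> n\<close>, so the cokernel \<open>q\<close> of \<open>m \<bullet> n\<close>
  kills \<open>f\<close>, hence factors through \<open>c\<close>, hence kills \<open>m\<close>. As
  \<open>m \<bullet> n\<close> is the kernel of \<open>q\<close>, the arrow \<open>m\<close> factors
  through it, so \<open>n\<close> has a right inverse and \<open>t\<close> is zero.\<close>

lemma is_image_factor:
  assumes "is_kernel C m c" "is_cokernel C c f"
  shows "\<exists>e. is_epi C e \<and> Dom C e = Dom C f \<and> Cod C e = Dom C m \<and> f = m \<bullet> e"
proof -
  note s = kernel_simps[OF assms(1)] cokernel_simps[OF assms(2)]
  obtain e where e: "e \<in> Arr C" "Dom C e = Dom C f" "Cod C e = Dom C m" "m \<bullet> e = f"
    using kernel_lift[OF assms(1), of f] s by auto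
  have "is_epi C e"
  proof (rule epiI[OF e(1)])
    fix t assume t: "t \<in> Arr C" "Dom C t = Cod C e" "t \<bullet> e = \<zero> (Dom C e) (Cod C t)"
    obtain n where n: "is_kernel C n t" using kernels t by auto
    note sn = kernel_simps[OF n]
    obtain e' where e': "e' \<in> Arr C" "Dom C e' = Dom C e" "Cod C e' = Dom C n" "n \<bullet> e' = e"
      using kernel_lift[OF n, of e] t e by auto
    have mn: "is_mono C (m \<bullet> n)" by (rule comp_mono) (use n sn assms e t kernel_mono in auto)
    obtain q where q: "is_cokernel C q (m \<bullet> n)" using cokernels mn mono_arr by blast
    note sq = cokernel_simps[OF q]
    have k: "is_kernel C (m \<bullet> n) q" using mono_is_kernel mn q by auto
    have ar: "n \<in> Arr C" "m \<in> Arr C" "Cod C n = Dom C m" "q \<in> Arr C" "Dom C q = Cod C m" "c \<in> Arr C" "Dom C c = Cod C m" "Cod C f = Cod C m" "f \<in> Arr C"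
      using sn s e t sq by auto
    have "q \<bullet> f = (q \<bullet> (m \<bullet> n)) \<bullet> e'" using ar e' e by auto
    then have "q \<bullet> f = \<zero> (Dom C f) (Cod C q)" using sq e' e ar by auto
    then obtain w where w: "w \<in> Arr C" "Dom C w = Cod C c" "Cod C w = Cod C q" "w \<bullet> c = q"
      using cokernel_desc[OF assms(2), of q] ar by auto
    have "q \<bullet> m = w \<bullet> (c \<bullet> m)" using w ar by auto
    then have "q \<bullet> m = \<zero> (Dom C m) (Cod C q)" using s w by auto
    then obtain v where v: "v \<in> Arr C" "Dom C v = Dom C m" "Cod C v = Dom C n" "(m \<bullet> n) \<bullet> v = m"
      using kernel_lift[OF k, of m] ar by auto
    have "n \<bullet> v = Id C (Dom C m)"
      by (rule monoD[OF kernel_mono[OF assms(1)]]) (use v ar in auto)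
    then have "t = t \<bullet> (n \<bullet> v)" using t e by auto
    also have "\<dots> = (t \<bullet> n) \<bullet> v" using t e v ar by auto
    also have "\<dots> = \<zero> (Cod C e) (Cod C t)" using sn v e t by auto
    finally show "t = \<zero> (Cod C e) (Cod C t)" .
  qed
  with e show ?thesis by auto
qed

text \<open>The working form of exactness, with an epimorphism onto the kernel of \<open>g\<close>.
  For the converse, composing with the epimorphism \<open>e\<close> leaves the cokernel of
  \<open>m\<close> unchanged, so it is also a cokernel of \<open>f\<close>.\<close>

lemma exact_at_iff: "exact_at C f g \<longleftrightarrow> (\<exists>m e. is_kernel C m g \<and> is_epi C e \<and> Cod C e = Dom C m \<and> f = m \<bullet> e)"
proof
  assume "exact_at C f g"
  then show "\<exists>m e. is_kernel C m g \<and> is_epi C e \<and> Cod C e = Dom C m \<and> f = m \<bullet> e"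
    unfolding exact_at_def is_image_def using is_image_factor by metis
next
  assume "\<exists>m e. is_kernel C m g \<and> is_epi C e \<and> Cod C e = Dom C m \<and> f = m \<bullet> e"
  then obtain m e where *: "is_kernel C m g" "is_epi C e" "Cod C e = Dom C m" "f = m \<bullet> e" by auto
  note s = kernel_simps[OF *(1)] epi_arr[OF *(2)]
  obtain c where c: "is_cokernel C c m" using cokernels s by auto
  note sc = cokernel_simps[OF c]
  have "is_cokernel C c f"
  proof (rule cokernelI[OF cokernel_epi[OF c]])
    have "c \<bullet> (m \<bullet> e) = \<zero> (Dom C m) (Cod C c) \<bullet> e" by (rule comp_reduce) (use s sc * in auto)
    then show "c \<bullet> f = \<zero> (Dom C f) (Cod C c)" using s sc(1-3) * by simp
    fix h assume h: "h \<in> Arr C" "Dom C h = Cod C f" "h \<bullet> f = \<zero> (Dom C f) (Cod C h)"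
    have "h \<bullet> m = \<zero> (Cod C e) (Cod C (h \<bullet> m))"
      by (rule epi_zero[OF *(2)]) (use h * s in auto)
    then show "\<exists>u\<in>homs C (Cod C c) (Cod C h). u \<bullet> c = h"
      using cokernel_ex[OF c, of h] h * s by simp
  qed (use s sc * in auto)
  then show "exact_at C f g"
    unfolding exact_at_def is_image_def using * kernel_is_cokernel_kernel[OF *(1) c] by blast
qed

lemma exact_at_simps:
  assumes "exact_at C f g"
  shows "f \<in> Arr C" "g \<in> Arr C" "Cod C f = Dom C g" "g \<bullet> f = \<zero> (Dom C f) (Cod C g)"
proof -
  obtain m e where *: "is_kernel C m g" "is_epi C e" "Cod C e = Dom C m" "f = m \<bullet> e"
    using assms unfolding exact_at_iff by auto
  note s = kernel_simps[OF *(1)] epi_arr[OF *(2)]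
  show "f \<in> Arr C" "g \<in> Arr C" "Cod C f = Dom C g" using * s by auto
  have "g \<bullet> (m \<bullet> e) = \<zero> (Dom C m) (Cod C g) \<bullet> e" by (rule comp_reduce) (use * s in auto)
  then show "g \<bullet> f = \<zero> (Dom C f) (Cod C g)" using * s by auto
qed

text \<open>If \<open>f\<close> is mono, so is its epi part \<open>e\<close>. As a normal
  monomorphism \<open>e\<close> is the kernel of some \<open>c\<close>, and \<open>c = 0\<close>
  because \<open>e\<close> is epi; so the identity factors through \<open>e\<close>, and the inverse
  \<open>v\<close> transports the lifting property from \<open>m\<close> to
  \<open>f\<close>.\<close>

lemma exact_mono_kernel: assumes "exact_at C f g" "is_mono C f" shows "is_kernel C f g"
proof -
  obtain m e where *: "is_kernel C m g" "is_epi C e" "Cod C e = Dom C m" "f = m \<bullet> e"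
    using assms unfolding exact_at_iff by auto
  note s = kernel_simps[OF *(1)] epi_arr[OF *(2)]
  have me: "is_mono C e" using mono_factor[of m e] assms * s by auto
  obtain c where c: "is_kernel C e c" using mono_normal me by auto
  note sc = kernel_simps[OF c]
  have "c = \<zero> (Cod C e) (Cod C c)" by (rule epi_zero[OF *(2)]) (use sc in auto)
  then have "c \<bullet> Id C (Cod C e) = \<zero> (Cod C e) (Cod C c)" using sc s by auto
  then obtain v where v: "v \<in> Arr C" "Dom C v = Cod C e" "Cod C v = Dom C e" "e \<bullet> v = Id C (Cod C e)"
    using kernel_lift[OF c, of "Id C (Cod C e)"] sc s by auto
  show ?thesis
  proof (rule kernelI)
    fix h assume h: "h \<in> Arr C" "Cod C h = Dom C g" "g \<bullet> h = \<zero> (Dom C h) (Cod C g)"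
    then obtain w where w: "w \<in> Arr C" "Dom C w = Dom C h" "Cod C w = Dom C m" "m \<bullet> w = h"
      using kernel_lift[OF *(1), of h] by auto
    have "e \<bullet> (v \<bullet> w) = Id C (Cod C e) \<bullet> w" by (rule comp_reduce) (use * s w v in auto)
    then have "m \<bullet> (e \<bullet> (v \<bullet> w)) = h" using * s w by simp
    then show "\<exists>u\<in>homs C (Dom C h) (Dom C f). f \<bullet> u = h" using * s v w
      by (intro bexI[of _ "v \<bullet> w"]) auto
  qed (use assms exact_at_simps[OF assms(1)] in auto)
qed

lemma exact_epi_cokernel: assumes "exact_at C f g" "is_epi C g" shows "is_cokernel C g f"
  using abelian_category.exact_mono_kernel[OF op_abelian, of g f] assms by simp

lemma kernel_exact: assumes "is_kernel C f g" shows "exact_at C f g"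
  unfolding exact_at_iff
  by (intro exI[of _ f] exI[of _ "Id C (Dom C f)"]) (use kernel_simps[OF assms] assms Id_epi in auto)

lemma cokernel_exact: "is_cokernel C g f \<Longrightarrow> exact_at C f g"
  using abelian_category.kernel_exact[OF op_abelian, of g f] by simp

lemma short_exact_iff: "short_exact C f g \<longleftrightarrow> is_kernel C f g \<and> is_cokernel C g f"
  unfolding short_exact_def
  using kernel_exact exact_mono_kernel exact_epi_cokernel kernel_mono cokernel_epi by blast

lemma short_exactI1: "\<lbrakk>is_mono C f; is_cokernel C g f\<rbrakk> \<Longrightarrow> short_exact C f g"
  by (simp add: short_exact_iff mono_is_kernel)

lemma short_exactI2: "\<lbrakk>is_epi C g; is_kernel C f g\<rbrakk> \<Longrightarrow> short_exact C f g"
  by (simp add: short_exact_iff epi_is_cokernel)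

lemma short_exact_simps:
  assumes "short_exact C f g"
  shows "f \<in> Arr C" "g \<in> Arr C" "Cod C f = Dom C g" "g \<bullet> f = \<zero> (Dom C f) (Cod C g)" "is_mono C f" "is_epi C g"
    "is_kernel C f g" "is_cokernel C g f"
  using assms kernel_simps[of f g] short_exact_iff[of f g] unfolding short_exact_def by auto

section \<open>Pushouts and pullbacks of short exact sequences\<close>

lemma biproductE:
  assumes "A \<in> Ob C" "B \<in> Ob C"
  obtains P i j p q where "P \<in> Ob C" "i \<in> Arr C" "j \<in> Arr C" "p \<in> Arr C" "q \<in> Arr C"
    "Dom C i = A" "Cod C i = P" "Dom C j = B" "Cod C j = P" "Dom C p = P" "Cod C p = A" "Dom C q = P" "Cod C q = B"
    "p \<bullet> i = Id C A" "q \<bullet> j = Id C B" "q \<bullet> i = \<zero> A B" "p \<bullet> j = \<zero> B A" "i \<bullet> p \<uplus> j \<bullet> q = Id C P"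
proof -
  obtain P i j p q where *: "is_biproduct C A B P i j p q" using biproducts assms by blast
  then have "P \<in> Ob C" by (auto simp: is_biproduct_def)
  with * show thesis using that[of P i j p q] by (auto simp: is_biproduct_def)
qed

text \<open>The pushout is the cokernel \<open>c\<close> of the arrow \<open>\<delta>\<close> with
  components \<open>h\<close> and minus \<open>f\<close> into a biproduct. Since \<open>f\<close> is
  mono, so is \<open>\<delta>\<close>, which is therefore the kernel of \<open>c\<close>; this is
  what makes \<open>f'\<close> mono. The universal property and the joint epimorphy are part of the
  conclusion because morphisms of longer extensions are later built from them.\<close>

lemma pushout:
  assumes "short_exact C f g" and h: "h \<in> homs C (Dom C f) Y"
  shows "\<exists>f' g' h'. short_exact C f' g' \<and> Dom C f' = Y \<and> Cod C g' = Cod C g \<and> h' \<in> homs C (Cod C f) (Cod C f') \<and>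
    h' \<bullet> f = f' \<bullet> h \<and> g' \<bullet> h' = g \<and>
    (\<forall>T. \<forall>u\<in>homs C Y T. \<forall>v\<in>homs C (Cod C f) T. u \<bullet> h = v \<bullet> f \<longrightarrow> (\<exists>w\<in>homs C (Cod C f') T. w \<bullet> f' = u \<and> w \<bullet> h' = v)) \<and>
    (\<forall>T. \<forall>u\<in>homs C (Cod C f') T. \<forall>v\<in>homs C (Cod C f') T. u \<bullet> f' = v \<bullet> f' \<longrightarrow> u \<bullet> h' = v \<bullet> h' \<longrightarrow> u = v)"
proof -
  note s = short_exact_simps[OF assms(1)]
  have Y: "Y \<in> Ob C" using h by auto
  obtain P i j p q where b: "P \<in> Ob C" "i \<in> Arr C" "j \<in> Arr C" "p \<in> Arr C" "q \<in> Arr C"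
    "Dom C i = Y" "Cod C i = P" "Dom C j = Dom C g" "Cod C j = P" "Dom C p = P" "Cod C p = Y" "Dom C q = P" "Cod C q = Dom C g"
    and bb: "p \<bullet> i = Id C Y" "q \<bullet> j = Id C (Dom C g)" "q \<bullet> i = \<zero> Y (Dom C g)" "p \<bullet> j = \<zero> (Dom C g) Y" "i \<bullet> p \<uplus> j \<bullet> q = Id C P"
    using biproductE[OF Y, of "Dom C g"] s(2) by (metis Dom_Ob)
  have r1: "p \<bullet> (i \<bullet> x) = x" if "x \<in> Arr C" "Cod C x = Y" for x
    using comp_reduce[OF bb(1), of x] b that by auto
  have r2: "q \<bullet> (j \<bullet> x) = x" if "x \<in> Arr C" "Cod C x = Dom C g" for x
    using comp_reduce[OF bb(2), of x] b that by auto
  have r3: "q \<bullet> (i \<bullet> x) = \<zero> (Dom C x) (Dom C g)" if "x \<in> Arr C" "Cod C x = Y" for x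
    using comp_reduce[OF bb(3), of x] b that s by auto
  have r4: "p \<bullet> (j \<bullet> x) = \<zero> (Dom C x) Y" if "x \<in> Arr C" "Cod C x = Dom C g" for x
    using comp_reduce[OF bb(4), of x] b that Y by auto
  define \<delta> where "\<delta> = i \<bullet> h \<setminus> j \<bullet> f"
  have \<delta>: "\<delta> \<in> Arr C" "Dom C \<delta> = Dom C f" "Cod C \<delta> = P" using h b s unfolding \<delta>_def by auto
  have q\<delta>: "q \<bullet> \<delta> = \<zero> (Dom C f) (Dom C g) \<setminus> f" unfolding \<delta>_def using h b s by (simp add: r3 r2)
  have p\<delta>: "p \<bullet> \<delta> = h" unfolding \<delta>_def using h b s by (simp add: r1 r4)
  have \<delta>m: "is_mono C \<delta>"
  proof (rule monoI[OF \<delta>(1)])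
    fix t assume t: "t \<in> Arr C" "Cod C t = Dom C \<delta>" "\<delta> \<bullet> t = \<zero> (Dom C t) (Cod C \<delta>)"
    have "(q \<bullet> \<delta>) \<bullet> t = \<zero> (Dom C t) (Dom C g)" using t b \<delta> s by simp
    then have "f \<bullet> t = \<zero> (Dom C t) (Dom C g)" unfolding q\<delta> using t s \<delta> by (simp add: minus_eq_zero)
    then show "t = \<zero> (Dom C t) (Dom C \<delta>)" using mono_zero[OF s(5), of t] t \<delta> s by simp
  qed
  obtain c where c: "is_cokernel C c \<delta>" using cokernels \<delta> by auto
  note sc = cokernel_simps[OF c]
  have cs: "c \<in> Arr C" "Dom C c = P" using sc \<delta> by auto
  have k: "is_kernel C \<delta> c" by (rule mono_is_kernel[OF \<delta>m c])
  have com: "c \<bullet> (i \<bullet> h) = c \<bullet> (j \<bullet> f)"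
  proof -
    have "c \<bullet> (i \<bullet> h) \<setminus> c \<bullet> (j \<bullet> f) = \<zero> (Dom C f) (Cod C c)" using sc(4) unfolding \<delta>_def using h b s cs by simp
    then show ?thesis using minus_eq_zero[of "c \<bullet> (i \<bullet> h)" "c \<bullet> (j \<bullet> f)"] h b s cs by simp
  qed
  have "(g \<bullet> q) \<bullet> \<delta> = g \<bullet> (\<zero> (Dom C f) (Dom C g) \<setminus> f)" using b s \<delta> by (simp add: q\<delta>)
  also have "\<dots> = \<zero> (Dom C f) (Cod C g)" using s by simp
  finally obtain g' where g': "g' \<in> Arr C" "Dom C g' = Cod C c" "Cod C g' = Cod C g" "g' \<bullet> c = g \<bullet> q"
    using cokernel_desc[OF c, of "g \<bullet> q"] b s \<delta> cs by auto
  have g'x: "g' \<bullet> (c \<bullet> x) = g \<bullet> (q \<bullet> x)" if "x \<in> Arr C" "Cod C x = P" for x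
    using comp_reduce[OF g'(4), of x] b that s g' cs by auto
  define f' where "f' = c \<bullet> i"
  define h' where "h' = c \<bullet> j"
  have f': "f' \<in> Arr C" "Dom C f' = Y" "Cod C f' = Cod C c" using b cs unfolding f'_def by auto
  have h': "h' \<in> Arr C" "Dom C h' = Cod C f" "Cod C h' = Cod C f'" using b cs s f' unfolding h'_def by auto
  have e1: "h' \<bullet> f = f' \<bullet> h" using com h b s cs unfolding f'_def h'_def by simp
  have e2: "g' \<bullet> h' = g" unfolding h'_def using g'x[of j] b bb s by simp
  have joint: "u = v" if "u \<in> homs C (Cod C f') T" "v \<in> homs C (Cod C f') T" "u \<bullet> f' = v \<bullet> f'" "u \<bullet> h' = v \<bullet> h'" for u v T
  proof -
    have "u \<bullet> c = (u \<bullet> c) \<bullet> (i \<bullet> p \<uplus> j \<bullet> q)" using bb b that cs f' by simp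
    also have "\<dots> = (u \<bullet> f') \<bullet> p \<uplus> (u \<bullet> h') \<bullet> q" using b that(1,2) cs f' unfolding f'_def h'_def by simp
    also have "\<dots> = (v \<bullet> f') \<bullet> p \<uplus> (v \<bullet> h') \<bullet> q" using that by simp
    also have "\<dots> = (v \<bullet> c) \<bullet> (i \<bullet> p \<uplus> j \<bullet> q)" using b that(1,2) cs f' unfolding f'_def h'_def by simp
    also have "\<dots> = v \<bullet> c" using bb b that cs f' by simp
    finally show ?thesis using epiD[OF cokernel_epi[OF c], of u v] that f' by auto
  qed
  have f'm: "is_mono C f'"
  proof (rule monoI[OF f'(1)])
    fix t assume t: "t \<in> Arr C" "Cod C t = Dom C f'" "f' \<bullet> t = \<zero> (Dom C t) (Cod C f')"
    then have "c \<bullet> (i \<bullet> t) = \<zero> (Dom C t) (Cod C c)" using f' b cs unfolding f'_def by simp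
    then obtain w where w: "w \<in> Arr C" "Dom C w = Dom C t" "Cod C w = Dom C f" "\<delta> \<bullet> w = i \<bullet> t"
      using kernel_lift[OF k, of "i \<bullet> t"] t b cs f' \<delta> by auto
    have "(q \<bullet> \<delta>) \<bullet> w = \<zero> (Dom C t) (Dom C g)" using w b \<delta> t f' by (simp add: r3)
    then have "f \<bullet> w = \<zero> (Dom C w) (Dom C g)" unfolding q\<delta> using w(1-3) s t(1)
        minus_eq_zero[of "\<zero> (Dom C t) (Dom C g)" "f \<bullet> w"] by simp
    then have "w = \<zero> (Dom C w) (Dom C f)" using mono_zero[OF s(5), of w] w s by simp
    then have "\<delta> \<bullet> w = \<zero> (Dom C t) P" using w \<delta> by (metis comp_Zero(1) Dom_Ob)
    then have "p \<bullet> (i \<bullet> t) = \<zero> (Dom C t) Y" using w b t by simp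
    then show "t = \<zero> (Dom C t) (Dom C f')" using r1 t f' by simp
  qed
  have g'f': "g' \<bullet> f' = \<zero> Y (Cod C g)" unfolding f'_def using g'x[of i] b bb s Y by simp
  have g'e: "is_epi C g'" using epi_factor[of g' h'] g' h' e2 s f' by simp
  have ck: "is_cokernel C g' f'"
  proof (rule cokernelI[OF g'e])
    fix u assume u: "u \<in> Arr C" "Dom C u = Cod C f'" "u \<bullet> f' = \<zero> (Dom C f') (Cod C u)"
    have "(u \<bullet> h') \<bullet> f = u \<bullet> (f' \<bullet> h)" using u h' f' h s e1 by simp
    also have "\<dots> = \<zero> (Dom C f') (Cod C u) \<bullet> h" by (rule comp_reduce) (use u h f' in auto)
    also have "\<dots> = \<zero> (Dom C f) (Cod C u)" using u h f' by simp
    finally obtain w where w: "w \<in> Arr C" "Dom C w = Cod C g" "Cod C w = Cod C u" "w \<bullet> g = u \<bullet> h'"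
      using cokernel_desc[OF s(8), of "u \<bullet> h'"] u h' s by auto
    have "w \<bullet> g' = u"
    proof (rule joint[of _ "Cod C u"])
      show "(w \<bullet> g') \<bullet> f' = u \<bullet> f'" using w g' f' u g'f' Y by simp
      show "(w \<bullet> g') \<bullet> h' = u \<bullet> h'" using w g' f' u e2 h' by simp
    qed (use w g' f' u in auto)
    then show "\<exists>w\<in>homs C (Cod C g') (Cod C u). w \<bullet> g' = u" using w g' by auto
  qed (use f' g' g'f' in auto)
  have univ: "\<exists>w\<in>homs C (Cod C f') T. w \<bullet> f' = u \<and> w \<bullet> h' = v"
    if uv: "u \<in> homs C Y T" "v \<in> homs C (Cod C f) T" "u \<bullet> h = v \<bullet> f" for T u v
  proof -
    have us: "u \<in> Arr C" "v \<in> Arr C" "Dom C u = Y" "Cod C u = T" "Dom C v = Dom C g" "Cod C v = T" "T \<in> Ob C"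
      using uv s by auto
    have "(u \<bullet> p \<uplus> v \<bullet> q) \<bullet> \<delta> = u \<bullet> (p \<bullet> \<delta>) \<uplus> v \<bullet> (q \<bullet> \<delta>)" using us b \<delta> by simp
    also have "\<dots> = u \<bullet> h \<uplus> (\<zero> (Dom C f) T \<setminus> v \<bullet> f)" unfolding p\<delta> q\<delta> using us s by simp
    also have "\<dots> = \<zero> (Dom C f) T" using us uv(3) s h by simp
    finally obtain w where w: "w \<in> Arr C" "Dom C w = Cod C c" "Cod C w = T" "w \<bullet> c = u \<bullet> p \<uplus> v \<bullet> q"
      using cokernel_desc[OF c, of "u \<bullet> p \<uplus> v \<bullet> q"] us b \<delta> by auto
    have wx: "w \<bullet> (c \<bullet> x) = (u \<bullet> p \<uplus> v \<bullet> q) \<bullet> x" if "x \<in> Arr C" "Cod C x = P" for x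
      using comp_reduce[OF w(4), of x] b that s w cs by simp
    have "w \<bullet> f' = u" "w \<bullet> h' = v" unfolding f'_def h'_def using us b s Y by (simp_all add: wx bb)
    then show ?thesis using w f' by auto
  qed
  have h'': "h' \<in> homs C (Cod C f) (Cod C f')" using h' by simp
  show ?thesis
    by (intro exI[of _ f'] exI[of _ g'] exI[of _ h'] conjI allI ballI impI short_exactI1[OF f'm ck] f'(2) g'(3) h'' e1 e2)
      (fact univ joint)+
qed

lemma pullback:
  assumes "short_exact C f g" and h: "h \<in> homs C Y (Cod C g)"
  shows "\<exists>f' g' h'. short_exact C f' g' \<and> Cod C g' = Y \<and> Dom C f' = Dom C f \<and> h' \<in> homs C (Dom C g') (Dom C g) \<and>
    g \<bullet> h' = h \<bullet> g' \<and> h' \<bullet> f' = f \<and>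
    (\<forall>T. \<forall>u\<in>homs C T Y. \<forall>v\<in>homs C T (Dom C g). h \<bullet> u = g \<bullet> v \<longrightarrow> (\<exists>w\<in>homs C T (Dom C g'). g' \<bullet> w = u \<and> h' \<bullet> w = v)) \<and>
    (\<forall>T. \<forall>u\<in>homs C T (Dom C g'). \<forall>v\<in>homs C T (Dom C g'). g' \<bullet> u = g' \<bullet> v \<longrightarrow> h' \<bullet> u = h' \<bullet> v \<longrightarrow> u = v)"
  using abelian_category.pushout[OF op_abelian, of g f h Y] assms
  unfolding op_short_exact op_simps op_homs by blast

lemma epi_pullback:
  assumes "is_epi C e" "h \<in> Arr C" "Cod C h = Cod C e"
  obtains p u where "is_epi C p" "Cod C p = Dom C h" "u \<in> homs C (Dom C p) (Dom C e)" "e \<bullet> u = h \<bullet> p"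
proof -
  obtain k where k: "is_kernel C k e" using kernels assms epi_arr by blast
  have "short_exact C k e" by (rule short_exactI2[OF assms(1) k])
  from pullback[OF this, of h "Dom C h"] obtain f' p u where "short_exact C f' p" "Cod C p = Dom C h"
    "u \<in> homs C (Dom C p) (Dom C e)" "e \<bullet> u = h \<bullet> p" using assms by auto
  then show thesis using that[of p u] short_exact_simps(6) by blast
qed

text \<open>The substitute for choosing a preimage of an element: the lift exists after pulling
  \<open>h\<close> back along an epimorphism \<open>p\<close>.\<close>

lemma exact_local_lift:
  assumes "exact_at C f g" "h \<in> Arr C" "Cod C h = Dom C g" "g \<bullet> h = \<zero> (Dom C h) (Cod C g)"
  obtains p u where "is_epi C p" "Cod C p = Dom C h" "u \<in> homs C (Dom C p) (Dom C f)" "f \<bullet> u = h \<bullet> p"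
proof -
  obtain m e where *: "is_kernel C m g" "is_epi C e" "Cod C e = Dom C m" "f = m \<bullet> e"
    using assms(1) unfolding exact_at_iff by auto
  note s = kernel_simps[OF *(1)] epi_arr[OF *(2)]
  obtain h' where h': "h' \<in> Arr C" "Dom C h' = Dom C h" "Cod C h' = Dom C m" "m \<bullet> h' = h"
    using kernel_lift[OF *(1), of h] assms by auto
  obtain p u where p: "is_epi C p" "Cod C p = Dom C h'" "u \<in> homs C (Dom C p) (Dom C e)" "e \<bullet> u = h' \<bullet> p"
    using epi_pullback[OF *(2), of h'] h' * by auto
  have "f \<bullet> u = m \<bullet> (e \<bullet> u)" using p * s by simp
  also have "\<dots> = h \<bullet> p" unfolding p(4) by (rule comp_reduce) (use p * s h' in auto)
  finally show thesis using that[of p u] p h' * s by simp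
qed

end

section \<open>Vanishing of Yoneda Ext as a lifting property\<close>

definition ext_split :: "('o, 'm) precat \<Rightarrow> 'o \<Rightarrow> 'o \<Rightarrow> bool" where
  "ext_split C A B \<longleftrightarrow> (\<forall>f g. short_exact C f g \<longrightarrow> Dom C f = B \<longrightarrow> Cod C g = A \<longrightarrow>
     (\<exists>r\<in>homs C (Cod C f) B. r \<odot>\<^bsub>C\<^esub> f = Id C B))"

definition extension_property :: "('o, 'm) precat \<Rightarrow> 'o set \<Rightarrow> 'o \<Rightarrow> bool" where
  "extension_property C S Y \<longleftrightarrow> Y \<in> Ob C \<and> (\<forall>j h. is_mono C j \<longrightarrow> cokernel_in C j S \<longrightarrow> h \<in> homs C (Dom C j) Y \<longrightarrow>
     (\<exists>h'\<in>homs C (Cod C j) Y. h' \<odot>\<^bsub>C\<^esub> j = h))"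

definition lifting_property :: "('o, 'm) precat \<Rightarrow> 'o set \<Rightarrow> 'o \<Rightarrow> bool" where
  "lifting_property C S P \<longleftrightarrow> P \<in> Ob C \<and> (\<forall>e h. is_epi C e \<longrightarrow> kernel_in C e S \<longrightarrow> h \<in> homs C P (Cod C e) \<longrightarrow>
     (\<exists>h'\<in>homs C P (Dom C e). e \<odot>\<^bsub>C\<^esub> h' = h))"

section \<open>Vanishing of Yoneda Ext as connectedness of the extensions\<close>

lemma Ext_zero_connected:
  assumes "Ext_zero C n A B" "\<xi> \<in> extensions C n A B" "\<xi>' \<in> extensions C n A B"
  shows "(\<xi>, \<xi>') \<in> (extension_arrows C n A B \<union> (extension_arrows C n A B)\<inverse>)\<^sup>*"
proof -
  let ?r = "(extension_arrows C n A B \<union> (extension_arrows C n A B)\<inverse>)\<^sup>*"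
  have "?r `` {\<xi>} \<in> yoneda_Ext C n A B" "?r `` {\<xi>'} \<in> yoneda_Ext C n A B"
    using assms(2,3) by (auto simp: yoneda_Ext_def intro: quotientI)
  then have "?r `` {\<xi>} = ?r `` {\<xi>'}" using assms(1) by (auto simp: Ext_zero_def is_singleton_def)
  then show ?thesis by auto
qed

text \<open>The way to use a vanishing Ext: a property preserved in both directions by morphisms of
  extensions spreads along the zigzags from one extension, in practice the trivial one, to all
  others.\<close>

lemma Ext_zero_invariant:
  assumes "Ext_zero C n A B" "\<xi> \<in> extensions C n A B" "\<xi>' \<in> extensions C n A B" "P \<xi>"
    and inv: "\<And>x y. (x, y) \<in> extension_arrows C n A B \<Longrightarrow> P x \<longleftrightarrow> P y"
  shows "P \<xi>'"
  using Ext_zero_connected[OF assms(1-3)]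
  by (induction rule: rtrancl_induct) (use assms(4) inv in auto)

text \<open>If every extension has a direct morphism to one fixed extension, the zigzags of length
  one already make the quotient a single class.\<close>

lemma Ext_zeroI:
  assumes "\<xi>\<^sub>0 \<in> extensions C n A B" "\<And>\<xi>. \<xi> \<in> extensions C n A B \<Longrightarrow> (\<xi>, \<xi>\<^sub>0) \<in> extension_arrows C n A B"
  shows "Ext_zero C n A B"
proof -
  let ?a = "extension_arrows C n A B \<union> (extension_arrows C n A B)\<inverse>"
  have sym: "sym (?a\<^sup>*)" by (intro sym_rtrancl symI) auto
  have *: "(\<xi>, \<xi>\<^sub>0) \<in> ?a\<^sup>*" if "\<xi> \<in> extensions C n A B" for \<xi>
    using assms(2)[OF that] by auto
  have cl: "?a\<^sup>* `` {\<xi>} = ?a\<^sup>* `` {\<xi>\<^sub>0}" if "\<xi> \<in> extensions C n A B" for \<xi>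
    using *[OF that] symD[OF sym *[OF that]] by (auto intro: rtrancl_trans[of \<xi>\<^sub>0 \<xi>] rtrancl_trans[of \<xi> \<xi>\<^sub>0])
  have "?a\<^sup>* `` {\<xi>\<^sub>0} \<in> yoneda_Ext C n A B" unfolding yoneda_Ext_def by (rule quotientI) (rule assms(1))
  moreover have "X = ?a\<^sup>* `` {\<xi>\<^sub>0}" if "X \<in> yoneda_Ext C n A B" for X
    using that unfolding yoneda_Ext_def by (rule quotientE) (use cl in blast)
  ultimately have "yoneda_Ext C n A B = {?a\<^sup>* `` {\<xi>\<^sub>0}}" by blast
  then show ?thesis by (auto simp: Ext_zero_def is_singleton_def)
qed

context abelian_category
begin

lemma lifting_op: "lifting_property C S P \<longleftrightarrow> extension_property (op_category C) S P"
  by (auto simp: lifting_property_def extension_property_def)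

lemma extension_op: "extension_property C S P \<longleftrightarrow> lifting_property (op_category C) S P"
  by (auto simp: lifting_property_def extension_property_def)

lemma extension_propertyD:
  assumes "extension_property C S Y" "is_mono C j" "cokernel_in C j S" "h \<in> homs C (Dom C j) Y"
  obtains h' where "h' \<in> homs C (Cod C j) Y" "h' \<bullet> j = h"
  using assms unfolding extension_property_def by metis

lemma lifting_propertyD:
  assumes "lifting_property C S P" "is_epi C e" "kernel_in C e S" "h \<in> homs C P (Cod C e)"
  obtains h' where "h' \<in> homs C P (Dom C e)" "e \<bullet> h' = h"
  using assms unfolding lifting_property_def by metis

text \<open>The projector complementary to \<open>f \<bullet> r\<close> kills \<open>f\<close>, so
  it factors through the cokernel \<open>g\<close>; that factor is the section.\<close>

lemma retraction_imp_section:
  assumes "short_exact C f g" "r \<in> homs C (Cod C f) (Dom C f)" "r \<bullet> f = Id C (Dom C f)"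
  shows "\<exists>s\<in>homs C (Cod C g) (Dom C g). g \<bullet> s = Id C (Cod C g)"
proof -
  note s = short_exact_simps[OF assms(1)]
  let ?t = "Id C (Dom C g) \<setminus> f \<bullet> r"
  have t: "?t \<in> Arr C" "Dom C ?t = Dom C g" "Cod C ?t = Dom C g" using assms s by auto
  have "?t \<bullet> f = \<zero> (Dom C f) (Dom C g)" using assms s by simp
  then obtain w where w: "w \<in> Arr C" "Dom C w = Cod C g" "Cod C w = Dom C g" "w \<bullet> g = ?t"
    using cokernel_desc[OF s(8), of ?t] t s by auto
  have gf: "g \<bullet> (f \<bullet> r) = \<zero> (Dom C f) (Cod C g) \<bullet> r" by (rule comp_reduce) (use s assms in auto)
  have "(g \<bullet> w) \<bullet> g = g \<bullet> ?t" using w s by simp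
  also have "\<dots> = g" using s assms gf by simp
  finally have "g \<bullet> w = Id C (Cod C g)" using epiD[OF s(6), of "g \<bullet> w" "Id C (Cod C g)"] w s by simp
  then show ?thesis using w by auto
qed

lemma section_imp_retraction:
  assumes "short_exact C f g" "s \<in> homs C (Cod C g) (Dom C g)" "g \<bullet> s = Id C (Cod C g)"
  shows "\<exists>r\<in>homs C (Cod C f) (Dom C f). r \<bullet> f = Id C (Dom C f)"
  using abelian_category.retraction_imp_section[OF op_abelian, of g f s] assms short_exact_simps(3)[OF assms(1)]
  by simp

lemma op_ext_split: "ext_split (op_category C) A B \<longleftrightarrow> ext_split C B A"
  unfolding ext_split_def op_short_exact op_simps op_homs
  using retraction_imp_section section_imp_retraction by (smt (verit) short_exact_simps(3))

lemma ext_split_section: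
  assumes "ext_split C A B" "short_exact C f g" "Dom C f = B" "Cod C g = A"
  obtains s where "s \<in> homs C A (Dom C g)" "g \<bullet> s = Id C A"
  using assms retraction_imp_section[OF assms(2)] unfolding ext_split_def by metis

text \<open>Pushing the sequence of \<open>j\<close> out along \<open>h\<close> gives an extension
  by \<open>Y\<close> with the same cokernel. A retraction of it, composed with the canonical arrow
  into the pushout, extends \<open>h\<close>. Conversely a retraction is an extension of the
  identity.\<close>

lemma extension_property_iff_split:
  "extension_property C S Y \<longleftrightarrow> Y \<in> Ob C \<and> (\<forall>A\<in>S. ext_split C A Y)"
proof (intro iffI conjI ballI)
  assume *: "extension_property C S Y"
  then show Y: "Y \<in> Ob C" by (simp add: extension_property_def)
  fix A assume "A \<in> S"
  show "ext_split C A Y"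
    unfolding ext_split_def
  proof (intro allI impI)
    fix f g assume **: "short_exact C f g" "Dom C f = Y" "Cod C g = A"
    note s = short_exact_simps[OF **(1)]
    have "cokernel_in C f S" using s(8) ** \<open>A \<in> S\<close> unfolding cokernel_in_def by auto
    then show "\<exists>r\<in>homs C (Cod C f) Y. r \<bullet> f = Id C Y"
      using extension_propertyD[OF * s(5), of "Id C Y"] ** Y by (metis in_homs Id_simps)
  qed
next
  assume *: "Y \<in> Ob C \<and> (\<forall>A\<in>S. ext_split C A Y)"
  show "extension_property C S Y"
    unfolding extension_property_def
  proof (intro conjI allI impI)
    fix j h assume j: "is_mono C j" "cokernel_in C j S" "h \<in> homs C (Dom C j) Y"
    then obtain c where c: "is_cokernel C c j" "Cod C c \<in> S" by (auto simp: cokernel_in_def)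
    have se: "short_exact C j c" by (rule short_exactI1) (use j c in auto)
    obtain f' g' h' where p: "short_exact C f' g'" "Dom C f' = Y" "Cod C g' = Cod C c" "h' \<in> homs C (Cod C j) (Cod C f')"
      "h' \<bullet> j = f' \<bullet> h" using pushout[OF se j(3)] by blast
    obtain r where r: "r \<in> homs C (Cod C f') Y" "r \<bullet> f' = Id C Y"
      using * c p unfolding ext_split_def by metis
    note s = short_exact_simps[OF p(1)]
    have "r \<bullet> (f' \<bullet> h) = Id C Y \<bullet> h" by (rule comp_reduce) (use r p s j in auto)
    then have "(r \<bullet> h') \<bullet> j = h" using r p s j by simp
    then show "\<exists>h'\<in>homs C (Cod C j) Y. h' \<bullet> j = h"
      using r p by (intro bexI[of _ "r \<bullet> h'"]) auto
  qed (use * in auto)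
qed

lemma lifting_property_iff_split:
  "lifting_property C S P \<longleftrightarrow> P \<in> Ob C \<and> (\<forall>A\<in>S. ext_split C P A)"
  unfolding lifting_op abelian_category.extension_property_iff_split[OF op_abelian] op_ext_split by simp

lemma short_exact_biproduct:
  assumes "i \<in> homs C A P" "j \<in> homs C B P" "p \<in> homs C P A" "q \<in> homs C P B"
    "p \<bullet> i = Id C A" "q \<bullet> j = Id C B" "q \<bullet> i = \<zero> A B" "i \<bullet> p \<uplus> j \<bullet> q = Id C P"
  shows "short_exact C i q"
proof (rule short_exactI2)
  have AB: "A \<in> Ob C" "B \<in> Ob C" using assms by auto
  show "is_epi C q" using epi_factor[of q j] Id_epi[of B] assms by auto
  have m: "is_mono C i" using mono_factor[of p i] Id_mono[of A] assms by auto
  show "is_kernel C i q"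
  proof (rule kernelI[OF m])
    fix h assume h: "h \<in> Arr C" "Cod C h = Dom C q" "q \<bullet> h = \<zero> (Dom C h) (Cod C q)"
    have "h = (i \<bullet> p \<uplus> j \<bullet> q) \<bullet> h" using assms h by simp
    also have "\<dots> = i \<bullet> (p \<bullet> h) \<uplus> j \<bullet> (q \<bullet> h)" using assms(1-4) h(1,2) by simp
    also have "\<dots> = i \<bullet> (p \<bullet> h)" unfolding h(3) using assms(1-4) h(1,2) by simp
    finally show "\<exists>u\<in>homs C (Dom C h) (Dom C i). i \<bullet> u = h" using assms h
      by (intro bexI[of _ "p \<bullet> h"]) auto
  qed (use assms in auto)
qed

lemma extension_short_exact:
  assumes "(E, d) \<in> extensions C 1 A B"
  shows "short_exact C (d 0) (d 1)" "Dom C (d 0) = B" "Cod C (d 1) = A" "d 0 \<in> homs C B (E 1)" "d 1 \<in> homs C (E 1) A"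
proof -
  have "d 0 \<in> homs C (E 0) (E 1)" "d 1 \<in> homs C (E 1) (E 2)" "E 0 = B" "E 2 = A" "is_mono C (d 0)"
    "exact_at C (d 0) (d 1)" "is_epi C (d 1)"
    using assms unfolding extensions_def by (auto simp: numeral_2_eq_2 simp del: in_homs)
  then show "short_exact C (d 0) (d 1)" "Dom C (d 0) = B" "Cod C (d 1) = A" "d 0 \<in> homs C B (E 1)" "d 1 \<in> homs C (E 1) A"
    by (auto simp: short_exact_def)
qed

lemma short_exact_extension:
  assumes "short_exact C f g" "Dom C f = B" "Cod C g = A"
  shows "(\<lambda>i. if i = 0 then B else if i = 1 then Cod C f else A, \<lambda>i. if i = 0 then f else g) \<in> extensions C 1 A B"
  using assms short_exact_simps[OF assms(1)] unfolding extensions_def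
  by (auto simp: short_exact_def le_Suc_eq)

text \<open>Splitting is invariant under morphisms of extensions: sections are pushed forward along
  the middle component \<open>u 1\<close>, retractions are pulled back along it. Conversely a split
  extension maps to the biproduct extension, so \<open>Ext_zeroI\<close> applies.\<close>

lemma Ext_zero_1_iff:
  assumes AB: "A \<in> Ob C" "B \<in> Ob C"
  shows "Ext_zero C 1 A B \<longleftrightarrow> ext_split C A B"
proof
  obtain P i j p q where b: "P \<in> Ob C" "i \<in> Arr C" "j \<in> Arr C" "p \<in> Arr C" "q \<in> Arr C"
    "Dom C i = B" "Cod C i = P" "Dom C j = A" "Cod C j = P" "Dom C p = P" "Cod C p = B" "Dom C q = P" "Cod C q = A"
    "p \<bullet> i = Id C B" "q \<bullet> j = Id C A" "q \<bullet> i = \<zero> B A" "p \<bullet> j = \<zero> A B" "i \<bullet> p \<uplus> j \<bullet> q = Id C P"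
    using biproductE[OF AB(2,1)] by metis
  have se: "short_exact C i q" by (rule short_exact_biproduct[of i B P j A p q]) (use b in auto)
  define \<xi> where "\<xi> = (\<lambda>k::nat. if k = 0 then B else if k = 1 then P else A, \<lambda>k::nat. if k = 0 then i else q)"
  have \<xi>: "\<xi> \<in> extensions C 1 A B"
    using short_exact_extension[OF se b(6) b(13)] unfolding \<xi>_def b(7) .
  define Sp where "Sp = (\<lambda>(E :: nat \<Rightarrow> 'o, d :: nat \<Rightarrow> 'm). \<exists>r\<in>homs C (E 1) B. r \<bullet> d 0 = Id C B)"
  {
    assume Ext: "Ext_zero C 1 A B"
    show "ext_split C A B"
      unfolding ext_split_def
    proof (intro allI impI)
      fix f g assume *: "short_exact C f g" "Dom C f = B" "Cod C g = A"
      let ?\<xi>' = "(\<lambda>i::nat. if i = 0 then B else if i = 1 then Cod C f else A, \<lambda>i::nat. if i = 0 then f else g)"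
      have "Sp ?\<xi>'"
      proof (rule Ext_zero_invariant[OF Ext \<xi> short_exact_extension[OF *]])
        show "Sp \<xi>" unfolding Sp_def \<xi>_def using b by auto
        fix x y assume xy: "(x, y) \<in> extension_arrows C 1 A B"
        obtain E d E' d' where [simp]: "x = (E, d)" "y = (E', d')" by (metis surj_pair)
        have x: "(E, d) \<in> extensions C 1 A B" and y: "(E', d') \<in> extensions C 1 A B"
          using xy by (auto simp: extension_arrows_def)
        note ex = extension_short_exact[OF x] and ey = extension_short_exact[OF y]
        obtain u where u0: "u (0::nat) = Id C B" "u 2 = Id C A" and ty: "\<forall>i\<le>2. u i \<in> homs C (E i) (E' i)"
          and cm: "\<forall>i\<le>1. u (i + 1) \<bullet> d i = d' i \<bullet> u i"
          using xy unfolding extension_arrows_def by (auto simp: numeral_2_eq_2 simp del: in_homs)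
        have u: "u 1 \<in> homs C (E 1) (E' 1)" using ty by auto
        have uc: "u 1 \<bullet> d 0 = d' 0 \<bullet> u 0" "u 2 \<bullet> d 1 = d' 1 \<bullet> u 1"
          using cm[rule_format, of 0] cm[rule_format, of 1] by (auto simp: numeral_2_eq_2)
        have u1: "u 1 \<bullet> d 0 = d' 0" and u2: "d' 1 \<bullet> u 1 = d 1" using u0 uc ex ey AB by auto
        show "Sp x \<longleftrightarrow> Sp y"
        proof
          assume "Sp x"
          then obtain r where r: "r \<in> homs C (Cod C (d 0)) (Dom C (d 0))" "r \<bullet> d 0 = Id C (Dom C (d 0))" using ex(2,4) by (auto simp: Sp_def)
          obtain s where s: "s \<in> homs C A (E 1)" "d 1 \<bullet> s = Id C A"
            using retraction_imp_section[OF ex(1) r] ex by auto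
          have "d' 1 \<bullet> (u 1 \<bullet> s) = d 1 \<bullet> s" by (rule comp_reduce) (use u2 u s ex ey in auto)
          then obtain r where "r \<in> homs C (Cod C (d' 0)) (Dom C (d' 0))" "r \<bullet> d' 0 = Id C (Dom C (d' 0))"
            using section_imp_retraction[OF ey(1), of "u 1 \<bullet> s"] u s ex ey by auto
          then show "Sp y" using ey by (auto simp: Sp_def)
        next
          assume "Sp y"
          then obtain r where r: "r \<in> homs C (E' 1) B" "r \<bullet> d' 0 = Id C B" by (auto simp: Sp_def)
          have "(r \<bullet> u 1) \<bullet> d 0 = Id C B" using r u u1 ex ey by simp
          then show "Sp x" using r u unfolding Sp_def by (auto intro!: bexI[of _ "r \<bullet> u 1"])
        qed
      qed
      then show "\<exists>r\<in>homs C (Cod C f) B. r \<bullet> f = Id C B" by (simp add: Sp_def)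
    qed
  next
    assume sp: "ext_split C A B"
    show "Ext_zero C 1 A B"
    proof (rule Ext_zeroI[OF \<xi>])
      fix x assume x: "x \<in> extensions C 1 A B"
      obtain E d where xe: "x = (E, d)" by (metis surj_pair)
      note ex = extension_short_exact[OF x[unfolded xe]]
      have exE: "E 0 = B" "E 2 = A" using x unfolding xe extensions_def by (auto simp: numeral_2_eq_2)
      obtain r where r: "r \<in> homs C (E 1) B" "r \<bullet> d 0 = Id C B"
        using sp[unfolded ext_split_def, rule_format, OF ex(1-3)] ex(4) by auto
      \<comment> \<open>The arrow into the biproduct whose components are the retraction
        \<open>r\<close> and the projection \<open>d 1\<close>.\<close>
      let ?m = "i \<bullet> r \<uplus> j \<bullet> d 1"
      have m: "?m \<in> homs C (E 1) P" using b r ex by auto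
      have m0: "?m \<bullet> d 0 = i" using b(1-13) r ex AB short_exact_simps(4)[OF ex(1)] by simp
      have qi: "q \<bullet> (i \<bullet> r) = \<zero> B A \<bullet> r" by (rule comp_reduce) (use b r in auto)
      have qj: "q \<bullet> (j \<bullet> d 1) = Id C A \<bullet> d 1" by (rule comp_reduce) (use b ex in auto)
      have m1: "q \<bullet> ?m = d 1" using b(1-13) r ex AB qi qj by simp
      let ?u = "\<lambda>k::nat. if k = 0 then Id C B else if k = 1 then ?m else Id C A"
      have H: "(\<forall>k\<le>1 + 1. ?u k \<in> homs C (E k) (fst \<xi> k)) \<and> ?u 0 = Id C B \<and> ?u (1 + 1) = Id C A \<and>
        (\<forall>k\<le>1. ?u (k + 1) \<bullet> d k = snd \<xi> k \<bullet> ?u k)"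
        using m m0 m1 b(1-13) exE ex AB unfolding \<xi>_def
        by (auto simp: le_Suc_eq numeral_2_eq_2 simp del: comp_add)
      have "(E, d) \<in> extensions C 1 A B \<and> (fst \<xi>, snd \<xi>) \<in> extensions C 1 A B \<and> (\<exists>u. (\<forall>k\<le>1 + 1. u k \<in> homs C (E k) (fst \<xi> k)) \<and>
        u 0 = Id C B \<and> u (1 + 1) = Id C A \<and> (\<forall>k\<le>1. u (k + 1) \<bullet> d k = snd \<xi> k \<bullet> u k))"
        using x \<xi> xe by (intro conjI exI[of _ ?u] H[THEN conjunct1] H[THEN conjunct2, THEN conjunct1]
            H[THEN conjunct2, THEN conjunct2, THEN conjunct1] H[THEN conjunct2, THEN conjunct2, THEN conjunct2]) auto
      then show "(x, \<xi>) \<in> extension_arrows C 1 A B"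
        unfolding extension_arrows_def xe by (simp add: case_prod_beta)
    qed
  }
qed

lemma right_orth_iff:
  assumes "S \<subseteq> Ob C" shows "X \<in> right_orth C S \<longleftrightarrow> extension_property C S X"
  using assms Ext_zero_1_iff unfolding right_orth_def extension_property_iff_split by auto

lemma left_orth_iff:
  assumes "S \<subseteq> Ob C" shows "X \<in> left_orth C S \<longleftrightarrow> lifting_property C S X"
  using assms Ext_zero_1_iff unfolding left_orth_def lifting_property_iff_split by auto

text \<open>Given an extension of \<open>A\<close> by the middle object, extend \<open>q\<close>
  over \<open>f\<close> to an arrow \<open>e\<close>. The kernel \<open>k\<close> of
  \<open>e\<close> is then the middle of an extension of \<open>A\<close> by \<open>Dom C i\<close>;
  it splits, and composing its section with \<open>k\<close> splits the given extension.\<close>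

lemma ext_split_middle:
  assumes "short_exact C i q" "ext_split C A (Dom C i)" "ext_split C A (Cod C q)"
  shows "ext_split C A (Dom C q)"
  unfolding ext_split_def
proof (intro allI impI)
  fix f g assume *: "short_exact C f g" "Dom C f = Dom C q" "Cod C g = A"
  note s = short_exact_simps[OF *(1)] and t = short_exact_simps[OF assms(1)]
  have "extension_property C {A} (Cod C q)" using assms(3) t by (simp add: extension_property_iff_split)
  moreover have "cokernel_in C f {A}" using s * by (auto simp: cokernel_in_def)
  ultimately obtain e where e: "e \<in> homs C (Cod C f) (Cod C q)" "e \<bullet> f = q"
    using extension_propertyD[of "{A}" "Cod C q" f q] s t * by auto
  have ee: "is_epi C e" using epi_factor[of e f] e t s * by auto
  obtain k where k: "is_kernel C k e" using kernels ee epi_arr by blast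
  note sk = kernel_simps[OF k]
  have ck: "is_cokernel C e k" by (rule epi_is_cokernel[OF ee k])
  have ar: "e \<in> Arr C" "Dom C e = Dom C g" "Cod C e = Cod C q" "k \<in> Arr C" "Cod C k = Dom C g" "f \<in> Arr C" "g \<in> Arr C"
    "Cod C f = Dom C g" "Dom C f = Dom C q" "i \<in> Arr C" "q \<in> Arr C" "Cod C i = Dom C q" using e sk s t * by auto
  have "e \<bullet> (f \<bullet> i) = q \<bullet> i" by (rule comp_reduce[OF e(2)]) (use ar in auto)
  then obtain i' where i': "i' \<in> Arr C" "Dom C i' = Dom C i" "Cod C i' = Dom C k" "k \<bullet> i' = f \<bullet> i"
    using kernel_lift[OF k, of "f \<bullet> i"] ar t by auto
  have fi: "is_mono C (f \<bullet> i)" by (rule comp_mono) (use t s * in auto)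
  have m: "is_mono C i'" using mono_factor[of k i'] fi i' ar by auto
  have se: "short_exact C i' (g \<bullet> k)"
  proof (rule short_exactI2)
    show "is_epi C (g \<bullet> k)"
    proof (rule epiI)
      fix x assume x: "x \<in> Arr C" "Dom C x = Cod C (g \<bullet> k)" "x \<bullet> (g \<bullet> k) = \<zero> (Dom C (g \<bullet> k)) (Cod C x)"
      then obtain w where w: "w \<in> Arr C" "Dom C w = Cod C e" "Cod C w = Cod C x" "w \<bullet> e = x \<bullet> g"
        using cokernel_desc[OF ck, of "x \<bullet> g"] ar by auto
      have "w \<bullet> (e \<bullet> f) = (x \<bullet> g) \<bullet> f" using comp_reduce[OF w(4), of f] w x ar by simp
      then have "w \<bullet> q = \<zero> (Dom C q) (Cod C w)" using e s x w ar by simp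
      then have "w = \<zero> (Cod C q) (Cod C w)" using epi_zero[OF t(6), of w] w ar by simp
      then have "w \<bullet> e = \<zero> (Dom C g) (Cod C x)" using w ar by (metis comp_Zero(2) Cod_Ob)
      then have "x = \<zero> (Cod C g) (Cod C x)" using epi_zero[OF s(6), of x] w x ar by simp
      then show "x = \<zero> (Cod C (g \<bullet> k)) (Cod C x)" using ar by simp
    qed (use ar in auto)
    show "is_kernel C i' (g \<bullet> k)"
    proof (rule kernelI[OF m])
      have "(g \<bullet> k) \<bullet> i' = g \<bullet> (f \<bullet> i)" using i' ar by simp
      also have "\<dots> = \<zero> (Dom C f) (Cod C g) \<bullet> i" by (rule comp_reduce) (use s ar in auto)
      finally show "(g \<bullet> k) \<bullet> i' = \<zero> (Dom C i') (Cod C (g \<bullet> k))" using i' ar by simp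
      fix h assume h: "h \<in> Arr C" "Cod C h = Dom C (g \<bullet> k)" "(g \<bullet> k) \<bullet> h = \<zero> (Dom C h) (Cod C (g \<bullet> k))"
      then obtain y where y: "y \<in> Arr C" "Dom C y = Dom C h" "Cod C y = Dom C q" "f \<bullet> y = k \<bullet> h"
        using kernel_lift[OF s(7), of "k \<bullet> h"] ar * by auto
      have "q \<bullet> y = e \<bullet> (f \<bullet> y)" using comp_reduce[OF e(2), of y] y ar by simp
      also have "\<dots> = \<zero> (Dom C k) (Cod C e) \<bullet> h" unfolding y(4) by (rule comp_reduce) (use sk ar h in auto)
      also have "\<dots> = \<zero> (Dom C y) (Cod C q)" using h y ar by simp
      finally obtain z where z: "z \<in> Arr C" "Dom C z = Dom C h" "Cod C z = Dom C i" "i \<bullet> z = y"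
        using kernel_lift[OF t(7), of y] y by auto
      have "k \<bullet> (i' \<bullet> z) = (f \<bullet> i) \<bullet> z" by (rule comp_reduce[OF i'(4)]) (use i' z ar in auto)
      also have "\<dots> = k \<bullet> h" using z y ar by simp
      finally have "i' \<bullet> z = h" using monoD[OF kernel_mono[OF k], of "i' \<bullet> z" h] i' z h ar by simp
      then show "\<exists>u\<in>homs C (Dom C h) (Dom C i'). i' \<bullet> u = h" using z i' by auto
    qed (use ar i' in auto)
  qed
  obtain \<sigma> where \<sigma>: "\<sigma> \<in> homs C A (Dom C (g \<bullet> k))" "(g \<bullet> k) \<bullet> \<sigma> = Id C A"
    using ext_split_section[OF assms(2) se i'(2)] ar * by auto
  then show "\<exists>r\<in>homs C (Cod C f) (Dom C q). r \<bullet> f = Id C (Dom C q)"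
    using section_imp_retraction[OF *(1), of "k \<bullet> \<sigma>"] ar * by auto
qed

lemma extension_property_middle:
  assumes "short_exact C i q" "extension_property C S (Dom C i)" "extension_property C S (Cod C q)"
  shows "extension_property C S (Dom C q)"
  using assms ext_split_middle[OF assms(1)] short_exact_simps(2)[OF assms(1)]
  unfolding extension_property_iff_split by auto

text \<open>
  For a two-fold extension \<open>B \<rightarrow> E\<^sub>1 \<rightarrow> E\<^sub>2 \<rightarrow> A\<close> with vanishing class, \<open>G\<close> is the middle object both of an extension of
  \<open>A\<close> by \<open>E\<^sub>1\<close> that pushes forward to the right half and of an extension of \<open>E\<^sub>2\<close> by \<open>B\<close> that pulls back to the left half.
  The first description is stable under morphisms of extensions in one direction, the second in the other.
\<close>

lemma splice_imp:
  assumes "is_mono C d0" "exact_at C d0 d1" "exact_at C d1 d2" "is_epi C d2"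
    and a: "a \<in> homs C (Dom C d1) G" and b: "b \<in> homs C G (Cod C d1)" "b \<bullet> a = d1" and se: "short_exact C a (d2 \<bullet> b)"
  shows "short_exact C (a \<bullet> d0) b"
proof -
  note s = short_exact_simps[OF se] and e1 = exact_at_simps[OF assms(2)] and e2 = exact_at_simps[OF assms(3)]
  have k: "is_kernel C d0 d1" by (rule exact_mono_kernel) fact+
  have c: "is_cokernel C d2 d1" by (rule exact_epi_cokernel) fact+
  have ar: "a \<in> Arr C" "b \<in> Arr C" "d0 \<in> Arr C" "d1 \<in> Arr C" "d2 \<in> Arr C" "Dom C a = Dom C d1" "Cod C a = G" "Dom C b = G" "Cod C b = Dom C d2"
    "Cod C d0 = Dom C d1" "Cod C d1 = Dom C d2" using a b e1 e2 by auto
  have m: "is_mono C (a \<bullet> d0)" by (rule comp_mono) (use s assms ar in auto)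
  have ba: "b \<bullet> (a \<bullet> x) = d1 \<bullet> x" if "x \<in> Arr C" "Cod C x = Dom C d1" for x
    using comp_reduce[OF b(2), of x] that ar by simp
  show ?thesis
  proof (rule short_exactI2)
    show "is_epi C b"
    proof (rule epiI)
      fix t assume t: "t \<in> Arr C" "Dom C t = Cod C b" "t \<bullet> b = \<zero> (Dom C b) (Cod C t)"
      have "t \<bullet> d1 = (t \<bullet> b) \<bullet> a" using b t(1,2) ar by simp
      also have "\<dots> = \<zero> (Dom C d1) (Cod C t)" unfolding t(3) using ar t by simp
      finally obtain w where w: "w \<in> Arr C" "Dom C w = Cod C d2" "Cod C w = Cod C t" "w \<bullet> d2 = t"
        using cokernel_desc[OF c, of t] t ar by auto
      have "w \<bullet> (d2 \<bullet> b) = t \<bullet> b" by (rule comp_reduce[OF w(4)]) (use w t ar in auto)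
      then have "w = \<zero> (Cod C (d2 \<bullet> b)) (Cod C w)" using w t ar s by (intro epi_zero) auto
      then have "w \<bullet> d2 = \<zero> (Dom C d2) (Cod C w)" using ar w by (metis comp_Zero(2) Cod_Ob comp_simps(3))
      then show "t = \<zero> (Cod C b) (Cod C t)" using w ar by simp
    qed (use ar in auto)
    show "is_kernel C (a \<bullet> d0) b"
    proof (rule kernelI[OF m])
      fix h assume h: "h \<in> Arr C" "Cod C h = Dom C b" "b \<bullet> h = \<zero> (Dom C h) (Cod C b)"
      then obtain e where e: "e \<in> Arr C" "Dom C e = Dom C h" "Cod C e = Dom C a" "a \<bullet> e = h"
        using kernel_lift[OF s(7), of h] ar by auto
      have "d1 \<bullet> e = \<zero> (Dom C e) (Cod C d1)" using ba[of e] e h ar by simp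
      then obtain y where y: "y \<in> Arr C" "Dom C y = Dom C e" "Cod C y = Dom C d0" "d0 \<bullet> y = e"
        using kernel_lift[OF k, of e] e ar by auto
      then show "\<exists>u\<in>homs C (Dom C h) (Dom C (a \<bullet> d0)). (a \<bullet> d0) \<bullet> u = h"
        using e ar by (intro bexI[of _ y]) auto
    qed (use ar ba[of d0] e1 in auto)
  qed
qed

lemma splice_iff:
  assumes "is_mono C d0" "exact_at C d0 d1" "exact_at C d1 d2" "is_epi C d2"
    and "a \<in> homs C (Dom C d1) G" "b \<in> homs C G (Cod C d1)" "b \<bullet> a = d1"
  shows "short_exact C a (d2 \<bullet> b) \<longleftrightarrow> short_exact C (a \<bullet> d0) b"
  using splice_imp[OF assms] abelian_category.splice_imp[OF op_abelian, of d2 d1 d0 b G a] assms by auto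

definition splice_splits :: "'m \<Rightarrow> 'm \<Rightarrow> 'm \<Rightarrow> bool" where
  "splice_splits d0 d1 d2 \<longleftrightarrow> (\<exists>G a b. a \<in> homs C (Dom C d1) G \<and> b \<in> homs C G (Cod C d1) \<and> b \<bullet> a = d1 \<and> short_exact C a (d2 \<bullet> b))"

text \<open>Push the extension of \<open>A\<close> by \<open>Dom C d1\<close> out along
  \<open>u1\<close>. The universal property applied to \<open>d1'\<close> and
  \<open>u2 \<bullet> b\<close> yields \<open>b'\<close>, and joint epimorphy shows that the new
  epimorphism is \<open>d2' \<bullet> b'\<close>.\<close>

lemma splice_splits_forward:
  assumes d: "d1 \<in> Arr C" "d2 \<in> Arr C" "d1' \<in> Arr C" "d2' \<in> Arr C" "Dom C d2 = Cod C d1" "Dom C d2' = Cod C d1'"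
      "d2' \<bullet> d1' = \<zero> (Dom C d1') (Cod C d2')"
    and u: "u1 \<in> homs C (Dom C d1) (Dom C d1')" "u2 \<in> homs C (Cod C d1) (Cod C d1')" "u2 \<bullet> d1 = d1' \<bullet> u1" "d2' \<bullet> u2 = d2"
    and sp: "splice_splits d0 d1 d2"
  shows "splice_splits d0' d1' d2'"
proof -
  obtain G a b where ab: "a \<in> homs C (Dom C d1) G" "b \<in> homs C G (Cod C d1)" "b \<bullet> a = d1" and se: "short_exact C a (d2 \<bullet> b)"
    using sp by (auto simp: splice_splits_def)
  have "u1 \<in> homs C (Dom C a) (Dom C d1')" using u ab by simp
  from pushout[OF se this] obtain a' c' h' where p: "short_exact C a' c'" "Dom C a' = Dom C d1'" "Cod C c' = Cod C (d2 \<bullet> b)"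
      "h' \<in> homs C (Cod C a) (Cod C a')" "h' \<bullet> a = a' \<bullet> u1" "c' \<bullet> h' = d2 \<bullet> b" and
     univ: "\<forall>T. \<forall>u\<in>homs C (Dom C d1') T. \<forall>v\<in>homs C (Cod C a) T. u \<bullet> u1 = v \<bullet> a \<longrightarrow> (\<exists>w\<in>homs C (Cod C a') T. w \<bullet> a' = u \<and> w \<bullet> h' = v)" and
     joint: "\<forall>T. \<forall>u\<in>homs C (Cod C a') T. \<forall>v\<in>homs C (Cod C a') T. u \<bullet> a' = v \<bullet> a' \<longrightarrow> u \<bullet> h' = v \<bullet> h' \<longrightarrow> u = v"
    by blast
  note s = short_exact_simps[OF se] and s' = short_exact_simps[OF p(1)]
  have "d1' \<in> homs C (Dom C d1') (Cod C d1')" "u2 \<bullet> b \<in> homs C (Cod C a) (Cod C d1')" "d1' \<bullet> u1 = (u2 \<bullet> b) \<bullet> a"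
    using d u ab by auto
  then obtain b' where b': "b' \<in> homs C (Cod C a') (Cod C d1')" "b' \<bullet> a' = d1'" "b' \<bullet> h' = u2 \<bullet> b"
    using univ by blast
  have "c' = d2' \<bullet> b'"
  proof (rule joint[rule_format, of _ "Cod C d2'"])
    have C: "Cod C d2 = Cod C d2'" using u(2,4) d by (metis comp_simps(3) in_homs)
    show "c' \<in> homs C (Cod C a') (Cod C d2')" using s' p d C ab by auto
    show "d2' \<bullet> b' \<in> homs C (Cod C a') (Cod C d2')" using b' d by auto
    show "c' \<bullet> a' = (d2' \<bullet> b') \<bullet> a'" using s' b' d p C ab by auto
    have "d2' \<bullet> (u2 \<bullet> b) = d2 \<bullet> b" by (rule comp_reduce[OF u(4)]) (use u ab d in auto)
    then show "c' \<bullet> h' = (d2' \<bullet> b') \<bullet> h'" using p b' d ab by auto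
  qed
  then show ?thesis using p s' b' unfolding splice_splits_def
    by (intro exI[of _ "Cod C a'"] exI[of _ a'] exI[of _ b']) auto
qed

lemma extension_2_simps:
  assumes "(E, d) \<in> extensions C 2 A B"
  shows "is_mono C (d 0)" "exact_at C (d 0) (d 1)" "exact_at C (d 1) (d 2)" "is_epi C (d 2)"
    "d 0 \<in> homs C B (E 1)" "d 1 \<in> homs C (E 1) (E 2)" "d 2 \<in> homs C (E 2) A"
proof -
  have E: "E 0 = B" "E 3 = A" using assms by (auto simp: extensions_def numeral_3_eq_3)
  have ty: "\<forall>i\<le>2. d i \<in> homs C (E i) (E (i + 1))" and ex: "\<forall>i<2. exact_at C (d i) (d (i + 1))"
    and "is_mono C (d 0)" "is_epi C (d 2)"
    using assms unfolding extensions_def by (auto simp del: in_homs)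
  then show "is_mono C (d 0)" "is_epi C (d 2)" by auto
  show "exact_at C (d 0) (d 1)" "exact_at C (d 1) (d 2)" using ex[rule_format, of 0] ex[rule_format, of 1]
    by (auto simp: numeral_2_eq_2)
  show "d 0 \<in> homs C B (E 1)" "d 1 \<in> homs C (E 1) (E 2)" "d 2 \<in> homs C (E 2) A"
    using ty[rule_format, of 0] ty[rule_format, of 1] ty[rule_format, of 2] E
    by (auto simp: numeral_2_eq_2 numeral_3_eq_3)
qed

lemma splice_splits_iff:
  assumes "is_mono C d0" "exact_at C d0 d1" "exact_at C d1 d2" "is_epi C d2"
  shows "splice_splits d0 d1 d2 \<longleftrightarrow> (\<exists>G b a. b \<in> homs C G (Cod C d1) \<and> a \<in> homs C (Dom C d1) G \<and> b \<bullet> a = d1 \<and> short_exact C (a \<bullet> d0) b)"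
proof -
  have "\<And>G a b. a \<in> homs C (Dom C d1) G \<and> b \<in> homs C G (Cod C d1) \<and> b \<bullet> a = d1 \<and> short_exact C a (d2 \<bullet> b) \<longleftrightarrow>
      b \<in> homs C G (Cod C d1) \<and> a \<in> homs C (Dom C d1) G \<and> b \<bullet> a = d1 \<and> short_exact C (a \<bullet> d0) b"
    using splice_iff[OF assms] by blast
  then show ?thesis unfolding splice_splits_def by blast
qed

lemma splice_splits_op:
  assumes "is_mono C d0" "exact_at C d0 d1" "exact_at C d1 d2" "is_epi C d2"
  shows "abelian_category.splice_splits (op_category C) d2 d1 d0 \<longleftrightarrow> splice_splits d0 d1 d2"
  unfolding splice_splits_iff[OF assms] abelian_category.splice_splits_def[OF op_abelian] by simp

text \<open>One direction is \<open>splice_splits_forward\<close>. The other is the same lemma in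
  the opposite category, where a morphism of extensions points backwards, combined with
  \<open>splice_splits_op\<close>.\<close>

lemma splice_splits_invariant:
  assumes "(x, y) \<in> extension_arrows C 2 A B"
  shows "(case x of (E, d) \<Rightarrow> splice_splits (d 0) (d 1) (d 2)) \<longleftrightarrow> (case y of (E, d) \<Rightarrow> splice_splits (d 0) (d 1) (d 2))"
proof -
  obtain E d E' d' where [simp]: "x = (E, d)" "y = (E', d')" by (metis surj_pair)
  have x: "(E, d) \<in> extensions C 2 A B" and y: "(E', d') \<in> extensions C 2 A B"
    using assms by (auto simp: extension_arrows_def)
  note ex = extension_2_simps[OF x] and ey = extension_2_simps[OF y]
  obtain u where u0: "u (0::nat) = Id C B" "u 3 = Id C A" and ty: "\<forall>i\<le>3. u i \<in> homs C (E i) (E' i)"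
    and cm: "\<forall>i\<le>2. u (i + 1) \<bullet> d i = d' i \<bullet> u i"
    using assms unfolding extension_arrows_def by (auto simp: numeral_3_eq_3 numeral_2_eq_2 simp del: in_homs)
  have u12: "u 1 \<in> homs C (E 1) (E' 1)" "u 2 \<in> homs C (E 2) (E' 2)" using ty by auto
  have "u 1 \<bullet> d 0 = d' 0 \<bullet> u 0" "u 2 \<bullet> d 1 = d' 1 \<bullet> u 1" "u 3 \<bullet> d 2 = d' 2 \<bullet> u 2"
    using cm[rule_format, of 0] cm[rule_format, of 1] cm[rule_format, of 2]
    by (auto simp: numeral_2_eq_2 numeral_3_eq_3)
  then have uc: "u 1 \<bullet> d 0 = d' 0" "u 2 \<bullet> d 1 = d' 1 \<bullet> u 1" "d' 2 \<bullet> u 2 = d 2"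
    using u0 ex ey by auto
  note e = exact_at_simps[OF ex(2)] exact_at_simps[OF ex(3)] exact_at_simps[OF ey(2)] exact_at_simps[OF ey(3)]
  have "splice_splits (d' 0) (d' 1) (d' 2)" if "splice_splits (d 0) (d 1) (d 2)"
    by (rule splice_splits_forward[of "d 1" "d 2" "d' 1" "d' 2" "u 1" "u 2" "d 0"]) (use that uc u12 ex ey e in auto)
  moreover have "abelian_category.splice_splits (op_category C) (d 2) (d 1) (d 0)"
    if "abelian_category.splice_splits (op_category C) (d' 2) (d' 1) (d' 0)"
    by (rule abelian_category.splice_splits_forward[OF op_abelian, of "d' 1" "d' 0" "d 1" "d 0" "u 2" "u 1" "d' 2"])
      (use that uc u12 ex ey e in auto)
  ultimately show ?thesis using splice_splits_op ex ey by auto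
qed

text \<open>The trivial extension is \<open>B = B\<close>, then zero to \<open>A\<close>, then
  \<open>A = A\<close>. For it the object \<open>G\<close> is the biproduct of \<open>B\<close> and
  \<open>A\<close>, and invariance carries this over to the given extension.\<close>

lemma Ext_zero_2_splits:
  assumes "Ext_zero C 2 A B" "A \<in> Ob C" "B \<in> Ob C"
    and d: "is_mono C d0" "exact_at C d0 d1" "exact_at C d1 d2" "is_epi C d2" "Dom C d0 = B" "Cod C d2 = A"
  shows "splice_splits d0 d1 d2"
proof -
  let ?E = "\<lambda>i::nat. if i = 0 then B else if i = 1 then Dom C d1 else if i = 2 then Dom C d2 else A"
  let ?d = "\<lambda>i::nat. if i = 0 then d0 else if i = 1 then d1 else d2"
  let ?F = "\<lambda>i::nat. if i \<le> 1 then B else A"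
  let ?e = "\<lambda>i::nat. if i = 0 then Id C B else if i = 1 then \<zero> B A else Id C A"
  let ?P = "\<lambda>(E :: nat \<Rightarrow> 'o, d). splice_splits (d (0::nat)) (d 1) (d 2)"
  have le2: "i \<le> 2 \<longleftrightarrow> i = 0 \<or> i = 1 \<or> i = 2" "i < 2 \<longleftrightarrow> i = 0 \<or> i = 1" for i :: nat by auto
  note e = exact_at_simps[OF d(2)] exact_at_simps[OF d(3)]
  have 1: "(?E, ?d) \<in> extensions C 2 A B"
    using d e unfolding extensions_def by (auto simp: le2)
  have e1: "exact_at C (Id C B) (\<zero> B A)"
    by (rule kernel_exact, rule kernelI[OF Id_mono]) (use assms in auto)
  have e2: "exact_at C (\<zero> B A) (Id C A)"
    by (rule cokernel_exact, rule cokernelI[OF Id_epi]) (use assms in auto)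
  have 2: "(?F, ?e) \<in> extensions C 2 A B"
    using e1 e2 Id_mono Id_epi assms(2,3) unfolding extensions_def by (auto simp: le2)
  have "?P (?F, ?e)"
  proof -
    obtain P i j p q where b: "P \<in> Ob C" "i \<in> Arr C" "j \<in> Arr C" "p \<in> Arr C" "q \<in> Arr C"
      "Dom C i = B" "Cod C i = P" "Dom C j = A" "Cod C j = P" "Dom C p = P" "Cod C p = B" "Dom C q = P" "Cod C q = A"
      "p \<bullet> i = Id C B" "q \<bullet> j = Id C A" "q \<bullet> i = \<zero> B A" "p \<bullet> j = \<zero> A B" "i \<bullet> p \<uplus> j \<bullet> q = Id C P"
      using biproductE[OF assms(3,2)] by metis
    have se: "short_exact C i q" by (rule short_exact_biproduct[of i B P j A p q]) (use b in auto)
    have "splice_splits (Id C B) (\<zero> B A) (Id C A)"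
      unfolding splice_splits_def using b se assms
      by (intro exI[of _ P] exI[of _ i] exI[of _ q]) auto
    then show ?thesis by simp
  qed
  then have "?P (?E, ?d)" by (rule Ext_zero_invariant[OF assms(1) 2 1]) (rule splice_splits_invariant)
  then show ?thesis by simp
qed

text \<open>A fragment of the long exact Ext sequence: an extension of \<open>A\<close> by
  \<open>Cod C q\<close>, spliced with \<open>i\<close> and \<open>q\<close>, gives a two-fold
  extension of \<open>A\<close> by \<open>Dom C i\<close>. Its vanishing lifts the extension to one
  of \<open>A\<close> by \<open>Dom C q\<close>; this splits, and \<open>b\<close> carries its
  section to one of the given extension.\<close>

lemma ext_split_cokernel:
  assumes "Ext_zero C 2 A (Dom C i)" "A \<in> Ob C" and iq: "short_exact C i q" and "ext_split C A (Dom C q)"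
  shows "ext_split C A (Cod C q)"
  unfolding ext_split_def
proof (intro allI impI)
  fix f g assume *: "short_exact C f g" "Dom C f = Cod C q" "Cod C g = A"
  note s = short_exact_simps[OF *(1)] and t = short_exact_simps[OF iq]
  have "splice_splits i (f \<bullet> q) g"
  proof (rule Ext_zero_2_splits[OF assms(1,2)])
    have "is_kernel C i (f \<bullet> q)"
    proof (rule kernelI)
      fix h assume h: "h \<in> Arr C" "Cod C h = Dom C (f \<bullet> q)" "(f \<bullet> q) \<bullet> h = \<zero> (Dom C h) (Cod C (f \<bullet> q))"
      have "q \<bullet> h = \<zero> (Dom C (q \<bullet> h)) (Dom C f)"
        by (rule mono_zero[OF s(5)]) (use h s t * in auto)
      then show "\<exists>u\<in>homs C (Dom C h) (Dom C i). i \<bullet> u = h"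
        using kernel_ex[OF t(7), of h] h s t * by simp
    qed (use t s * in auto)
    then show "exact_at C i (f \<bullet> q)" by (rule kernel_exact)
    show "exact_at C (f \<bullet> q) g" unfolding exact_at_iff by (intro exI[of _ f] exI[of _ q]) (use s t * in auto)
  qed (use s t * in auto)
  then obtain G a b where ab: "a \<in> homs C (Dom C q) G" "b \<in> homs C G (Cod C f)" "short_exact C a (g \<bullet> b)"
    unfolding splice_splits_def using s t * by auto
  obtain \<sigma> where \<sigma>: "\<sigma> \<in> homs C A (Dom C (g \<bullet> b))" "(g \<bullet> b) \<bullet> \<sigma> = Id C A"
    using ext_split_section[OF assms(4) ab(3)] ab s * by auto
  then show "\<exists>r\<in>homs C (Cod C f) (Cod C q). r \<bullet> f = Id C (Cod C q)"
    using section_imp_retraction[OF *(1), of "b \<bullet> \<sigma>"] s ab * by auto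
qed

text \<open>The dual fragment, argued directly with the second description of
  \<open>splice_splits\<close>; this avoids comparing Yoneda Ext in \<open>C\<close> with Yoneda Ext
  in the opposite category. The retraction of the extension of \<open>Dom C q\<close> by
  \<open>Y\<close> restricts along \<open>a\<close>.\<close>

lemma ext_split_kernel:
  assumes "Ext_zero C 2 (Cod C q) Y" "Y \<in> Ob C" and iq: "short_exact C i q" and "ext_split C (Dom C q) Y"
  shows "ext_split C (Dom C i) Y"
  unfolding ext_split_def
proof (intro allI impI)
  fix f g assume *: "short_exact C f g" "Dom C f = Y" "Cod C g = Dom C i"
  note s = short_exact_simps[OF *(1)] and t = short_exact_simps[OF iq]
  have d: "is_mono C f" "exact_at C f (i \<bullet> g)" "exact_at C (i \<bullet> g) q" "is_epi C q"
  proof -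
    have "is_kernel C f (i \<bullet> g)"
    proof (rule kernelI)
      fix h assume h: "h \<in> Arr C" "Cod C h = Dom C (i \<bullet> g)" "(i \<bullet> g) \<bullet> h = \<zero> (Dom C h) (Cod C (i \<bullet> g))"
      have "g \<bullet> h = \<zero> (Dom C (g \<bullet> h)) (Dom C i)"
        by (rule mono_zero[OF t(5)]) (use h s t * in auto)
      then show "\<exists>u\<in>homs C (Dom C h) (Dom C f). f \<bullet> u = h"
        using kernel_ex[OF s(7), of h] h s t * by simp
    qed (use t s * in auto)
    then show "exact_at C f (i \<bullet> g)" by (rule kernel_exact)
    show "exact_at C (i \<bullet> g) q" unfolding exact_at_iff by (intro exI[of _ i] exI[of _ g]) (use s t * in auto)
  qed (use s t in auto)
  have "splice_splits f (i \<bullet> g) q" by (rule Ext_zero_2_splits[OF assms(1) _ assms(2) d]) (use s t * in auto)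
  then obtain G a b where ab: "a \<in> homs C (Dom C g) G" "b \<in> homs C G (Cod C i)" "short_exact C (a \<bullet> f) b"
    unfolding splice_splits_iff[OF d] using s t * by auto
  obtain r where r: "r \<in> homs C G Y" "r \<bullet> (a \<bullet> f) = Id C Y"
    using assms(4) ab s t * unfolding ext_split_def by (metis comp_simps in_homs)
  then show "\<exists>r\<in>homs C (Cod C f) Y. r \<bullet> f = Id C Y" using ab s by (intro bexI[of _ "r \<bullet> a"]) auto
qed

end

section \<open>Comparison of resolutions\<close>

context preadditive_category
begin

lemma homs_Ob: "f \<in> homs C A B \<Longrightarrow> A \<in> Ob C" "f \<in> homs C A B \<Longrightarrow> B \<in> Ob C"
  using Dom_in Cod_in by fastforce+

text \<open>Resolutions are indexed so that \<open>X 0\<close> is the resolved object and \<open>d 0\<close> the augmentation.\<close>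

definition lifts_against :: "(nat \<Rightarrow> 'o) \<Rightarrow> (nat \<Rightarrow> 'o) \<Rightarrow> (nat \<Rightarrow> 'm) \<Rightarrow> bool" where
  "lifts_against X X' d' \<longleftrightarrow> (\<forall>n m. \<forall>u\<in>homs C (X (Suc n)) (X' m). (m = 0 \<or> d' (m - 1) \<bullet> u = \<zero> (X (Suc n)) (X' (m - 1))) \<longrightarrow>
     (\<exists>v\<in>homs C (X (Suc n)) (X' (Suc m)). d' m \<bullet> v = u))"

lemma comparison_map:
  assumes d: "\<And>n. d n \<in> homs C (X (Suc n)) (X n)" "\<And>n. d n \<bullet> d (Suc n) = \<zero> (X (Suc (Suc n))) (X n)"
    and d': "\<And>n. d' n \<in> homs C (X' (Suc n)) (X' n)"
    and lift: "lifts_against X X' d'" and f: "f \<in> homs C (X 0) (X' 0)"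
  shows "\<exists>F. F 0 = f \<and> (\<forall>n. F n \<in> homs C (X n) (X' n) \<and> d' n \<bullet> F (Suc n) = F n \<bullet> d n)"
proof -
  \<comment> \<open>Invariant of the recursion: the composite of \<open>x\<close> with
    \<open>d n\<close> is a cycle, which is what \<open>lifts_against\<close> asks for when the next
    component is chosen.\<close>
  let ?P = "\<lambda>n x. x \<in> homs C (X n) (X' n) \<and> (n = 0 \<longrightarrow> x = f) \<and> (n = 0 \<or> d' (n - 1) \<bullet> (x \<bullet> d n) = \<zero> (X (Suc n)) (X' (n - 1)))"
  have "\<exists>F. \<forall>n. ?P n (F n) \<and> d' n \<bullet> F (Suc n) = F n \<bullet> d n"
  proof (rule dependent_nat_choice)
    show "\<exists>x. ?P 0 x" using f by blast
    fix x n assume x: "?P n x"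
    have "x \<bullet> d n \<in> homs C (X (Suc n)) (X' n)" using x d(1)[of n] by auto
    then obtain y where y: "y \<in> homs C (X (Suc n)) (X' (Suc n))" "d' n \<bullet> y = x \<bullet> d n"
      using lift x unfolding lifts_against_def by blast
    have "d' n \<bullet> (y \<bullet> d (Suc n)) = (x \<bullet> d n) \<bullet> d (Suc n)"
      by (rule comp_reduce[OF y(2)]) (use y d(1)[of "Suc n"] d'[of n] in auto)
    also have "\<dots> = x \<bullet> (d n \<bullet> d (Suc n))" using x d(1)[of n] d(1)[of "Suc n"] by auto
    also have "\<dots> = \<zero> (X (Suc (Suc n))) (X' n)" unfolding d(2) using x homs_Ob(1)[OF d(1)[of "Suc n"]] by auto
    finally show "\<exists>y. ?P (Suc n) y \<and> d' n \<bullet> y = x \<bullet> d n" using y by auto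
  qed
  then obtain F where F: "\<forall>n. ?P n (F n) \<and> d' n \<bullet> F (Suc n) = F n \<bullet> d n" by blast
  then show ?thesis by (intro exI[of _ F]) simp
qed

text \<open>Since \<open>F 0\<close> vanishes, \<open>F 1\<close> is already a cycle, so the
  recursion can start with the prescribed value \<open>s 0 = 0\<close>. With this normalization the
  homotopies of the two halves of a coresolution fit together.\<close>

lemma comparison_homotopy:
  assumes d: "\<And>n. d n \<in> homs C (X (Suc n)) (X n)" "\<And>n. d n \<bullet> d (Suc n) = \<zero> (X (Suc (Suc n))) (X n)"
    and d': "\<And>n. d' n \<in> homs C (X' (Suc n)) (X' n)"
    and lift: "lifts_against X X' d'"
    and F: "\<And>n. F n \<in> homs C (X n) (X' n)" "\<And>n. d' n \<bullet> F (Suc n) = F n \<bullet> d n" "F 0 = \<zero> (X 0) (X' 0)"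
  shows "\<exists>s. s 0 = \<zero> (X 0) (X' 1) \<and> (\<forall>n. s n \<in> homs C (X n) (X' (Suc n)) \<and> F (Suc n) = d' (Suc n) \<bullet> s (Suc n) \<uplus> s n \<bullet> d n)"
proof -
  let ?P = "\<lambda>n x. x \<in> homs C (X n) (X' (Suc n)) \<and> (n = 0 \<longrightarrow> x = \<zero> (X 0) (X' 1)) \<and> d' n \<bullet> (F (Suc n) \<setminus> x \<bullet> d n) = \<zero> (X (Suc n)) (X' n)"
  have Ob: "X n \<in> Ob C" "X' n \<in> Ob C" for n using homs_Ob[OF F(1)[of n]] by auto
  have "\<exists>s. \<forall>n. ?P n (s n) \<and> F (Suc n) = d' (Suc n) \<bullet> s (Suc n) \<uplus> s n \<bullet> d n"
  proof (rule dependent_nat_choice)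
    have "d' 0 \<bullet> F 1 = \<zero> (X 1) (X' 0)" using F(2)[of 0] F(3) d(1)[of 0] Ob by auto
    then have "?P 0 (\<zero> (X 0) (X' 1))" using F(1)[of 1] d(1)[of 0] d'[of 0] Ob by auto
    then show "\<exists>x. ?P 0 x" by blast
    fix x n assume x: "?P n x"
    have "F (Suc n) \<setminus> x \<bullet> d n \<in> homs C (X (Suc n)) (X' (Suc n))" using x d(1)[of n] F(1)[of "Suc n"] by auto
    then obtain y where y: "y \<in> homs C (X (Suc n)) (X' (Suc (Suc n)))" "d' (Suc n) \<bullet> y = F (Suc n) \<setminus> x \<bullet> d n"
      using lift x unfolding lifts_against_def by (metis diff_Suc_1)
    have F': "F (Suc n) = d' (Suc n) \<bullet> y \<uplus> x \<bullet> d n"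
      unfolding y(2) using x F(1)[of "Suc n"] d(1)[of n] by simp
    have "d' (Suc n) \<bullet> (y \<bullet> d (Suc n)) = (F (Suc n) \<setminus> x \<bullet> d n) \<bullet> d (Suc n)"
      by (rule comp_reduce[OF y(2)]) (use y d(1)[of "Suc n"] d'[of "Suc n"] in auto)
    also have "\<dots> = F (Suc n) \<bullet> d (Suc n) \<setminus> x \<bullet> (d n \<bullet> d (Suc n))"
      using x d(1)[of n] d(1)[of "Suc n"] F(1)[of "Suc n"] by auto
    also have "\<dots> = d' (Suc n) \<bullet> F (Suc (Suc n))" unfolding d(2) F(2)
      using x F(1)[of "Suc n"] d(1)[of "Suc n"] Ob by auto
    finally have "d' (Suc n) \<bullet> (F (Suc (Suc n)) \<setminus> y \<bullet> d (Suc n)) = \<zero> (X (Suc (Suc n))) (X' (Suc n))"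
      using y d(1)[of "Suc n"] d'[of "Suc n"] F(1)[of "Suc (Suc n)"] by simp
    then have "?P (Suc n) y" using y by simp
    then show "\<exists>y. ?P (Suc n) y \<and> F (Suc n) = d' (Suc n) \<bullet> y \<uplus> x \<bullet> d n" using F' by blast
  qed
  then obtain s where "\<forall>n. ?P n (s n) \<and> F (Suc n) = d' (Suc n) \<bullet> s (Suc n) \<uplus> s n \<bullet> d n" by blast
  then show ?thesis by (intro exI[of _ s]) auto
qed

end

section \<open>Classes of a hereditary abelian model structure\<close>

context abelian_category
begin

text \<open>Factor \<open>f\<close> into an epimorphism \<open>e\<close> followed by the kernel
  \<open>m\<close> of \<open>g\<close>. First \<open>h\<close> factors through \<open>m\<close>;
  then it lifts along \<open>e\<close>, because \<open>e\<close> and \<open>f\<close> have the same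
  kernel.\<close>

lemma exact_lift:
  assumes "exact_at C f g" "kernel_in C f S" "lifting_property C S P" "h \<in> homs C P (Cod C f)" "g \<bullet> h = \<zero> P (Cod C g)"
  shows "\<exists>u\<in>homs C P (Dom C f). f \<bullet> u = h"
proof -
  obtain m e where *: "is_kernel C m g" "is_epi C e" "Cod C e = Dom C m" "f = m \<bullet> e"
    using assms(1) unfolding exact_at_iff by auto
  note s = kernel_simps[OF *(1)] epi_arr[OF *(2)] exact_at_simps[OF assms(1)]
  obtain h' where h': "h' \<in> Arr C" "Dom C h' = P" "Cod C h' = Dom C m" "m \<bullet> h' = h"
    using kernel_lift[OF *(1), of h] assms s by auto
  obtain k where k: "is_kernel C k f" "Dom C k \<in> S" using assms(2) by (auto simp: kernel_in_def)
  note sk = kernel_simps[OF k(1)]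
  have "is_kernel C k e"
  proof (rule kernelI[OF kernel_mono[OF k(1)]])
    have "m \<bullet> (e \<bullet> k) = \<zero> (Dom C k) (Cod C f)" using sk s * by simp
    then show "e \<bullet> k = \<zero> (Dom C k) (Cod C e)"
      using mono_zero[OF kernel_mono[OF *(1)], of "e \<bullet> k"] s sk * by simp
    fix x assume x: "x \<in> Arr C" "Cod C x = Dom C e" "e \<bullet> x = \<zero> (Dom C x) (Cod C e)"
    then have "f \<bullet> x = \<zero> (Dom C x) (Cod C f)" using * s by simp
    then show "\<exists>u\<in>homs C (Dom C x) (Dom C k). k \<bullet> u = x" using kernel_ex[OF k(1), of x] x * s by simp
  qed (use s sk * in auto)
  then have "kernel_in C e S" using k by (auto simp: kernel_in_def)
  then obtain u where "u \<in> homs C P (Dom C e)" "e \<bullet> u = h'"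
    using lifting_propertyD[OF assms(3) *(2)] h' * by auto
  then show ?thesis using h' * s by (intro bexI[of _ u]) auto
qed

lemma exact_extend:
  assumes "exact_at C f g" "cokernel_in C g S" "extension_property C S Y" "h \<in> homs C (Dom C g) Y" "h \<bullet> f = \<zero> (Dom C f) Y"
  shows "\<exists>u\<in>homs C (Cod C g) Y. u \<bullet> g = h"
  using abelian_category.exact_lift[OF op_abelian, of g f S Y h] assms by (simp add: extension_op)

end

locale model_structure = abelian_category C for C :: "('o, 'm) precat" +
  fixes Q W R :: "'o set"
  assumes model: "hereditary_abelian_model C Q W R"
begin

section \<open>The model axioms as lifting and extension properties\<close>

lemma model_facts:
  "thick C W" "Q = left_orth C (W \<inter> R)" "W \<inter> R = right_orth C Q" "Q \<inter> W = left_orth C R" "R = right_orth C (Q \<inter> W)"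
  "complete_pair C Q (W \<inter> R)" "complete_pair C (Q \<inter> W) R" "hereditary_pair C Q (W \<inter> R)" "hereditary_pair C (Q \<inter> W) R"
  using model unfolding hereditary_abelian_model_def cotorsion_pair_def by - (blast+)

lemma Q_Ob: "Q \<subseteq> Ob C" and R_Ob: "R \<subseteq> Ob C"
proof -
  have "left_orth C (W \<inter> R) \<subseteq> Ob C" "right_orth C (Q \<inter> W) \<subseteq> Ob C" by (auto simp: left_orth_def right_orth_def)
  then show "Q \<subseteq> Ob C" "R \<subseteq> Ob C" using model_facts(2,5) by blast+
qed

lemma Ob_simps [simp]: "A \<in> Q \<Longrightarrow> A \<in> Ob C" "A \<in> R \<Longrightarrow> A \<in> Ob C"
  using Q_Ob R_Ob by auto

lemma R_iff: "Y \<in> R \<longleftrightarrow> extension_property C (Q \<inter> W) Y"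
  using right_orth_iff[of "Q \<inter> W" Y] model_facts(5) Q_Ob by blast

lemma RW_iff: "Y \<in> W \<inter> R \<longleftrightarrow> extension_property C Q Y"
  using right_orth_iff[OF Q_Ob, of Y] model_facts(3) by blast

lemma Q_iff: "P \<in> Q \<longleftrightarrow> lifting_property C (W \<inter> R) P"
  using left_orth_iff[of "W \<inter> R" P] model_facts(2) R_Ob by blast

lemma QW_iff: "P \<in> Q \<inter> W \<longleftrightarrow> lifting_property C R P"
  using left_orth_iff[OF R_Ob, of P] model_facts(4) by blast

lemma lifting_property_middle:
  assumes "short_exact C i q" "lifting_property C S (Dom C i)" "lifting_property C S (Cod C q)"
  shows "lifting_property C S (Dom C q)"
  using abelian_category.extension_property_middle[OF op_abelian, of q i S] assms short_exact_simps(3)[OF assms(1)]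
  by (simp add: lifting_op)

lemma R_middle: "\<lbrakk>short_exact C i q; Dom C i \<in> R; Cod C q \<in> R\<rbrakk> \<Longrightarrow> Dom C q \<in> R"
  unfolding R_iff by (rule extension_property_middle)

lemma Q_middle: "\<lbrakk>short_exact C i q; Dom C i \<in> Q; Cod C q \<in> Q\<rbrakk> \<Longrightarrow> Dom C q \<in> Q"
  unfolding Q_iff by (rule lifting_property_middle)

text \<open>This is where the hereditary condition enters, through the vanishing of Ext in degree
  2.\<close>

lemma R_cokernel:
  assumes "short_exact C i q" "Dom C i \<in> R" "Dom C q \<in> R" shows "Cod C q \<in> R"
proof -
  have "ext_split C A (Cod C q)" if "A \<in> Q \<inter> W" for A
  proof (rule ext_split_cokernel[OF _ _ assms(1)])
    show "Ext_zero C 2 A (Dom C i)" using model_facts(9) that assms unfolding hereditary_pair_def by (auto simp del: Int_iff)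
    show "ext_split C A (Dom C q)" using assms(3) that unfolding R_iff extension_property_iff_split by auto
  qed (use that in auto)
  then show ?thesis unfolding R_iff extension_property_iff_split using short_exact_simps(2)[OF assms(1)] by simp
qed

lemma Q_kernel:
  assumes "short_exact C i q" "Cod C q \<in> Q" "Dom C q \<in> Q" shows "Dom C i \<in> Q"
proof -
  have "ext_split C (Dom C i) Y" if "Y \<in> W \<inter> R" for Y
  proof (rule ext_split_kernel[OF _ _ assms(1)])
    show "Ext_zero C 2 (Cod C q) Y" using model_facts(8) that assms unfolding hereditary_pair_def by (auto simp del: Int_iff)
    show "ext_split C (Dom C q) Y" using assms(3) that unfolding Q_iff lifting_property_iff_split by auto
  qed (use that in auto)
  then show ?thesis unfolding Q_iff lifting_property_iff_split using short_exact_simps(1)[OF assms(1)] by simp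
qed

text \<open>\<open>kernel_in\<close> speaks about some kernel, while arguments produce a particular
  one. The object \<open>Dom C k\<close> is a retract of \<open>Dom C k'\<close>, and the extension
  property passes to retracts.\<close>

lemma kernel_unique_in_R:
  assumes "is_kernel C k g" "kernel_in C g R" shows "Dom C k \<in> R"
proof -
  obtain k' where k': "is_kernel C k' g" "Dom C k' \<in> R" using assms(2) by (auto simp: kernel_in_def)
  note s = kernel_simps[OF assms(1)] and s' = kernel_simps[OF k'(1)]
  obtain u where u: "u \<in> Arr C" "Dom C u = Dom C k" "Cod C u = Dom C k'" "k' \<bullet> u = k"
    using kernel_lift[OF k'(1), of k] s by auto
  obtain v where v: "v \<in> Arr C" "Dom C v = Dom C k'" "Cod C v = Dom C k" "k \<bullet> v = k'"
    using kernel_lift[OF assms(1), of k'] s' by auto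
  have "k \<bullet> (v \<bullet> u) = k" using comp_reduce[OF v(4), of u] u(1-3) v(1-3) s s' by (simp add: u(4))
  then have vu: "v \<bullet> u = Id C (Dom C k)"
    using monoD[OF kernel_mono[OF assms(1)], of "v \<bullet> u" "Id C (Dom C k)"] u(1-3) v(1-3) s by simp
  show ?thesis unfolding R_iff extension_property_def
  proof (intro conjI allI impI)
    fix j h assume j: "is_mono C j" "cokernel_in C j (Q \<inter> W)" "h \<in> homs C (Dom C j) (Dom C k)"
    then obtain h' where h': "h' \<in> homs C (Cod C j) (Dom C k')" "h' \<bullet> j = u \<bullet> h"
      using extension_propertyD[OF k'(2)[unfolded R_iff] j(1,2), of "u \<bullet> h"] u by auto
    have "v \<bullet> (u \<bullet> h) = Id C (Dom C k) \<bullet> h" by (rule comp_reduce[OF vu]) (use u v j in auto)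
    then have "(v \<bullet> h') \<bullet> j = h" using h' v j by simp
    then show "\<exists>h'\<in>homs C (Cod C j) (Dom C k). h' \<bullet> j = h" using h' v by (intro bexI[of _ "v \<bullet> h'"]) auto
  qed (use s in auto)
qed

text \<open>Position 0 is the resolved object, so position 1 is degree \<open>-1\<close> on the left
  and degree \<open>0\<close> on the right. The left half is then a resolution in \<open>C\<close>
  and the right half one in the opposite category, so that the same comparison lemmas serve for
  both.\<close>

definition left_obj :: "('o, 'm) coresolution \<Rightarrow> 'o \<Rightarrow> nat \<Rightarrow> 'o" where
  "left_obj K B n = (case n of 0 \<Rightarrow> B | Suc m \<Rightarrow> obj K (-1 - int m))"
definition left_diff :: "('o, 'm) coresolution \<Rightarrow> nat \<Rightarrow> 'm" where
  "left_diff K n = (case n of 0 \<Rightarrow> aug K | Suc m \<Rightarrow> diff K (-2 - int m))"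
definition right_obj :: "('o, 'm) coresolution \<Rightarrow> 'o \<Rightarrow> nat \<Rightarrow> 'o" where
  "right_obj K B n = (case n of 0 \<Rightarrow> B | Suc m \<Rightarrow> obj K (int m))"
definition right_diff :: "('o, 'm) coresolution \<Rightarrow> nat \<Rightarrow> 'm" where
  "right_diff K n = (case n of 0 \<Rightarrow> coaug K | Suc m \<Rightarrow> diff K (int m))"

lemma half_simps [simp]:
  "left_obj K B 0 = B" "left_obj K B (Suc n) = obj K (-1 - int n)" "left_diff K 0 = aug K" "left_diff K (Suc n) = diff K (-2 - int n)"
  "right_obj K B 0 = B" "right_obj K B (Suc n) = obj K (int n)" "right_diff K 0 = coaug K" "right_diff K (Suc n) = diff K (int n)"
  by (simp_all add: left_obj_def left_diff_def right_obj_def right_diff_def)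

abbreviation coresolution where "coresolution B K \<equiv> model_coresolution C Q W R B K"

lemma coresolution_facts:
  assumes "coresolution B K"
  shows "diff K i \<in> homs C (obj K i) (obj K (i + 1))" "exact_at C (diff K i) (diff K (i + 1))"
    "aug K \<in> homs C (obj K (-1)) B" "coaug K \<in> homs C B (obj K 0)" "diff K (-1) = coaug K \<bullet> aug K"
    "exact_at C (diff K (-2)) (aug K)" "is_epi C (aug K)" "is_mono C (coaug K)" "exact_at C (coaug K) (diff K 0)"
    "i < 0 \<Longrightarrow> obj K i \<in> Q \<inter> W" "i \<ge> 0 \<Longrightarrow> obj K i \<in> W \<inter> R"
    "kernel_in C (aug K) R" "i < -1 \<Longrightarrow> kernel_in C (diff K i) R"
    "cokernel_in C (coaug K) Q" "i \<ge> 0 \<Longrightarrow> cokernel_in C (diff K i) Q"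
  using assms unfolding model_coresolution_def by simp_all

lemma coresolution_arr:
  assumes "coresolution B K"
  shows "diff K i \<in> Arr C" "Dom C (diff K i) = obj K i" "Cod C (diff K i) = obj K (i + 1)"
    "aug K \<in> Arr C" "Dom C (aug K) = obj K (-1)" "Cod C (aug K) = B"
    "coaug K \<in> Arr C" "Dom C (coaug K) = B" "Cod C (coaug K) = obj K 0" "obj K i \<in> Ob C" "B \<in> Ob C"
    "diff K (i + 1) \<bullet> diff K i = \<zero> (obj K i) (obj K (i + 1 + 1))"
  using coresolution_facts(1,3,4)[OF assms] exact_at_simps[OF coresolution_facts(2)[OF assms], of i]
    homs_Ob(1)[OF coresolution_facts(1)[OF assms, of i]] homs_Ob(2)[OF coresolution_facts(3)[OF assms]]
  by auto

lemma left_resolution: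
  assumes "coresolution B K"
  shows "left_diff K n \<in> homs C (left_obj K B (Suc n)) (left_obj K B n)"
    "left_diff K n \<bullet> left_diff K (Suc n) = \<zero> (left_obj K B (Suc (Suc n))) (left_obj K B n)"
    "exact_at C (left_diff K (Suc n)) (left_diff K n)"
proof -
  note s = coresolution_facts[OF assms] coresolution_arr[OF assms]
  have e: "- 2 - int m + 1 = - 1 - int m" "-1 - int (Suc m) = -2 - int m" "- 2 - int (Suc m) + 1 = -2 - int m" for m by auto
  show 1: "left_diff K n \<in> homs C (left_obj K B (Suc n)) (left_obj K B n)" for n
    by (cases n) (use s(3) s(1)[of "- 2 - int (n - 1)"] e(1) in auto)
  show ex: "exact_at C (left_diff K (Suc n)) (left_diff K n)"
    by (cases n) (use s(6) s(2)[of "- 2 - int n"] e in auto)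
  show "left_diff K n \<bullet> left_diff K (Suc n) = \<zero> (left_obj K B (Suc (Suc n))) (left_obj K B n)"
    using exact_at_simps(4)[OF ex] 1[of n] 1[of "Suc n"] by (simp del: half_simps)
qed

lemma right_resolution:
  assumes "coresolution B K"
  shows "right_diff K n \<in> homs C (right_obj K B n) (right_obj K B (Suc n))"
    "right_diff K (Suc n) \<bullet> right_diff K n = \<zero> (right_obj K B n) (right_obj K B (Suc (Suc n)))"
    "exact_at C (right_diff K n) (right_diff K (Suc n))"
proof -
  note s = coresolution_facts[OF assms] coresolution_arr[OF assms]
  show 1: "right_diff K n \<in> homs C (right_obj K B n) (right_obj K B (Suc n))" for n
    by (cases n) (use s(4) s(1)[of "int (n - 1)"] in \<open>auto simp: add.commute\<close>)
  show ex: "exact_at C (right_diff K n) (right_diff K (Suc n))"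
    by (cases n) (use s(9) s(2)[of "int (n - 1)"] in \<open>auto simp: add.commute\<close>)
  show "right_diff K (Suc n) \<bullet> right_diff K n = \<zero> (right_obj K B n) (right_obj K B (Suc (Suc n)))"
    using exact_at_simps(4)[OF ex] 1[of n] 1[of "Suc n"] by (simp del: half_simps)
qed

lemma left_lift:
  assumes K: "coresolution B K" and P: "lifting_property C R P" and u: "u \<in> homs C P (left_obj K B m)"
    and z: "m = 0 \<or> left_diff K (m - 1) \<bullet> u = \<zero> P (left_obj K B (m - 1))"
  shows "\<exists>v\<in>homs C P (left_obj K B (Suc m)). left_diff K m \<bullet> v = u"
proof (cases m)
  case 0
  then show ?thesis using lifting_propertyD[OF P coresolution_facts(7,12)[OF K], of u] u coresolution_arr[OF K]
    by (metis half_simps(1-3) of_nat_0 diff_zero)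
next
  case (Suc n)
  have "kernel_in C (left_diff K (Suc n)) R" using coresolution_facts(13)[OF K] by simp
  from exact_lift[OF left_resolution(3)[OF K] this P, of u]
  show ?thesis using u z left_resolution(1)[OF K, of n] left_resolution(1)[OF K, of "Suc n"] unfolding Suc
    by (simp del: half_simps)
qed

lemma right_extend:
  assumes K: "coresolution B K" and Y: "extension_property C Q Y" and u: "u \<in> homs C (right_obj K B m) Y"
    and z: "m = 0 \<or> u \<bullet> right_diff K (m - 1) = \<zero> (right_obj K B (m - 1)) Y"
  shows "\<exists>v\<in>homs C (right_obj K B (Suc m)) Y. v \<bullet> right_diff K m = u"
proof (cases m)
  case 0
  then show ?thesis using extension_propertyD[OF Y coresolution_facts(8,14)[OF K], of u] u coresolution_arr[OF K]
    by (metis half_simps(5-7) of_nat_0)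
next
  case (Suc n)
  have "cokernel_in C (right_diff K (Suc n)) Q" using coresolution_facts(15)[OF K] by simp
  from exact_extend[OF right_resolution(3)[OF K] this Y, of u]
  show ?thesis using u z right_resolution(1)[OF K, of n] right_resolution(1)[OF K, of "Suc n"] unfolding Suc
    by (simp del: half_simps)
qed

lemma left_lifts_against:
  assumes "coresolution B K" "coresolution B' K'"
  shows "lifts_against (left_obj K B) (left_obj K' B') (left_diff K')"
  unfolding lifts_against_def
proof (intro allI ballI impI)
  fix n m u assume "u \<in> homs C (left_obj K B (Suc n)) (left_obj K' B' m)"
    "m = 0 \<or> left_diff K' (m - 1) \<bullet> u = \<zero> (left_obj K B (Suc n)) (left_obj K' B' (m - 1))"
  moreover have "lifting_property C R (left_obj K B (Suc n))"
    using coresolution_facts(10)[OF assms(1)] by (simp flip: QW_iff)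
  ultimately show "\<exists>v\<in>homs C (left_obj K B (Suc n)) (left_obj K' B' (Suc m)). left_diff K' m \<bullet> v = u"
    by (intro left_lift[OF assms(2)])
qed

lemma right_lifts_against:
  assumes "coresolution B K" "coresolution B' K'"
  shows "preadditive_category.lifts_against (op_category C) (right_obj K' B') (right_obj K B) (right_diff K)"
  unfolding preadditive_category.lifts_against_def[OF op_preadditive] op_simps op_homs
proof (intro allI ballI impI)
  fix n m u assume "u \<in> homs C (right_obj K B m) (right_obj K' B' (Suc n))"
    "m = 0 \<or> u \<bullet> right_diff K (m - 1) = \<zero> (right_obj K B (m - 1)) (right_obj K' B' (Suc n))"
  moreover have "extension_property C Q (right_obj K' B' (Suc n))"
    using coresolution_facts(11)[OF assms(2)] by (simp flip: RW_iff)
  ultimately show "\<exists>v\<in>homs C (right_obj K B (Suc m)) (right_obj K' B' (Suc n)). v \<bullet> right_diff K m = u"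
    by (intro right_extend[OF assms(1)])
qed

lemma int_split3:
  fixes i :: int obtains n where "i = -2 - int n" | "i = -1" | n where "i = int n"
proof -
  consider "i \<le> -2" | "i = -1" | "i \<ge> 0" by linarith
  then show thesis
  proof cases
    case 1
    then show thesis using that(1)[of "nat (-2 - i)"] by simp
  next
    case 3
    then show thesis using that(3)[of "nat i"] by simp
  qed (fact that(2))
qed

section \<open>Cochain maps between coresolutions and their homotopies\<close>

lemma extends_to_ex:
  assumes K: "coresolution B K" and K': "coresolution B' K'" and g: "g \<in> homs C B B'"
  shows "\<exists>\<phi>. extends_to C K K' g \<phi>"
proof -
  have "\<exists>F. F 0 = g \<and> (\<forall>n. F n \<in> homs C (left_obj K B n) (left_obj K' B' n) \<and> left_diff K' n \<bullet> F (Suc n) = F n \<bullet> left_diff K n)"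
    by (rule comparison_map[OF left_resolution(1,2)[OF K] left_resolution(1)[OF K'] left_lifts_against[OF K K']]) (use g in simp)
  then obtain F where F: "F 0 = g" "\<And>n. F n \<in> homs C (left_obj K B n) (left_obj K' B' n)"
    "\<And>n. left_diff K' n \<bullet> F (Suc n) = F n \<bullet> left_diff K n" by blast
  have "\<exists>F. F 0 = g \<and> (\<forall>n. F n \<in> homs (op_category C) (right_obj K' B' n) (right_obj K B n) \<and>
      right_diff K n \<odot>\<^bsub>op_category C\<^esub> F (Suc n) = F n \<odot>\<^bsub>op_category C\<^esub> right_diff K' n)"
    by (rule preadditive_category.comparison_map[OF op_preadditive _ _ _ right_lifts_against[OF K K']])
      (use g right_resolution[OF K] right_resolution[OF K'] in \<open>simp_all del: in_homs half_simps(2-4,6-8)\<close>)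
  then obtain H where H: "H 0 = g" "\<And>n. H n \<in> homs C (right_obj K B n) (right_obj K' B' n)"
    "\<And>n. H (Suc n) \<bullet> right_diff K n = right_diff K' n \<bullet> H n" by auto
  define \<phi> where "\<phi> i = (if i < 0 then F (Suc (nat (-1 - i))) else H (Suc (nat i)))" for i :: int
  note s = coresolution_arr[OF K] coresolution_arr[OF K']
  have \<phi>1: "\<phi> (-1 - int n) = F (Suc n)" "\<phi> (int n) = H (Suc n)" for n by (auto simp: \<phi>_def)
  have \<phi>0: "\<phi> (-1) = F 1" "\<phi> 0 = H 1" by (auto simp: \<phi>_def)
  show ?thesis
    unfolding extends_to_def
  proof (intro exI[of _ \<phi>] conjI allI)
    show "\<phi> i \<in> homs C (obj K i) (obj K' i)" for i
      unfolding \<phi>_def using F(2)[of "Suc (nat (-1 - i))"] H(2)[of "Suc (nat i)"] by auto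
    show au: "aug K' \<bullet> \<phi> (- 1) = g \<bullet> aug K" using F(3)[of 0] F(1) \<phi>0 by simp
    show co: "\<phi> 0 \<bullet> coaug K = coaug K' \<bullet> g" using H(3)[of 0] H(1) \<phi>0 by simp
    have \<phi>_arr: "\<phi> 0 \<in> homs C (obj K 0) (obj K' 0)" "\<phi> (-1) \<in> homs C (obj K (-1)) (obj K' (-1))"
      unfolding \<phi>0 using F(2)[of 1] H(2)[of 1] by auto
    show "\<phi> (i + 1) \<bullet> diff K i = diff K' i \<bullet> \<phi> i" for i
    proof (cases i rule: int_split3)
      case (1 n)
      have "i = -1 - int (Suc n)" "i + 1 = -1 - int n" using 1 by auto
      then have "\<phi> i = F (Suc (Suc n))" "\<phi> (i + 1) = F (Suc n)" using \<phi>1(1) by metis+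
      then show ?thesis using F(3)[of "Suc n"] 1 by simp
    next
      \<comment> \<open>Degree \<open>-1\<close> is the splice. Both halves of the cochain map cover
        the same \<open>g\<close>, so the square commutes once the differentials are factored
        through \<open>B\<close> and \<open>B'\<close>.\<close>
      case 2
      have "\<phi> 0 \<bullet> (coaug K \<bullet> aug K) = (coaug K' \<bullet> g) \<bullet> aug K"
        by (rule comp_reduce[OF co]) (use s \<phi>_arr in auto)
      also have "\<dots> = coaug K' \<bullet> (aug K' \<bullet> \<phi> (-1))" unfolding au using s g by simp
      also have "\<dots> = (coaug K' \<bullet> aug K') \<bullet> \<phi> (-1)" using s \<phi>_arr by simp
      finally show ?thesis using 2 coresolution_facts(5)[OF K] coresolution_facts(5)[OF K'] by simp
    next
      case (3 n)
      have "i + 1 = int (Suc n)" using 3 by auto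
      then have "\<phi> i = H (Suc n)" "\<phi> (i + 1) = H (Suc (Suc n))" using \<phi>1(2) 3 by metis+
      then show ?thesis using H(3)[of "Suc n"] 3 by simp
    qed
  qed
qed

text \<open>The vanishing of the component in degree 0 lets the homotopy respect the two halves of the coresolutions.\<close>

lemma null_homotopy:
  assumes K: "coresolution B K" and K': "coresolution B' K'" and \<psi>: "extends_to C K K' (\<zero> B B') \<psi>"
  shows "\<exists>s. (\<forall>i. s i \<in> homs C (obj K i) (obj K' (i - 1))) \<and> s 0 = \<zero> (obj K 0) (obj K' (-1)) \<and>
    (\<forall>i. \<psi> i = diff K' (i - 1) \<bullet> s i \<uplus> s (i + 1) \<bullet> diff K i)"
proof -
  note s = coresolution_arr[OF K] coresolution_arr[OF K']
  have \<psi>: "\<psi> i \<in> homs C (obj K i) (obj K' i)" "\<psi> (i + 1) \<bullet> diff K i = diff K' i \<bullet> \<psi> i"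
    "aug K' \<bullet> \<psi> (-1) = \<zero> B B' \<bullet> aug K" "\<psi> 0 \<bullet> coaug K = coaug K' \<bullet> \<zero> B B'" for i
    using \<psi> unfolding extends_to_def by auto
  define F where "F n = (case n of 0 \<Rightarrow> \<zero> B B' | Suc m \<Rightarrow> \<psi> (-1 - int m))" for n
  define H where "H n = (case n of 0 \<Rightarrow> \<zero> B B' | Suc m \<Rightarrow> \<psi> (int m))" for n
  have F1: "F n \<in> homs C (left_obj K B n) (left_obj K' B' n)" for n
    using \<psi>(1) s by (cases n) (auto simp: F_def)
  have H1: "H n \<in> homs C (right_obj K B n) (right_obj K' B' n)" for n
    using \<psi>(1) s by (cases n) (auto simp: H_def)
  have F2: "left_diff K' n \<bullet> F (Suc n) = F n \<bullet> left_diff K n" for n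
  proof (cases n)
    case (Suc m)
    have "-2 - int m + 1 = -1 - int m" by simp
    then show ?thesis using \<psi>(2)[of "-2 - int m"] Suc by (simp add: F_def)
  qed (use \<psi>(3) in \<open>simp add: F_def\<close>)
  have H2: "H (Suc n) \<bullet> right_diff K n = right_diff K' n \<bullet> H n" for n
    using \<psi>(2)[of "int (n - 1)"] \<psi>(4) by (cases n) (auto simp: H_def add.commute)
  have "\<exists>s. s 0 = \<zero> (left_obj K B 0) (left_obj K' B' 1) \<and> (\<forall>n. s n \<in> homs C (left_obj K B n) (left_obj K' B' (Suc n)) \<and>
      F (Suc n) = left_diff K' (Suc n) \<bullet> s (Suc n) \<uplus> s n \<bullet> left_diff K n)"
    by (rule comparison_homotopy[OF left_resolution(1,2)[OF K] left_resolution(1)[OF K'] left_lifts_against[OF K K'] F1 F2])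
      (simp add: F_def)
  then obtain l where l: "l 0 = \<zero> B (obj K' (-1))" "\<And>n. l n \<in> homs C (left_obj K B n) (left_obj K' B' (Suc n))"
    "\<And>n. F (Suc n) = left_diff K' (Suc n) \<bullet> l (Suc n) \<uplus> l n \<bullet> left_diff K n" by auto
  have "\<exists>s. s 0 = Zero (op_category C) (right_obj K' B' 0) (right_obj K B 1) \<and> (\<forall>n. s n \<in> homs (op_category C) (right_obj K' B' n) (right_obj K B (Suc n)) \<and>
      H (Suc n) = Add (op_category C) (right_diff K (Suc n) \<odot>\<^bsub>op_category C\<^esub> s (Suc n)) (s n \<odot>\<^bsub>op_category C\<^esub> right_diff K' n))"
    by (rule preadditive_category.comparison_homotopy[OF op_preadditive _ _ _ right_lifts_against[OF K K'], where F = H])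
      (use H1 H2 right_resolution[OF K] right_resolution[OF K'] in \<open>simp_all add: H_def[of 0] del: in_homs half_simps(2-4,6-8)\<close>)
  then obtain r where r: "r 0 = \<zero> (obj K 0) B'" "\<And>n. r n \<in> homs C (right_obj K B (Suc n)) (right_obj K' B' n)"
    "\<And>n. H (Suc n) = r (Suc n) \<bullet> right_diff K (Suc n) \<uplus> right_diff K' n \<bullet> r n" by auto
  \<comment> \<open>Position \<open>Suc m\<close> of \<open>l\<close> starts in degree
    \<open>-1 - m\<close>, position \<open>Suc m\<close> of \<open>r\<close> in degree
    \<open>Suc m - 1 + 1\<close>, that is, \<open>r (nat i)\<close> starts in degree
    \<open>i\<close>. In degree 0 the value is zero: the components \<open>l 0\<close> and
    \<open>r 0\<close> at the resolved objects vanish, so neither half demands a contribution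
    there.\<close>
  define t where "t i = (if i < 0 then l (Suc (nat (-1 - i))) else if i = 0 then \<zero> (obj K 0) (obj K' (-1)) else r (nat i))" for i :: int
  have t: "t i \<in> homs C (obj K i) (obj K' (i - 1))" for i
  proof -
    consider "i < 0" | "i = 0" | "i > 0" by linarith
    then show ?thesis
    proof cases
      case 1
      then have "-1 - int (Suc (nat (-1 - i))) = i - 1" by simp
      then show ?thesis using 1 l(2)[of "Suc (nat (-1 - i))"] by (simp add: t_def)
    next
      case 3
      then obtain m where m: "i = int (Suc m)" by (metis gr0_conv_Suc zero_less_imp_eq_int)
      then have "nat i = Suc m" by simp
      then show ?thesis using r(2)[of "Suc m"] m by (simp add: t_def)
    qed (use s in \<open>auto simp: t_def\<close>)
  qed
  have eq: "\<psi> i = diff K' (i - 1) \<bullet> t i \<uplus> t (i + 1) \<bullet> diff K i" for i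
  proof (cases i rule: int_split3)
    case (1 n)
    have e: "nat (-1 - i) = Suc n" "nat (-1 - (i + 1)) = n" "i < 0" "i + 1 < 0" "i - 1 = -2 - int (Suc n)" "i = -1 - int (Suc n)" using 1 by auto
    have "F (Suc (Suc n)) = \<psi> i" using e(6) by (simp add: F_def)
    then show ?thesis using l(3)[of "Suc n"] e 1 by (simp add: t_def)
  next
    case 2
    have "F (Suc 0) = \<psi> i" using 2 by (simp add: F_def)
    then show ?thesis using l(3)[of 0] l(1) l(2)[of 1] \<psi>(1)[of "-1"] 2 s by (simp add: t_def)
  next
    case (3 n)
    show ?thesis
    proof (cases n)
      case 0
      have "H (Suc 0) = \<psi> i" using 3 0 by (simp add: H_def)
      then show ?thesis using r(3)[of 0] r(1) r(2)[of 1] \<psi>(1)[of 0] 0 3 s by (simp add: t_def)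
    next
      case (Suc m)
      have "H (Suc n) = \<psi> i" using 3 by (simp add: H_def)
      then have "\<psi> i = t (i + 1) \<bullet> diff K i \<uplus> diff K' (i - 1) \<bullet> t i"
        using r(3)[of n] 3 Suc by (simp add: t_def nat_add_distrib)
      also have "\<dots> = diff K' (i - 1) \<bullet> t i \<uplus> t (i + 1) \<bullet> diff K i"
        by (rule add_commute) (use t[of i] t[of "i + 1"] s in auto)
      finally show ?thesis .
    qed
  qed
  show ?thesis using t eq by (intro exI[of _ t]) (auto simp: t_def)
qed

end

section \<open>Cohomology of complexes of abelian groups\<close>

locale cochain_complex =
  fixes G :: "int \<Rightarrow> 'a monoid" and d :: "int \<Rightarrow> 'a \<Rightarrow> 'a"
  assumes comm: "comm_group (G n)"
    and d_hom: "d n \<in> hom (G n) (G (n + 1))"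
    and dd: "x \<in> carrier (G n) \<Longrightarrow> d (n + 1) (d n x) = \<one>\<^bsub>G (n + 1 + 1)\<^esub>"
begin

sublocale G: comm_group "G n" for n by (rule comm)

sublocale d: group_hom "G n" "G (n + 1)" "d n" for n
  by unfold_locales (rule d_hom)

definition cocycles :: "int \<Rightarrow> 'a set" where
  "cocycles n = {x \<in> carrier (G n). d n x = \<one>\<^bsub>G (n + 1)\<^esub>}"

definition cls :: "int \<Rightarrow> 'a \<Rightarrow> 'a set" where
  "cls n z = coboundaries G d n #>\<^bsub>G n\<^esub> z"

lemma cocyclesD: "z \<in> cocycles n \<Longrightarrow> z \<in> carrier (G n)" "z \<in> cocycles n \<Longrightarrow> d n z = \<one>\<^bsub>G (n + 1)\<^esub>"
  by (auto simp: cocycles_def)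

lemma cocycles_subgroup: "subgroup (cocycles n) (G n)"
  using d.subgroup_kernel[of n] by (simp add: cocycles_def kernel_def)

lemma d_pred [simp]:
  "x \<in> carrier (G (n - 1)) \<Longrightarrow> d (n - 1) x \<in> carrier (G n)"
  "x \<in> carrier (G (n - 1)) \<Longrightarrow> y \<in> carrier (G (n - 1)) \<Longrightarrow> d (n - 1) (x \<otimes>\<^bsub>G (n - 1)\<^esub> y) = d (n - 1) x \<otimes>\<^bsub>G n\<^esub> d (n - 1) y"
  "d (n - 1) \<one>\<^bsub>G (n - 1)\<^esub> = \<one>\<^bsub>G n\<^esub>"
  "x \<in> carrier (G (n - 1)) \<Longrightarrow> d (n - 1) (inv\<^bsub>G (n - 1)\<^esub> x) = inv\<^bsub>G n\<^esub> (d (n - 1) x)"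
  "x \<in> carrier (G (n - 1)) \<Longrightarrow> d n (d (n - 1) x) = \<one>\<^bsub>G (n + 1)\<^esub>"
  using d.hom_closed[of x "n - 1"] d.hom_mult[of x "n - 1" y] d.hom_one[of "n - 1"] d.hom_inv[of x "n - 1"]
    dd[of x "n - 1"] by auto

lemma coboundary_cocycle: "x \<in> carrier (G (n - 1)) \<Longrightarrow> d (n - 1) x \<in> cocycles n"
  by (simp add: cocycles_def)

lemma coboundaries_subgroup: "subgroup (coboundaries G d n) (G n)"
proof -
  interpret h: group_hom "G (n - 1)" "G n" "d (n - 1)"
    using d.group_hom_axioms[of "n - 1"] by simp
  show ?thesis unfolding coboundaries_def by (rule h.img_is_subgroup)
qed

lemma cocycle_group: "comm_group ((G n)\<lparr>carrier := cocycles n\<rparr>)"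
  by (rule group.group_comm_groupI[OF G.subgroup_imp_group[OF cocycles_subgroup]])
    (auto simp: cocycles_def G.m_comm)

lemma coboundaries_normal: "coboundaries G d n \<lhd> (G n)\<lparr>carrier := cocycles n\<rparr>"
proof (rule comm_group.subgroup_imp_normal[OF cocycle_group])
  show "subgroup (coboundaries G d n) ((G n)\<lparr>carrier := cocycles n\<rparr>)"
    by (rule G.subgroup_incl[OF coboundaries_subgroup cocycles_subgroup])
      (auto simp: coboundaries_def coboundary_cocycle)
qed

lemma cohomology_eq: "cohomology G d n = (G n)\<lparr>carrier := cocycles n\<rparr> Mod coboundaries G d n"
  by (simp add: cohomology_def cocycles_def kernel_def)

lemma cohomology_carrier: "carrier (cohomology G d n) = cls n ` cocycles n"
  by (auto simp: cohomology_eq FactGroup_def RCOSETS_def cls_def r_coset_def)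

lemma cohomology_comm_group: "comm_group (cohomology G d n)"
  unfolding cohomology_eq
  by (rule comm_group.abelian_FactGroup[OF cocycle_group]) (rule normal_imp_subgroup[OF coboundaries_normal])

lemma cls_mult:
  assumes "x \<in> cocycles n" "y \<in> cocycles n"
  shows "cls n x \<otimes>\<^bsub>cohomology G d n\<^esub> cls n y = cls n (x \<otimes>\<^bsub>G n\<^esub> y)"
  using normal.rcos_sum[OF coboundaries_normal, of x n y] assms
  by (simp add: cohomology_eq cls_def r_coset_def set_mult_def)

lemma cls_one: "\<one>\<^bsub>cohomology G d n\<^esub> = cls n \<one>\<^bsub>G n\<^esub>"
  using subgroup.subset[OF coboundaries_subgroup] by (simp add: cohomology_eq cls_def G.coset_mult_one)

lemma cls_eq_iff:
  assumes "x \<in> cocycles n" "y \<in> cocycles n"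
  shows "cls n x = cls n y \<longleftrightarrow> (\<exists>w\<in>carrier (G (n - 1)). x = d (n - 1) w \<otimes>\<^bsub>G n\<^esub> y)"
proof
  assume "cls n x = cls n y"
  then have "x \<in> coboundaries G d n #>\<^bsub>G n\<^esub> y"
    using G.rcos_self[OF _ coboundaries_subgroup, of x n] assms by (simp add: cls_def cocyclesD)
  then show "\<exists>w\<in>carrier (G (n - 1)). x = d (n - 1) w \<otimes>\<^bsub>G n\<^esub> y"
    by (auto simp: r_coset_def coboundaries_def)
next
  assume "\<exists>w\<in>carrier (G (n - 1)). x = d (n - 1) w \<otimes>\<^bsub>G n\<^esub> y"
  then have "x \<in> coboundaries G d n #>\<^bsub>G n\<^esub> y" by (auto simp: r_coset_def coboundaries_def)
  then show "cls n x = cls n y"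
    using G.repr_independence[OF _ _ coboundaries_subgroup, of x n y] assms by (simp add: cls_def cocyclesD)
qed

lemma cls_eq_one_iff:
  assumes "x \<in> cocycles n"
  shows "cls n x = \<one>\<^bsub>cohomology G d n\<^esub> \<longleftrightarrow> (\<exists>w\<in>carrier (G (n - 1)). x = d (n - 1) w)"
  using cls_eq_iff[OF assms subgroup.one_closed[OF cocycles_subgroup]] by (auto simp: cls_one)

end

text \<open>The map is asked to be a homomorphism in degree \<open>n\<close> that sends coboundaries
  to coboundaries. In this form the lemma computes both the action of a cochain map and that of
  precomposition.\<close>

lemma cohomology_map_cls:
  assumes "cochain_complex G d" "cochain_complex H e"
    and phi: "\<phi> n \<in> hom (H n) (G n)" "\<And>y. y \<in> carrier (H (n - 1)) \<Longrightarrow> \<exists>w\<in>carrier (G (n - 1)). \<phi> n (e (n - 1) y) = d (n - 1) w"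
    and z: "z \<in> carrier (H n)"
  shows "cohomology_map G d \<phi> n (cochain_complex.cls H e n z) = cochain_complex.cls G d n (\<phi> n z)"
proof -
  interpret G: cochain_complex G d by fact
  interpret H: cochain_complex H e by fact
  interpret h: group_hom "H n" "G n" "\<phi> n" by unfold_locales (rule phi)
  have "b \<otimes>\<^bsub>G n\<^esub> \<phi> n (e (n - 1) y \<otimes>\<^bsub>H n\<^esub> z) \<in> coboundaries G d n #>\<^bsub>G n\<^esub> \<phi> n z"
    if b: "b \<in> coboundaries G d n" and y: "y \<in> carrier (H (n - 1))" for b y
  proof -
    obtain w where w: "w \<in> carrier (G (n - 1))" "\<phi> n (e (n - 1) y) = d (n - 1) w" using phi(2)[OF y] by auto
    obtain v where v: "v \<in> carrier (G (n - 1))" "b = d (n - 1) v" using b by (auto simp: coboundaries_def)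
    have "b \<otimes>\<^bsub>G n\<^esub> \<phi> n (e (n - 1) y \<otimes>\<^bsub>H n\<^esub> z) = d (n - 1) (v \<otimes>\<^bsub>G (n - 1)\<^esub> w) \<otimes>\<^bsub>G n\<^esub> \<phi> n z"
      using v w y z by (simp add: G.G.m_assoc)
    moreover have "d (n - 1) (v \<otimes>\<^bsub>G (n - 1)\<^esub> w) \<in> coboundaries G d n"
      unfolding coboundaries_def by (rule imageI) (use v w in simp)
    ultimately show ?thesis by (auto simp: r_coset_def)
  qed
  moreover have "b \<otimes>\<^bsub>G n\<^esub> \<phi> n z \<in> coboundaries G d n <#>\<^bsub>G n\<^esub> \<phi> n ` (coboundaries H e n #>\<^bsub>H n\<^esub> z)"
    if b: "b \<in> coboundaries G d n" for b
  proof -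
    have "z \<in> coboundaries H e n #>\<^bsub>H n\<^esub> z" by (rule H.G.rcos_self[OF z H.coboundaries_subgroup])
    then show ?thesis using b by (auto simp: set_mult_def)
  qed
  ultimately show ?thesis
    unfolding cohomology_map_def G.cls_def H.cls_def
    by (auto simp: set_mult_def r_coset_def coboundaries_def)
qed

text \<open>
  A pair of composable cochain maps together with a null-homotopy \<open>s\<close> of the composite; \<open>total_exact\<close> says
  that the total complex of \<open>X \<rightarrow> Y \<rightarrow> Z\<close>, with \<open>s\<close> as the secondary differential, is exact.
\<close>

locale exact_triple =
  X: cochain_complex X dX + Y: cochain_complex Y dY + Z: cochain_complex Z dZ
  for X Y Z :: "int \<Rightarrow> 'a monoid" and dX dY dZ +
  fixes \<alpha> \<beta> s :: "int \<Rightarrow> 'a \<Rightarrow> 'a"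
  assumes \<alpha>_hom: "\<alpha> n \<in> hom (X n) (Y n)" and \<beta>_hom: "\<beta> n \<in> hom (Y n) (Z n)" and s_hom: "s n \<in> hom (X n) (Z (n - 1))"
    and \<alpha>_d: "x \<in> carrier (X n) \<Longrightarrow> \<alpha> (n + 1) (dX n x) = dY n (\<alpha> n x)"
    and \<beta>_d: "y \<in> carrier (Y n) \<Longrightarrow> \<beta> (n + 1) (dY n y) = dZ n (\<beta> n y)"
    and homotopy: "x \<in> carrier (X n) \<Longrightarrow> \<beta> n (\<alpha> n x) = dZ (n - 1) (s n x) \<otimes>\<^bsub>Z n\<^esub> s (n + 1) (dX n x)"
    and total_exact: "\<lbrakk>x \<in> carrier (X (n + 1)); y \<in> carrier (Y n); z \<in> carrier (Z (n - 1)); dX (n + 1) x = \<one>\<^bsub>X (n + 1 + 1)\<^esub>;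
        \<alpha> (n + 1) x = dY n y; \<beta> n y = s (n + 1) x \<otimes>\<^bsub>Z n\<^esub> dZ (n - 1) z\<rbrakk>
      \<Longrightarrow> \<exists>x'\<in>carrier (X n). \<exists>y'\<in>carrier (Y (n - 1)). \<exists>z'\<in>carrier (Z (n - 2)).
        x = dX n x' \<and> \<alpha> n x' = y \<otimes>\<^bsub>Y n\<^esub> dY (n - 1) y' \<and> s n x' \<otimes>\<^bsub>Z (n - 1)\<^esub> dZ (n - 2) z' = z \<otimes>\<^bsub>Z (n - 1)\<^esub> \<beta> (n - 1) y'"
begin

sublocale \<alpha>: group_hom "X n" "Y n" "\<alpha> n" for n by unfold_locales (rule \<alpha>_hom)
sublocale \<beta>: group_hom "Y n" "Z n" "\<beta> n" for n by unfold_locales (rule \<beta>_hom)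
sublocale s: group_hom "X n" "Z (n - 1)" "s n" for n by unfold_locales (rule s_hom)

lemma s_Suc [simp]:
  "x \<in> carrier (X (n + 1)) \<Longrightarrow> s (n + 1) x \<in> carrier (Z n)"
  "x \<in> carrier (X (n + 1)) \<Longrightarrow> y \<in> carrier (X (n + 1)) \<Longrightarrow> s (n + 1) (x \<otimes>\<^bsub>X (n + 1)\<^esub> y) = s (n + 1) x \<otimes>\<^bsub>Z n\<^esub> s (n + 1) y"
  "s (n + 1) \<one>\<^bsub>X (n + 1)\<^esub> = \<one>\<^bsub>Z n\<^esub>"
  "x \<in> carrier (X (n + 1)) \<Longrightarrow> s (n + 1) (inv\<^bsub>X (n + 1)\<^esub> x) = inv\<^bsub>Z n\<^esub> (s (n + 1) x)"
  using s.hom_closed[of x "n + 1"] s.hom_mult[of x "n + 1" y] s.hom_one[of "n + 1"] s.hom_inv[of x "n + 1"] by auto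

text \<open>The relation of the snake lemma, up to sign: \<open>y\<close> is a preimage of minus
  \<open>z\<close> whose differential comes from \<open>x\<close>. The term
  \<open>s (n + 1) x\<close> corrects for the composite being only null-homotopic, and
  \<open>w\<close> absorbs a coboundary. It is stated as a relation because \<open>x\<close> depends
  on choices.\<close>

definition zigzag :: "int \<Rightarrow> 'a \<Rightarrow> 'a \<Rightarrow> bool" where
  "zigzag n z x \<longleftrightarrow> x \<in> X.cocycles (n + 1) \<and> (\<exists>y\<in>carrier (Y n). \<exists>w\<in>carrier (Z (n - 1)).
     \<alpha> (n + 1) x = dY n y \<and> z \<otimes>\<^bsub>Z n\<^esub> \<beta> n y = s (n + 1) x \<otimes>\<^bsub>Z n\<^esub> dZ (n - 1) w)"

lemma zigzag_ex:
  assumes "z \<in> Z.cocycles n" shows "\<exists>x. zigzag n z x"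
proof -
  note z = Z.cocyclesD[OF assms]
  \<comment> \<open>The triple \<open>(0, 0, z)\<close> is a cocycle of the total complex one degree
    higher, since \<open>z\<close> is a cocycle. A primitive of it is the required zigzag.\<close>
  have "\<exists>x'\<in>carrier (X (n + 1)). \<exists>y'\<in>carrier (Y (n + 1 - 1)). \<exists>z'\<in>carrier (Z (n + 1 - 2)).
        \<one>\<^bsub>X (n + 1 + 1)\<^esub> = dX (n + 1) x' \<and> \<alpha> (n + 1) x' = \<one>\<^bsub>Y (n + 1)\<^esub> \<otimes>\<^bsub>Y (n + 1)\<^esub> dY (n + 1 - 1) y' \<and>
        s (n + 1) x' \<otimes>\<^bsub>Z (n + 1 - 1)\<^esub> dZ (n + 1 - 2) z' = z \<otimes>\<^bsub>Z (n + 1 - 1)\<^esub> \<beta> (n + 1 - 1) y'"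
    by (rule total_exact) (use z s_Suc(3)[of "n + 1"] in auto)
  moreover have e: "n + 1 - 1 = n" "n + 1 - 2 = n - 1" by auto
  ultimately have "\<exists>x'\<in>carrier (X (n + 1)). \<exists>y'\<in>carrier (Y n). \<exists>z'\<in>carrier (Z (n - 1)).
        \<one>\<^bsub>X (n + 1 + 1)\<^esub> = dX (n + 1) x' \<and> \<alpha> (n + 1) x' = \<one>\<^bsub>Y (n + 1)\<^esub> \<otimes>\<^bsub>Y (n + 1)\<^esub> dY n y' \<and>
        s (n + 1) x' \<otimes>\<^bsub>Z n\<^esub> dZ (n - 1) z' = z \<otimes>\<^bsub>Z n\<^esub> \<beta> n y'" unfolding e by blast
  then obtain x' y' z' where *: "x' \<in> carrier (X (n + 1))" "y' \<in> carrier (Y n)" "z' \<in> carrier (Z (n - 1))"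
    "\<one>\<^bsub>X (n + 1 + 1)\<^esub> = dX (n + 1) x'" "\<alpha> (n + 1) x' = \<one>\<^bsub>Y (n + 1)\<^esub> \<otimes>\<^bsub>Y (n + 1)\<^esub> dY n y'"
    "s (n + 1) x' \<otimes>\<^bsub>Z n\<^esub> dZ (n - 1) z' = z \<otimes>\<^bsub>Z n\<^esub> \<beta> n y'" by blast
  have "zigzag n z x'"
    unfolding zigzag_def X.cocycles_def
    by (intro conjI CollectI bexI[of _ y'] bexI[of _ z'] *(1-3) *(4)[symmetric] *(6)[symmetric]) (use * in simp)
  then show ?thesis by blast
qed

lemma zigzag_mult:
  assumes "zigzag n z x" "zigzag n z' x'" "z \<in> carrier (Z n)" "z' \<in> carrier (Z n)"
  shows "zigzag n (z \<otimes>\<^bsub>Z n\<^esub> z') (x \<otimes>\<^bsub>X (n + 1)\<^esub> x')"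
proof -
  obtain y w where 1: "y \<in> carrier (Y n)" "w \<in> carrier (Z (n - 1))" "\<alpha> (n + 1) x = dY n y"
    "z \<otimes>\<^bsub>Z n\<^esub> \<beta> n y = s (n + 1) x \<otimes>\<^bsub>Z n\<^esub> dZ (n - 1) w" using assms by (auto simp: zigzag_def)
  obtain y' w' where 2: "y' \<in> carrier (Y n)" "w' \<in> carrier (Z (n - 1))" "\<alpha> (n + 1) x' = dY n y'"
    "z' \<otimes>\<^bsub>Z n\<^esub> \<beta> n y' = s (n + 1) x' \<otimes>\<^bsub>Z n\<^esub> dZ (n - 1) w'" using assms by (auto simp: zigzag_def)
  have x: "x \<in> X.cocycles (n + 1)" "x' \<in> X.cocycles (n + 1)" using assms by (auto simp: zigzag_def)
  note xc = x[THEN X.cocyclesD(1)]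
  have "(z \<otimes>\<^bsub>Z n\<^esub> z') \<otimes>\<^bsub>Z n\<^esub> (\<beta> n y \<otimes>\<^bsub>Z n\<^esub> \<beta> n y') = (z \<otimes>\<^bsub>Z n\<^esub> \<beta> n y) \<otimes>\<^bsub>Z n\<^esub> (z' \<otimes>\<^bsub>Z n\<^esub> \<beta> n y')"
    using assms(3,4) 1(1,2) 2(1,2) by (simp add: Z.G.m_ac)
  also have "\<dots> = (s (n + 1) x \<otimes>\<^bsub>Z n\<^esub> s (n + 1) x') \<otimes>\<^bsub>Z n\<^esub> (dZ (n - 1) w \<otimes>\<^bsub>Z n\<^esub> dZ (n - 1) w')"
    unfolding 1(4) 2(4) using xc 1(1,2) 2(1,2) by (simp add: Z.G.m_ac)
  finally show ?thesis
    unfolding zigzag_def using 1 2 xc x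
    by (intro conjI bexI[of _ "y \<otimes>\<^bsub>Y n\<^esub> y'"] bexI[of _ "w \<otimes>\<^bsub>Z (n - 1)\<^esub> w'"] subgroup.m_closed[OF X.cocycles_subgroup]) auto
qed

lemma zigzag_inv:
  assumes "zigzag n z x" "z \<in> carrier (Z n)"
  shows "zigzag n (inv\<^bsub>Z n\<^esub> z) (inv\<^bsub>X (n + 1)\<^esub> x)"
proof -
  obtain y w where 1: "y \<in> carrier (Y n)" "w \<in> carrier (Z (n - 1))" "\<alpha> (n + 1) x = dY n y"
    "z \<otimes>\<^bsub>Z n\<^esub> \<beta> n y = s (n + 1) x \<otimes>\<^bsub>Z n\<^esub> dZ (n - 1) w" using assms by (auto simp: zigzag_def)
  have x: "x \<in> X.cocycles (n + 1)" using assms by (auto simp: zigzag_def)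
  note xc = x[THEN X.cocyclesD(1)]
  have "inv\<^bsub>Z n\<^esub> (z \<otimes>\<^bsub>Z n\<^esub> \<beta> n y) = inv\<^bsub>Z n\<^esub> (s (n + 1) x \<otimes>\<^bsub>Z n\<^esub> dZ (n - 1) w)" using 1 by simp
  then have "inv\<^bsub>Z n\<^esub> z \<otimes>\<^bsub>Z n\<^esub> inv\<^bsub>Z n\<^esub> \<beta> n y = inv\<^bsub>Z n\<^esub> (s (n + 1) x) \<otimes>\<^bsub>Z n\<^esub> inv\<^bsub>Z n\<^esub> (dZ (n - 1) w)"
    using 1(1,2) xc assms(2) by (simp add: Z.G.inv_mult)
  then show ?thesis
    unfolding zigzag_def using 1 xc x
    by (intro conjI bexI[of _ "inv\<^bsub>Y n\<^esub> y"] bexI[of _ "inv\<^bsub>Z (n - 1)\<^esub> w"] subgroup.m_inv_closed[OF X.cocycles_subgroup]) auto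
qed

text \<open>The triple \<open>(x, y, w - t)\<close> is a cocycle of the total complex, so it is a
  coboundary, and its first coordinate exhibits \<open>x\<close> as a coboundary. Together with the
  additivity of \<open>zigzag\<close> this makes the connecting map well defined.\<close>

lemma zigzag_coboundary:
  assumes "zigzag n (dZ (n - 1) t) x" "t \<in> carrier (Z (n - 1))"
  shows "X.cls (n + 1) x = \<one>\<^bsub>cohomology X dX (n + 1)\<^esub>"
proof -
  obtain y w where 1: "y \<in> carrier (Y n)" "w \<in> carrier (Z (n - 1))" "\<alpha> (n + 1) x = dY n y"
    "dZ (n - 1) t \<otimes>\<^bsub>Z n\<^esub> \<beta> n y = s (n + 1) x \<otimes>\<^bsub>Z n\<^esub> dZ (n - 1) w" using assms by (auto simp: zigzag_def)
  have x: "x \<in> X.cocycles (n + 1)" using assms by (auto simp: zigzag_def)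
  note xc = X.cocyclesD[OF x]
  let ?z = "w \<otimes>\<^bsub>Z (n - 1)\<^esub> inv\<^bsub>Z (n - 1)\<^esub> t"
  have "\<beta> n y = inv\<^bsub>Z n\<^esub> (dZ (n - 1) t) \<otimes>\<^bsub>Z n\<^esub> (s (n + 1) x \<otimes>\<^bsub>Z n\<^esub> dZ (n - 1) w)"
    using 1 assms(2) xc by (simp flip: 1(4) Z.G.m_assoc)
  also have "\<dots> = s (n + 1) x \<otimes>\<^bsub>Z n\<^esub> dZ (n - 1) ?z"
    using 1(1,2) assms(2) xc by (simp add: Z.G.m_ac)
  finally have "\<beta> n y = s (n + 1) x \<otimes>\<^bsub>Z n\<^esub> dZ (n - 1) ?z" .
  from total_exact[OF xc(1) 1(1) _ xc(2) 1(3) this] 1 assms(2)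
  obtain x' where "x' \<in> carrier (X n)" "x = dX n x'" by auto
  then show ?thesis using X.cls_eq_one_iff[OF x] by auto
qed

definition connecting :: "int \<Rightarrow> 'a set \<Rightarrow> 'a set" where
  "connecting n \<zeta> = X.cls (n + 1) (SOME x. \<exists>z\<in>Z.cocycles n. \<zeta> = Z.cls n z \<and> zigzag n z x)"

text \<open>Two choices of the representative and of its zigzag differ by a zigzag that starts in a
  coboundary, so \<open>zigzag_coboundary\<close> identifies their classes.\<close>

lemma connecting_cls:
  assumes z: "z \<in> Z.cocycles n" and x: "zigzag n z x"
  shows "connecting n (Z.cls n z) = X.cls (n + 1) x"
proof -
  define x' where "x' = (SOME x. \<exists>z'\<in>Z.cocycles n. Z.cls n z = Z.cls n z' \<and> zigzag n z' x)"
  have "\<exists>z'\<in>Z.cocycles n. Z.cls n z = Z.cls n z' \<and> zigzag n z' x'"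
    unfolding x'_def by (rule someI[of _ x]) (use z x in auto)
  then obtain z' where z': "z' \<in> Z.cocycles n" "Z.cls n z = Z.cls n z'" "zigzag n z' x'" by auto
  then obtain t where t: "t \<in> carrier (Z (n - 1))" "z = dZ (n - 1) t \<otimes>\<^bsub>Z n\<^esub> z'"
    using Z.cls_eq_iff[OF z z'(1)] by auto
  note zc = Z.cocyclesD(1)[OF z'(1)]
  have "z \<otimes>\<^bsub>Z n\<^esub> inv\<^bsub>Z n\<^esub> z' = dZ (n - 1) t" using t zc by (simp add: Z.G.m_assoc)
  then have "zigzag n (dZ (n - 1) t) (x \<otimes>\<^bsub>X (n + 1)\<^esub> inv\<^bsub>X (n + 1)\<^esub> x')"
    using zigzag_mult[OF x zigzag_inv[OF z'(3)]] z zc Z.cocyclesD(1) by auto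
  from zigzag_coboundary[OF this t(1)]
  have 1: "X.cls (n + 1) (x \<otimes>\<^bsub>X (n + 1)\<^esub> inv\<^bsub>X (n + 1)\<^esub> x') = \<one>\<^bsub>cohomology X dX (n + 1)\<^esub>" .
  have xs: "x \<in> X.cocycles (n + 1)" "x' \<in> X.cocycles (n + 1)" using x z' by (auto simp: zigzag_def)
  note xc = xs[THEN X.cocyclesD(1)]
  have "x \<otimes>\<^bsub>X (n + 1)\<^esub> inv\<^bsub>X (n + 1)\<^esub> x' \<in> X.cocycles (n + 1)"
    using xs subgroup.m_closed[OF X.cocycles_subgroup] subgroup.m_inv_closed[OF X.cocycles_subgroup] by auto
  then obtain w where w: "w \<in> carrier (X n)" "x \<otimes>\<^bsub>X (n + 1)\<^esub> inv\<^bsub>X (n + 1)\<^esub> x' = dX n w"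
    using 1 X.cls_eq_one_iff by auto
  have "dX n w \<otimes>\<^bsub>X (n + 1)\<^esub> x' = x"
    unfolding w(2)[symmetric] using xc by (simp add: X.G.m_assoc)
  then have "X.cls (n + 1) x = X.cls (n + 1) x'"
    using X.cls_eq_iff[OF xs] w by auto
  then show ?thesis unfolding connecting_def x'_def[symmetric] by simp
qed

lemma \<alpha>_cocycle: "x \<in> X.cocycles n \<Longrightarrow> \<alpha> n x \<in> Y.cocycles n"
  using \<alpha>_d[of x n] by (auto simp: X.cocycles_def Y.cocycles_def)

lemma \<beta>_cocycle: "x \<in> Y.cocycles n \<Longrightarrow> \<beta> n x \<in> Z.cocycles n"
  using \<beta>_d[of x n] by (auto simp: Y.cocycles_def Z.cocycles_def)

theorem long_exact:
  assumes \<alpha>H: "\<And>n x. x \<in> X.cocycles n \<Longrightarrow> \<alpha>H n (X.cls n x) = Y.cls n (\<alpha> n x)"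
    and \<beta>H: "\<And>n y. y \<in> Y.cocycles n \<Longrightarrow> \<beta>H n (Y.cls n y) = Z.cls n (\<beta> n y)"
  shows "long_exact_sequence (cohomology X dX) (cohomology Y dY) (cohomology Z dZ) \<alpha>H \<beta>H connecting"
proof -
  have gX: "group (cohomology X dX n)" and gY: "group (cohomology Y dY n)" and gZ: "group (cohomology Z dZ n)" for n
    using X.cohomology_comm_group Y.cohomology_comm_group Z.cohomology_comm_group by (auto simp: comm_group_def)
  have h\<alpha>: "\<alpha>H n \<in> hom (cohomology X dX n) (cohomology Y dY n)" for n
    unfolding hom_def X.cohomology_carrier Y.cohomology_carrier
    using \<alpha>H[of _ n] subgroup.m_closed[OF X.cocycles_subgroup, of _ n]
    by (auto simp: X.cls_mult Y.cls_mult \<alpha>_cocycle X.cocyclesD)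
  have h\<beta>: "\<beta>H n \<in> hom (cohomology Y dY n) (cohomology Z dZ n)" for n
    unfolding hom_def Z.cohomology_carrier Y.cohomology_carrier
    using \<beta>H[of _ n] subgroup.m_closed[OF Y.cocycles_subgroup, of _ n]
    by (auto simp: Z.cls_mult Y.cls_mult \<beta>_cocycle Y.cocyclesD)
  have zc: "x \<in> X.cocycles (n + 1)" if "zigzag n z x" for n z x using that by (simp add: zigzag_def)
  have cn: "\<exists>x\<in>X.cocycles (n + 1). zigzag n z x \<and> connecting n (Z.cls n z) = X.cls (n + 1) x" if "z \<in> Z.cocycles n" for n z
    using zigzag_ex[OF that] connecting_cls[OF that] zc by blast
  have h\<delta>: "connecting n \<in> hom (cohomology Z dZ n) (cohomology X dX (n + 1))" for n
    unfolding hom_def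
  proof (intro CollectI conjI ballI Pi_I)
    fix \<zeta> assume "\<zeta> \<in> carrier (cohomology Z dZ n)"
    then obtain z where z: "z \<in> Z.cocycles n" "\<zeta> = Z.cls n z" unfolding Z.cohomology_carrier by auto
    then show "connecting n \<zeta> \<in> carrier (cohomology X dX (n + 1))"
      using cn[OF z(1)] unfolding X.cohomology_carrier by auto
    fix \<xi> assume "\<xi> \<in> carrier (cohomology Z dZ n)"
    then obtain y where y: "y \<in> Z.cocycles n" "\<xi> = Z.cls n y" unfolding Z.cohomology_carrier by auto
    obtain a where a: "a \<in> X.cocycles (n + 1)" "zigzag n z a" "connecting n \<zeta> = X.cls (n + 1) a" using cn[OF z(1)] z(2) by blast
    obtain b where b: "b \<in> X.cocycles (n + 1)" "zigzag n y b" "connecting n \<xi> = X.cls (n + 1) b" using cn[OF y(1)] y(2) by blast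
    have "zigzag n (z \<otimes>\<^bsub>Z n\<^esub> y) (a \<otimes>\<^bsub>X (n + 1)\<^esub> b)" by (rule zigzag_mult) (use a b z y Z.cocyclesD in auto)
    moreover have "z \<otimes>\<^bsub>Z n\<^esub> y \<in> Z.cocycles n" using z y subgroup.m_closed[OF Z.cocycles_subgroup] by auto
    ultimately show "connecting n (\<zeta> \<otimes>\<^bsub>cohomology Z dZ n\<^esub> \<xi>) = connecting n \<zeta> \<otimes>\<^bsub>cohomology X dX (n + 1)\<^esub> connecting n \<xi>"
      unfolding a(3) b(3) using z y a b connecting_cls by (simp add: Z.cls_mult X.cls_mult)
  qed
  have eY: "kernel (cohomology Y dY n) (cohomology Z dZ n) (\<beta>H n) = \<alpha>H n ` carrier (cohomology X dX n)" for n
  proof (intro equalityI subsetI)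
    fix \<eta> assume "\<eta> \<in> kernel (cohomology Y dY n) (cohomology Z dZ n) (\<beta>H n)"
    then obtain y where y: "y \<in> Y.cocycles n" "\<eta> = Y.cls n y" and "\<beta>H n \<eta> = \<one>\<^bsub>cohomology Z dZ n\<^esub>"
      by (auto simp: kernel_def Y.cohomology_carrier)
    then obtain z where z: "z \<in> carrier (Z (n - 1))" "\<beta> n y = dZ (n - 1) z"
      using \<beta>H[OF y(1)] Z.cls_eq_one_iff[OF \<beta>_cocycle[OF y(1)]] by auto
    note yc = Y.cocyclesD[OF y(1)]
    \<comment> \<open>Exactness of the total complex is applied to \<open>(0, y, z)\<close>. Its
      primitive starts with a cocycle \<open>x'\<close> whose image is cohomologous to
      \<open>y\<close>.\<close>
    obtain x' y' where *: "x' \<in> carrier (X n)" "y' \<in> carrier (Y (n - 1))" "\<one>\<^bsub>X (n + 1)\<^esub> = dX n x'" "\<alpha> n x' = y \<otimes>\<^bsub>Y n\<^esub> dY (n - 1) y'"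
      using total_exact[of "\<one>\<^bsub>X (n + 1)\<^esub>" n y z] yc z by auto
    have x': "x' \<in> X.cocycles n" using * by (simp add: X.cocycles_def)
    have "Y.cls n (\<alpha> n x') = Y.cls n y"
      using * yc by (subst Y.cls_eq_iff[OF \<alpha>_cocycle[OF x'] y(1)]) (auto simp: Y.G.m_comm)
    then show "\<eta> \<in> \<alpha>H n ` carrier (cohomology X dX n)"
      unfolding X.cohomology_carrier using x' y \<alpha>H[OF x'] by auto
  next
    fix \<eta> assume "\<eta> \<in> \<alpha>H n ` carrier (cohomology X dX n)"
    then obtain x where x: "x \<in> X.cocycles n" "\<eta> = Y.cls n (\<alpha> n x)" using \<alpha>H by (auto simp: X.cohomology_carrier)
    note xc = X.cocyclesD[OF x(1)]
    have "\<beta> n (\<alpha> n x) = dZ (n - 1) (s n x)"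
      using homotopy[OF xc(1)] xc by simp
    then have "Z.cls n (\<beta> n (\<alpha> n x)) = \<one>\<^bsub>cohomology Z dZ n\<^esub>"
      using Z.cls_eq_one_iff[OF \<beta>_cocycle[OF \<alpha>_cocycle[OF x(1)]]] xc by auto
    then show "\<eta> \<in> kernel (cohomology Y dY n) (cohomology Z dZ n) (\<beta>H n)"
      using \<alpha>_cocycle[OF x(1)] \<beta>H x by (auto simp: kernel_def Y.cohomology_carrier)
  qed
  have eZ: "kernel (cohomology Z dZ n) (cohomology X dX (n + 1)) (connecting n) = \<beta>H n ` carrier (cohomology Y dY n)" for n
  proof (intro equalityI subsetI)
    fix \<zeta> assume "\<zeta> \<in> kernel (cohomology Z dZ n) (cohomology X dX (n + 1)) (connecting n)"
    then obtain z where z: "z \<in> Z.cocycles n" "\<zeta> = Z.cls n z" and c1: "connecting n \<zeta> = \<one>\<^bsub>cohomology X dX (n + 1)\<^esub>"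
      by (auto simp: kernel_def Z.cohomology_carrier)
    obtain x where x: "x \<in> X.cocycles (n + 1)" "zigzag n z x" "connecting n \<zeta> = X.cls (n + 1) x" using cn[OF z(1)] z(2) by blast
    then obtain x' where x': "x' \<in> carrier (X n)" "x = dX n x'"
      using c1 X.cls_eq_one_iff[OF x(1)] by auto
    obtain y w where 1: "y \<in> carrier (Y n)" "w \<in> carrier (Z (n - 1))" "\<alpha> (n + 1) x = dY n y"
      "z \<otimes>\<^bsub>Z n\<^esub> \<beta> n y = s (n + 1) x \<otimes>\<^bsub>Z n\<^esub> dZ (n - 1) w" using x by (auto simp: zigzag_def)
    note zc = Z.cocyclesD[OF z(1)] and xc = X.cocyclesD[OF x(1)]
    \<comment> \<open>As \<open>x\<close> is the differential of \<open>x'\<close>, the elements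
      \<open>\<alpha> n x'\<close> and \<open>y\<close> have the same differential. Their difference
      is a cocycle, and the homotopy identity together with the zigzag equation shows that
      \<open>\<beta>\<close> sends it into the class of \<open>z\<close>.\<close>
    let ?y = "\<alpha> n x' \<otimes>\<^bsub>Y n\<^esub> inv\<^bsub>Y n\<^esub> y"
    have "dY n ?y = \<one>\<^bsub>Y (n + 1)\<^esub>" using 1 x' \<alpha>_d[OF x'(1)] by simp
    then have yc: "?y \<in> Y.cocycles n" using 1 x' by (simp add: Y.cocycles_def)
    have "\<beta> n ?y \<otimes>\<^bsub>Z n\<^esub> (\<beta> n y \<otimes>\<^bsub>Z n\<^esub> dZ (n - 1) w) = \<beta> n (\<alpha> n x') \<otimes>\<^bsub>Z n\<^esub> dZ (n - 1) w"
      using 1(1,2) x' by (simp flip: Z.G.m_assoc) (simp add: Z.G.m_assoc)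
    also have "\<dots> = dZ (n - 1) (s n x') \<otimes>\<^bsub>Z n\<^esub> (s (n + 1) x \<otimes>\<^bsub>Z n\<^esub> dZ (n - 1) w)"
      unfolding homotopy[OF x'(1)] using 1(1,2) x' xc by (simp add: Z.G.m_assoc)
    also have "\<dots> = dZ (n - 1) (s n x') \<otimes>\<^bsub>Z n\<^esub> (z \<otimes>\<^bsub>Z n\<^esub> \<beta> n y)" by (simp add: 1(4))
    finally have "\<beta> n ?y \<otimes>\<^bsub>Z n\<^esub> (\<beta> n y \<otimes>\<^bsub>Z n\<^esub> dZ (n - 1) w) = dZ (n - 1) (s n x') \<otimes>\<^bsub>Z n\<^esub> (z \<otimes>\<^bsub>Z n\<^esub> \<beta> n y)" .
    then have "\<beta> n y \<otimes>\<^bsub>Z n\<^esub> (\<beta> n ?y \<otimes>\<^bsub>Z n\<^esub> dZ (n - 1) w) = \<beta> n y \<otimes>\<^bsub>Z n\<^esub> (dZ (n - 1) (s n x') \<otimes>\<^bsub>Z n\<^esub> z)"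
      using 1(1,2) x' zc by (simp add: Z.G.m_ac del: \<beta>.hom_mult \<beta>.hom_inv)
    then have e: "\<beta> n ?y \<otimes>\<^bsub>Z n\<^esub> dZ (n - 1) w = dZ (n - 1) (s n x') \<otimes>\<^bsub>Z n\<^esub> z"
      using 1(1,2) x' zc by (subst (asm) Z.G.Units_l_cancel) auto
    have "\<beta> n ?y = (\<beta> n ?y \<otimes>\<^bsub>Z n\<^esub> dZ (n - 1) w) \<otimes>\<^bsub>Z n\<^esub> inv\<^bsub>Z n\<^esub> (dZ (n - 1) w)"
      using 1(1,2) x' by (simp add: Z.G.m_assoc del: \<beta>.hom_mult \<beta>.hom_inv)
    also have "\<dots> = dZ (n - 1) (s n x' \<otimes>\<^bsub>Z (n - 1)\<^esub> inv\<^bsub>Z (n - 1)\<^esub> w) \<otimes>\<^bsub>Z n\<^esub> z"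
      unfolding e using 1(1,2) x' zc by (simp add: Z.G.m_ac)
    finally have "Z.cls n (\<beta> n ?y) = Z.cls n z"
      by (rule Z.cls_eq_iff[OF \<beta>_cocycle[OF yc] z(1), THEN iffD2, OF bexI]) (use 1(1,2) x' in simp)
    then show "\<zeta> \<in> \<beta>H n ` carrier (cohomology Y dY n)"
      unfolding Y.cohomology_carrier using yc z \<beta>H[OF yc] by auto
  next
    fix \<zeta> assume "\<zeta> \<in> \<beta>H n ` carrier (cohomology Y dY n)"
    then obtain y where y: "y \<in> Y.cocycles n" "\<zeta> = Z.cls n (\<beta> n y)" using \<beta>H by (auto simp: Y.cohomology_carrier)
    note yc = Y.cocyclesD[OF y(1)]
    have "zigzag n (\<beta> n y) \<one>\<^bsub>X (n + 1)\<^esub>"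
      unfolding zigzag_def using yc
      by (intro conjI bexI[of _ "inv\<^bsub>Y n\<^esub> y"] bexI[of _ "\<one>\<^bsub>Z (n - 1)\<^esub>"] subgroup.one_closed[OF X.cocycles_subgroup]) auto
    then show "\<zeta> \<in> kernel (cohomology Z dZ n) (cohomology X dX (n + 1)) (connecting n)"
      using connecting_cls[OF \<beta>_cocycle[OF y(1)]] \<beta>_cocycle[OF y(1)] y
      by (auto simp: kernel_def Z.cohomology_carrier X.cls_one)
  qed
  have eX: "kernel (cohomology X dX (n + 1)) (cohomology Y dY (n + 1)) (\<alpha>H (n + 1)) = connecting n ` carrier (cohomology Z dZ n)" for n
  proof (intro equalityI subsetI)
    fix \<xi> assume "\<xi> \<in> kernel (cohomology X dX (n + 1)) (cohomology Y dY (n + 1)) (\<alpha>H (n + 1))"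
    then obtain x where x: "x \<in> X.cocycles (n + 1)" "\<xi> = X.cls (n + 1) x" and "\<alpha>H (n + 1) \<xi> = \<one>\<^bsub>cohomology Y dY (n + 1)\<^esub>"
      by (auto simp: kernel_def X.cohomology_carrier)
    then obtain y where y: "y \<in> carrier (Y n)" "\<alpha> (n + 1) x = dY n y"
      using \<alpha>H[OF x(1)] Y.cls_eq_one_iff[OF \<alpha>_cocycle[OF x(1)]] by auto
    note xc = X.cocyclesD[OF x(1)]
    \<comment> \<open>Solving the zigzag equation for \<open>z\<close> with \<open>w = 0\<close>.
      The homotopy identity makes this a cocycle, since \<open>x\<close> is one.\<close>
    let ?z = "s (n + 1) x \<otimes>\<^bsub>Z n\<^esub> inv\<^bsub>Z n\<^esub> \<beta> n y"
    have "dZ n (s (n + 1) x) = \<beta> (n + 1) (\<alpha> (n + 1) x)"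
      using homotopy[OF xc(1), unfolded xc(2) s_Suc(3)] xc(1) by (simp add: Z.d.hom_closed)
    also have "\<dots> = dZ n (\<beta> n y)" using y \<beta>_d by simp
    finally have z: "?z \<in> Z.cocycles n" using xc y by (simp add: Z.cocycles_def)
    have "zigzag n ?z x" unfolding zigzag_def using x xc y
      by (intro conjI bexI[of _ y] bexI[of _ "\<one>\<^bsub>Z (n - 1)\<^esub>"]) (auto simp: Z.G.m_assoc)
    then show "\<xi> \<in> connecting n ` carrier (cohomology Z dZ n)"
      unfolding Z.cohomology_carrier using connecting_cls[OF z] z x by auto
  next
    fix \<xi> assume "\<xi> \<in> connecting n ` carrier (cohomology Z dZ n)"
    then obtain z where z: "z \<in> Z.cocycles n" "\<xi> = connecting n (Z.cls n z)" by (auto simp: Z.cohomology_carrier)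
    then obtain x where x: "x \<in> X.cocycles (n + 1)" "zigzag n z x" "\<xi> = X.cls (n + 1) x" using cn by metis
    obtain y where "y \<in> carrier (Y n)" "\<alpha> (n + 1) x = dY n y" using x by (auto simp: zigzag_def)
    then have "Y.cls (n + 1) (\<alpha> (n + 1) x) = \<one>\<^bsub>cohomology Y dY (n + 1)\<^esub>"
      by (subst Y.cls_eq_one_iff[OF \<alpha>_cocycle[OF x(1)]]) auto
    then show "\<xi> \<in> kernel (cohomology X dX (n + 1)) (cohomology Y dY (n + 1)) (\<alpha>H (n + 1))"
      using x \<alpha>H[OF x(1)] by (auto simp: kernel_def X.cohomology_carrier)
  qed
  show ?thesis
    unfolding long_exact_sequence_def
    using gX gY gZ h\<alpha> h\<beta> h\<delta> eY eZ eX by (auto simp: group_hom_def group_hom_axioms_def)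
qed

end

section \<open>Existence of coresolutions\<close>

context abelian_category
begin

lemma kernel_comp_mono:
  assumes "is_kernel C k e" "is_mono C m" "Dom C m = Cod C e" shows "is_kernel C k (m \<bullet> e)"
proof (rule kernelI[OF kernel_mono[OF assms(1)]])
  note s = kernel_simps[OF assms(1)] mono_arr[OF assms(2)]
  show "m \<bullet> e \<in> Arr C" "Cod C k = Dom C (m \<bullet> e)" "(m \<bullet> e) \<bullet> k = \<zero> (Dom C k) (Cod C (m \<bullet> e))" using s assms by auto
  fix h assume h: "h \<in> Arr C" "Cod C h = Dom C (m \<bullet> e)" "(m \<bullet> e) \<bullet> h = \<zero> (Dom C h) (Cod C (m \<bullet> e))"
  have "e \<bullet> h = \<zero> (Dom C h) (Cod C e)" using mono_zero[OF assms(2), of "e \<bullet> h"] h s assms by simp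
  then show "\<exists>u\<in>homs C (Dom C h) (Dom C k). k \<bullet> u = h" using kernel_ex[OF assms(1), of h] h s assms by simp
qed

lemma cokernel_comp_epi:
  assumes "is_cokernel C c m" "is_epi C e" "Cod C e = Dom C m" shows "is_cokernel C c (m \<bullet> e)"
  using abelian_category.kernel_comp_mono[OF op_abelian, of c m e] assms by simp

lemma exact_splice:
  assumes "short_exact C k e" "is_epi C e'" "Cod C e' = Dom C k" "is_mono C k'" "Dom C k' = Cod C e"
  shows "exact_at C (k \<bullet> e') (k' \<bullet> e)"
  unfolding exact_at_iff using kernel_comp_mono[OF short_exact_simps(7)[OF assms(1)] assms(4,5)] assms(2,3)
  by blast

lemma exact_splice_right:
  assumes "short_exact C k e" "is_epi C e'" "Cod C e' = Dom C k"
  shows "exact_at C (k \<bullet> e') e"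
  unfolding exact_at_iff using short_exact_simps(7)[OF assms(1)] assms(2,3) by blast

lemma exact_splice_left:
  assumes "short_exact C k e" "is_mono C k'" "Dom C k' = Cod C e"
  shows "exact_at C k (k' \<bullet> e)"
  by (rule kernel_exact[OF kernel_comp_mono[OF short_exact_simps(7)[OF assms(1)] assms(2,3)]])

end

context model_structure
begin

text \<open>Completeness is iterated on the successive kernels. Each stage of the recursion stores
  an object together with a short exact sequence that ends in it; the next object is the
  kernel.\<close>

lemma left_syzygies:
  assumes "B \<in> Ob C"
  obtains Z k e where "Z 0 = B" "\<And>n. short_exact C (k n) (e n)" "\<And>n. Dom C (k n) = Z (Suc n)" "\<And>n. Cod C (e n) = Z n"
    "\<And>n. Dom C (e n) \<in> Q \<inter> W" "\<And>n. Z (Suc n) \<in> R"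
proof -
  let ?P = "\<lambda>n (Z, k, e). (n = (0::nat) \<longrightarrow> Z = B) \<and> short_exact C k e \<and> Cod C e = Z \<and> Dom C e \<in> Q \<inter> W \<and> Dom C k \<in> R"
  have ex: "\<exists>k e. short_exact C k e \<and> Cod C e = A \<and> Dom C e \<in> Q \<inter> W \<and> Dom C k \<in> R" if "A \<in> Ob C" for A
    using model_facts(7) that unfolding complete_pair_def by blast
  have "\<exists>t. \<forall>n. ?P n (t n) \<and> fst (t (Suc n)) = Dom C (fst (snd (t n)))"
  proof (rule dependent_nat_choice)
    show "\<exists>x. ?P 0 x" using ex[OF assms] by auto
    fix x n assume "?P n x"
    then have "Dom C (fst (snd x)) \<in> Ob C" by auto
    from ex[OF this] show "\<exists>y. ?P (Suc n) y \<and> fst y = Dom C (fst (snd x))" by auto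
  qed
  then obtain t where "\<forall>n. ?P n (t n) \<and> fst (t (Suc n)) = Dom C (fst (snd (t n)))" ..
  then have t: "?P n (t n)" "fst (t (Suc n)) = Dom C (fst (snd (t n)))" for n by simp_all
  show thesis
  proof (rule that[of "\<lambda>n. fst (t n)" "\<lambda>n. fst (snd (t n))" "\<lambda>n. snd (snd (t n))"])
    fix n
    show "fst (t 0) = B" using t(1)[of 0] by (auto simp: case_prod_beta)
    show "short_exact C (fst (snd (t n))) (snd (snd (t n)))" "Dom C (snd (snd (t n))) \<in> Q \<inter> W" "Cod C (snd (snd (t n))) = fst (t n)"
      using t(1)[of n] by (auto simp: case_prod_beta)
    show "Dom C (fst (snd (t n))) = fst (t (Suc n))" using t(2) by simp
    show "fst (t (Suc n)) \<in> R" unfolding t(2) using t(1)[of n] by (auto simp: case_prod_beta)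
  qed
qed

lemma right_syzygies:
  assumes "B \<in> Ob C"
  obtains Z k e where "Z 0 = B" "\<And>n. short_exact C (k n) (e n)" "\<And>n. Dom C (k n) = Z n" "\<And>n. Cod C (e n) = Z (Suc n)"
    "\<And>n. Cod C (k n) \<in> W \<inter> R" "\<And>n. Z (Suc n) \<in> Q"
proof -
  let ?P = "\<lambda>n (Z, k, e). (n = (0::nat) \<longrightarrow> Z = B) \<and> short_exact C k e \<and> Dom C k = Z \<and> Cod C k \<in> W \<inter> R \<and> Cod C e \<in> Q"
  have ex: "\<exists>k e. short_exact C k e \<and> Dom C k = A \<and> Cod C k \<in> W \<inter> R \<and> Cod C e \<in> Q" if "A \<in> Ob C" for A
    using model_facts(6) that unfolding complete_pair_def by blast
  have "\<exists>t. \<forall>n. ?P n (t n) \<and> fst (t (Suc n)) = Cod C (snd (snd (t n)))"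
  proof (rule dependent_nat_choice)
    show "\<exists>x. ?P 0 x" using ex[OF assms] by auto
    fix x n assume "?P n x"
    then have "Cod C (snd (snd x)) \<in> Ob C" by auto
    from ex[OF this] show "\<exists>y. ?P (Suc n) y \<and> fst y = Cod C (snd (snd x))" by auto
  qed
  then obtain t where "\<forall>n. ?P n (t n) \<and> fst (t (Suc n)) = Cod C (snd (snd (t n)))" ..
  then have t: "?P n (t n)" "fst (t (Suc n)) = Cod C (snd (snd (t n)))" for n by simp_all
  show thesis
  proof (rule that[of "\<lambda>n. fst (t n)" "\<lambda>n. fst (snd (t n))" "\<lambda>n. snd (snd (t n))"])
    fix n
    show "fst (t 0) = B" using t(1)[of 0] by (auto simp: case_prod_beta)
    show "short_exact C (fst (snd (t n))) (snd (snd (t n)))" "Cod C (fst (snd (t n))) \<in> W \<inter> R" "Dom C (fst (snd (t n))) = fst (t n)"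
      using t(1)[of n] by (auto simp: case_prod_beta)
    show "Cod C (snd (snd (t n))) = fst (t (Suc n))" using t(2) by simp
    show "fst (t (Suc n)) \<in> Q" unfolding t(2) using t(1)[of n] by (auto simp: case_prod_beta)
  qed
qed

lemma coresolution_ex:
  assumes "B \<in> Ob C" shows "\<exists>K. coresolution B K"
proof -
  obtain Z k e where Z: "Z 0 = B" "\<And>n. short_exact C (k n) (e n)" "\<And>n. Dom C (k n) = Z (Suc n)" "\<And>n. Cod C (e n) = Z n"
    "\<And>n. Dom C (e n) \<in> Q \<inter> W" "\<And>n. Z (Suc n) \<in> R" using left_syzygies[OF assms] by blast
  obtain Y j q where Y: "Y 0 = B" "\<And>n. short_exact C (j n) (q n)" "\<And>n. Dom C (j n) = Y n" "\<And>n. Cod C (q n) = Y (Suc n)"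
    "\<And>n. Cod C (j n) \<in> W \<inter> R" "\<And>n. Y (Suc n) \<in> Q" using right_syzygies[OF assms] by blast
  note sZ = short_exact_simps[OF Z(2)] and sY = short_exact_simps[OF Y(2)]
  \<comment> \<open>The two families of short exact sequences are spliced: below degree
    \<open>-1\<close> through the syzygies \<open>Z\<close>, from degree 0 on through the cosyzygies
    \<open>Y\<close>, and in degree \<open>-1\<close> through \<open>B\<close> itself.\<close>
  define K where "K = \<lparr>obj = (\<lambda>i. if i < 0 then Dom C (e (nat (-1 - i))) else Cod C (j (nat i))),
    diff = (\<lambda>i. if i < -1 then k (nat (-2 - i)) \<bullet> e (nat (-1 - i)) else if i = -1 then j 0 \<bullet> e 0 else j (Suc (nat i)) \<bullet> q (nat i)),
    aug = e 0, coaug = j 0\<rparr>"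
  have o: "obj K (-1 - int n) = Dom C (e n)" "obj K (int n) = Cod C (j n)" for n by (auto simp: K_def)
  have o': "obj K (-1) = Dom C (e 0)" "obj K 0 = Cod C (j 0)" by (auto simp: K_def)
  have d: "diff K (-2 - int n) = k n \<bullet> e (Suc n)" "diff K (int n) = j (Suc n) \<bullet> q n" for n by (auto simp: K_def nat_add_distrib)
  have d': "diff K (-1) = j 0 \<bullet> e 0" "diff K 0 = j 1 \<bullet> q 0" "diff K (-2) = k 0 \<bullet> e 1" by (auto simp: K_def)
  have ac: "aug K = e 0" "coaug K = j 0" by (auto simp: K_def)
  have ex: "exact_at C (diff K i) (diff K (i + 1))" for i
  proof (cases i rule: int_split3)
    case (1 n)
    show ?thesis
    proof (cases n)
      case 0
      then show ?thesis using 1 exact_splice[OF Z(2)[of 0], of "e 1" "j 0"] Z(1,3,4) Y(1,3) sZ(6) sY(5) by (simp add: d')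
    next
      case (Suc m)
      then have "i + 1 = -2 - int m" using 1 by simp
      then have "diff K (i + 1) = k m \<bullet> e (Suc m)" using d(1)[of m] by metis
      moreover have "diff K i = k n \<bullet> e (Suc n)" using d(1)[of n] 1 by metis
      ultimately show ?thesis using exact_splice[OF Z(2)[of n], of "e (Suc n)" "k m"] Z(3,4) sZ(5,6) Suc by simp
    qed
  next
    case 2
    then show ?thesis using exact_splice[OF Y(2)[of 0], of "e 0" "j 1"] Z(1,4) Y(1,3,4) sZ(6) sY(5) by (simp add: d')
  next
    case (3 n)
    then have "i + 1 = int (Suc n)" by simp
    then have "diff K (i + 1) = j (Suc (Suc n)) \<bullet> q (Suc n)" using d(2)[of "Suc n"] by metis
    moreover have "diff K i = j (Suc n) \<bullet> q n" using d(2)[of n] 3 by metis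
    ultimately show ?thesis using exact_splice[OF Y(2)[of "Suc n"], of "q n" "j (Suc (Suc n))"] Y(3,4) sY(5,6) by simp
  qed
  have ty: "diff K i \<in> homs C (obj K i) (obj K (i + 1))" for i
  proof (cases i rule: int_split3)
    case (1 n)
    have e: "i + 1 = -1 - int n" "i = -1 - int (Suc n)" using 1 by auto
    have "obj K i = Dom C (e (Suc n))" "obj K (i + 1) = Dom C (e n)" using o(1)[of "Suc n"] o(1)[of n] e by metis+
    moreover have "diff K i = k n \<bullet> e (Suc n)" using d(1)[of n] 1 by simp
    ultimately show ?thesis using sZ[of n] sZ[of "Suc n"] Z(3,4) by simp
  next
    case 2
    then show ?thesis using sZ[of 0] sY[of 0] Z(1,4) Y(1,3) by (simp add: d' o')
  next
    case (3 n)
    have "i + 1 = int (Suc n)" using 3 by simp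
    then have "obj K i = Cod C (j n)" "obj K (i + 1) = Cod C (j (Suc n))" using o(2)[of "Suc n"] o(2)[of n] 3 by metis+
    moreover have "diff K i = j (Suc n) \<bullet> q n" using d(2)[of n] 3 by simp
    ultimately show ?thesis using sY[of n] sY[of "Suc n"] Y(3,4) by simp
  qed
  have kd: "kernel_in C (diff K i) R" if "i \<le> -2" for i
  proof -
    have n: "i = -2 - int (nat (-2 - i))" (is "i = -2 - int ?n") using that by simp
    have "is_kernel C (k (Suc ?n)) (k ?n \<bullet> e (Suc ?n))" by (rule kernel_comp_mono) (use sZ Z(3,4) in auto)
    then have "is_kernel C (k (Suc ?n)) (diff K i)" using d(1)[of ?n] n by metis
    then show ?thesis unfolding kernel_in_def using Z(3,6) by auto
  qed
  have cd: "cokernel_in C (diff K i) Q" if i0: "i \<ge> 0" for i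
  proof -
    obtain n where n: "i = int n" using i0 by (rule nonneg_eq_int)
    have "is_cokernel C (q (Suc n)) (j (Suc n) \<bullet> q n)" by (rule cokernel_comp_epi) (use sY Y(3,4) in auto)
    then show ?thesis unfolding cokernel_in_def n d using Y(4,6) by auto
  qed
  have "coresolution B K"
    unfolding model_coresolution_def
  proof (intro conjI allI impI)
    show "aug K \<in> homs C (obj K (- 1)) B" "coaug K \<in> homs C B (obj K 0)" "diff K (- 1) = coaug K \<bullet> aug K"
      using sZ[of 0] sY[of 0] Z(1,4) Y(1,3) by (auto simp: ac o' d')
    show "exact_at C (diff K (- 2)) (aug K)" unfolding d' ac
      by (rule exact_splice_right[OF Z(2)]) (use sZ(6) Z(3,4) in auto)
    show "exact_at C (coaug K) (diff K 0)" unfolding d' ac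
      by (rule exact_splice_left[OF Y(2)]) (use sY(5) Y(3,4) in auto)
    show "is_epi C (aug K)" "is_mono C (coaug K)" using sZ sY by (auto simp: ac)
    show "kernel_in C (aug K) R" unfolding kernel_in_def ac using sZ(7)[of 0] Z(3,6) by auto
    show "cokernel_in C (coaug K) Q" unfolding cokernel_in_def ac using sY(8)[of 0] Y(4,6) by auto
    show "obj K i \<in> Q \<inter> W" if "i \<le> -1" for i using that Z(5) by (auto simp: K_def)
    show "obj K i \<in> W \<inter> R" if "0 \<le> i" for i using that Y(5) by (auto simp: K_def)
  qed (fact ty ex kd cd | rule ex)+
  then show ?thesis by blast
qed

lemma coresolution_choice_ex: "\<exists>K. coresolution_choice C Q W R K"
  unfolding coresolution_choice_def using coresolution_ex by (meson bchoice)

end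

section \<open>The action of morphisms on \<open>rExt\<close>\<close>

context model_structure
begin

abbreviation Hom_cpx where "Hom_cpx A L \<equiv> hom_complex_obj C A L"
abbreviation Hom_diff where "Hom_diff L \<equiv> hom_complex_diff C L"

lemma hom_cochain_complex:
  assumes L: "coresolution B L" and A: "A \<in> Ob C"
  shows "cochain_complex (Hom_cpx A L) (Hom_diff L)"
proof (rule cochain_complex.intro)
  note s = coresolution_arr[OF L]
  show "comm_group (Hom_cpx A L n)" for n unfolding hom_complex_obj_def by (rule hom_comm_group) (use s A in auto)
  show "Hom_diff L n \<in> hom (Hom_cpx A L n) (Hom_cpx A L (n + 1))" for n
    unfolding hom_complex_obj_def hom_complex_diff_def hom_def using s by auto
  show "Hom_diff L (n + 1) (Hom_diff L n x) = \<one>\<^bsub>Hom_cpx A L (n + 1 + 1)\<^esub>" if "x \<in> carrier (Hom_cpx A L n)" for x n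
  proof -
    have "diff L (n + 1) \<bullet> (diff L n \<bullet> x) = \<zero> (obj L n) (obj L (n + 1 + 1)) \<bullet> x"
      by (rule comp_reduce) (use s that in \<open>auto simp: hom_complex_obj_def\<close>)
    then show ?thesis using that s(10) by (auto simp: hom_complex_obj_def hom_complex_diff_def)
  qed
qed

definition hom_cocycles where
  "hom_cocycles A L n = {z \<in> homs C A (obj L n). diff L n \<bullet> z = \<zero> A (obj L (n + 1))}"
definition hom_class where "hom_class A L n z = cochain_complex.cls (Hom_cpx A L) (Hom_diff L) n z"

lemma hom_cocycles_eq:
  assumes "coresolution B L" "A \<in> Ob C"
  shows "cochain_complex.cocycles (Hom_cpx A L) (Hom_diff L) n = hom_cocycles A L n"
  unfolding cochain_complex.cocycles_def[OF hom_cochain_complex[OF assms]] hom_cocycles_def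
  by (simp add: hom_complex_obj_def hom_complex_diff_def)

lemma hom_class_eq_iff:
  assumes "coresolution B L" "A \<in> Ob C" "z \<in> hom_cocycles A L n" "z' \<in> hom_cocycles A L n"
  shows "hom_class A L n z = hom_class A L n z' \<longleftrightarrow> (\<exists>w\<in>homs C A (obj L (n - 1)). z = diff L (n - 1) \<bullet> w \<uplus> z')"
  using cochain_complex.cls_eq_iff[OF hom_cochain_complex[OF assms(1,2)], of z n z'] assms(3,4)
  unfolding hom_cocycles_eq[OF assms(1,2)] hom_class_def by (simp add: hom_complex_obj_def hom_complex_diff_def)

lemma cohomology_hom_facts:
  assumes "coresolution B L" "A \<in> Ob C"
  shows "comm_group (cohomology (Hom_cpx A L) (Hom_diff L) n)"
    "carrier (cohomology (Hom_cpx A L) (Hom_diff L) n) = hom_class A L n ` hom_cocycles A L n"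
    "\<lbrakk>z \<in> hom_cocycles A L n; z' \<in> hom_cocycles A L n\<rbrakk> \<Longrightarrow>
      hom_class A L n z \<otimes>\<^bsub>cohomology (Hom_cpx A L) (Hom_diff L) n\<^esub> hom_class A L n z' = hom_class A L n (z \<uplus> z')"
  using cochain_complex.cohomology_comm_group[OF hom_cochain_complex[OF assms]]
    cochain_complex.cohomology_carrier[OF hom_cochain_complex[OF assms], of n]
    cochain_complex.cls_mult[OF hom_cochain_complex[OF assms], of z n z']
  unfolding hom_cocycles_eq[OF assms] hom_class_def by (auto simp: hom_complex_obj_def)

lemma extends_toD:
  assumes "extends_to C L L' g \<phi>"
  shows "\<phi> i \<in> homs C (obj L i) (obj L' i)" "\<phi> (i + 1) \<bullet> diff L i = diff L' i \<bullet> \<phi> i"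
    "aug L' \<bullet> \<phi> (-1) = g \<bullet> aug L" "\<phi> 0 \<bullet> coaug L = coaug L' \<bullet> g"
  using assms by (auto simp: extends_to_def)

lemma extends_cocycle:
  assumes "coresolution B L" "coresolution B' L'" and \<phi>: "extends_to C L L' g \<phi>" and z: "z \<in> hom_cocycles A L n"
  shows "\<phi> n \<bullet> z \<in> hom_cocycles A L' n"
proof -
  note s = coresolution_arr[OF assms(1)] coresolution_arr[OF assms(2)] and p = extends_toD[OF \<phi>]
  have z': "z \<in> Arr C" "Dom C z = A" "Cod C z = obj L n" "diff L n \<bullet> z = \<zero> A (obj L (n + 1))" "A \<in> Ob C"
    using z by (auto simp: hom_cocycles_def)
  have "diff L' n \<bullet> (\<phi> n \<bullet> z) = (\<phi> (n + 1) \<bullet> diff L n) \<bullet> z"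
    by (rule comp_reduce[OF p(2)[symmetric]]) (use p(1) s z' in auto)
  also have "\<dots> = \<zero> A (obj L' (n + 1))" using p(1)[of "n + 1"] s z' by simp
  finally show ?thesis using p(1)[of n] z' s by (simp add: hom_cocycles_def)
qed

lemma extends_to_Id: "coresolution B L \<Longrightarrow> extends_to C L L (Id C B) (\<lambda>i. Id C (obj L i))"
  using coresolution_arr[of B L] unfolding extends_to_def by simp

lemma extends_to_comp:
  assumes L: "coresolution B L" "coresolution B' L'" "coresolution B'' L''"
    and g: "g \<in> homs C B B'" "g' \<in> homs C B' B''" and \<phi>: "extends_to C L L' g \<phi>" "extends_to C L' L'' g' \<phi>'"
  shows "extends_to C L L'' (g' \<bullet> g) (\<lambda>i. \<phi>' i \<bullet> \<phi> i)"
proof -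
  note s = coresolution_arr[OF L(1)] coresolution_arr[OF L(2)] coresolution_arr[OF L(3)] and p = extends_toD[OF \<phi>(1)] extends_toD[OF \<phi>(2)]
  show ?thesis unfolding extends_to_def
  proof (intro conjI allI)
    show "\<phi>' i \<bullet> \<phi> i \<in> homs C (obj L i) (obj L'' i)" for i using p(1)[of i] p(5)[of i] by auto
    show "(\<phi>' (i + 1) \<bullet> \<phi> (i + 1)) \<bullet> diff L i = diff L'' i \<bullet> (\<phi>' i \<bullet> \<phi> i)" for i
    proof -
      have "(\<phi>' (i + 1) \<bullet> \<phi> (i + 1)) \<bullet> diff L i = \<phi>' (i + 1) \<bullet> (\<phi> (i + 1) \<bullet> diff L i)" using p(1)[of "i + 1"] p(5)[of "i + 1"] s by simp
      also have "\<dots> = (\<phi>' (i + 1) \<bullet> diff L' i) \<bullet> \<phi> i" unfolding p(2) using p(1)[of i] p(5)[of "i + 1"] s by simp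
      also have "\<dots> = diff L'' i \<bullet> (\<phi>' i \<bullet> \<phi> i)" unfolding p(6) using p(1)[of i] p(5)[of "i"] s by simp
      finally show ?thesis .
    qed
    have "aug L'' \<bullet> (\<phi>' (-1) \<bullet> \<phi> (-1)) = (g' \<bullet> aug L') \<bullet> \<phi> (-1)"
      by (rule comp_reduce[OF p(7)]) (use p(1)[of "-1"] p(5)[of "-1"] s in auto)
    also have "\<dots> = g' \<bullet> (aug L' \<bullet> \<phi> (-1))" using p(1)[of "-1"] s g by simp
    also have "\<dots> = (g' \<bullet> g) \<bullet> aug L" unfolding p(3) using s g by simp
    finally show "aug L'' \<bullet> (\<phi>' (-1) \<bullet> \<phi> (-1)) = (g' \<bullet> g) \<bullet> aug L" .
    have "(\<phi>' 0 \<bullet> \<phi> 0) \<bullet> coaug L = \<phi>' 0 \<bullet> (\<phi> 0 \<bullet> coaug L)" using p(1)[of 0] p(5)[of 0] s by simp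
    also have "\<dots> = (\<phi>' 0 \<bullet> coaug L') \<bullet> g" unfolding p(4) using p(5)[of 0] s g by simp
    also have "\<dots> = coaug L'' \<bullet> (g' \<bullet> g)" unfolding p(8) using s g by simp
    finally show "(\<phi>' 0 \<bullet> \<phi> 0) \<bullet> coaug L = coaug L'' \<bullet> (g' \<bullet> g)" .
  qed
qed

lemma extends_to_add:
  assumes L: "coresolution B L" "coresolution B' L'"
    and g: "g \<in> homs C B B'" "g' \<in> homs C B B'" and \<phi>: "extends_to C L L' g \<phi>" "extends_to C L L' g' \<phi>'"
  shows "extends_to C L L' (g \<uplus> g') (\<lambda>i. \<phi> i \<uplus> \<phi>' i)" "extends_to C L L' (g \<setminus> g') (\<lambda>i. \<phi> i \<setminus> \<phi>' i)"
proof -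
  note s = coresolution_arr[OF L(1)] coresolution_arr[OF L(2)] and p = extends_toD[OF \<phi>(1)] extends_toD[OF \<phi>(2)]
  have p': "\<phi> i \<in> Arr C" "Dom C (\<phi> i) = obj L i" "Cod C (\<phi> i) = obj L' i" "\<phi>' i \<in> Arr C" "Dom C (\<phi>' i) = obj L i" "Cod C (\<phi>' i) = obj L' i" for i
    using p(1)[of i] p(5)[of i] by auto
  show "extends_to C L L' (g \<uplus> g') (\<lambda>i. \<phi> i \<uplus> \<phi>' i)" "extends_to C L L' (g \<setminus> g') (\<lambda>i. \<phi> i \<setminus> \<phi>' i)"
    unfolding extends_to_def using p' p(2-4,6-8) s g by auto
qed

text \<open>The difference of the two cochain maps extends zero and is null-homotopic. On a cocycle
  the term of the homotopy that begins with the differential vanishes, and the other term is a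
  coboundary.\<close>

lemma extends_class_unique:
  assumes L: "coresolution B L" "coresolution B' L'" and A: "A \<in> Ob C" and g: "g \<in> homs C B B'"
    and \<phi>: "extends_to C L L' g \<phi>" "extends_to C L L' g \<phi>'" and z: "z \<in> hom_cocycles A L n"
  shows "hom_class A L' n (\<phi> n \<bullet> z) = hom_class A L' n (\<phi>' n \<bullet> z)"
proof -
  note s = coresolution_arr[OF L(1)] coresolution_arr[OF L(2)] and p = extends_toD[OF \<phi>(1)] extends_toD[OF \<phi>(2)]
  have "extends_to C L L' (\<zero> B B') (\<lambda>i. \<phi> i \<setminus> \<phi>' i)"
    using extends_to_add(2)[OF L g g \<phi>] g by auto
  from null_homotopy[OF L this] obtain t where t: "\<forall>i. t i \<in> homs C (obj L i) (obj L' (i - 1))"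
    "\<forall>i. \<phi> i \<setminus> \<phi>' i = diff L' (i - 1) \<bullet> t i \<uplus> t (i + 1) \<bullet> diff L i" by blast
  have z': "z \<in> Arr C" "Dom C z = A" "Cod C z = obj L n" "diff L n \<bullet> z = \<zero> A (obj L (n + 1))"
    using z by (auto simp: hom_cocycles_def)
  have "t (n + 1) \<bullet> (diff L n \<bullet> z) = \<zero> A (obj L' n)" unfolding z' using t(1)[rule_format, of "n + 1"] A by simp
  then have "(\<phi> n \<setminus> \<phi>' n) \<bullet> z = diff L' (n - 1) \<bullet> (t n \<bullet> z)"
    unfolding t(2)[rule_format] using t(1)[rule_format, of "n + 1"] t(1)[rule_format, of n] z' s A by simp
  then have "\<phi> n \<bullet> z = diff L' (n - 1) \<bullet> (t n \<bullet> z) \<uplus> \<phi>' n \<bullet> z"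
    using p(1)[of n] p(5)[of n] z' s t(1)[rule_format, of n] by (simp add: minus_eq_iff)
  then show ?thesis
    using t(1)[rule_format, of n] z'
    by (subst hom_class_eq_iff[OF L(2) A extends_cocycle[OF L \<phi>(1) z] extends_cocycle[OF L \<phi>(2) z]]) auto
qed

lemma class_of_cochain_map:
  assumes L: "coresolution B L" "coresolution B' L'" and A: "A \<in> Ob C" and \<phi>: "extends_to C L L' g \<phi>" and z: "z \<in> hom_cocycles A L n"
  shows "cohomology_map (Hom_cpx A L') (Hom_diff L') (\<lambda>i x. \<phi> i \<bullet> x) n (hom_class A L n z) = hom_class A L' n (\<phi> n \<bullet> z)"
  unfolding hom_class_def
proof (rule cohomology_map_cls[OF hom_cochain_complex[OF L(2) A] hom_cochain_complex[OF L(1) A]])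
  note s = coresolution_arr[OF L(1)] coresolution_arr[OF L(2)] and p = extends_toD[OF \<phi>]
  show "(\<bullet>) (\<phi> n) \<in> hom (Hom_cpx A L n) (Hom_cpx A L' n)"
    unfolding hom_def hom_complex_obj_def using p(1)[of n] by auto
  show "z \<in> carrier (Hom_cpx A L n)" using z by (simp add: hom_complex_obj_def hom_cocycles_def)
  fix y assume "y \<in> carrier (Hom_cpx A L (n - 1))"
  then have y: "y \<in> Arr C" "Dom C y = A" "Cod C y = obj L (n - 1)" by (auto simp: hom_complex_obj_def)
  have "\<phi> n \<bullet> (diff L (n - 1) \<bullet> y) = (diff L' (n - 1) \<bullet> \<phi> (n - 1)) \<bullet> y"
    by (rule comp_reduce) (use p(1)[of n] p(2)[of "n - 1"] s y in auto)
  then have "\<phi> n \<bullet> (diff L (n - 1) \<bullet> y) = diff L' (n - 1) \<bullet> (\<phi> (n - 1) \<bullet> y)" using p(1)[of "n - 1"] s y by simp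
  then show "\<exists>w\<in>carrier (Hom_cpx A L' (n - 1)). \<phi> n \<bullet> Hom_diff L (n - 1) y = Hom_diff L' (n - 1) w"
    using p(1)[of "n - 1"] y by (intro bexI[of _ "\<phi> (n - 1) \<bullet> y"]) (auto simp: hom_complex_obj_def hom_complex_diff_def)
qed

lemma precomp_cocycle:
  assumes L: "coresolution B L" and f: "f \<in> homs C A A'" and z: "z \<in> hom_cocycles A' L n"
  shows "z \<bullet> f \<in> hom_cocycles A L n"
proof -
  note s = coresolution_arr[OF L]
  have "diff L n \<bullet> (z \<bullet> f) = \<zero> A' (obj L (n + 1)) \<bullet> f"
    by (rule comp_reduce) (use z f s in \<open>auto simp: hom_cocycles_def\<close>)
  then show ?thesis using f z s by (auto simp: hom_cocycles_def)
qed

lemma class_of_precomp: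
  assumes L: "coresolution B L" and f: "f \<in> homs C A A'" and z: "z \<in> hom_cocycles A' L n"
  shows "cohomology_map (Hom_cpx A L) (Hom_diff L) (\<lambda>i x. x \<bullet> f) n (hom_class A' L n z) = hom_class A L n (z \<bullet> f)"
  unfolding hom_class_def
proof (rule cohomology_map_cls[OF hom_cochain_complex[OF L homs_Ob(1)[OF f]] hom_cochain_complex[OF L homs_Ob(2)[OF f]]])
  note s = coresolution_arr[OF L]
  show "(\<lambda>x. x \<bullet> f) \<in> hom (Hom_cpx A' L n) (Hom_cpx A L n)"
    unfolding hom_def hom_complex_obj_def using f by auto
  show "z \<in> carrier (Hom_cpx A' L n)" using z by (simp add: hom_complex_obj_def hom_cocycles_def)
  fix y assume "y \<in> carrier (Hom_cpx A' L (n - 1))"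
  then show "\<exists>w\<in>carrier (Hom_cpx A L (n - 1)). Hom_diff L (n - 1) y \<bullet> f = Hom_diff L (n - 1) w"
    using f s by (intro bexI[of _ "y \<bullet> f"]) (auto simp: hom_complex_obj_def hom_complex_diff_def)
qed

end

locale chosen_coresolutions = model_structure +
  fixes K :: "'a \<Rightarrow> ('a, 'b) coresolution"
  assumes choice: "coresolution_choice C Q W R K"
begin

lemma K: "B \<in> Ob C \<Longrightarrow> coresolution B (K B)"
  using choice by (simp add: coresolution_choice_def)

abbreviation cl where "cl A B n z \<equiv> hom_class A (K B) n z"
abbreviation cocyc where "cocyc A B n \<equiv> hom_cocycles A (K B) n"

lemma rExt_facts:
  assumes "A \<in> Ob C" "B \<in> Ob C"
  shows "comm_group (rExt C K n A B)" "carrier (rExt C K n A B) = cl A B n ` cocyc A B n"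
    "\<lbrakk>z \<in> cocyc A B n; z' \<in> cocyc A B n\<rbrakk> \<Longrightarrow> cl A B n z \<otimes>\<^bsub>rExt C K n A B\<^esub> cl A B n z' = cl A B n (z \<uplus> z')"
  unfolding rExt_def using cohomology_hom_facts[OF K[OF assms(2)] assms(1)] by auto

text \<open>Replaces the arbitrarily chosen cochain map in \<open>rExt_cov\<close> by whichever
  extension of \<open>g\<close> is convenient. All later computations with the covariant action rest
  on this.\<close>

lemma rExt_cov_class:
  assumes A: "A \<in> Ob C" and g: "g \<in> homs C B B'" and \<phi>: "extends_to C (K B) (K B') g \<phi>" and z: "z \<in> cocyc A B n"
  shows "rExt_cov C K n A g (cl A B n z) = cl A B' n (\<phi> n \<bullet> z)"
proof -
  note L = K[OF homs_Ob(1)[OF g]] K[OF homs_Ob(2)[OF g]]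
  define \<phi>' where "\<phi>' = (SOME \<phi>. extends_to C (K B) (K B') g \<phi>)"
  have \<phi>': "extends_to C (K B) (K B') g \<phi>'" unfolding \<phi>'_def by (rule someI[of _ \<phi>]) (rule \<phi>)
  have D: "Dom C g = B" "Cod C g = B'" using g by auto
  have "rExt_cov C K n A g (cl A B n z) = cl A B' n (\<phi>' n \<bullet> z)"
    unfolding rExt_cov_def Let_def D \<phi>'_def[symmetric] by (rule class_of_cochain_map[OF L A \<phi>' z])
  also have "\<dots> = cl A B' n (\<phi> n \<bullet> z)" by (rule extends_class_unique[OF L A g \<phi>' \<phi> z])
  finally show ?thesis .
qed

lemma rExt_con_class:
  assumes B: "B \<in> Ob C" and f: "f \<in> homs C A A'" and z: "z \<in> cocyc A' B n"
  shows "rExt_con C K n f B (cl A' B n z) = cl A B n (z \<bullet> f)"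
proof -
  have "Dom C f = A" using f by auto
  then show ?thesis unfolding rExt_con_def using class_of_precomp[OF K[OF B] f z] by simp
qed

lemma cocycle_simps:
  assumes "z \<in> cocyc A B n"
  shows "z \<in> Arr C" "Dom C z = A" "Cod C z = obj (K B) n" "diff (K B) n \<bullet> z = \<zero> A (obj (K B) (n + 1))"
  using assms by (auto simp: hom_cocycles_def)

lemma cocyc_add:
  assumes "B \<in> Ob C" "z \<in> cocyc A B n" "z' \<in> cocyc A B n" shows "z \<uplus> z' \<in> cocyc A B n"
  using cocycle_simps[OF assms(2)] cocycle_simps[OF assms(3)] coresolution_arr[OF K[OF assms(1)]]
    homs_Ob(1)[of z A "obj (K B) n"]
  by (simp add: hom_cocycles_def)

lemma chain_map_ex: "g \<in> homs C B B' \<Longrightarrow> \<exists>\<phi>. extends_to C (K B) (K B') g \<phi>"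
  by (rule extends_to_ex[OF K K]) (auto simp: homs_Ob)

lemma rExt_cov_functor:
  assumes A: "A \<in> Ob C" shows "additive_functor C (\<lambda>B. rExt C K n A B) (\<lambda>g. rExt_cov C K n A g)"
  unfolding additive_functor_def
proof (intro conjI ballI impI)
  show "comm_group (rExt C K n A B)" if "B \<in> Ob C" for B using rExt_facts that A by auto
  show "rExt_cov C K n A g \<in> hom (rExt C K n A (Dom C g)) (rExt C K n A (Cod C g))" if g: "g \<in> Arr C" for g
  proof -
    have gh: "g \<in> homs C (Dom C g) (Cod C g)" and o: "Dom C g \<in> Ob C" "Cod C g \<in> Ob C" using g by auto
    obtain \<phi> where \<phi>: "extends_to C (K (Dom C g)) (K (Cod C g)) g \<phi>" using chain_map_ex[OF gh] by auto
    have cc: "\<phi> n \<bullet> z \<in> cocyc A (Cod C g) n" if "z \<in> cocyc A (Dom C g) n" for z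
      by (rule extends_cocycle[OF K[OF o(1)] K[OF o(2)] \<phi> that])
    have ad: "\<phi> n \<bullet> (z \<uplus> z') = \<phi> n \<bullet> z \<uplus> \<phi> n \<bullet> z'" if "z \<in> cocyc A (Dom C g) n" "z' \<in> cocyc A (Dom C g) n" for z z'
      using cocycle_simps[OF that(1)] cocycle_simps[OF that(2)] extends_toD(1)[OF \<phi>, of n] by simp
    show ?thesis
      unfolding hom_def rExt_facts(2)[OF A o(1)] rExt_facts(2)[OF A o(2)]
      using cocyc_add[OF o(1)] cc
      by (auto simp: rExt_cov_class[OF A gh \<phi>] rExt_facts(3)[OF A o(1)] rExt_facts(3)[OF A o(2)] ad)
  qed
  show "rExt_cov C K n A (Id C B) x = x" if B: "B \<in> Ob C" and x: "x \<in> carrier (rExt C K n A B)" for B x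
  proof -
    obtain z where z: "z \<in> cocyc A B n" "x = cl A B n z" using x rExt_facts(2)[OF A B] by auto
    show ?thesis using rExt_cov_class[OF A _ extends_to_Id[OF K[OF B]] z(1)] z B cocycle_simps[OF z(1)] by simp
  qed
  show "rExt_cov C K n A (g \<bullet> f) x = rExt_cov C K n A g (rExt_cov C K n A f x)"
    if fg: "f \<in> Arr C" "g \<in> Arr C" "Cod C f = Dom C g" and x: "x \<in> carrier (rExt C K n A (Dom C f))" for f g x
  proof -
    have o: "Dom C f \<in> Ob C" "Dom C g \<in> Ob C" "Cod C g \<in> Ob C" using fg by auto
    have h: "f \<in> homs C (Dom C f) (Dom C g)" "g \<in> homs C (Dom C g) (Cod C g)" "g \<bullet> f \<in> homs C (Dom C f) (Cod C g)" using fg by auto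
    obtain z where z: "z \<in> cocyc A (Dom C f) n" "x = cl A (Dom C f) n z" using x rExt_facts(2)[OF A o(1)] by auto
    obtain \<phi> \<phi>' where \<phi>: "extends_to C (K (Dom C f)) (K (Dom C g)) f \<phi>" "extends_to C (K (Dom C g)) (K (Cod C g)) g \<phi>'"
      using chain_map_ex[OF h(1)] chain_map_ex[OF h(2)] by auto
    note L = K[OF o(1)] K[OF o(2)] K[OF o(3)]
    show ?thesis unfolding z(2) rExt_cov_class[OF A h(1) \<phi>(1) z(1)]
        rExt_cov_class[OF A h(2) \<phi>(2) extends_cocycle[OF L(1,2) \<phi>(1) z(1)]]
        rExt_cov_class[OF A h(3) extends_to_comp[OF L h(1,2) \<phi>] z(1)]
      using cocycle_simps[OF z(1)] extends_toD(1)[OF \<phi>(1), of n] extends_toD(1)[OF \<phi>(2), of n] by simp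
  qed
  show "rExt_cov C K n A (f \<uplus> g) x = rExt_cov C K n A f x \<otimes>\<^bsub>rExt C K n A (Cod C f)\<^esub> rExt_cov C K n A g x"
    if fg: "f \<in> Arr C" "g \<in> Arr C" "Dom C f = Dom C g \<and> Cod C f = Cod C g" and x: "x \<in> carrier (rExt C K n A (Dom C f))" for f g x
  proof -
    have o: "Dom C f \<in> Ob C" "Cod C f \<in> Ob C" using fg by auto
    have h: "f \<in> homs C (Dom C f) (Cod C f)" "g \<in> homs C (Dom C f) (Cod C f)" "f \<uplus> g \<in> homs C (Dom C f) (Cod C f)" using fg by auto
    obtain z where z: "z \<in> cocyc A (Dom C f) n" "x = cl A (Dom C f) n z" using x rExt_facts(2)[OF A o(1)] by auto
    obtain \<phi> \<phi>' where \<phi>: "extends_to C (K (Dom C f)) (K (Cod C f)) f \<phi>" "extends_to C (K (Dom C f)) (K (Cod C f)) g \<phi>'"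
      using chain_map_ex[OF h(1)] chain_map_ex[OF h(2)] by auto
    note L = K[OF o(1)] K[OF o(2)]
    show ?thesis unfolding z(2) rExt_cov_class[OF A h(1) \<phi>(1) z(1)] rExt_cov_class[OF A h(2) \<phi>(2) z(1)]
        rExt_facts(3)[OF A o(2) extends_cocycle[OF L \<phi>(1) z(1)] extends_cocycle[OF L \<phi>(2) z(1)]]
        rExt_cov_class[OF A h(3) extends_to_add(1)[OF L h(1,2) \<phi>] z(1)]
      using cocycle_simps[OF z(1)] extends_toD(1)[OF \<phi>(1), of n] extends_toD(1)[OF \<phi>(2), of n] by simp
  qed
qed

lemma rExt_con_functor:
  assumes B: "B \<in> Ob C" shows "additive_functor (op_category C) (\<lambda>A. rExt C K n A B) (\<lambda>f. rExt_con C K n f B)"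
  unfolding additive_functor_def op_simps
proof (intro conjI ballI impI)
  note F = rExt_facts(2)[OF _ B]
  show "comm_group (rExt C K n A B)" if "A \<in> Ob C" for A using rExt_facts that B by auto
  show "rExt_con C K n f B \<in> hom (rExt C K n (Cod C f) B) (rExt C K n (Dom C f) B)" if f: "f \<in> Arr C" for f
  proof -
    have fh: "f \<in> homs C (Dom C f) (Cod C f)" and o: "Dom C f \<in> Ob C" "Cod C f \<in> Ob C" using f by auto
    have ad: "(z \<uplus> z') \<bullet> f = z \<bullet> f \<uplus> z' \<bullet> f" if "z \<in> cocyc (Cod C f) B n" "z' \<in> cocyc (Cod C f) B n" for z z'
      using cocycle_simps[OF that(1)] cocycle_simps[OF that(2)] f by simp
    show ?thesis
      unfolding hom_def F[OF o(1)] F[OF o(2)]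
      using cocyc_add[OF B, of _ "Cod C f"] precomp_cocycle[OF K[OF B] fh]
      by (auto simp: rExt_con_class[OF B fh] rExt_facts(3)[OF o(1) B] rExt_facts(3)[OF o(2) B] ad)
  qed
  show "rExt_con C K n (Id C A) B x = x" if A: "A \<in> Ob C" and x: "x \<in> carrier (rExt C K n A B)" for A x
  proof -
    obtain z where z: "z \<in> cocyc A B n" "x = cl A B n z" using x F[OF A] by auto
    show ?thesis using rExt_con_class[OF B Id_in[OF A] z(1)] z cocycle_simps[OF z(1)] by simp
  qed
  show "rExt_con C K n (f \<bullet> g) B x = rExt_con C K n g B (rExt_con C K n f B x)"
    if fg: "f \<in> Arr C" "g \<in> Arr C" "Dom C f = Cod C g" and x: "x \<in> carrier (rExt C K n (Cod C f) B)" for f g x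
  proof -
    have h: "f \<in> homs C (Dom C f) (Cod C f)" "g \<in> homs C (Dom C g) (Dom C f)" "f \<bullet> g \<in> homs C (Dom C g) (Cod C f)" using fg by auto
    obtain z where z: "z \<in> cocyc (Cod C f) B n" "x = cl (Cod C f) B n z" using x F fg by auto
    show ?thesis unfolding z(2) rExt_con_class[OF B h(1) z(1)] rExt_con_class[OF B h(3) z(1)]
        rExt_con_class[OF B h(2) precomp_cocycle[OF K[OF B] h(1) z(1)]]
      using cocycle_simps[OF z(1)] fg by simp
  qed
  show "rExt_con C K n (f \<uplus> g) B x = rExt_con C K n f B x \<otimes>\<^bsub>rExt C K n (Dom C f) B\<^esub> rExt_con C K n g B x"
    if fg: "f \<in> Arr C" "g \<in> Arr C" "Cod C f = Cod C g \<and> Dom C f = Dom C g" and x: "x \<in> carrier (rExt C K n (Cod C f) B)" for f g x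
  proof -
    have h: "f \<in> homs C (Dom C f) (Cod C f)" "g \<in> homs C (Dom C f) (Cod C f)" "f \<uplus> g \<in> homs C (Dom C f) (Cod C f)" using fg by auto
    obtain z where z: "z \<in> cocyc (Cod C f) B n" "x = cl (Cod C f) B n z" using x F fg by auto
    have o: "Dom C f \<in> Ob C" using fg by auto
    show ?thesis unfolding z(2) rExt_con_class[OF B h(1) z(1)] rExt_con_class[OF B h(2) z(1)] rExt_con_class[OF B h(3) z(1)]
        rExt_facts(3)[OF o B precomp_cocycle[OF K[OF B] h(1) z(1)] precomp_cocycle[OF K[OF B] h(2) z(1)]]
      using cocycle_simps[OF z(1)] fg by simp
  qed
qed

lemma rExt_bifunctor:
  assumes f: "f \<in> Arr C" and g: "g \<in> Arr C" and x: "x \<in> carrier (rExt C K n (Cod C f) (Dom C g))"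
  shows "rExt_con C K n f (Cod C g) (rExt_cov C K n (Cod C f) g x) = rExt_cov C K n (Dom C f) g (rExt_con C K n f (Dom C g) x)"
proof -
  have o: "Dom C f \<in> Ob C" "Cod C f \<in> Ob C" "Dom C g \<in> Ob C" "Cod C g \<in> Ob C" using f g by auto
  have h: "f \<in> homs C (Dom C f) (Cod C f)" "g \<in> homs C (Dom C g) (Cod C g)" using f g by auto
  obtain \<phi> where \<phi>: "extends_to C (K (Dom C g)) (K (Cod C g)) g \<phi>" using chain_map_ex[OF h(2)] by auto
  obtain z where z: "z \<in> cocyc (Cod C f) (Dom C g) n" "x = cl (Cod C f) (Dom C g) n z" using x rExt_facts(2)[OF o(2,3)] by auto
  show ?thesis unfolding z(2) rExt_cov_class[OF o(2) h(2) \<phi> z(1)] rExt_con_class[OF o(3) h(1) z(1)]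
      rExt_con_class[OF o(4) h(1) extends_cocycle[OF K[OF o(3)] K[OF o(4)] \<phi> z(1)]]
      rExt_cov_class[OF o(1) h(2) \<phi> precomp_cocycle[OF K[OF o(3)] h(1) z(1)]]
    using cocycle_simps[OF z(1)] f extends_toD(1)[OF \<phi>, of n] by simp
qed

end

section \<open>Fibrant coefficients\<close>

context model_structure
begin

text \<open>By exactness \<open>Dom C f\<close> is an extension of the kernel of \<open>g\<close> by
  the kernel of \<open>f\<close>.\<close>

lemma exact_Dom_in_R:
  assumes "exact_at C f g" "kernel_in C f R" "kernel_in C g R" shows "Dom C f \<in> R"
proof -
  obtain m e where *: "is_kernel C m g" "is_epi C e" "Cod C e = Dom C m" "f = m \<bullet> e"
    using assms(1) unfolding exact_at_iff by auto
  note s = kernel_simps[OF *(1)] epi_arr[OF *(2)]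
  obtain k where k: "is_kernel C k e" using kernels s by blast
  have kf: "is_kernel C k f" unfolding *(4) by (rule kernel_comp_mono[OF k kernel_mono[OF *(1)]]) (use * in simp)
  have "Dom C e \<in> R"
    by (rule R_middle[OF short_exactI2[OF *(2) k]])
      (use kernel_unique_in_R[OF kf assms(2)] kernel_unique_in_R[OF *(1) assms(3)] * in auto)
  then show ?thesis using * s by simp
qed

text \<open>By exactness the kernel of \<open>g\<close> is the quotient of \<open>Dom C f\<close> by
  the kernel of \<open>f\<close>, so \<open>R_cokernel\<close> applies.\<close>

lemma exact_kernel_in_R:
  assumes "exact_at C f g" "kernel_in C f R" "Dom C f \<in> R" shows "kernel_in C g R"
proof -
  obtain m e where *: "is_kernel C m g" "is_epi C e" "Cod C e = Dom C m" "f = m \<bullet> e"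
    using assms(1) unfolding exact_at_iff by auto
  note s = kernel_simps[OF *(1)] epi_arr[OF *(2)]
  obtain k where k: "is_kernel C k e" using kernels s by blast
  have kf: "is_kernel C k f" unfolding *(4) by (rule kernel_comp_mono[OF k kernel_mono[OF *(1)]]) (use * in simp)
  have "Cod C e \<in> R"
    by (rule R_cokernel[OF short_exactI2[OF *(2) k]])
      (use kernel_unique_in_R[OF kf assms(2)] assms(3) * s in auto)
  then show ?thesis using * by (auto simp: kernel_in_def)
qed

text \<open>To the left the cycles are fibrant by definition; the differential in degree
  \<open>-1\<close> has the same kernel as the augmentation because the coaugmentation is mono. In
  degree 0 the cycles are \<open>B\<close>, and fibrancy then propagates to the right by
  \<open>exact_kernel_in_R\<close>. The negative entries are extensions of cycles.\<close>

lemma coresolution_of_fibrant: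
  assumes L: "coresolution B L" and B: "B \<in> R"
  shows "obj L i \<in> W \<inter> R" "kernel_in C (diff L i) R"
proof -
  note s = coresolution_arr[OF L] and c = coresolution_facts[OF L]
  have k0: "is_kernel C (coaug L) (diff L 0)" by (rule exact_mono_kernel) (use c in auto)
  have km: "kernel_in C (diff L (-1)) R"
  proof -
    obtain k where k: "is_kernel C k (aug L)" "Dom C k \<in> R" using c(12) by (auto simp: kernel_in_def)
    have "is_kernel C k (diff L (-1))" unfolding c(5) by (rule kernel_comp_mono[OF k(1) c(8)]) (use s in simp)
    then show ?thesis using k by (auto simp: kernel_in_def)
  qed
  have kp: "kernel_in C (diff L (int n)) R" for n
  proof (induction n)
    case 0
    then show ?case using k0 s B by (auto simp: kernel_in_def)
  next
    case (Suc n)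
    have "obj L (int n) \<in> R" using c(11) by simp
    then show ?case using exact_kernel_in_R[OF c(2)[of "int n"] Suc] s by (simp add: add.commute)
  qed
  show kd: "kernel_in C (diff L i) R" for i
  proof (cases i rule: int_split3)
    case (1 n) then show ?thesis using c(13)[of i] by simp
  qed (use km kp in auto)
  show "obj L i \<in> W \<inter> R"
  proof (cases "i < 0")
    case True
    have "obj L i \<in> R" using exact_Dom_in_R[OF c(2) kd kd, of i] s by simp
    then show ?thesis using c(10)[OF True] by auto
  qed (use c(11) in auto)
qed

lemma trivially_cofibrant_acyclic:
  assumes L: "coresolution B L" and B: "B \<in> R" and P: "P \<in> Q \<inter> W" and z: "z \<in> hom_cocycles P L n"
  shows "\<exists>w\<in>homs C P (obj L (n - 1)). diff L (n - 1) \<bullet> w = z"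
proof -
  note s = coresolution_arr[OF L]
  have "exact_at C (diff L (n - 1)) (diff L n)" using coresolution_facts(2)[OF L, of "n - 1"] by simp
  from exact_lift[OF this coresolution_of_fibrant(2)[OF L B] P[unfolded QW_iff], of z] show ?thesis
    using z s by (auto simp: hom_cocycles_def)
qed

end

context chosen_coresolutions
begin

text \<open>Restates \<open>long_exact\<close> for \<open>rExt\<close>. Objects vary in both
  arguments so that it covers the cofibration sequence as well as the fibration sequence.\<close>

lemma hom_long_exact:
  assumes o: "A1 \<in> Ob C" "A2 \<in> Ob C" "A3 \<in> Ob C" and B: "B1 \<in> Ob C" "B2 \<in> Ob C" "B3 \<in> Ob C"
    and T: "exact_triple (Hom_cpx A1 (K B1)) (Hom_cpx A2 (K B2)) (Hom_cpx A3 (K B3)) (Hom_diff (K B1)) (Hom_diff (K B2)) (Hom_diff (K B3)) \<alpha> \<beta> s"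
    and a: "\<And>n x. x \<in> cocyc A1 B1 n \<Longrightarrow> \<alpha>H n (cl A1 B1 n x) = cl A2 B2 n (\<alpha> n x)"
    and b: "\<And>n x. x \<in> cocyc A2 B2 n \<Longrightarrow> \<beta>H n (cl A2 B2 n x) = cl A3 B3 n (\<beta> n x)"
  shows "\<exists>\<delta>. long_exact_sequence (\<lambda>n. rExt C K n A1 B1) (\<lambda>n. rExt C K n A2 B2) (\<lambda>n. rExt C K n A3 B3) \<alpha>H \<beta>H \<delta>"
proof -
  have "rExt C K n A B = cohomology (Hom_cpx A (K B)) (Hom_diff (K B)) n" for n A B by (simp add: rExt_def)
  moreover note exact_triple.long_exact[OF T, unfolded hom_cocycles_eq[OF K[OF B(1)] o(1)] hom_cocycles_eq[OF K[OF B(2)] o(2)],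
      folded hom_class_def, OF a b]
  ultimately show ?thesis by (metis (no_types, lifting) ext)
qed

lemma cofibration_long_exact:
  assumes B: "B \<in> R" and f: "cofibration C Q f" and c: "is_cokernel C c f"
  shows "\<exists>\<delta>. long_exact_sequence (\<lambda>n. rExt C K n (Cod C c) B) (\<lambda>n. rExt C K n (Cod C f) B) (\<lambda>n. rExt C K n (Dom C f) B)
      (\<lambda>n. rExt_con C K n c B) (\<lambda>n. rExt_con C K n f B) \<delta>"
proof -
  have BO: "B \<in> Ob C" using B by simp
  note L = K[OF BO]
  note s = coresolution_arr[OF L]
  have m: "is_mono C f" "cokernel_in C f Q" using f by (auto simp: cofibration_def)
  have se: "short_exact C f c" by (rule short_exactI1[OF m(1) c])
  note t = short_exact_simps[OF se]
  have o: "Cod C c \<in> Ob C" "Dom C c \<in> Ob C" "Dom C f \<in> Ob C" using t by auto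
  have ch: "c \<in> homs C (Dom C c) (Cod C c)" "f \<in> homs C (Dom C f) (Dom C c)" using t by auto
  \<comment> \<open>Precomposition with \<open>c \<bullet> f = 0\<close> is strictly zero, so the
    null-homotopy is zero as well.\<close>
  define \<sigma> where "\<sigma> = (\<lambda>i (x :: 'b). \<zero> (Dom C f) (obj (K B) (i - 1)))"
  have "exact_triple (Hom_cpx (Cod C c) (K B)) (Hom_cpx (Dom C c) (K B)) (Hom_cpx (Dom C f) (K B)) (Hom_diff (K B)) (Hom_diff (K B)) (Hom_diff (K B))
     (\<lambda>n x. x \<bullet> c) (\<lambda>n x. x \<bullet> f) \<sigma>"
  proof (intro exact_triple.intro exact_triple_axioms.intro hom_cochain_complex[OF L] o)
    fix n
    show "(\<lambda>x. x \<bullet> c) \<in> hom (Hom_cpx (Cod C c) (K B) n) (Hom_cpx (Dom C c) (K B) n)"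
      "(\<lambda>x. x \<bullet> f) \<in> hom (Hom_cpx (Dom C c) (K B) n) (Hom_cpx (Dom C f) (K B) n)"
      "\<sigma> n \<in> hom (Hom_cpx (Cod C c) (K B) n) (Hom_cpx (Dom C f) (K B) (n - 1))"
      using t o s by (auto simp: hom_def hom_complex_obj_def \<sigma>_def)
  next
    fix n x assume x: "x \<in> carrier (Hom_cpx (Cod C c) (K B) n)"
    show "Hom_diff (K B) n x \<bullet> c = Hom_diff (K B) n (x \<bullet> c)"
      using x t s by (auto simp: hom_complex_obj_def hom_complex_diff_def)
    have "x \<bullet> (c \<bullet> f) = \<zero> (Dom C f) (obj (K B) n)" using t(1-4) x o by (auto simp: hom_complex_obj_def)
    then show "(x \<bullet> c) \<bullet> f = Hom_diff (K B) (n - 1) (\<sigma> n x) \<otimes>\<^bsub>Hom_cpx (Dom C f) (K B) n\<^esub> \<sigma> (n + 1) (Hom_diff (K B) n x)"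
      using x t s o by (simp add: hom_complex_obj_def hom_complex_diff_def \<sigma>_def)
  next
    fix n y assume y: "y \<in> carrier (Hom_cpx (Dom C c) (K B) n)"
    show "Hom_diff (K B) n y \<bullet> f = Hom_diff (K B) n (y \<bullet> f)"
      using y t s by (auto simp: hom_complex_obj_def hom_complex_diff_def)
  next
    fix n x y z assume *: "x \<in> carrier (Hom_cpx (Cod C c) (K B) (n + 1))" "y \<in> carrier (Hom_cpx (Dom C c) (K B) n)" "z \<in> carrier (Hom_cpx (Dom C f) (K B) (n - 1))"
      and eq: "Hom_diff (K B) (n + 1) x = \<one>\<^bsub>Hom_cpx (Cod C c) (K B) (n + 1 + 1)\<^esub>" "x \<bullet> c = Hom_diff (K B) n y"
        "y \<bullet> f = \<sigma> (n + 1) x \<otimes>\<^bsub>Hom_cpx (Dom C f) (K B) n\<^esub> Hom_diff (K B) (n - 1) z"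
    have x: "x \<in> Arr C" "Dom C x = Cod C c" "Cod C x = obj (K B) (n + 1)"
      and y: "y \<in> Arr C" "Dom C y = Dom C c" "Cod C y = obj (K B) n"
      and z: "z \<in> Arr C" "Dom C z = Dom C f" "Cod C z = obj (K B) (n - 1)" using * by (auto simp: hom_complex_obj_def)
    have xc: "x \<bullet> c = diff (K B) n \<bullet> y" using eq by (simp add: hom_complex_diff_def)
    have yf: "y \<bullet> f = diff (K B) (n - 1) \<bullet> z" using eq(3) z s o by (simp add: hom_complex_diff_def hom_complex_obj_def \<sigma>_def)
    \<comment> \<open>Because \<open>B\<close> is fibrant, every entry of its coresolution lies in
      \<open>W \<inter> R\<close>, so \<open>z\<close> extends along the cofibration
      \<open>f\<close>.\<close>
    have "extension_property C Q (obj (K B) (n - 1))"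
      using coresolution_of_fibrant(1)[OF L B] by (simp only: RW_iff)
    then obtain y0 where y0: "y0 \<in> homs C (Cod C f) (obj (K B) (n - 1))" "y0 \<bullet> f = z"
      using extension_propertyD[OF _ m, of "obj (K B) (n - 1)" z] z by auto
    \<comment> \<open>The sign is chosen so that \<open>y\<close> plus the differential of
      \<open>y'\<close> vanishes on \<open>f\<close> and hence descends to the cokernel; the
      descended arrow is the primitive of \<open>x\<close>.\<close>
    define y' where "y' = \<zero> (Dom C c) (obj (K B) (n - 1)) \<setminus> y0"
    have y': "y' \<in> Arr C" "Dom C y' = Dom C c" "Cod C y' = obj (K B) (n - 1)" using y0 o s t by (auto simp: y'_def)
    have y'f: "y' \<bullet> f = \<zero> (Dom C f) (obj (K B) (n - 1)) \<setminus> z" using y0 o s t by (auto simp: y'_def)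
    let ?v = "y \<uplus> diff (K B) (n - 1) \<bullet> y'"
    have v: "?v \<in> Arr C" "Dom C ?v = Dom C c" "Cod C ?v = obj (K B) n" using y y' s by auto
    have "?v \<bullet> f = diff (K B) (n - 1) \<bullet> z \<uplus> diff (K B) (n - 1) \<bullet> (y' \<bullet> f)" using y y' s t yf by simp
    also have "\<dots> = \<zero> (Dom C f) (obj (K B) n)" unfolding y'f using s z o by simp
    finally obtain x' where x': "x' \<in> Arr C" "Dom C x' = Cod C c" "Cod C x' = obj (K B) n" "x' \<bullet> c = ?v"
      using cokernel_desc[OF c, of ?v] v t by auto
    have "diff (K B) n \<bullet> (diff (K B) (n - 1) \<bullet> y') = \<zero> (obj (K B) (n - 1)) (obj (K B) (n + 1)) \<bullet> y'"
      by (rule comp_reduce) (use s(12)[of "n - 1"] s y' in auto)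
    then have "diff (K B) n \<bullet> ?v = x \<bullet> c" using xc y y' s t by simp
    then have "(diff (K B) n \<bullet> x') \<bullet> c = x \<bullet> c" using x' s t by simp
    then have dx: "diff (K B) n \<bullet> x' = x" using epiD[OF t(6), of "diff (K B) n \<bullet> x'" x] x x' s by simp
    show "\<exists>x'\<in>carrier (Hom_cpx (Cod C c) (K B) n). \<exists>y'\<in>carrier (Hom_cpx (Dom C c) (K B) (n - 1)). \<exists>z'\<in>carrier (Hom_cpx (Dom C f) (K B) (n - 2)).
          x = Hom_diff (K B) n x' \<and> x' \<bullet> c = y \<otimes>\<^bsub>Hom_cpx (Dom C c) (K B) n\<^esub> Hom_diff (K B) (n - 1) y' \<and>
          \<sigma> n x' \<otimes>\<^bsub>Hom_cpx (Dom C f) (K B) (n - 1)\<^esub> Hom_diff (K B) (n - 2) z' = z \<otimes>\<^bsub>Hom_cpx (Dom C f) (K B) (n - 1)\<^esub> (y' \<bullet> f)"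
      by (rule bexI[of _ x'], rule bexI[of _ y'], rule bexI[of _ "\<zero> (Dom C f) (obj (K B) (n - 2))"])
        (use x' y' dx y'f z s o in \<open>auto simp: hom_complex_diff_def hom_complex_obj_def \<sigma>_def\<close>)
  qed
  from hom_long_exact[OF o BO BO BO this, of "\<lambda>n. rExt_con C K n c B" "\<lambda>n. rExt_con C K n f B"]
  show ?thesis using rExt_con_class[OF BO ch(1)] rExt_con_class[OF BO ch(2)] t by simp
qed

lemma rExt_con_right_homotopic:
  assumes B: "B \<in> R" and h: "right_homotopic C Q W f g" and x: "x \<in> carrier (rExt C K n (Cod C f) B)"
  shows "rExt_con C K n f B x = rExt_con C K n g B x"
proof -
  have BO: "B \<in> Ob C" using B by simp
  note L = K[OF BO]
  note s = coresolution_arr[OF L]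
  have fg: "f \<in> Arr C" "g \<in> Arr C" "Dom C f = Dom C g" "Cod C f = Cod C g"
    using h by (auto simp: right_homotopic_def homotopic_via_def)
  then obtain P u v where P: "P \<in> Q \<inter> W" "u \<in> homs C (Dom C g) P" "v \<in> homs C P (Cod C g)" "g \<setminus> f = v \<bullet> u"
    using h by (auto simp: right_homotopic_def homotopic_via_def factors_through_class_def)
  obtain z where z: "z \<in> cocyc (Cod C g) B n" "x = cl (Cod C g) B n z" using x rExt_facts(2)[OF _ BO] fg by auto
  note zs = cocycle_simps[OF z(1)]
  \<comment> \<open>The restriction of the cocycle \<open>z\<close> to the trivially cofibrant
    \<open>P\<close> is a coboundary. Composing a primitive with \<open>u\<close> makes
    \<open>z \<bullet> g\<close> and \<open>z \<bullet> f\<close> cohomologous.\<close>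
  obtain w where w: "w \<in> homs C P (obj (K B) (n - 1))" "diff (K B) (n - 1) \<bullet> w = z \<bullet> v"
    using trivially_cofibrant_acyclic[OF L B P(1) precomp_cocycle[OF L P(3) z(1)]] by blast
  have h: "f \<in> homs C (Dom C g) (Cod C g)" "g \<in> homs C (Dom C g) (Cod C g)" using fg by auto
  have "diff (K B) (n - 1) \<bullet> (w \<bullet> u) = (z \<bullet> v) \<bullet> u" by (rule comp_reduce[OF w(2)]) (use w P s in auto)
  also have "\<dots> = z \<bullet> (g \<setminus> f)" unfolding P(4) using zs P by simp
  finally have "z \<bullet> g = diff (K B) (n - 1) \<bullet> (w \<bullet> u) \<uplus> z \<bullet> f" using zs fg by simp
  then have "cl (Dom C g) B n (z \<bullet> g) = cl (Dom C g) B n (z \<bullet> f)"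
    using w P fg by (subst hom_class_eq_iff[OF L _ precomp_cocycle[OF L h(2) z(1)] precomp_cocycle[OF L h(1) z(1)]]) auto
  then show ?thesis unfolding z(2) rExt_con_class[OF BO h(1) z(1)] rExt_con_class[OF BO h(2) z(1)] by simp
qed

lemma rExt_cov_homotopic:
  assumes A: "A \<in> Ob C" and h: "homotopic_via C (core Q W R) f g" and x: "x \<in> carrier (rExt C K n A (Dom C f))"
  shows "rExt_cov C K n A f x = rExt_cov C K n A g x"
proof -
  have fg: "f \<in> Arr C" "g \<in> Arr C" "Dom C f = Dom C g" "Cod C f = Cod C g"
    using h by (auto simp: homotopic_via_def)
  define B B' where "B = Dom C g" and "B' = Cod C g"
  have fg': "f \<in> homs C B B'" "g \<in> homs C B B'" and o: "B \<in> Ob C" "B' \<in> Ob C" using fg by (auto simp: B_def B'_def)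
  obtain P u v where P: "P \<in> Q \<inter> W" "P \<in> W \<inter> R" "u \<in> homs C B P" "v \<in> homs C P B'" "g \<setminus> f = v \<bullet> u"
    using h fg by (auto simp: homotopic_via_def factors_through_class_def B_def B'_def core_def)
  note L = K[OF o(1)] K[OF o(2)]
  note s = coresolution_arr[OF L(1)] coresolution_arr[OF L(2)] and c = coresolution_facts[OF L(1)] coresolution_facts[OF L(2)]
  obtain v' where v': "v' \<in> homs C P (obj (K B') (-1))" "aug (K B') \<bullet> v' = v"
    using lifting_propertyD[OF P(1)[unfolded QW_iff] c(22) c(27), of v] P(4) s by auto
  obtain u' where u': "u' \<in> homs C (obj (K B) 0) P" "u' \<bullet> coaug (K B) = u"
    using extension_propertyD[OF P(2)[unfolded RW_iff] c(8) c(14), of u] P(3) s by auto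
  \<comment> \<open>Both properties of a core object are used here: \<open>v\<close> lifts through
    the augmentation of \<open>B'\<close> because \<open>P\<close> is trivially cofibrant, and
    \<open>u\<close> extends along the coaugmentation of \<open>B\<close> because \<open>P\<close>
    is trivially fibrant.\<close>
  define \<eta> where "\<eta> = v' \<bullet> u'"
  have \<eta>: "\<eta> \<in> Arr C" "Dom C \<eta> = obj (K B) 0" "Cod C \<eta> = obj (K B') (-1)" using u' v' by (auto simp: \<eta>_def)
  \<comment> \<open>The boundary of the homotopy whose only nonzero component is
    \<open>\<eta>\<close>. Its two nonzero terms sit on either side of the splice, which is why it
    extends \<open>v \<bullet> u\<close>.\<close>
  define \<psi> where "\<psi> i = (if i = -1 then \<eta> \<bullet> diff (K B) (-1) else if i = 0 then diff (K B') (-1) \<bullet> \<eta> else \<zero> (obj (K B) i) (obj (K B') i))" for i :: int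
  have \<psi>h: "\<psi> i \<in> homs C (obj (K B) i) (obj (K B') i)" for i using \<eta> s by (auto simp: \<psi>_def)
  have dd: "diff (K B) (-1) \<bullet> diff (K B) (-2) = \<zero> (obj (K B) (-2)) (obj (K B) 0)"
    "diff (K B') 0 \<bullet> diff (K B') (-1) = \<zero> (obj (K B') (-1)) (obj (K B') 1)"
    using s(12)[of "-2"] s(24)[of "-1"] by auto
  have cm: "\<psi> (i + 1) \<bullet> diff (K B) i = diff (K B') i \<bullet> \<psi> i" for i
  proof -
    consider "i = -2" | "i = -1" | "i = 0" | "i \<noteq> -2" "i \<noteq> -1" "i \<noteq> 0" by blast
    then show ?thesis
    proof cases
      case 3
      have "diff (K B') 0 \<bullet> (diff (K B') (-1) \<bullet> \<eta>) = \<zero> (obj (K B') (-1)) (obj (K B') 1) \<bullet> \<eta>"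
        by (rule comp_reduce[OF dd(2)]) (use \<eta> s in auto)
      then show ?thesis using 3 \<eta> s by (simp add: \<psi>_def)
    qed (use \<eta> s dd in \<open>auto simp: \<psi>_def\<close>)
  qed
  have ext: "extends_to C (K B) (K B') (g \<setminus> f) \<psi>"
    unfolding extends_to_def
  proof (intro conjI allI \<psi>h cm)
    have e1: "u' \<bullet> (coaug (K B) \<bullet> aug (K B)) = u \<bullet> aug (K B)"
      by (rule comp_reduce[OF u'(2)]) (use u' s in auto)
    have e2: "aug (K B') \<bullet> (v' \<bullet> (u \<bullet> aug (K B))) = v \<bullet> (u \<bullet> aug (K B))"
      by (rule comp_reduce[OF v'(2)]) (use v' P s in auto)
    show "aug (K B') \<bullet> \<psi> (- 1) = (g \<setminus> f) \<bullet> aug (K B)"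
      unfolding P(5) using u'(1) v'(1) P(3,4) s by (simp add: \<psi>_def \<eta>_def c(5) e1 e2)
    have "\<psi> 0 \<bullet> coaug (K B) = coaug (K B') \<bullet> (aug (K B') \<bullet> (v' \<bullet> u))"
      using u' v' s by (simp add: \<psi>_def \<eta>_def c(20))
    also have "aug (K B') \<bullet> (v' \<bullet> u) = v \<bullet> u" by (rule comp_reduce[OF v'(2)]) (use v' P s in auto)
    finally show "\<psi> 0 \<bullet> coaug (K B) = coaug (K B') \<bullet> (g \<setminus> f)" unfolding P(5) .
  qed
  obtain \<phi> where \<phi>: "extends_to C (K B) (K B') f \<phi>" using chain_map_ex[OF fg'(1)] by auto
  have gf: "g \<setminus> f \<in> homs C B B'" using fg' by auto
  have "f \<uplus> (g \<setminus> f) = g" using fg by simp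
  then have \<phi>': "extends_to C (K B) (K B') g (\<lambda>i. \<phi> i \<uplus> \<psi> i)" using extends_to_add(1)[OF L fg'(1) gf \<phi> ext] by simp
  obtain z where z: "z \<in> cocyc A B n" "x = cl A B n z" using x rExt_facts(2)[OF A o(1)] fg by (auto simp: B_def)
  note zs = cocycle_simps[OF z(1)]
  \<comment> \<open>In degree \<open>-1\<close> the composite with a cocycle is zero, in degree 0 it
    is the differential of \<open>\<eta> \<bullet> z\<close>, and in all other degrees
    \<open>\<psi>\<close> is zero.\<close>
  have "\<exists>w\<in>homs C A (obj (K B') (n - 1)). diff (K B') (n - 1) \<bullet> w = \<psi> n \<bullet> z"
  proof -
    consider "n = -1" | "n = 0" | "n \<noteq> -1" "n \<noteq> 0" by blast
    then show ?thesis
    proof cases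
      case 1
      have "\<psi> n \<bullet> z = \<eta> \<bullet> (diff (K B) n \<bullet> z)" using 1 \<eta> zs s by (simp add: \<psi>_def)
      also have "\<dots> = \<zero> A (obj (K B') n)" unfolding zs(4) using 1 \<eta> A by simp
      finally show ?thesis using s A by (intro bexI[of _ "\<zero> A (obj (K B') (n - 1))"]) auto
    next
      case 2
      then show ?thesis using \<eta> zs s by (intro bexI[of _ "\<eta> \<bullet> z"]) (auto simp: \<psi>_def)
    next
      case 3
      then have "\<psi> n \<bullet> z = \<zero> A (obj (K B') n)" using zs s by (simp add: \<psi>_def)
      then show ?thesis using s A by (intro bexI[of _ "\<zero> A (obj (K B') (n - 1))"]) auto
    qed
  qed
  then obtain w where w: "w \<in> homs C A (obj (K B') (n - 1))" "diff (K B') (n - 1) \<bullet> w = \<psi> n \<bullet> z" by blast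
  have "(\<phi> n \<uplus> \<psi> n) \<bullet> z = diff (K B') (n - 1) \<bullet> w \<uplus> \<phi> n \<bullet> z"
    unfolding w(2) using zs \<psi>h[of n] extends_toD(1)[OF \<phi>, of n] by (simp add: add_commute)
  then have "cl A B' n ((\<phi> n \<uplus> \<psi> n) \<bullet> z) = cl A B' n (\<phi> n \<bullet> z)"
    by (subst hom_class_eq_iff[OF L(2) A extends_cocycle[OF L \<phi>' z(1)] extends_cocycle[OF L \<phi> z(1)]]) (rule bexI[OF _ w(1)])
  then show ?thesis
    unfolding z(2) rExt_cov_class[OF A fg'(1) \<phi> z(1)] rExt_cov_class[OF A fg'(2) \<phi>' z(1)] by simp
qed

end

section \<open>The stable category\<close>

text \<open>The assumptions are equations about \<open>\<gamma>\<close>, stated for arbitrary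
  \<open>C\<close> and \<open>D\<close>, so that one proof serves the stable category and its
  opposite. The arrow part of the factorization is computed on a chosen preimage under
  \<open>\<gamma>\<close>; the last assumption makes the choice harmless.\<close>

lemma factors_viaI:
  assumes F: "additive_functor C F F'" and DO: "\<And>f. f \<in> Arr C \<Longrightarrow> Dom C f \<in> Ob C"
    and Ob: "Ob D = Ob C" "Arr D = \<gamma> ` Arr C" and DC: "\<And>f. f \<in> Arr C \<Longrightarrow> Dom D (\<gamma> f) = Dom C f" "\<And>f. f \<in> Arr C \<Longrightarrow> Cod D (\<gamma> f) = Cod C f"
    and Id: "\<And>A. A \<in> Ob C \<Longrightarrow> Id D A = \<gamma> (Id C A)" "\<And>A. A \<in> Ob C \<Longrightarrow> Id C A \<in> Arr C" "\<And>A. A \<in> Ob C \<Longrightarrow> Dom C (Id C A) = A"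
    and Comp: "\<And>f g. \<lbrakk>f \<in> Arr C; g \<in> Arr C; Cod C f = Dom C g\<rbrakk> \<Longrightarrow> \<gamma> g \<odot>\<^bsub>D\<^esub> \<gamma> f = \<gamma> (g \<odot>\<^bsub>C\<^esub> f)"
      "\<And>f g. \<lbrakk>f \<in> Arr C; g \<in> Arr C; Cod C f = Dom C g\<rbrakk> \<Longrightarrow> g \<odot>\<^bsub>C\<^esub> f \<in> Arr C \<and> Dom C (g \<odot>\<^bsub>C\<^esub> f) = Dom C f"
    and Add: "\<And>f g. \<lbrakk>f \<in> Arr C; g \<in> Arr C; Dom C f = Dom C g; Cod C f = Cod C g\<rbrakk> \<Longrightarrow> Add D (\<gamma> f) (\<gamma> g) = \<gamma> (Add C f g)"
      "\<And>f g. \<lbrakk>f \<in> Arr C; g \<in> Arr C; Dom C f = Dom C g; Cod C f = Cod C g\<rbrakk> \<Longrightarrow> Add C f g \<in> Arr C \<and> Dom C (Add C f g) = Dom C f"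
    and inv: "\<And>f g x. \<lbrakk>f \<in> Arr C; g \<in> Arr C; \<gamma> f = \<gamma> g; x \<in> carrier (F (Dom C f))\<rbrakk> \<Longrightarrow> F' f x = F' g x"
  shows "factors_via C D \<gamma> F F'"
proof -
  define G' where "G' X = F' (SOME f. f \<in> Arr C \<and> \<gamma> f = X)" for X
  have G: "G' (\<gamma> f) x = F' f x" if "f \<in> Arr C" "x \<in> carrier (F (Dom C f))" for f x
  proof -
    define h where "h = (SOME h. h \<in> Arr C \<and> \<gamma> h = \<gamma> f)"
    have "h \<in> Arr C \<and> \<gamma> h = \<gamma> f" unfolding h_def by (rule someI[of _ f]) (use that in simp)
    then show ?thesis unfolding G'_def h_def[symmetric] using inv[of f h x] that by simp
  qed
  note A = F[unfolded additive_functor_def]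
  have "additive_functor D F G'"
    unfolding additive_functor_def Ob ball_simps(9)
  proof (intro conjI ballI impI)
    show "comm_group (F B)" if "B \<in> Ob C" for B using A that by blast
    show "G' (\<gamma> f) \<in> hom (F (Dom D (\<gamma> f))) (F (Cod D (\<gamma> f)))" if "f \<in> Arr C" for f
    proof -
      have h: "F' f \<in> hom (F (Dom C f)) (F (Cod C f))" using A that by blast
      have "comm_group (F (Dom C f))" using A DO[OF that] by blast
      then have "x \<otimes>\<^bsub>F (Dom C f)\<^esub> y \<in> carrier (F (Dom C f))"
        if "x \<in> carrier (F (Dom C f))" "y \<in> carrier (F (Dom C f))" for x y
        using that by (intro monoid.m_closed comm_monoid.axioms(1) comm_group.axioms(1))
      then show ?thesis
        unfolding DC(1)[OF that] DC(2)[OF that] hom_def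
        using h G[OF that] by (auto simp: hom_def)
    qed
    show "G' (Id D B) x = x" if "B \<in> Ob C" "x \<in> carrier (F B)" for B x
      using G[of "Id C B" x] Id that A by simp
    show "G' (\<gamma> g \<odot>\<^bsub>D\<^esub> \<gamma> f) x = G' (\<gamma> g) (G' (\<gamma> f) x)"
      if fg: "f \<in> Arr C" "g \<in> Arr C" "Cod D (\<gamma> f) = Dom D (\<gamma> g)" and x: "x \<in> carrier (F (Dom D (\<gamma> f)))" for f g x
    proof -
      have c: "Cod C f = Dom C g" and x': "x \<in> carrier (F (Dom C f))" using fg x DC by auto
      have "F' f \<in> hom (F (Dom C f)) (F (Cod C f))" using A fg(1) by blast
      then have "F' f x \<in> carrier (F (Dom C g))" using x' c by (auto simp: hom_def)
      moreover have "F' (g \<odot>\<^bsub>C\<^esub> f) x = F' g (F' f x)" using A fg x' c by blast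
      ultimately show ?thesis using G[OF fg(1) x'] G[OF fg(2), of "F' f x"] G[of "g \<odot>\<^bsub>C\<^esub> f" x] Comp[OF fg(1,2) c] x' by simp
    qed
    show "G' (Add D (\<gamma> f) (\<gamma> g)) x = G' (\<gamma> f) x \<otimes>\<^bsub>F (Cod D (\<gamma> f))\<^esub> G' (\<gamma> g) x"
      if fg: "f \<in> Arr C" "g \<in> Arr C" "Dom D (\<gamma> f) = Dom D (\<gamma> g) \<and> Cod D (\<gamma> f) = Cod D (\<gamma> g)" and x: "x \<in> carrier (F (Dom D (\<gamma> f)))" for f g x
    proof -
      have c: "Dom C f = Dom C g" "Cod C f = Cod C g" and x': "x \<in> carrier (F (Dom C f))" using fg x DC by auto
      have "F' (Add C f g) x = F' f x \<otimes>\<^bsub>F (Cod C f)\<^esub> F' g x" using A fg x' c by blast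
      then show ?thesis using G[OF fg(1) x'] G[OF fg(2), of x] G[of "Add C f g" x] Add[OF fg(1,2) c] x' c DC fg by simp
    qed
  qed
  then show ?thesis unfolding factors_via_def using G by blast
qed

context preadditive_category
begin

text \<open>The conditions under which the arrows that factor through \<open>S\<close> form a
  two-sided ideal: nonemptiness provides the zero arrows, biproducts provide sums. It suffices that
  one biproduct of each pair lies in \<open>S\<close>.\<close>

definition ideal_class :: "'o set \<Rightarrow> bool" where
  "ideal_class S \<longleftrightarrow> S \<subseteq> Ob C \<and> S \<noteq> {} \<and> (\<forall>P\<in>S. \<forall>P'\<in>S. \<exists>B\<in>S. \<exists>i j p q. is_biproduct C P P' B i j p q)"

text \<open>Two factorizations are added by factoring the sum through the biproduct of their middle
  objects.\<close>

lemma factors_add: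
  assumes S: "ideal_class S" and h: "h \<in> Arr C" "h' \<in> Arr C" "Dom C h = Dom C h'" "Cod C h = Cod C h'"
    and f: "factors_through_class C S h" "factors_through_class C S h'"
  shows "factors_through_class C S (h \<uplus> h')"
proof -
  obtain P u v where P: "P \<in> S" "u \<in> homs C (Dom C h) P" "v \<in> homs C P (Cod C h)" "h = v \<bullet> u"
    using f(1) unfolding factors_through_class_def by blast
  obtain P' u' v' where P': "P' \<in> S" "u' \<in> homs C (Dom C h) P'" "v' \<in> homs C P' (Cod C h)" "h' = v' \<bullet> u'"
    using f(2) unfolding factors_through_class_def h(3,4)[symmetric] by blast
  have "\<exists>B\<in>S. \<exists>i j p q. is_biproduct C P P' B i j p q" using S P(1) P'(1) unfolding ideal_class_def by simp
  then obtain B i j p q where B: "B \<in> S" "is_biproduct C P P' B i j p q" by blast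
  have b: "i \<in> homs C P B" "j \<in> homs C P' B" "p \<in> homs C B P" "q \<in> homs C B P'"
     "p \<bullet> i = Id C P" "q \<bullet> j = Id C P'" "q \<bullet> i = \<zero> P P'" "p \<bullet> j = \<zero> P' P" using B(2) unfolding is_biproduct_def by simp_all
  have PO: "P \<in> Ob C" "P' \<in> Ob C" using homs_Ob b by blast+
  have r: "p \<bullet> (i \<bullet> x) = x" "q \<bullet> (i \<bullet> x) = \<zero> (Dom C x) P'" if "x \<in> Arr C" "Cod C x = P" for x
    using comp_reduce[OF b(5), of x] comp_reduce[OF b(7), of x] b(1-4) that PO by auto
  have r': "q \<bullet> (j \<bullet> x) = x" "p \<bullet> (j \<bullet> x) = \<zero> (Dom C x) P" if "x \<in> Arr C" "Cod C x = P'" for x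
    using comp_reduce[OF b(6), of x] comp_reduce[OF b(8), of x] b(1-4) that PO by auto
  have DO: "Dom C h \<in> Ob C" using h by simp
  have "(v \<bullet> p \<uplus> v' \<bullet> q) \<bullet> (i \<bullet> u \<uplus> j \<bullet> u') = h \<uplus> h'"
    unfolding P(4) P'(4) using b(1-4) P(2,3) P'(2,3) DO r[of u] r'[of u'] by simp
  then show ?thesis unfolding factors_through_class_def
    using B(1) b(1-4) P(2,3) P'(2,3) h
    by (intro bexI[of _ B] bexI[of _ "i \<bullet> u \<uplus> j \<bullet> u'"] bexI[of _ "v \<bullet> p \<uplus> v' \<bullet> q"]) auto
qed

lemma factors_comp:
  assumes "factors_through_class C S h" "h \<in> Arr C" "f \<in> Arr C" "g \<in> Arr C" "Cod C f = Dom C h" "Cod C h = Dom C g"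
  shows "factors_through_class C S (h \<bullet> f)" "factors_through_class C S (g \<bullet> h)"
proof -
  obtain P u v where P: "P \<in> S" "u \<in> homs C (Dom C h) P" "v \<in> homs C P (Cod C h)" "h = v \<bullet> u"
    using assms(1) unfolding factors_through_class_def by blast
  have "h \<bullet> f = v \<bullet> (u \<bullet> f)" unfolding P(4) using P(2,3) assms(2-6) by simp
  then show "factors_through_class C S (h \<bullet> f)" unfolding factors_through_class_def
    by (intro bexI[OF _ P(1)] bexI[of _ "u \<bullet> f"] bexI[of _ v]) (use P(2,3) assms(2-6) in simp_all)
  have "g \<bullet> h = (g \<bullet> v) \<bullet> u" unfolding P(4) using P(2,3) assms(2-6) by simp
  then show "factors_through_class C S (g \<bullet> h)" unfolding factors_through_class_def
    by (intro bexI[OF _ P(1)] bexI[of _ u] bexI[of _ "g \<bullet> v"]) (use P(2,3) assms(2-6) in simp_all)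
qed

lemma factors_zero:
  assumes "ideal_class S" "A \<in> Ob C" "B \<in> Ob C" shows "factors_through_class C S (\<zero> A B)"
proof -
  obtain P where "P \<in> S" "P \<in> Ob C" using assms(1) by (auto simp: ideal_class_def)
  then show ?thesis unfolding factors_through_class_def using assms
    by (intro bexI[of _ P] bexI[of _ "\<zero> A P"] bexI[of _ "\<zero> P B"]) auto
qed

lemma homotopic_via_iff: "homotopic_via C S f g \<longleftrightarrow> f \<in> Arr C \<and> g \<in> Arr C \<and> Dom C f = Dom C g \<and> Cod C f = Cod C g \<and>
     factors_through_class C S (g \<setminus> f)"
  by (simp add: homotopic_via_def)

lemma homotopic_refl: "ideal_class S \<Longrightarrow> f \<in> Arr C \<Longrightarrow> homotopic_via C S f f"
  by (simp add: homotopic_via_iff factors_zero)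

lemma homotopic_trans:
  assumes S: "ideal_class S" and h: "homotopic_via C S f g" "homotopic_via C S g h"
  shows "homotopic_via C S f h"
proof -
  have a: "f \<in> Arr C" "g \<in> Arr C" "h \<in> Arr C" "Dom C f = Dom C h" "Cod C f = Cod C h" "Dom C g = Dom C h" "Cod C g = Cod C h"
    using h by (auto simp: homotopic_via_iff)
  have "factors_through_class C S ((h \<setminus> g) \<uplus> (g \<setminus> f))"
    by (rule factors_add[OF S]) (use h a in \<open>auto simp: homotopic_via_iff\<close>)
  moreover have "(h \<setminus> g) \<uplus> (g \<setminus> f) = h \<setminus> f"
    using a by (simp add: eq_minus_iff add_assoc)
  ultimately show ?thesis using a by (simp add: homotopic_via_iff)
qed

lemma homotopic_sym:
  assumes S: "ideal_class S" and h: "homotopic_via C S f g"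
  shows "homotopic_via C S g f"
proof -
  have a: "f \<in> Arr C" "g \<in> Arr C" "Dom C f = Dom C g" "Cod C f = Cod C g"
    and "factors_through_class C S (g \<setminus> f)" using h by (auto simp: homotopic_via_iff)
  then obtain P u v where P: "P \<in> S" "u \<in> homs C (Dom C g) P" "v \<in> homs C P (Cod C g)" "g \<setminus> f = v \<bullet> u"
    by (auto simp: factors_through_class_def)
  have PO: "P \<in> Ob C" "Cod C g \<in> Ob C" "Dom C g \<in> Ob C" using P(1) S a by (auto simp: ideal_class_def)
  have "(\<zero> (Dom C g) (Cod C g) \<setminus> (g \<setminus> f)) \<uplus> ((g \<setminus> f) \<uplus> f) = ((\<zero> (Dom C g) (Cod C g) \<setminus> (g \<setminus> f)) \<uplus> (g \<setminus> f)) \<uplus> f"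
    by (rule add_assoc[symmetric]) (use a PO in auto)
  then have "f = (\<zero> (Dom C g) (Cod C g) \<setminus> (g \<setminus> f)) \<uplus> g" using a PO by simp
  then have "f \<setminus> g = \<zero> (Dom C g) (Cod C g) \<setminus> (g \<setminus> f)" using a PO by (subst minus_eq_iff) auto
  also have "\<dots> = (\<zero> P (Cod C g) \<setminus> v) \<bullet> u" unfolding P(4) using P(2,3) PO by simp
  finally have "f \<setminus> g = (\<zero> P (Cod C g) \<setminus> v) \<bullet> u" .
  then have "factors_through_class C S (f \<setminus> g)" unfolding factors_through_class_def using P PO a
    by (intro bexI[of _ P] bexI[of _ u] bexI[of _ "\<zero> P (Cod C g) \<setminus> v"]) auto
  then show ?thesis using a by (simp add: homotopic_via_iff)
qed

lemma stable_class_eq_iff: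
  assumes "ideal_class S" "f \<in> Arr C" shows "stable_class C S f = stable_class C S g \<longleftrightarrow> homotopic_via C S g f"
  unfolding stable_class_def using homotopic_refl[OF assms] homotopic_sym[OF assms(1)] homotopic_trans[OF assms(1)] by blast

lemma homotopic_comp:
  assumes S: "ideal_class S" and h: "homotopic_via C S f f'" "homotopic_via C S g g'" and c: "Cod C f = Dom C g"
  shows "homotopic_via C S (g \<bullet> f) (g' \<bullet> f')"
proof -
  have a: "f \<in> Arr C" "f' \<in> Arr C" "g \<in> Arr C" "g' \<in> Arr C" "Dom C f = Dom C f'" "Cod C f = Dom C g'" "Cod C f' = Dom C g'"
      "Dom C g = Dom C g'" "Cod C g = Cod C g'" and h': "factors_through_class C S (f' \<setminus> f)" "factors_through_class C S (g' \<setminus> g)"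
    using h c by (auto simp: homotopic_via_iff)
  have "homotopic_via C S (g \<bullet> f) (g \<bullet> f')"
    using factors_comp(2)[OF h'(1), of "Id C (Dom C f')" g] a by (simp add: homotopic_via_iff)
  moreover have "homotopic_via C S (g \<bullet> f') (g' \<bullet> f')"
    using factors_comp(1)[OF h'(2), of f' "Id C (Cod C g')"] a by (simp add: homotopic_via_iff)
  ultimately show ?thesis using homotopic_trans[OF S] by blast
qed

lemma homotopic_add:
  assumes S: "ideal_class S" and h: "homotopic_via C S f f'" "homotopic_via C S g g'" and c: "Dom C f = Dom C g" "Cod C f = Cod C g"
  shows "homotopic_via C S (f \<uplus> g) (f' \<uplus> g')"
proof -
  have a: "f \<in> Arr C" "f' \<in> Arr C" "g \<in> Arr C" "g' \<in> Arr C" "Dom C f = Dom C g'" "Dom C f' = Dom C g'" "Dom C g = Dom C g'"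
      "Cod C f = Cod C g'" "Cod C f' = Cod C g'" "Cod C g = Cod C g'" and h': "factors_through_class C S (f' \<setminus> f)" "factors_through_class C S (g' \<setminus> g)"
    using h c by (auto simp: homotopic_via_iff)
  have "(f' \<uplus> g') \<setminus> (f \<uplus> g) = (f' \<setminus> f) \<uplus> (g' \<setminus> g)"
  proof -
    have "(f' \<setminus> f) \<uplus> (g' \<setminus> g) \<uplus> (f \<uplus> g) = ((f' \<setminus> f) \<uplus> f) \<uplus> ((g' \<setminus> g) \<uplus> g)"
      using a by (simp only: add_ac add_simps minus_simps)
    then show ?thesis using a by (simp add: minus_eq_iff)
  qed
  then show ?thesis using factors_add[OF S _ _ _ _ h'] a by (simp add: homotopic_via_iff)
qed

lemma stable_category_simps:
  assumes S: "ideal_class S"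
  shows "Ob (stable_category C S) = Ob C" "Arr (stable_category C S) = stable_class C S ` Arr C"
    "f \<in> Arr C \<Longrightarrow> Dom (stable_category C S) (stable_class C S f) = Dom C f"
    "f \<in> Arr C \<Longrightarrow> Cod (stable_category C S) (stable_class C S f) = Cod C f"
    "Id (stable_category C S) A = stable_class C S (Id C A)"
    "\<lbrakk>f \<in> Arr C; g \<in> Arr C; Cod C f = Dom C g\<rbrakk> \<Longrightarrow> stable_class C S g \<odot>\<^bsub>stable_category C S\<^esub> stable_class C S f = stable_class C S (g \<bullet> f)"
    "\<lbrakk>f \<in> Arr C; g \<in> Arr C; Dom C f = Dom C g; Cod C f = Cod C g\<rbrakk> \<Longrightarrow>
      Add (stable_category C S) (stable_class C S f) (stable_class C S g) = stable_class C S (f \<uplus> g)"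
proof -
  show "Ob (stable_category C S) = Ob C" "Arr (stable_category C S) = stable_class C S ` Arr C"
    "Id (stable_category C S) A = stable_class C S (Id C A)" by (simp_all add: stable_category_def)
  have self: "f \<in> stable_class C S f" if "f \<in> Arr C" for f using homotopic_refl[OF S that] by (simp add: stable_class_def)
  have "Dom C ` stable_class C S f = {Dom C f}" "Cod C ` stable_class C S f = {Cod C f}" if "f \<in> Arr C" for f
    using self[OF that] by (auto simp: stable_class_def homotopic_via_iff)
  then show "Dom (stable_category C S) (stable_class C S f) = Dom C f"
    "Cod (stable_category C S) (stable_class C S f) = Cod C f" if "f \<in> Arr C" using that by (simp_all add: stable_category_def)
  show "stable_class C S g \<odot>\<^bsub>stable_category C S\<^esub> stable_class C S f = stable_class C S (g \<bullet> f)"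
    if fg: "f \<in> Arr C" "g \<in> Arr C" "Cod C f = Dom C g"
  proof -
    have eq: "stable_class C S (g' \<bullet> f') = stable_class C S (g \<bullet> f)" if "g' \<in> stable_class C S g" "f' \<in> stable_class C S f" for g' f'
    proof -
      have h: "homotopic_via C S f f'" "homotopic_via C S g g'" using that by (simp_all add: stable_class_def)
      have "g' \<bullet> f' \<in> Arr C" using h fg by (auto simp: homotopic_via_iff)
      then show ?thesis using stable_class_eq_iff[OF S] homotopic_comp[OF S h fg(3)] by blast
    qed
    \<comment> \<open>The union that defines the composite has a single value, because the class of
      \<open>g' \<bullet> f'\<close> is independent of the representatives.\<close>
    have "(\<Union>g'\<in>stable_class C S g. \<Union>f'\<in>stable_class C S f. stable_class C S (g' \<bullet> f')) =
        (\<Union>g'\<in>stable_class C S g. \<Union>f'\<in>stable_class C S f. stable_class C S (g \<bullet> f))"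
      by (intro SUP_cong refl eq)
    also have "\<dots> = stable_class C S (g \<bullet> f)" using self[OF fg(1)] self[OF fg(2)] by blast
    finally show ?thesis by (simp add: stable_category_def)
  qed
  show "Add (stable_category C S) (stable_class C S f) (stable_class C S g) = stable_class C S (f \<uplus> g)"
    if fg: "f \<in> Arr C" "g \<in> Arr C" "Dom C f = Dom C g" "Cod C f = Cod C g"
  proof -
    have eq: "stable_class C S (f' \<uplus> g') = stable_class C S (f \<uplus> g)" if "g' \<in> stable_class C S g" "f' \<in> stable_class C S f" for g' f'
    proof -
      have h: "homotopic_via C S f f'" "homotopic_via C S g g'" using that by (simp_all add: stable_class_def)
      have "f' \<uplus> g' \<in> Arr C" using h fg by (auto simp: homotopic_via_iff)
      then show ?thesis using stable_class_eq_iff[OF S] homotopic_add[OF S h fg(3,4)] by blast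
    qed
    have "(\<Union>f'\<in>stable_class C S f. \<Union>g'\<in>stable_class C S g. stable_class C S (f' \<uplus> g')) =
        (\<Union>f'\<in>stable_class C S f. \<Union>g'\<in>stable_class C S g. stable_class C S (f \<uplus> g))"
      by (intro SUP_cong refl eq)
    also have "\<dots> = stable_class C S (f \<uplus> g)" using self[OF fg(1)] self[OF fg(2)] by blast
    finally show ?thesis by (simp add: stable_category_def)
  qed
qed

lemma factors_via_stable:
  assumes S: "ideal_class S" and F: "additive_functor C F F'"
    and inv: "\<And>f g x. \<lbrakk>homotopic_via C S f g; x \<in> carrier (F (Dom C f))\<rbrakk> \<Longrightarrow> F' f x = F' g x"
  shows "factors_via C (stable_category C S) (stable_class C S) F F'"
  by (rule factors_viaI[OF F])
    (use stable_category_simps[OF S] inv stable_class_eq_iff[OF S] homotopic_sym[OF S] in auto)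

lemma factors_via_stable_op:
  assumes S: "ideal_class S" and F: "additive_functor (op_category C) F F'"
    and inv: "\<And>f g x. \<lbrakk>homotopic_via C S f g; x \<in> carrier (F (Cod C f))\<rbrakk> \<Longrightarrow> F' f x = F' g x"
  shows "factors_via (op_category C) (op_category (stable_category C S)) (stable_class C S) F F'"
proof -
  have o: "Ob (op_category D) = Ob D" "Arr (op_category D) = Arr D" "Dom (op_category D) = Cod D"
   "Cod (op_category D) = Dom D" "Id (op_category D) = Id D" "g \<odot>\<^bsub>op_category D\<^esub> f = f \<odot>\<^bsub>D\<^esub> g" "Add (op_category D) = Add D"
    for D :: "('o, 'm set) precat" and f g by (simp_all add: op_category_def)
  show ?thesis
    by (rule factors_viaI[OF F], unfold o op_simps)
      (use stable_category_simps[OF S] inv stable_class_eq_iff[OF S] homotopic_sym[OF S] in auto)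
qed

end

context abelian_category
begin

lemma zero_lifting:
  assumes "is_zero_object C Z" shows "lifting_property C S Z" "\<And>h A. h \<in> homs C A Z \<Longrightarrow> h = \<zero> A Z"
proof -
  have ZO: "Z \<in> Ob C" using assms by (simp add: is_zero_object_def)
  show "h = \<zero> A Z" if "h \<in> homs C A Z" for h A
    using assms that homs_Ob(1)[OF that] ZO unfolding is_zero_object_def by (metis Zero_simps in_homs)
  show "lifting_property C S Z" unfolding lifting_property_def
  proof (intro conjI allI impI ZO)
    fix j h assume "is_epi C j" "kernel_in C j S" and h: "h \<in> homs C Z (Cod C j)"
    then have j: "j \<in> Arr C" by simp
    have "h = \<zero> Z (Cod C j)" using assms h j ZO unfolding is_zero_object_def by (metis Zero_simps in_homs Cod_Ob)
    then show "\<exists>h'\<in>homs C Z (Dom C j). j \<bullet> h' = h" using j ZO by (intro bexI[of _ "\<zero> Z (Dom C j)"]) auto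
  qed
qed

lemma zero_extending: "is_zero_object C Z \<Longrightarrow> extension_property C S Z"
  using abelian_category.zero_lifting(1)[OF op_abelian, of Z S] by (simp add: extension_op lifting_op is_zero_object_def conj_ac)

end

context model_structure
begin

text \<open>A biproduct is an extension of one summand by the other. So closure under extensions
  puts it into \<open>Q\<close> and \<open>R\<close>, and thickness puts it into
  \<open>W\<close>.\<close>

lemma core_ideal: "ideal_class (core Q W R)"
  unfolding ideal_class_def
proof (intro conjI ballI)
  show "core Q W R \<subseteq> Ob C" by (auto simp: core_def)
  obtain Z where Z: "is_zero_object C Z" using zero_object by auto
  have "Z \<in> W \<inter> R" "Z \<in> Q" using zero_lifting(1)[OF Z] zero_extending[OF Z] by (simp_all only: RW_iff Q_iff)
  then show "core Q W R \<noteq> {}" by (auto simp: core_def)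
  fix P P' assume P: "P \<in> core Q W R" "P' \<in> core Q W R"
  have PO: "P \<in> Ob C" "P' \<in> Ob C" using P by (auto simp: core_def)
  obtain B i j p q where b: "is_biproduct C P P' B i j p q" using biproducts[OF PO] by blast
  have se: "short_exact C i q" by (rule short_exact_biproduct[of i P B j P' p q]) (use b in \<open>simp_all add: is_biproduct_def\<close>)
  have bs: "Dom C i = P" "Cod C q = P'" "Dom C q = B" "Cod C i = B" using b by (auto simp: is_biproduct_def)
  have "B \<in> Q" "B \<in> R" using Q_middle[OF se] R_middle[OF se] bs P by (auto simp: core_def)
  moreover have "B \<in> W" using model_facts(1) se bs P unfolding thick_def core_def by (metis IntD1 IntD2)
  ultimately have "B \<in> core Q W R" by (simp add: core_def)
  then show "\<exists>B\<in>core Q W R. \<exists>i j p q. is_biproduct C P P' B i j p q" using b by blast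
qed

end

context chosen_coresolutions
begin

lemma rExt_cov_stable:
  assumes "A \<in> Ob C"
  shows "factors_via C (stable_category C (core Q W R)) (stable_class C (core Q W R)) (\<lambda>B. rExt C K n A B) (\<lambda>g. rExt_cov C K n A g)"
  by (rule factors_via_stable[OF core_ideal rExt_cov_functor[OF assms]]) (rule rExt_cov_homotopic[OF assms])

lemma rExt_con_stable:
  assumes "B \<in> R"
  shows "factors_via (op_category C) (op_category (stable_category C (core Q W R))) (stable_class C (core Q W R))
      (\<lambda>A. rExt C K n A B) (\<lambda>f. rExt_con C K n f B)"
proof (rule factors_via_stable_op[OF core_ideal rExt_con_functor])
  fix f g x assume "homotopic_via C (core Q W R) f g" and x: "x \<in> carrier (rExt C K n (Cod C f) B)"
  then have "right_homotopic C Q W f g"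
    unfolding right_homotopic_def homotopic_via_def factors_through_class_def core_def by blast
  then show "rExt_con C K n f B x = rExt_con C K n g B x" by (rule rExt_con_right_homotopic[OF assms _ x])
qed (use assms in simp)

end

section \<open>The long exact sequence of a fibration\<close>

context preadditive_category
begin

section \<open>Sign identities in the groups of arrows\<close>

definition neg_arr where "neg_arr f = \<zero> (Dom C f) (Cod C f) \<setminus> f"

lemma neg_simps [simp]:
  assumes "f \<in> Arr C" shows "neg_arr f \<in> Arr C" "Dom C (neg_arr f) = Dom C f" "Cod C (neg_arr f) = Cod C f"
    "f \<uplus> neg_arr f = \<zero> (Dom C f) (Cod C f)" "neg_arr f \<uplus> f = \<zero> (Dom C f) (Cod C f)"
  using assms by (auto simp: neg_arr_def)

lemma minus_conv_neg:
  assumes "f \<in> Arr C" "g \<in> Arr C" "Dom C f = Dom C g" "Cod C f = Cod C g"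
  shows "f \<setminus> g = f \<uplus> neg_arr g"
  using assms by (simp add: minus_eq_iff add_assoc)

lemma neg_add:
  assumes "f \<in> Arr C" "g \<in> Arr C" "Dom C f = Dom C g" "Cod C f = Cod C g"
  shows "neg_arr (f \<uplus> g) = neg_arr f \<uplus> neg_arr g"
proof -
  have "neg_arr f \<uplus> neg_arr g \<uplus> (f \<uplus> g) = (neg_arr f \<uplus> f) \<uplus> (neg_arr g \<uplus> g)"
    using assms by (simp only: add_ac neg_simps(1-3) add_simps)
  then show ?thesis unfolding neg_arr_def[of "f \<uplus> g"] using assms by (simp add: minus_eq_iff)
qed

lemma neg_neg [simp]: "f \<in> Arr C \<Longrightarrow> neg_arr (neg_arr f) = f"
  unfolding neg_arr_def[of "neg_arr f"] by (simp add: minus_eq_iff)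

text \<open>Differences become sums with negatives, which associativity and commutativity then bring
  into a normal form.\<close>

lemmas group_norm = minus_conv_neg neg_add add_ac

lemma minus_minus_swap:
  assumes "a \<in> Arr C" "b \<in> Arr C" "c \<in> Arr C" "d \<in> Arr C" "Dom C a = Dom C d" "Dom C b = Dom C d" "Dom C c = Dom C d"
    "Cod C a = Cod C d" "Cod C b = Cod C d" "Cod C c = Cod C d"
  shows "(a \<setminus> b) \<setminus> (c \<setminus> d) = (a \<setminus> c) \<setminus> (b \<setminus> d)" "(a \<uplus> b) \<setminus> (c \<uplus> d) = (a \<setminus> c) \<uplus> (b \<setminus> d)" "(a \<setminus> b) \<uplus> (c \<setminus> d) = (a \<uplus> c) \<setminus> (b \<uplus> d)"
    "(a \<uplus> b) \<uplus> (c \<uplus> d) = (a \<uplus> c) \<uplus> (b \<uplus> d)"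
  using assms by (simp_all add: group_norm)

text \<open>The first identity is the third coordinate of \<open>D \<circ> D = 0\<close>; the others
  recover a given coordinate from a correction that was subtracted from it.\<close>

lemma sum_cancel:
  assumes "a \<in> Arr C" "b \<in> Arr C" "c \<in> Arr C" "Dom C a = Dom C c" "Dom C b = Dom C c" "Cod C a = Cod C c" "Cod C b = Cod C c"
  shows "(a \<setminus> ((b \<uplus> a) \<setminus> c)) \<uplus> (b \<setminus> c) = \<zero> (Dom C c) (Cod C c)" "a \<setminus> b \<uplus> (c \<setminus> (a \<setminus> b)) = c" "(a \<setminus> (a \<setminus> b)) = b"
    "\<zero> (Dom C c) (Cod C c) \<setminus> b \<uplus> (c \<uplus> b) = c"
proof -
  define p where "p = (b \<uplus> a) \<setminus> c"
  define q where "q = a \<setminus> p"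
  define r where "r = b \<setminus> c"
  have ar: "p \<in> Arr C" "q \<in> Arr C" "r \<in> Arr C" "Dom C p = Dom C c" "Dom C q = Dom C c" "Dom C r = Dom C c"
    "Cod C p = Cod C c" "Cod C q = Cod C c" "Cod C r = Cod C c" using assms by (auto simp: p_def q_def r_def)
  have 1: "p \<uplus> c = b \<uplus> a" "q \<uplus> p = a" "r \<uplus> c = b" using assms ar by (simp_all add: p_def r_def q_def)
  have "(p \<uplus> c) \<uplus> (q \<uplus> r) = (r \<uplus> c) \<uplus> (q \<uplus> p)" using assms ar by (simp add: add_ac)
  also have "\<dots> = (p \<uplus> c) \<uplus> \<zero> (Dom C c) (Cod C c)" unfolding 1 using assms by simp
  finally show "(a \<setminus> ((b \<uplus> a) \<setminus> c)) \<uplus> (b \<setminus> c) = \<zero> (Dom C c) (Cod C c)"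
    unfolding p_def[symmetric] q_def[symmetric] r_def[symmetric] using assms ar by (subst (asm) add_cancel) auto
  show "a \<setminus> b \<uplus> (c \<setminus> (a \<setminus> b)) = c" using assms by simp
  show "(a \<setminus> (a \<setminus> b)) = b" using assms by (simp add: minus_eq_iff)
  have "\<zero> (Dom C c) (Cod C c) \<setminus> b \<uplus> (c \<uplus> b) = (\<zero> (Dom C c) (Cod C c) \<setminus> b \<uplus> b) \<uplus> c"
    using assms by (simp only: add_ac add_simps minus_simps Zero_simps Dom_Ob Cod_Ob)
  then show "\<zero> (Dom C c) (Cod C c) \<setminus> b \<uplus> (c \<uplus> b) = c" using assms by simp
qed

end

context model_structure
begin

text \<open>This and the next two lemmas are \<open>left_lift\<close> in the original degrees,
  according to whether the condition on \<open>u\<close> is imposed by a differential, by the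
  augmentation, or by nothing.\<close>

lemma lift_negative:
  assumes L: "coresolution B L" and P: "lifting_property C R P" and u: "u \<in> homs C P (obj L i)" and i: "i \<le> -2"
    and z: "diff L i \<bullet> u = \<zero> P (obj L (i + 1))"
  shows "\<exists>v\<in>homs C P (obj L (i - 1)). diff L (i - 1) \<bullet> v = u"
proof -
  define m where "m = nat (-2 - i)"
  have e: "- 1 - int (Suc m) = i" "-1 - int m = i + 1" "-1 - int (Suc (Suc m)) = i - 1" "-2 - int m = i" "-2 - int (Suc m) = i - 1"
    using i by (auto simp: m_def)
  show ?thesis using left_lift[OF L P, of u "Suc (Suc m)"] u z unfolding half_simps e diff_Suc_1 by blast
qed

lemma lift_degree_minus_1:
  assumes L: "coresolution B L" and P: "lifting_property C R P" and u: "u \<in> homs C P (obj L (-1))"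
    and z: "aug L \<bullet> u = \<zero> P B"
  shows "\<exists>v\<in>homs C P (obj L (-2)). diff L (-2) \<bullet> v = u"
  using left_lift[OF L P, of u "Suc 0"] u z by simp

lemma lift_aug:
  assumes L: "coresolution B L" and P: "lifting_property C R P" and u: "u \<in> homs C P B"
  shows "\<exists>v\<in>homs C P (obj L (-1)). aug L \<bullet> v = u"
  using left_lift[OF L P, of u 0] u by simp

end

text \<open>
  The components of a morphism into the total complex of \<open>X \<rightarrow> Y \<rightarrow> Z\<close> in degree \<open>n\<close> are a triple of morphisms into
  \<open>X\<^sup>n\<^sup>+\<^sup>1\<close>, \<open>Y\<^sup>n\<close> and \<open>Z\<^sup>n\<^sup>-\<^sup>1\<close>. The condition \<open>s 0 = 0\<close> makes the components in nonnegative degrees a subcomplex.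
\<close>

locale fibration_complexes = model_structure C Q W R for C :: "('o, 'm) precat" and Q W R +
  fixes k g :: 'm and X Y Z :: "('o, 'm) coresolution" and \<alpha> \<beta> s :: "int \<Rightarrow> 'm"
  assumes se: "short_exact C k g" and kR: "Dom C k \<in> R"
    and X: "model_coresolution C Q W R (Dom C k) X" and Y: "model_coresolution C Q W R (Dom C g) Y"
    and Z: "model_coresolution C Q W R (Cod C g) Z"
    and \<alpha>: "extends_to C X Y k \<alpha>" and \<beta>: "extends_to C Y Z g \<beta>"
    and s: "s i \<in> homs C (obj X i) (obj Z (i - 1))" and s0: "s 0 = Zero C (obj X 0) (obj Z (-1))"
    and \<beta>\<alpha>: "\<beta> i \<bullet> \<alpha> i = diff Z (i - 1) \<bullet> s i \<uplus> s (i + 1) \<bullet> diff X i"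
begin

definition T :: "int \<Rightarrow> 'o \<Rightarrow> ('m \<times> 'm \<times> 'm) set" where
  "T n A = homs C A (obj X (n + 1)) \<times> homs C A (obj Y n) \<times> homs C A (obj Z (n - 1))"
definition zeroT :: "int \<Rightarrow> 'o \<Rightarrow> 'm \<times> 'm \<times> 'm" where
  "zeroT n A = (\<zero> A (obj X (n + 1)), \<zero> A (obj Y n), \<zero> A (obj Z (n - 1)))"
definition subT :: "'m \<times> 'm \<times> 'm \<Rightarrow> 'm \<times> 'm \<times> 'm \<Rightarrow> 'm \<times> 'm \<times> 'm" where
  "subT = (\<lambda>(x, y, z) (x', y', z'). (x \<setminus> x', y \<setminus> y', z \<setminus> z'))"
definition addT :: "'m \<times> 'm \<times> 'm \<Rightarrow> 'm \<times> 'm \<times> 'm \<Rightarrow> 'm \<times> 'm \<times> 'm" where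
  "addT = (\<lambda>(x, y, z) (x', y', z'). (x \<uplus> x', y \<uplus> y', z \<uplus> z'))"
definition actT :: "'m \<times> 'm \<times> 'm \<Rightarrow> 'm \<Rightarrow> 'm \<times> 'm \<times> 'm" where
  "actT = (\<lambda>(x, y, z) f. (x \<bullet> f, y \<bullet> f, z \<bullet> f))"
text \<open>The signs make the square of \<open>D\<close> zero: the \<open>Y\<close> terms cancel
  because \<open>\<alpha>\<close> and \<open>\<beta>\<close> commute with the differentials, and the
  remaining terms in \<open>x\<close> cancel by the homotopy identity for
  \<open>\<beta> \<bullet> \<alpha>\<close>.\<close>

definition D :: "int \<Rightarrow> 'm \<times> 'm \<times> 'm \<Rightarrow> 'm \<times> 'm \<times> 'm" where
  "D n = (\<lambda>(x, y, z). (diff X (n + 1) \<bullet> x, \<alpha> (n + 1) \<bullet> x \<setminus> diff Y n \<bullet> y, (s (n + 1) \<bullet> x \<setminus> \<beta> n \<bullet> y) \<uplus> diff Z (n - 1) \<bullet> z))"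
text \<open>The image of a triple in the quotient by the nonnegative entries, represented inside
  \<open>T\<close> with zeros in the omitted places. Thus
  \<open>neg_part n A \<xi> = zeroT n A\<close> says that \<open>\<xi>\<close> lies in the
  subcomplex, and equations between negative parts are equations in the quotient. Each coordinate is
  tested by its own degree, \<open>n + 1\<close>, \<open>n\<close> or \<open>n - 1\<close>.\<close>

definition neg_part :: "int \<Rightarrow> 'o \<Rightarrow> 'm \<times> 'm \<times> 'm \<Rightarrow> 'm \<times> 'm \<times> 'm" where
  "neg_part n A = (\<lambda>(x, y, z). (if n + 1 < 0 then x else \<zero> A (obj X (n + 1)), if n < 0 then y else \<zero> A (obj Y n),
     if n - 1 < 0 then z else \<zero> A (obj Z (n - 1))))"

lemmas arrX = coresolution_arr[OF X] and arrY = coresolution_arr[OF Y] and arrZ = coresolution_arr[OF Z]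

section \<open>Additivity and naturality of the calculus of triples\<close>

lemma arrs [simp]:
  "diff X i \<in> Arr C" "Dom C (diff X i) = obj X i" "Cod C (diff X i) = obj X (i + 1)" "obj X i \<in> Ob C"
  "diff Y i \<in> Arr C" "Dom C (diff Y i) = obj Y i" "Cod C (diff Y i) = obj Y (i + 1)" "obj Y i \<in> Ob C"
  "diff Z i \<in> Arr C" "Dom C (diff Z i) = obj Z i" "Cod C (diff Z i) = obj Z (i + 1)" "obj Z i \<in> Ob C"
  "\<alpha> i \<in> Arr C" "Dom C (\<alpha> i) = obj X i" "Cod C (\<alpha> i) = obj Y i" "\<beta> i \<in> Arr C" "Dom C (\<beta> i) = obj Y i" "Cod C (\<beta> i) = obj Z i"
  "s i \<in> Arr C" "Dom C (s i) = obj X i" "Cod C (s i) = obj Z (i - 1)"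
  using arrX arrY arrZ extends_toD(1)[OF \<alpha>, of i] extends_toD(1)[OF \<beta>, of i] s[of i] by auto

lemma TI: "\<lbrakk>x \<in> homs C A (obj X (n + 1)); y \<in> homs C A (obj Y n); z \<in> homs C A (obj Z (n - 1))\<rbrakk> \<Longrightarrow> (x, y, z) \<in> T n A"
  by (simp add: T_def)

lemma T_subT: "\<lbrakk>A \<in> Ob C; \<xi> \<in> T n A; \<xi>' \<in> T n A\<rbrakk> \<Longrightarrow> subT \<xi> \<xi>' \<in> T n A"
  and T_addT: "\<lbrakk>A \<in> Ob C; \<xi> \<in> T n A; \<xi>' \<in> T n A\<rbrakk> \<Longrightarrow> addT \<xi> \<xi>' \<in> T n A"
  by (auto simp: T_def subT_def addT_def)

lemma T_actT: "\<lbrakk>\<xi> \<in> T n A; f \<in> homs C A' A\<rbrakk> \<Longrightarrow> actT \<xi> f \<in> T n A'"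
  by (auto simp: T_def actT_def)

lemma T_zero: "A \<in> Ob C \<Longrightarrow> zeroT n A \<in> T n A" by (auto simp: T_def zeroT_def)

lemma T_D: "\<xi> \<in> T n A \<Longrightarrow> D n \<xi> \<in> T (n + 1) A"
  by (auto simp: T_def D_def)

lemma T_neg: "A \<in> Ob C \<Longrightarrow> \<xi> \<in> T n A \<Longrightarrow> neg_part n A \<xi> \<in> T n A"
  by (auto simp: T_def neg_part_def)

lemma D_zero: "A \<in> Ob C \<Longrightarrow> D n (zeroT n A) = zeroT (n + 1) A"
  by (simp add: D_def zeroT_def)

lemma D_sub: "\<lbrakk>A \<in> Ob C; \<xi> \<in> T n A; \<xi>' \<in> T n A\<rbrakk> \<Longrightarrow> D n (subT \<xi> \<xi>') = subT (D n \<xi>) (D n \<xi>')"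
proof -
  assume A: "A \<in> Ob C" and "\<xi> \<in> T n A" "\<xi>' \<in> T n A"
  then obtain x y z x' y' z' where \<xi>: "\<xi> = (x, y, z)" "\<xi>' = (x', y', z')" and t: "x \<in> Arr C" "Dom C x = A" "Cod C x = obj X (n + 1)"
    "y \<in> Arr C" "Dom C y = A" "Cod C y = obj Y n" "z \<in> Arr C" "Dom C z = A" "Cod C z = obj Z (n - 1)"
    "x' \<in> Arr C" "Dom C x' = A" "Cod C x' = obj X (n + 1)"
    "y' \<in> Arr C" "Dom C y' = A" "Cod C y' = obj Y n" "z' \<in> Arr C" "Dom C z' = A" "Cod C z' = obj Z (n - 1)"
    by (auto simp: T_def)
  have 2: "\<alpha> (n + 1) \<bullet> (x \<setminus> x') \<setminus> diff Y n \<bullet> (y \<setminus> y') = (\<alpha> (n + 1) \<bullet> x \<setminus> diff Y n \<bullet> y) \<setminus> (\<alpha> (n + 1) \<bullet> x' \<setminus> diff Y n \<bullet> y')"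
    using t by (simp, subst minus_minus_swap(1)) simp_all
  have "(s (n + 1) \<bullet> (x \<setminus> x') \<setminus> \<beta> n \<bullet> (y \<setminus> y')) \<uplus> diff Z (n - 1) \<bullet> (z \<setminus> z') =
      ((s (n + 1) \<bullet> x \<setminus> \<beta> n \<bullet> y) \<setminus> (s (n + 1) \<bullet> x' \<setminus> \<beta> n \<bullet> y')) \<uplus> (diff Z (n - 1) \<bullet> z \<setminus> diff Z (n - 1) \<bullet> z')"
    using t by (simp, subst minus_minus_swap(1)) simp_all
  also have "\<dots> = ((s (n + 1) \<bullet> x \<setminus> \<beta> n \<bullet> y) \<uplus> diff Z (n - 1) \<bullet> z) \<setminus> ((s (n + 1) \<bullet> x' \<setminus> \<beta> n \<bullet> y') \<uplus> diff Z (n - 1) \<bullet> z')"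
    by (rule minus_minus_swap(3)) (use t in simp_all)
  finally show ?thesis using t 2 unfolding \<xi> subT_def D_def by simp
qed

lemma D_add: "\<lbrakk>A \<in> Ob C; \<xi> \<in> T n A; \<xi>' \<in> T n A\<rbrakk> \<Longrightarrow> D n (addT \<xi> \<xi>') = addT (D n \<xi>) (D n \<xi>')"
proof -
  assume A: "A \<in> Ob C" and "\<xi> \<in> T n A" "\<xi>' \<in> T n A"
  then obtain x y z x' y' z' where \<xi>: "\<xi> = (x, y, z)" "\<xi>' = (x', y', z')" and t: "x \<in> Arr C" "Dom C x = A" "Cod C x = obj X (n + 1)"
    "y \<in> Arr C" "Dom C y = A" "Cod C y = obj Y n" "z \<in> Arr C" "Dom C z = A" "Cod C z = obj Z (n - 1)"
    "x' \<in> Arr C" "Dom C x' = A" "Cod C x' = obj X (n + 1)"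
    "y' \<in> Arr C" "Dom C y' = A" "Cod C y' = obj Y n" "z' \<in> Arr C" "Dom C z' = A" "Cod C z' = obj Z (n - 1)"
    by (auto simp: T_def)
  have 2: "\<alpha> (n + 1) \<bullet> (x \<uplus> x') \<setminus> diff Y n \<bullet> (y \<uplus> y') = (\<alpha> (n + 1) \<bullet> x \<setminus> diff Y n \<bullet> y) \<uplus> (\<alpha> (n + 1) \<bullet> x' \<setminus> diff Y n \<bullet> y')"
    using t by (simp, subst minus_minus_swap(2)) simp_all
  have "(s (n + 1) \<bullet> (x \<uplus> x') \<setminus> \<beta> n \<bullet> (y \<uplus> y')) \<uplus> diff Z (n - 1) \<bullet> (z \<uplus> z') =
      ((s (n + 1) \<bullet> x \<setminus> \<beta> n \<bullet> y) \<uplus> (s (n + 1) \<bullet> x' \<setminus> \<beta> n \<bullet> y')) \<uplus> (diff Z (n - 1) \<bullet> z \<uplus> diff Z (n - 1) \<bullet> z')"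
    using t by (simp, subst minus_minus_swap(2)) simp_all
  also have "\<dots> = ((s (n + 1) \<bullet> x \<setminus> \<beta> n \<bullet> y) \<uplus> diff Z (n - 1) \<bullet> z) \<uplus> ((s (n + 1) \<bullet> x' \<setminus> \<beta> n \<bullet> y') \<uplus> diff Z (n - 1) \<bullet> z')"
    by (rule minus_minus_swap(4)) (use t in simp_all)
  finally show ?thesis using t 2 unfolding \<xi> addT_def D_def by simp
qed

lemma D_act: "\<lbrakk>\<xi> \<in> T n A; f \<in> homs C A' A\<rbrakk> \<Longrightarrow> D n (actT \<xi> f) = actT (D n \<xi>) f"
  by (auto simp: T_def D_def actT_def)

lemma dd: "x \<in> Arr C \<Longrightarrow> Cod C x = obj X i \<Longrightarrow> diff X (i + 1) \<bullet> (diff X i \<bullet> x) = \<zero> (Dom C x) (obj X (i + 1 + 1))"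
  "x \<in> Arr C \<Longrightarrow> Cod C x = obj Y i \<Longrightarrow> diff Y (i + 1) \<bullet> (diff Y i \<bullet> x) = \<zero> (Dom C x) (obj Y (i + 1 + 1))"
  "x \<in> Arr C \<Longrightarrow> Cod C x = obj Z i \<Longrightarrow> diff Z (i + 1) \<bullet> (diff Z i \<bullet> x) = \<zero> (Dom C x) (obj Z (i + 1 + 1))"
  using comp_reduce[OF arrX(12)[of i], of x] comp_reduce[OF arrY(12)[of i], of x] comp_reduce[OF arrZ(12)[of i], of x]
  by simp_all

lemma chain:
  "x \<in> Arr C \<Longrightarrow> Cod C x = obj X i \<Longrightarrow> \<alpha> (i + 1) \<bullet> (diff X i \<bullet> x) = diff Y i \<bullet> (\<alpha> i \<bullet> x)"
  "x \<in> Arr C \<Longrightarrow> Cod C x = obj Y i \<Longrightarrow> \<beta> (i + 1) \<bullet> (diff Y i \<bullet> x) = diff Z i \<bullet> (\<beta> i \<bullet> x)"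
  "x \<in> Arr C \<Longrightarrow> Cod C x = obj X i \<Longrightarrow> \<beta> i \<bullet> (\<alpha> i \<bullet> x) = diff Z (i - 1) \<bullet> (s i \<bullet> x) \<uplus> s (i + 1) \<bullet> (diff X i \<bullet> x)"
  using comp_reduce[OF extends_toD(2)[OF \<alpha>, of i], of x] comp_reduce[OF extends_toD(2)[OF \<beta>, of i], of x]
   comp_reduce[OF \<beta>\<alpha>[of i], of x] by simp_all

lemma D_D:
  assumes "A \<in> Ob C" "\<xi> \<in> T n A" shows "D (n + 1) (D n \<xi>) = zeroT (n + 1 + 1) A"
proof -
  obtain x y z where \<xi>: "\<xi> = (x, y, z)" and t: "x \<in> Arr C" "Dom C x = A" "Cod C x = obj X (n + 1)"
    "y \<in> Arr C" "Dom C y = A" "Cod C y = obj Y n" "z \<in> Arr C" "Dom C z = A" "Cod C z = obj Z (n - 1)"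
    using assms(2) by (auto simp: T_def)
  have 1: "diff X (n + 1 + 1) \<bullet> (diff X (n + 1) \<bullet> x) = \<zero> A (obj X (n + 1 + 1 + 1))" using dd(1)[of x "n + 1"] t by simp
  have 2: "\<alpha> (n + 1 + 1) \<bullet> (diff X (n + 1) \<bullet> x) = diff Y (n + 1) \<bullet> (\<alpha> (n + 1) \<bullet> x)" using chain(1)[of x "n + 1"] t by simp
  have 3: "diff Y (n + 1) \<bullet> (diff Y n \<bullet> y) = \<zero> A (obj Y (n + 1 + 1))" using dd(2)[of y n] t by simp
  have 4: "\<beta> (n + 1) \<bullet> (diff Y n \<bullet> y) = diff Z n \<bullet> (\<beta> n \<bullet> y)" using chain(2)[of y n] t by simp
  have 5: "\<beta> (n + 1) \<bullet> (\<alpha> (n + 1) \<bullet> x) = diff Z n \<bullet> (s (n + 1) \<bullet> x) \<uplus> s (n + 1 + 1) \<bullet> (diff X (n + 1) \<bullet> x)"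
    using chain(3)[of x "n + 1"] t by simp
  have 6: "diff Z n \<bullet> (diff Z (n - 1) \<bullet> z) = \<zero> A (obj Z (n + 1))" using dd(3)[of z "n - 1"] t by simp
  have c1: "diff Z n \<bullet> (s (n + 1) \<bullet> x \<setminus> \<beta> n \<bullet> y \<uplus> diff Z (n - 1) \<bullet> z) = diff Z n \<bullet> (s (n + 1) \<bullet> x) \<setminus> diff Z n \<bullet> (\<beta> n \<bullet> y)"
    using t assms(1) 6 by simp
  have c2: "\<beta> (n + 1) \<bullet> (\<alpha> (n + 1) \<bullet> x \<setminus> diff Y n \<bullet> y) = (diff Z n \<bullet> (s (n + 1) \<bullet> x) \<uplus> s (n + 1 + 1) \<bullet> (diff X (n + 1) \<bullet> x)) \<setminus> diff Z n \<bullet> (\<beta> n \<bullet> y)"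
    using t 4 5 by simp
  have 7: "(s (n + 1 + 1) \<bullet> (diff X (n + 1) \<bullet> x) \<setminus> \<beta> (n + 1) \<bullet> (\<alpha> (n + 1) \<bullet> x \<setminus> diff Y n \<bullet> y)) \<uplus>
      diff Z n \<bullet> (s (n + 1) \<bullet> x \<setminus> \<beta> n \<bullet> y \<uplus> diff Z (n - 1) \<bullet> z) = \<zero> A (obj Z (n + 1))"
    unfolding c1 c2
    using sum_cancel(1)[of "s (n + 1 + 1) \<bullet> (diff X (n + 1) \<bullet> x)" "diff Z n \<bullet> (s (n + 1) \<bullet> x)" "diff Z n \<bullet> (\<beta> n \<bullet> y)"] t
    by (simp del: comp_minus add: add.commute[of 1 n])
  have 8: "\<alpha> (n + 1 + 1) \<bullet> (diff X (n + 1) \<bullet> x) \<setminus> diff Y (n + 1) \<bullet> (\<alpha> (n + 1) \<bullet> x \<setminus> diff Y n \<bullet> y) = \<zero> A (obj Y (n + 1 + 1))"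
    unfolding 2 using 3 t assms(1) by simp
  show ?thesis unfolding \<xi> D_def prod.case zeroT_def using 1 7 8 by (simp add: add.commute[of 1 n])
qed

lemma act_act: "\<lbrakk>\<xi> \<in> T n A; f \<in> homs C A' A; f' \<in> homs C A'' A'\<rbrakk> \<Longrightarrow> actT (actT \<xi> f) f' = actT \<xi> (f \<bullet> f')"
  by (auto simp: T_def actT_def)

lemma act_sub: "\<lbrakk>\<xi> \<in> T n A; \<xi>' \<in> T n A; f \<in> homs C A' A\<rbrakk> \<Longrightarrow> actT (subT \<xi> \<xi>') f = subT (actT \<xi> f) (actT \<xi>' f)"
  by (auto simp: T_def actT_def subT_def)

lemma act_zero: "\<lbrakk>A \<in> Ob C; f \<in> homs C A' A\<rbrakk> \<Longrightarrow> actT (zeroT n A) f = zeroT n A'"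
  by (auto simp: zeroT_def actT_def)

lemma act_by_zero: "\<lbrakk>\<xi> \<in> T n A; A' \<in> Ob C\<rbrakk> \<Longrightarrow> actT \<xi> (\<zero> A' A) = zeroT n A'"
  by (auto simp: T_def zeroT_def actT_def)

lemma act_Id: "\<xi> \<in> T n A \<Longrightarrow> actT \<xi> (Id C A) = \<xi>"
  by (auto simp: T_def actT_def)

lemma act_epi_cancel: "\<lbrakk>is_epi C p; Cod C p = A; \<xi> \<in> T n A; \<xi>' \<in> T n A; actT \<xi> p = actT \<xi>' p\<rbrakk> \<Longrightarrow> \<xi> = \<xi>'"
  by (auto simp: T_def actT_def intro: epiD)

lemma sub_self: "A \<in> Ob C \<Longrightarrow> \<xi> \<in> T n A \<Longrightarrow> subT \<xi> \<xi> = zeroT n A"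
  by (auto simp: T_def subT_def zeroT_def)

lemma sub_zero: "\<lbrakk>A \<in> Ob C; \<xi> \<in> T n A\<rbrakk> \<Longrightarrow> subT \<xi> (zeroT n A) = \<xi>"
  by (auto simp: T_def subT_def zeroT_def)

lemma sub_add: "\<lbrakk>A \<in> Ob C; \<xi> \<in> T n A; \<xi>' \<in> T n A\<rbrakk> \<Longrightarrow> addT (subT \<xi> \<xi>') \<xi>' = \<xi>"
  by (auto simp: T_def subT_def addT_def)

lemma neg_sub: "\<lbrakk>A \<in> Ob C; \<xi> \<in> T n A; \<xi>' \<in> T n A\<rbrakk> \<Longrightarrow> neg_part n A (subT \<xi> \<xi>') = subT (neg_part n A \<xi>) (neg_part n A \<xi>')"
  by (auto simp: T_def neg_part_def subT_def)

lemma neg_add: "\<lbrakk>A \<in> Ob C; \<xi> \<in> T n A; \<xi>' \<in> T n A\<rbrakk> \<Longrightarrow> neg_part n A (addT \<xi> \<xi>') = addT (neg_part n A \<xi>) (neg_part n A \<xi>')"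
  by (auto simp: T_def neg_part_def addT_def)

lemma neg_act: "\<lbrakk>A \<in> Ob C; \<xi> \<in> T n A; f \<in> homs C A' A\<rbrakk> \<Longrightarrow> neg_part n A' (actT \<xi> f) = actT (neg_part n A \<xi>) f"
  by (auto simp: T_def neg_part_def actT_def)

lemma neg_zero: "neg_part n A (zeroT n A) = zeroT n A"
  by (auto simp: neg_part_def zeroT_def)

text \<open>No component of \<open>D\<close> leads from a nonnegative degree to a negative one. The
  only candidate is \<open>s 0\<close>, which maps degree 0 to degree \<open>-1\<close> and is
  zero.\<close>

lemma neg_D:
  assumes "A \<in> Ob C" "\<xi> \<in> T n A" shows "neg_part (n + 1) A (D n (neg_part n A \<xi>)) = neg_part (n + 1) A (D n \<xi>)"
proof -
  obtain x y z where \<xi>: "\<xi> = (x, y, z)" and t: "x \<in> Arr C" "Dom C x = A" "Cod C x = obj X (n + 1)"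
    "y \<in> Arr C" "Dom C y = A" "Cod C y = obj Y n" "z \<in> Arr C" "Dom C z = A" "Cod C z = obj Z (n - 1)"
    using assms(2) by (auto simp: T_def)
  have "s (n + 1) \<bullet> \<zero> A (obj X (n + 1)) = s (n + 1) \<bullet> x" if "\<not> n + 1 < 0" "n < 0"
  proof -
    have "n + 1 = 0" using that by simp
    then show ?thesis using t assms(1) s0 by simp
  qed
  then show ?thesis unfolding \<xi> neg_part_def D_def by auto
qed

lemma neg_part_D_zero: "\<lbrakk>A \<in> Ob C; \<xi> \<in> T n A; neg_part n A \<xi> = zeroT n A\<rbrakk> \<Longrightarrow> neg_part (n + 1) A (D n \<xi>) = zeroT (n + 1) A"
  using neg_D[of A \<xi> n] by (simp add: D_zero neg_zero)

end

context preadditive_category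
begin

text \<open>The computation behind the last lift in \<open>negative_exact_lifting\<close>: it shows
  that the corrected third coordinate is a cycle.\<close>

lemma sum_cancel_zero:
  assumes "a \<in> Arr C" "b \<in> Arr C" "c \<in> Arr C" "e \<in> Arr C" "Dom C a = Dom C e" "Dom C b = Dom C e" "Dom C c = Dom C e"
    "Cod C a = Cod C e" "Cod C b = Cod C e" "Cod C c = Cod C e" and z: "(a \<setminus> c) \<uplus> e = \<zero> (Dom C e) (Cod C e)"
  shows "e \<setminus> (b \<setminus> ((b \<uplus> a) \<setminus> c)) = \<zero> (Dom C e) (Cod C e)"
proof -
  define p where "p = (b \<uplus> a) \<setminus> c"
  define r where "r = a \<setminus> c"
  have ar: "p \<in> Arr C" "Dom C p = Dom C e" "Cod C p = Cod C e" "r \<in> Arr C" "Dom C r = Dom C e" "Cod C r = Cod C e"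
    using assms by (auto simp: p_def r_def)
  have 1: "p \<uplus> c = b \<uplus> a" "r \<uplus> c = a" using assms ar by (simp_all add: p_def r_def)
  have "c \<uplus> (e \<uplus> p) = e \<uplus> (b \<uplus> a)" using assms ar 1(1) by (simp add: add_ac flip: 1(1))
  also have "\<dots> = (r \<uplus> e) \<uplus> (b \<uplus> c)" unfolding 1(2)[symmetric] using assms ar by (simp add: add_ac)
  also have "\<dots> = c \<uplus> b" unfolding r_def z using assms by (simp add: add_commute)
  finally have "e \<uplus> p = b" using assms ar by (subst (asm) add_cancel) auto
  then have "e = b \<setminus> p" using assms ar by (subst eq_minus_iff) auto
  then show ?thesis unfolding p_def[symmetric] using assms by simp
qed

end

context abelian_category
begin

text \<open>The function \<open>F\<close> is the pairing into the product. It is part of the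
  conclusion, together with its compatibility with precomposition, because the contraction built
  from it has to be natural in the test object.\<close>

lemma lifting_biproduct:
  assumes "lifting_property C S O1" "lifting_property C S O2"
  shows "\<exists>P p1 p2 F. lifting_property C S P \<and> p1 \<in> homs C P O1 \<and> p2 \<in> homs C P O2 \<and>
    (\<forall>A. \<forall>x\<in>homs C A O1. \<forall>y\<in>homs C A O2. F x y \<in> homs C A P \<and> p1 \<bullet> F x y = x \<and> p2 \<bullet> F x y = y \<and>
      (\<forall>A'. \<forall>f\<in>homs C A' A. F (x \<bullet> f) (y \<bullet> f) = F x y \<bullet> f))"
proof -
  have O: "O1 \<in> Ob C" "O2 \<in> Ob C" using assms by (auto simp: lifting_property_def)
  obtain P i j p q where b: "P \<in> Ob C" "i \<in> Arr C" "j \<in> Arr C" "p \<in> Arr C" "q \<in> Arr C"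
    "Dom C i = O1" "Cod C i = P" "Dom C j = O2" "Cod C j = P" "Dom C p = P" "Cod C p = O1" "Dom C q = P" "Cod C q = O2"
    and bb: "p \<bullet> i = Id C O1" "q \<bullet> j = Id C O2" "q \<bullet> i = \<zero> O1 O2" "p \<bullet> j = \<zero> O2 O1" "i \<bullet> p \<uplus> j \<bullet> q = Id C P"
    using biproductE[OF O] by metis
  have r: "p \<bullet> (i \<bullet> x) = x" "q \<bullet> (i \<bullet> x) = \<zero> (Dom C x) O2" if "x \<in> Arr C" "Cod C x = O1" for x
    using comp_reduce[OF bb(1), of x] comp_reduce[OF bb(3), of x] b that O by auto
  have r': "q \<bullet> (j \<bullet> x) = x" "p \<bullet> (j \<bullet> x) = \<zero> (Dom C x) O1" if "x \<in> Arr C" "Cod C x = O2" for x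
    using comp_reduce[OF bb(2), of x] comp_reduce[OF bb(4), of x] b that O by auto
  have "lifting_property C S P" unfolding lifting_property_def
  proof (intro conjI allI impI b)
    fix e h assume e: "is_epi C e" "kernel_in C e S" "h \<in> homs C P (Cod C e)"
    obtain h1 where h1: "h1 \<in> homs C O1 (Dom C e)" "e \<bullet> h1 = h \<bullet> i" using lifting_propertyD[OF assms(1) e(1,2), of "h \<bullet> i"] e b by auto
    obtain h2 where h2: "h2 \<in> homs C O2 (Dom C e)" "e \<bullet> h2 = h \<bullet> j" using lifting_propertyD[OF assms(2) e(1,2), of "h \<bullet> j"] e b by auto
    have ea: "e \<in> Arr C" using e by simp
    have "e \<bullet> (h1 \<bullet> p \<uplus> h2 \<bullet> q) = (e \<bullet> h1) \<bullet> p \<uplus> (e \<bullet> h2) \<bullet> q" using h1(1) h2(1) b ea by simp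
    also have "\<dots> = h \<bullet> (i \<bullet> p \<uplus> j \<bullet> q)" unfolding h1(2) h2(2) using e(3) b by simp
    also have "\<dots> = h" unfolding bb using e(3) by auto
    finally show "\<exists>h'\<in>homs C P (Dom C e). e \<bullet> h' = h" using h1(1) h2(1) b by (intro bexI[of _ "h1 \<bullet> p \<uplus> h2 \<bullet> q"]) auto
  qed
  moreover have "i \<bullet> x \<uplus> j \<bullet> y \<in> homs C A P \<and> p \<bullet> (i \<bullet> x \<uplus> j \<bullet> y) = x \<and> q \<bullet> (i \<bullet> x \<uplus> j \<bullet> y) = y \<and>
      (\<forall>A'. \<forall>f\<in>homs C A' A. i \<bullet> (x \<bullet> f) \<uplus> j \<bullet> (y \<bullet> f) = (i \<bullet> x \<uplus> j \<bullet> y) \<bullet> f)"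
    if x: "x \<in> homs C A O1" and y: "y \<in> homs C A O2" for A x y
    using x y homs_Ob(1)[OF x] b r[of x] r'[of y] by simp
  moreover have "p \<in> homs C P O1" "q \<in> homs C P O2" using b by auto
  ultimately show ?thesis by (intro exI[of _ P] exI[of _ p] exI[of _ q] exI[of _ "\<lambda>x y. i \<bullet> x \<uplus> j \<bullet> y"]) blast
qed

lemma lifting_biproduct3:
  assumes "lifting_property C S O1" "lifting_property C S O2" "lifting_property C S O3"
  shows "\<exists>P p1 p2 p3 F. lifting_property C S P \<and> p1 \<in> homs C P O1 \<and> p2 \<in> homs C P O2 \<and> p3 \<in> homs C P O3 \<and>
    (\<forall>A. \<forall>x\<in>homs C A O1. \<forall>y\<in>homs C A O2. \<forall>z\<in>homs C A O3. F x y z \<in> homs C A P \<and> p1 \<bullet> F x y z = x \<and> p2 \<bullet> F x y z = y \<and> p3 \<bullet> F x y z = z \<and>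
      (\<forall>A'. \<forall>f\<in>homs C A' A. F (x \<bullet> f) (y \<bullet> f) (z \<bullet> f) = F x y z \<bullet> f))"
proof -
  obtain P p1 p2 F where P: "lifting_property C S P" "p1 \<in> homs C P O1" "p2 \<in> homs C P O2" and
    F: "\<And>A x y. x \<in> homs C A O1 \<Longrightarrow> y \<in> homs C A O2 \<Longrightarrow> F x y \<in> homs C A P \<and> p1 \<bullet> F x y = x \<and> p2 \<bullet> F x y = y \<and>
      (\<forall>A'. \<forall>f\<in>homs C A' A. F (x \<bullet> f) (y \<bullet> f) = F x y \<bullet> f)"
    using lifting_biproduct[OF assms(1,2)] by blast
  obtain P' q p3 G where P': "lifting_property C S P'" "q \<in> homs C P' P" "p3 \<in> homs C P' O3" and
    G: "\<And>A x y. x \<in> homs C A P \<Longrightarrow> y \<in> homs C A O3 \<Longrightarrow> G x y \<in> homs C A P' \<and> q \<bullet> G x y = x \<and> p3 \<bullet> G x y = y \<and>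
      (\<forall>A'. \<forall>f\<in>homs C A' A. G (x \<bullet> f) (y \<bullet> f) = G x y \<bullet> f)"
    using lifting_biproduct[OF P(1) assms(3)] by blast
  have "G (F x y) z \<in> homs C A P' \<and> (p1 \<bullet> q) \<bullet> G (F x y) z = x \<and> (p2 \<bullet> q) \<bullet> G (F x y) z = y \<and> p3 \<bullet> G (F x y) z = z \<and>
      (\<forall>A'. \<forall>f\<in>homs C A' A. G (F (x \<bullet> f) (y \<bullet> f)) (z \<bullet> f) = G (F x y) z \<bullet> f)"
    if xyz: "x \<in> homs C A O1" "y \<in> homs C A O2" "z \<in> homs C A O3" for A x y z
  proof -
    note f = F[OF xyz(1,2)]
    note g = G[OF f[THEN conjunct1] xyz(3)]
    have "(p1 \<bullet> q) \<bullet> G (F x y) z = p1 \<bullet> (q \<bullet> G (F x y) z)" "(p2 \<bullet> q) \<bullet> G (F x y) z = p2 \<bullet> (q \<bullet> G (F x y) z)"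
      using g P P' by auto
    then show ?thesis using f g by simp
  qed
  moreover have "p1 \<bullet> q \<in> homs C P' O1" "p2 \<bullet> q \<in> homs C P' O2" using P P' by auto
  ultimately show ?thesis using P'(1,3)
    by (intro exI[of _ P'] exI[of _ "p1 \<bullet> q"] exI[of _ "p2 \<bullet> q"] exI[of _ p3] exI[of _ "\<lambda>x y z. G (F x y) z"]) blast
qed

end

context fibration_complexes
begin

section \<open>Exactness of the total complex modulo nonnegative degrees\<close>

lemma T_cases:
  assumes "\<xi> \<in> T n A"
  obtains x y z where "\<xi> = (x, y, z)" "x \<in> Arr C" "Dom C x = A" "Cod C x = obj X (n + 1)"
    "y \<in> Arr C" "Dom C y = A" "Cod C y = obj Y n" "z \<in> Arr C" "Dom C z = A" "Cod C z = obj Z (n - 1)"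
  using assms by (auto simp: T_def)

lemma T_D_pred: "\<theta> \<in> T (n - 1) A \<Longrightarrow> D (n - 1) \<theta> \<in> T n A"
  using T_D[of \<theta> "n - 1" A] by simp

lemma D_zero_pred: "A \<in> Ob C \<Longrightarrow> D (n - 1) (zeroT (n - 1) A) = zeroT n A"
  using D_zero[of A "n - 1"] by simp

lemma D_D_pred: "\<lbrakk>A \<in> Ob C; \<theta> \<in> T (n - 1) A\<rbrakk> \<Longrightarrow> D n (D (n - 1) \<theta>) = zeroT (n + 1) A"
  using D_D[of A \<theta> "n - 1"] by simp

lemma D_pred: "D (n - 1) (x, y, z) = (diff X n \<bullet> x, \<alpha> n \<bullet> x \<setminus> diff Y (n - 1) \<bullet> y, (s n \<bullet> x \<setminus> \<beta> (n - 1) \<bullet> y) \<uplus> diff Z (n - 2) \<bullet> z)"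
  by (simp add: D_def)

lemma kg: "k \<in> Arr C" "g \<in> Arr C" "Cod C k = Dom C g" "Dom C g \<in> Ob C" "Cod C g \<in> Ob C" "Dom C k \<in> Ob C" "is_mono C k" "is_epi C g" "is_kernel C k g"
  using short_exact_simps[OF se] by auto

lemma augs [simp]:
  "aug X \<in> Arr C" "Dom C (aug X) = obj X (-1)" "Cod C (aug X) = Dom C k" "aug Y \<in> Arr C" "Dom C (aug Y) = obj Y (-1)" "Cod C (aug Y) = Dom C g"
  "aug Z \<in> Arr C" "Dom C (aug Z) = obj Z (-1)" "Cod C (aug Z) = Cod C g"
  "coaug X \<in> Arr C" "Dom C (coaug X) = Dom C k" "Cod C (coaug X) = obj X 0" "coaug Y \<in> Arr C" "Dom C (coaug Y) = Dom C g" "Cod C (coaug Y) = obj Y 0"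
  "coaug Z \<in> Arr C" "Dom C (coaug Z) = Cod C g" "Cod C (coaug Z) = obj Z 0"
  using arrX(4-9) arrY(4-9) arrZ(4-9) by auto

lemma aug_chain:
  "x \<in> Arr C \<Longrightarrow> Cod C x = obj X (-1) \<Longrightarrow> aug Y \<bullet> (\<alpha> (-1) \<bullet> x) = k \<bullet> (aug X \<bullet> x)"
  "x \<in> Arr C \<Longrightarrow> Cod C x = obj Y (-1) \<Longrightarrow> aug Z \<bullet> (\<beta> (-1) \<bullet> x) = g \<bullet> (aug Y \<bullet> x)"
  "x \<in> Arr C \<Longrightarrow> Cod C x = Dom C k \<Longrightarrow> \<alpha> 0 \<bullet> (coaug X \<bullet> x) = coaug Y \<bullet> (k \<bullet> x)"
  "x \<in> Arr C \<Longrightarrow> Cod C x = Dom C g \<Longrightarrow> \<beta> 0 \<bullet> (coaug Y \<bullet> x) = coaug Z \<bullet> (g \<bullet> x)"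
  using comp_reduce[OF extends_toD(3)[OF \<alpha>], of x] comp_reduce[OF extends_toD(3)[OF \<beta>], of x]
    comp_reduce[OF extends_toD(4)[OF \<alpha>], of x] comp_reduce[OF extends_toD(4)[OF \<beta>], of x] kg by simp_all

lemma aug_diff:
  "x \<in> Arr C \<Longrightarrow> Cod C x = obj Y (-2) \<Longrightarrow> aug Y \<bullet> (diff Y (-2) \<bullet> x) = \<zero> (Dom C x) (Dom C g)"
  "x \<in> Arr C \<Longrightarrow> Cod C x = obj Z (-2) \<Longrightarrow> aug Z \<bullet> (diff Z (-2) \<bullet> x) = \<zero> (Dom C x) (Cod C g)"
  "x \<in> Arr C \<Longrightarrow> Cod C x = Dom C k \<Longrightarrow> diff X 0 \<bullet> (coaug X \<bullet> x) = \<zero> (Dom C x) (obj X 1)"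
  "x \<in> Arr C \<Longrightarrow> Cod C x = Dom C g \<Longrightarrow> diff Y 0 \<bullet> (coaug Y \<bullet> x) = \<zero> (Dom C x) (obj Y 1)"
  using comp_reduce[OF exact_at_simps(4)[OF coresolution_facts(6)[OF Y]], of x]
   comp_reduce[OF exact_at_simps(4)[OF coresolution_facts(6)[OF Z]], of x]
   comp_reduce[OF exact_at_simps(4)[OF coresolution_facts(9)[OF X]], of x]
   comp_reduce[OF exact_at_simps(4)[OF coresolution_facts(9)[OF Y]], of x] kg by simp_all

lemma k_zero: "x \<in> Arr C \<Longrightarrow> Cod C x = Dom C k \<Longrightarrow> k \<bullet> x = \<zero> (Dom C x) (Dom C g) \<Longrightarrow> x = \<zero> (Dom C x) (Dom C k)"
  using mono_zero[OF kg(7), of x] kg by simp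

text \<open>
  In negative degrees the entries of the total complex have the lifting property. Exactness on test objects with that
  property therefore applies to the entries themselves and yields a natural contraction, hence exactness on all test objects.
\<close>

lemma negative_exact_lifting:
  assumes P: "lifting_property C R P" and \<xi>: "\<xi> \<in> T n P" and cl: "neg_part (n + 1) P (D n \<xi>) = zeroT (n + 1) P"
  shows "\<exists>\<theta>\<in>T (n - 1) P. neg_part n P (D (n - 1) \<theta>) = neg_part n P \<xi>"
proof -
  have PO: "P \<in> Ob C" using P by (simp add: lifting_property_def)
  obtain x y z where xyz: "\<xi> = (x, y, z)" and t: "x \<in> Arr C" "Dom C x = P" "Cod C x = obj X (n + 1)"
    "y \<in> Arr C" "Dom C y = P" "Cod C y = obj Y n" "z \<in> Arr C" "Dom C z = P" "Cod C z = obj Z (n - 1)"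
    using T_cases[OF \<xi>] by metis
  have c1: "diff X (n + 1) \<bullet> x = \<zero> P (obj X (n + 1 + 1))" if "n + 1 + 1 < 0"
    using cl that unfolding xyz D_def neg_part_def zeroT_def by simp
  have c2: "\<alpha> (n + 1) \<bullet> x \<setminus> diff Y n \<bullet> y = \<zero> P (obj Y (n + 1))" if "n + 1 < 0"
    using cl that unfolding xyz D_def neg_part_def zeroT_def by simp
  have c3: "(s (n + 1) \<bullet> x \<setminus> \<beta> n \<bullet> y) \<uplus> diff Z (n - 1) \<bullet> z = \<zero> P (obj Z n)" if "n < 0"
    using cl that unfolding xyz D_def neg_part_def zeroT_def by simp
  consider "n \<ge> 1" | "n = 0" | "n < 0" by linarith
  then show ?thesis
  proof cases
    case 1
    then have "neg_part n P \<xi> = zeroT n P" by (simp add: xyz neg_part_def zeroT_def)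
    then show ?thesis using T_zero[OF PO] by (intro bexI[of _ "zeroT (n - 1) P"]) (simp_all add: D_zero_pred PO neg_zero)
  next
    \<comment> \<open>Only \<open>z\<close>, in degree \<open>-1\<close>, survives in the quotient,
      and it satisfies no condition. Since \<open>g\<close> is epi with fibrant kernel, minus the
      augmentation of \<open>z\<close> lifts through \<open>g\<close> and then to \<open>y'\<close>;
      what remains of \<open>z\<close> is killed by the augmentation and is a differential.\<close>
    case 2
    have "aug Z \<bullet> z \<in> homs C P (Cod C g)" using t 2 by simp
    then have "\<zero> P (Cod C g) \<setminus> aug Z \<bullet> z \<in> homs C P (Cod C g)" using PO kg by simp
    moreover have "kernel_in C g R" using kg(9) kR by (auto simp: kernel_in_def)
    ultimately obtain b where b: "b \<in> homs C P (Dom C g)" "g \<bullet> b = \<zero> P (Cod C g) \<setminus> aug Z \<bullet> z"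
      using lifting_propertyD[OF P kg(8)] by blast
    obtain y' where y': "y' \<in> homs C P (obj Y (-1))" "aug Y \<bullet> y' = b" using lift_aug[OF Y P b(1)] by blast
    have "aug Z \<bullet> (z \<uplus> \<beta> (-1) \<bullet> y') = aug Z \<bullet> z \<uplus> g \<bullet> (aug Y \<bullet> y')" using t 2 y'(1) aug_chain(2)[of y'] by simp
    also have "\<dots> = \<zero> P (Cod C g)" unfolding y'(2) b(2) using t 2 PO kg by simp
    finally obtain z' where z': "z' \<in> homs C P (obj Z (-2))" "diff Z (-2) \<bullet> z' = z \<uplus> \<beta> (-1) \<bullet> y'"
      using lift_degree_minus_1[OF Z P, of "z \<uplus> \<beta> (-1) \<bullet> y'"] t 2 y'(1) by auto
    have zz: "(\<zero> P (obj Z (-1)) \<setminus> \<beta> (-1) \<bullet> y') \<uplus> (z \<uplus> \<beta> (-1) \<bullet> y') = z"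
      using sum_cancel(4)[of z "\<beta> (-1) \<bullet> y'" z] t 2 y'(1) by simp
    show ?thesis
      by (rule bexI[of _ "(\<zero> P (obj X n), y', z')"])
        (use t 2 y'(1) z' zz PO s0 in \<open>auto simp: D_def xyz neg_part_def T_def\<close>)
  next
    case 3
    \<comment> \<open>For \<open>n = -1\<close> the coordinate \<open>x\<close> is invisible.
      Instead \<open>x'\<close> has to correct \<open>y\<close> so that the difference is killed by
      the augmentation: the augmentation of \<open>y\<close> is killed by \<open>g\<close>, hence
      comes from \<open>Dom C k\<close>, and lifts to \<open>X\<close> in degree
      \<open>-1\<close>.\<close>
    have x'1: "\<exists>x'\<in>homs C P (obj X n). aug Y \<bullet> y = k \<bullet> (aug X \<bullet> x')" if n: "n = -1"
    proof -
      have t': "y \<in> Arr C" "Dom C y = P" "Cod C y = obj Y (-1)" "z \<in> Arr C" "Dom C z = P" "Cod C z = obj Z (-2)"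
        "x \<in> Arr C" "Cod C x = obj X 0" "Dom C x = P" using t n by auto
      have "(\<zero> P (obj Z (-1)) \<setminus> \<beta> (-1) \<bullet> y) \<uplus> diff Z (-2) \<bullet> z = \<zero> P (obj Z (-1))" using c3 n s0 t' PO by simp
      then have "\<beta> (-1) \<bullet> y \<uplus> ((\<zero> P (obj Z (-1)) \<setminus> \<beta> (-1) \<bullet> y) \<uplus> diff Z (-2) \<bullet> z) = \<beta> (-1) \<bullet> y" using t' PO by simp
      then have "diff Z (-2) \<bullet> z = \<beta> (-1) \<bullet> y" using t' PO by (subst (asm) add_assoc[symmetric]) simp_all
      then have "g \<bullet> (aug Y \<bullet> y) = \<zero> P (Cod C g)" using aug_chain(2)[of y] aug_diff(2)[of z] t' by simp
      then obtain \<kappa> where \<kappa>: "\<kappa> \<in> Arr C" "Dom C \<kappa> = P" "Cod C \<kappa> = Dom C k" "k \<bullet> \<kappa> = aug Y \<bullet> y"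
        using kernel_lift[OF kg(9), of "aug Y \<bullet> y"] t' by auto
      then have "\<kappa> \<in> homs C P (Dom C k)" by simp
      then obtain x' where x': "x' \<in> homs C P (obj X (-1))" "aug X \<bullet> x' = \<kappa>" using lift_aug[OF X P] by blast
      then have "x' \<in> homs C P (obj X n)" "aug Y \<bullet> y = k \<bullet> (aug X \<bullet> x')" using \<kappa>(4) n by simp_all
      then show ?thesis by blast
    qed
    \<comment> \<open>For \<open>n = -2\<close> the coordinate \<open>x\<close> sits in degree
      \<open>-1\<close>, where its augmentation has to vanish. It does because \<open>k\<close> is
      mono and the composite with \<open>k\<close> is the augmentation of a differential in
      \<open>Y\<close>.\<close>
    have x'2: "\<exists>x'\<in>homs C P (obj X n). diff X n \<bullet> x' = x" if n: "n + 1 < 0"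
    proof (cases "n = -2")
      case True
      have t': "y \<in> Arr C" "Dom C y = P" "Cod C y = obj Y (-2)" "x \<in> Arr C" "Cod C x = obj X (-1)" "Dom C x = P" using t True by auto
      have "\<alpha> (-1) \<bullet> x = diff Y (-2) \<bullet> y" using c2 True minus_eq_zero[of "\<alpha> (-1) \<bullet> x" "diff Y (-2) \<bullet> y"] t' by simp
      then have "k \<bullet> (aug X \<bullet> x) = \<zero> P (Dom C g)" using aug_chain(1)[of x] aug_diff(1)[of y] t' by simp
      then have "aug X \<bullet> x = \<zero> P (Dom C k)" using k_zero[of "aug X \<bullet> x"] t' by simp
      then show ?thesis using lift_degree_minus_1[OF X P, of x] t' True by auto
    next
      case False
      then show ?thesis using lift_negative[OF X P, of x "n + 1"] c1 t n by auto
    qed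
    have "\<exists>x'\<in>homs C P (obj X n). (n = -1 \<longrightarrow> aug Y \<bullet> y = k \<bullet> (aug X \<bullet> x')) \<and> (n + 1 < 0 \<longrightarrow> diff X n \<bullet> x' = x)"
    proof (cases "n = -1")
      case True
      then have "\<not> n + 1 < 0" by simp
      then show ?thesis using x'1[OF True] by blast
    next
      case False
      then have "n + 1 < 0" using 3 by simp
      then show ?thesis using x'2 False by blast
    qed
    then obtain x' where x'h: "x' \<in> homs C P (obj X n)" and
      xa: "n = -1 \<Longrightarrow> aug Y \<bullet> y = k \<bullet> (aug X \<bullet> x')" and xd: "n + 1 < 0 \<Longrightarrow> diff X n \<bullet> x' = x" by blast
    have x': "x' \<in> Arr C" "Dom C x' = P" "Cod C x' = obj X n" using x'h by simp_all
    have "\<exists>y'\<in>homs C P (obj Y (n - 1)). diff Y (n - 1) \<bullet> y' = \<alpha> n \<bullet> x' \<setminus> y"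
    proof (cases "n = -1")
      case True
      have "aug Y \<bullet> (\<alpha> (-1) \<bullet> x' \<setminus> y) = \<zero> P (Dom C g)" using xa[OF True] x' t True aug_chain(1)[of x'] kg by simp
      then show ?thesis using lift_degree_minus_1[OF Y P, of "\<alpha> (-1) \<bullet> x' \<setminus> y"] x' t True by simp
    next
      case False
      then have n: "n + 1 < 0" using 3 by simp
      have "diff Y n \<bullet> (\<alpha> n \<bullet> x') = \<alpha> (n + 1) \<bullet> x" using chain(1)[of x' n] x' xd[OF n] by simp
      also have "\<dots> = diff Y n \<bullet> y" using c2[OF n] minus_eq_zero[of "\<alpha> (n + 1) \<bullet> x" "diff Y n \<bullet> y"] t by simp
      finally have "diff Y n \<bullet> (\<alpha> n \<bullet> x' \<setminus> y) = \<zero> P (obj Y (n + 1))" using x' t by simp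
      then show ?thesis using lift_negative[OF Y P, of "\<alpha> n \<bullet> x' \<setminus> y" n] x' t n by simp
    qed
    then obtain y' where y': "y' \<in> Arr C" "Dom C y' = P" "Cod C y' = obj Y (n - 1)" "diff Y (n - 1) \<bullet> y' = \<alpha> n \<bullet> x' \<setminus> y" by auto
    have yy: "\<alpha> n \<bullet> x' \<setminus> diff Y (n - 1) \<bullet> y' = y" unfolding y'(4) using sum_cancel(3)[of "\<alpha> n \<bullet> x'" y y] x' t by simp
    \<comment> \<open>For \<open>n = -1\<close> the arrow \<open>x'\<close> need not be a primitive
      of \<open>x\<close>, but both sides contain \<open>s 0 = 0\<close>.\<close>
    have sx: "s (n + 1) \<bullet> (diff X n \<bullet> x') = s (n + 1) \<bullet> x"
    proof (cases "n = -1")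
      case True
      then show ?thesis using s0 x' t PO by simp
    qed (use xd 3 in simp)
    \<comment> \<open>What \<open>x'\<close> and \<open>y'\<close> leave of the third coordinate. It
      is a cycle in degree \<open>n - 1 \<le> -2\<close>, so it has a primitive
      \<open>z'\<close>.\<close>
    let ?w = "z \<setminus> (s n \<bullet> x' \<setminus> \<beta> (n - 1) \<bullet> y')"
    have "diff Z (n - 1) \<bullet> (\<beta> (n - 1) \<bullet> y') = \<beta> n \<bullet> (\<alpha> n \<bullet> x' \<setminus> y)"
      using chain(2)[of y' "n - 1"] y' by simp
    also have "\<dots> = \<beta> n \<bullet> (\<alpha> n \<bullet> x') \<setminus> \<beta> n \<bullet> y" using x' t by simp
    also have "\<beta> n \<bullet> (\<alpha> n \<bullet> x') = diff Z (n - 1) \<bullet> (s n \<bullet> x') \<uplus> s (n + 1) \<bullet> x"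
      using chain(3)[of x' n] x' sx by simp
    finally have dw: "diff Z (n - 1) \<bullet> ?w = diff Z (n - 1) \<bullet> z \<setminus> (diff Z (n - 1) \<bullet> (s n \<bullet> x') \<setminus>
        ((diff Z (n - 1) \<bullet> (s n \<bullet> x') \<uplus> s (n + 1) \<bullet> x) \<setminus> \<beta> n \<bullet> y))" using x' y'(1-3) t by simp
    have "diff Z (n - 1) \<bullet> ?w = \<zero> P (obj Z (n - 1 + 1))"
      unfolding dw using sum_cancel_zero[of "s (n + 1) \<bullet> x" "diff Z (n - 1) \<bullet> (s n \<bullet> x')" "\<beta> n \<bullet> y" "diff Z (n - 1) \<bullet> z"]
        c3[OF 3] x' t by simp
    then obtain z' where z': "z' \<in> homs C P (obj Z (n - 1 - 1))" "diff Z (n - 1 - 1) \<bullet> z' = ?w"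
      using lift_negative[OF Z P, of ?w "n - 1"] x' y'(1-3) t 3 by auto
    have zz: "(s n \<bullet> x' \<setminus> \<beta> (n - 1) \<bullet> y') \<uplus> ?w = z" using x' y'(1-3) t by simp
    show ?thesis
      by (rule bexI[of _ "(x', y', z')"])
        (use x' y'(1-3) z' yy zz xd in \<open>auto simp: D_pred xyz neg_part_def T_def\<close>)
  qed
qed

text \<open>A choice of primitives that is natural in the test object. It is constrained only on
  cocycles of the quotient and does not have to be additive; the condition on
  \<open>neg_part\<close> makes it a function on the quotient.\<close>

definition contraction :: "int \<Rightarrow> ('o \<Rightarrow> 'm \<times> 'm \<times> 'm \<Rightarrow> 'm \<times> 'm \<times> 'm) \<Rightarrow> bool" where
  "contraction n h \<longleftrightarrow> (\<forall>A\<in>Ob C. \<forall>\<xi>\<in>T n A. neg_part (n + 1) A (D n \<xi>) = zeroT (n + 1) A \<longrightarrow>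
     h A \<xi> \<in> T (n - 1) A \<and> neg_part n A (D (n - 1) (h A \<xi>)) = neg_part n A \<xi> \<and> h A (neg_part n A \<xi>) = h A \<xi> \<and>
     (\<forall>A'. \<forall>f\<in>homs C A' A. h A' (actT \<xi> f) = actT (h A \<xi>) f))"

lemma contractionD:
  assumes "contraction n h" "A \<in> Ob C" "\<xi> \<in> T n A" "neg_part (n + 1) A (D n \<xi>) = zeroT (n + 1) A"
  shows "h A \<xi> \<in> T (n - 1) A" "neg_part n A (D (n - 1) (h A \<xi>)) = neg_part n A \<xi>" "h A (neg_part n A \<xi>) = h A \<xi>"
    "f \<in> homs C A' A \<Longrightarrow> h A' (actT \<xi> f) = actT (h A \<xi>) f"
  using assms unfolding contraction_def by blast+

text \<open>A Yoneda argument. Let \<open>u\<close> be the universal element of degree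
  \<open>n\<close>, defined on the product \<open>P\<close> of the negative entries. Then
  \<open>u\<close> minus \<open>h\<close> of \<open>D n u\<close> is a cocycle on an object with the
  lifting property, so it has a primitive \<open>\<theta>\<close>. A cocycle \<open>\<xi>\<close>
  agrees modulo nonnegative entries with \<open>u\<close> composed with some arrow; along this arrow
  \<open>D n u\<close> becomes zero in the quotient, hence so does its image under \<open>h\<close>,
  and \<open>\<theta>\<close> composed with the arrow is a primitive of
  \<open>\<xi>\<close>.\<close>

lemma contraction_step:
  assumes h: "contraction (n + 1) h" shows "\<exists>h. contraction n h"
proof -
  obtain Z0 where Z0: "is_zero_object C Z0" using zero_object by blast
  note z0 = zero_lifting[OF Z0]
  have ZO: "Z0 \<in> Ob C" using Z0 by (simp add: is_zero_object_def)
  have Z0QW: "Z0 \<in> Q \<inter> W" by (simp only: QW_iff z0(1))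
  \<comment> \<open>Entries in nonnegative degrees need not have the lifting property; a zero object
    takes their place.\<close>
  define O1 where "O1 = (if n + 1 < 0 then obj X (n + 1) else Z0)"
  define O2 where "O2 = (if n < 0 then obj Y n else Z0)"
  define O3 where "O3 = (if n - 1 < 0 then obj Z (n - 1) else Z0)"
  have "lifting_property C R O1" "lifting_property C R O2" "lifting_property C R O3"
    using Z0QW coresolution_facts(10)[OF X, of "n + 1"] coresolution_facts(10)[OF Y, of n] coresolution_facts(10)[OF Z, of "n - 1"]
    by (simp_all add: O1_def O2_def O3_def flip: QW_iff)
  from lifting_biproduct3[OF this] obtain P p1 p2 p3 F where P: "lifting_property C R P"
    and p: "p1 \<in> homs C P O1" "p2 \<in> homs C P O2" "p3 \<in> homs C P O3" and
    F: "\<And>A x y z. x \<in> homs C A O1 \<Longrightarrow> y \<in> homs C A O2 \<Longrightarrow> z \<in> homs C A O3 \<Longrightarrow> F x y z \<in> homs C A P \<and>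
      p1 \<bullet> F x y z = x \<and> p2 \<bullet> F x y z = y \<and> p3 \<bullet> F x y z = z \<and> (\<forall>A'. \<forall>f\<in>homs C A' A. F (x \<bullet> f) (y \<bullet> f) (z \<bullet> f) = F x y z \<bullet> f)"
    by blast
  have PO: "P \<in> Ob C" using P by (simp add: lifting_property_def)
  \<comment> \<open>The universal element consists of the projections of \<open>P\<close> on the
    negative entries, and of zeros elsewhere.\<close>
  define u where "u = (if n + 1 < 0 then p1 else \<zero> P (obj X (n + 1)), if n < 0 then p2 else \<zero> P (obj Y n), if n - 1 < 0 then p3 else \<zero> P (obj Z (n - 1)))"
  have u: "u \<in> T n P" using p PO unfolding u_def T_def O1_def O2_def O3_def by auto
  define fac where "fac A = (\<lambda>(x, y, z). F (if n + 1 < 0 then x else \<zero> A Z0) (if n < 0 then y else \<zero> A Z0) (if n - 1 < 0 then z else \<zero> A Z0))" for A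
  have fac: "fac A \<xi> \<in> homs C A P" "neg_part n A (actT u (fac A \<xi>)) = neg_part n A \<xi>" "fac A (neg_part n A \<xi>) = fac A \<xi>"
    "f \<in> homs C A' A \<Longrightarrow> fac A' (actT \<xi> f) = fac A \<xi> \<bullet> f"
    if A: "A \<in> Ob C" and \<xi>: "\<xi> \<in> T n A" for A \<xi> A' f
  proof -
    obtain x y z where xyz: "\<xi> = (x, y, z)" and t: "x \<in> Arr C" "Dom C x = A" "Cod C x = obj X (n + 1)"
      "y \<in> Arr C" "Dom C y = A" "Cod C y = obj Y n" "z \<in> Arr C" "Dom C z = A" "Cod C z = obj Z (n - 1)"
      using T_cases[OF \<xi>] by metis
    define x' where "x' = (if n + 1 < 0 then x else \<zero> A Z0)"
    define y' where "y' = (if n < 0 then y else \<zero> A Z0)"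
    define z' where "z' = (if n - 1 < 0 then z else \<zero> A Z0)"
    have "x' \<in> homs C A O1" "y' \<in> homs C A O2" "z' \<in> homs C A O3"
      using t A ZO by (auto simp: x'_def y'_def z'_def O1_def O2_def O3_def)
    note f = F[OF this]
    have fe: "fac A \<xi> = F x' y' z'" by (simp add: fac_def xyz x'_def y'_def z'_def)
    show "fac A \<xi> \<in> homs C A P" unfolding fe using f by blast
    show "fac A (neg_part n A \<xi>) = fac A \<xi>" by (simp add: fac_def xyz neg_part_def)
    show "neg_part n A (actT u (fac A \<xi>)) = neg_part n A \<xi>"
    proof -
      have "neg_part n A (actT u (F x' y' z')) = neg_part n A (x, y, z)"
        using f unfolding u_def actT_def neg_part_def by (auto simp: x'_def y'_def z'_def)
      then show ?thesis unfolding fe by (simp add: xyz)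
    qed
    assume ff: "f \<in> homs C A' A"
    have "fac A' (actT \<xi> f) = F (x' \<bullet> f) (y' \<bullet> f) (z' \<bullet> f)"
      using ff ZO by (auto simp: fac_def xyz actT_def x'_def y'_def z'_def)
    also have "\<dots> = F x' y' z' \<bullet> f" using f ff by blast
    finally show "fac A' (actT \<xi> f) = fac A \<xi> \<bullet> f" unfolding fe .
  qed
  have Du: "D n u \<in> T (n + 1) P" "neg_part (n + 1 + 1) P (D (n + 1) (D n u)) = zeroT (n + 1 + 1) P"
    using T_D[OF u] D_D[OF PO u] by (simp_all add: neg_zero)
  note hu = contractionD[OF h PO Du]
  have hT: "h P (D n u) \<in> T n P" using hu(1) by simp
  have hD: "neg_part (n + 1) P (D n (h P (D n u))) = neg_part (n + 1) P (D n u)" using hu(2) by simp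
  \<comment> \<open>Subtracting a primitive of \<open>D n u\<close> turns the universal element into
    a cocycle without affecting its role for cocycles \<open>\<xi>\<close>.\<close>
  let ?\<zeta> = "subT u (h P (D n u))"
  have \<zeta>: "?\<zeta> \<in> T n P" by (rule T_subT[OF PO u hT])
  have "neg_part (n + 1) P (D n ?\<zeta>) = zeroT (n + 1) P"
    using hD T_D[OF u] T_D[OF hT] T_neg[OF PO T_D[OF u]] PO u hT by (simp add: D_sub neg_sub sub_self)
  from negative_exact_lifting[OF P \<zeta> this] obtain \<theta> where \<theta>: "\<theta> \<in> T (n - 1) P" "neg_part n P (D (n - 1) \<theta>) = neg_part n P ?\<zeta>" by blast
  have "contraction n (\<lambda>A \<xi>. actT \<theta> (fac A \<xi>))"
    unfolding contraction_def
  proof (intro ballI impI conjI allI)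
    fix A \<xi> assume A: "A \<in> Ob C" and \<xi>: "\<xi> \<in> T n A" and cl: "neg_part (n + 1) A (D n \<xi>) = zeroT (n + 1) A"
    note f = fac[OF A \<xi>]
    show "actT \<theta> (fac A \<xi>) \<in> T (n - 1) A" by (rule T_actT[OF \<theta>(1) f(1)])
    show "actT \<theta> (fac A (neg_part n A \<xi>)) = actT \<theta> (fac A \<xi>)" using f by simp
    show "actT \<theta> (fac A' (actT \<xi> f)) = actT (actT \<theta> (fac A \<xi>)) f" if "f \<in> homs C A' A" for A' f
      unfolding fac(4)[OF A \<xi> that] act_act[OF \<theta>(1) f(1) that] ..
    let ?f = "fac A \<xi>"
    have uf: "actT u ?f \<in> T n A" by (rule T_actT[OF u f(1)])
    have Duf: "actT (D n u) ?f \<in> T (n + 1) A" by (rule T_actT[OF T_D[OF u] f(1)])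
    have "neg_part (n + 1) A (actT (D n u) ?f) = neg_part (n + 1) A (D n (actT u ?f))"
      using D_act[OF u f(1)] by simp
    also have "\<dots> = neg_part (n + 1) A (D n (neg_part n A \<xi>))" using neg_D[OF A uf] f(2) by simp
    also have "\<dots> = zeroT (n + 1) A" using neg_D[OF A \<xi>] cl by simp
    finally have 0: "neg_part (n + 1) A (actT (D n u) ?f) = zeroT (n + 1) A" .
    have DDu: "neg_part (n + 1 + 1) A (D (n + 1) (actT (D n u) ?f)) = zeroT (n + 1 + 1) A"
      using D_act[OF T_D[OF u] f(1)] D_D[OF PO u] act_zero[OF PO f(1)] by (simp add: neg_zero)
    have z: "neg_part (n + 1 + 1) A (D (n + 1) (zeroT (n + 1) A)) = zeroT (n + 1 + 1) A"
      using D_zero[OF A] by (simp add: neg_zero)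
    \<comment> \<open>As \<open>h\<close> is not known to be additive, \<open>h 0 = 0\<close> is
      obtained from naturality along the zero endomorphism.\<close>
    have zA: "\<zero> A A \<in> homs C A A" using A by simp
    have "h A (zeroT (n + 1) A) = h A (actT (zeroT (n + 1) A) (\<zero> A A))" using act_zero[OF A zA] by simp
    also have "\<dots> = actT (h A (zeroT (n + 1) A)) (\<zero> A A)" by (rule contractionD(4)[OF h A T_zero[OF A] z zA])
    also have "\<dots> = zeroT n A" using act_by_zero[OF contractionD(1)[OF h A T_zero[OF A] z] A] by simp
    finally have hz: "h A (zeroT (n + 1) A) = zeroT n A" .
    have "actT (h P (D n u)) ?f = h A (actT (D n u) ?f)" using hu(4)[OF f(1)] by simp
    also have "\<dots> = h A (neg_part (n + 1) A (actT (D n u) ?f))" using contractionD(3)[OF h A Duf DDu] by simp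
    also have "\<dots> = zeroT n A" unfolding 0 hz ..
    finally have hf: "actT (h P (D n u)) ?f = zeroT n A" .
    have "neg_part n A (D (n - 1) (actT \<theta> ?f)) = actT (neg_part n P (D (n - 1) \<theta>)) ?f"
      using D_act[OF \<theta>(1) f(1)] neg_act[OF PO T_D_pred[OF \<theta>(1)] f(1)] by simp
    also have "\<dots> = neg_part n A (actT ?\<zeta> ?f)" unfolding \<theta>(2) using neg_act[OF PO \<zeta> f(1)] by simp
    also have "actT ?\<zeta> ?f = actT u ?f" using act_sub[OF u hT f(1)] hf sub_zero[OF A uf] by simp
    finally show "neg_part n A (D (n - 1) (actT \<theta> ?f)) = neg_part n A \<xi>" using f(2) by simp
  qed
  then show ?thesis by blast
qed

text \<open>Descending induction on the degree: from degree 1 on all three coordinates are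
  nonnegative, so the quotient is zero.\<close>

lemma contraction_ex: "\<exists>h. contraction n h"
proof -
  have b: "\<exists>h. contraction n h" if "n \<ge> 1" for n
  proof -
    have "neg_part n A \<xi> = zeroT n A" for A \<xi> using that by (auto simp: neg_part_def zeroT_def split: prod.splits)
    then have "contraction n (\<lambda>A \<xi>. zeroT (n - 1) A)"
      unfolding contraction_def by (auto simp: T_zero D_zero_pred act_zero simp del: in_homs)
    then show ?thesis by blast
  qed
  have "\<exists>h. contraction (1 - int m) h" for m
  proof (induction m)
    case (Suc m)
    have "1 - int m = (1 - int (Suc m)) + 1" by simp
    then show ?case using Suc contraction_step by metis
  qed (use b in simp)
  from this[of "nat (1 - n)"] show ?thesis using b[of n] by (cases "n \<ge> 1") auto
qed

lemma negative_exact: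
  assumes "A \<in> Ob C" "\<xi> \<in> T n A" "neg_part (n + 1) A (D n \<xi>) = zeroT (n + 1) A"
  shows "\<exists>\<theta>\<in>T (n - 1) A. neg_part n A (D (n - 1) \<theta>) = neg_part n A \<xi>"
  using contraction_ex[of n] contractionD(1,2)[OF _ assms] by blast

end

lemma (in preadditive_category) add_right_commute:
  assumes "a \<in> Arr C" "b \<in> Arr C" "c \<in> Arr C" "Dom C a = Dom C c" "Dom C b = Dom C c" "Cod C a = Cod C c" "Cod C b = Cod C c"
  shows "(a \<uplus> b) \<uplus> c = (a \<uplus> c) \<uplus> b"
  using assms by (simp add: add_ac)

lemma (in preadditive_category) sum_cancel_neg:
  assumes "a \<in> Arr C" "b \<in> Arr C" "Dom C a = Dom C b" "Cod C a = Cod C b"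
  shows "(a \<setminus> (a \<uplus> b)) \<uplus> b = \<zero> (Dom C b) (Cod C b)"
proof -
  have "a \<setminus> (a \<uplus> b) = \<zero> (Dom C b) (Cod C b) \<setminus> b"
    using assms by (simp add: minus_conv_neg neg_add add_assoc[symmetric])
  then show ?thesis using assms by simp
qed

context fibration_complexes
begin

text \<open>
  In nonnegative degrees the total complex is exact with entries in \<open>W \<inter> R\<close>. A cocycle on a cofibrant object becomes a coboundary
  on a cofibrant cover, and what obstructs descent is a cocycle of lower degree on the kernel of the cover, again cofibrant.
\<close>

definition pos_cocycle :: "int \<Rightarrow> 'o \<Rightarrow> 'm \<times> 'm \<times> 'm \<Rightarrow> bool" where
  "pos_cocycle n A \<xi> \<longleftrightarrow> \<xi> \<in> T n A \<and> neg_part n A \<xi> = zeroT n A \<and> D n \<xi> = zeroT (n + 1) A"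

definition local_coboundary :: "int \<Rightarrow> 'o \<Rightarrow> 'm \<times> 'm \<times> 'm \<Rightarrow> bool" where
  "local_coboundary n A \<xi> \<longleftrightarrow> (\<exists>p \<theta>. is_epi C p \<and> Cod C p = A \<and> \<theta> \<in> T (n - 1) (Dom C p) \<and>
     neg_part (n - 1) (Dom C p) \<theta> = zeroT (n - 1) (Dom C p) \<and> D (n - 1) \<theta> = actT \<xi> p)"

lemma neg_part_D_pred: "\<lbrakk>A \<in> Ob C; \<theta> \<in> T (n - 1) A; neg_part (n - 1) A \<theta> = zeroT (n - 1) A\<rbrakk> \<Longrightarrow> neg_part n A (D (n - 1) \<theta>) = zeroT n A"
  using neg_part_D_zero[of A \<theta> "n - 1"] by simp

lemma local_coboundary_zero:
  assumes "A \<in> Ob C" shows "local_coboundary n A (zeroT n A)"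
  unfolding local_coboundary_def
  by (intro exI[of _ "Id C A"] exI[of _ "zeroT (n - 1) A"])
    (use assms T_zero[OF assms] in \<open>simp add: Id_epi neg_zero D_zero_pred act_Id[OF T_zero[OF assms]]\<close>)

lemma pos_cocycle_act:
  assumes "pos_cocycle n A \<xi>" "f \<in> homs C A' A" shows "pos_cocycle n A' (actT \<xi> f)"
proof -
  have A: "A \<in> Ob C" using assms homs_Ob by blast
  have \<xi>: "\<xi> \<in> T n A" "neg_part n A \<xi> = zeroT n A" "D n \<xi> = zeroT (n + 1) A" using assms(1) by (auto simp: pos_cocycle_def)
  show ?thesis unfolding pos_cocycle_def D_act[OF \<xi>(1) assms(2)] neg_act[OF A \<xi>(1) assms(2)] \<xi>(2,3) act_zero[OF A assms(2)]
    using T_actT[OF \<xi>(1) assms(2)] by simp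
qed

lemma pos_cocycle_sub:
  assumes "A \<in> Ob C" "pos_cocycle n A \<xi>" "\<theta> \<in> T (n - 1) A" "neg_part (n - 1) A \<theta> = zeroT (n - 1) A"
  shows "pos_cocycle n A (subT \<xi> (D (n - 1) \<theta>))"
  using assms T_D_pred[OF assms(3)] T_zero[OF assms(1)] unfolding pos_cocycle_def
  by (auto simp: T_subT neg_sub neg_part_D_pred D_sub D_D_pred sub_self)

text \<open>Being a coboundary on a cover may be tested after subtracting a boundary on a cover.
  This allows the coordinates to be removed one at a time, passing to a finer cover each
  time.\<close>

lemma local_coboundary_step:
  assumes c: "pos_cocycle n A \<xi>" and p: "is_epi C p" "Cod C p = A" and \<theta>: "\<theta> \<in> T (n - 1) (Dom C p)" "neg_part (n - 1) (Dom C p) \<theta> = zeroT (n - 1) (Dom C p)"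
    and l: "pos_cocycle n (Dom C p) (subT (actT \<xi> p) (D (n - 1) \<theta>)) \<Longrightarrow> local_coboundary n (Dom C p) (subT (actT \<xi> p) (D (n - 1) \<theta>))"
  shows "local_coboundary n A \<xi>"
proof -
  let ?A = "Dom C p"
  have ph: "p \<in> homs C ?A A" using p by simp
  have O: "?A \<in> Ob C" "A \<in> Ob C" using p epi_arr[OF p(1)] by auto
  have \<xi>: "\<xi> \<in> T n A" using c by (simp add: pos_cocycle_def)
  have \<xi>p: "actT \<xi> p \<in> T n ?A" by (rule T_actT[OF \<xi> ph])
  let ?\<eta> = "subT (actT \<xi> p) (D (n - 1) \<theta>)"
  obtain q \<theta>' where q: "is_epi C q" "Cod C q = ?A" "\<theta>' \<in> T (n - 1) (Dom C q)"
    "neg_part (n - 1) (Dom C q) \<theta>' = zeroT (n - 1) (Dom C q)" "D (n - 1) \<theta>' = actT ?\<eta> q"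
    using l[OF pos_cocycle_sub[OF O(1) pos_cocycle_act[OF c ph] \<theta>]] unfolding local_coboundary_def by blast
  let ?B = "Dom C q"
  have qh: "q \<in> homs C ?B ?A" using q by simp
  have BO: "?B \<in> Ob C" using q(1) epi_arr[OF q(1)] by auto
  have \<theta>q: "actT \<theta> q \<in> T (n - 1) ?B" by (rule T_actT[OF \<theta>(1) qh])
  have "D (n - 1) (addT \<theta>' (actT \<theta> q)) = addT (actT ?\<eta> q) (actT (D (n - 1) \<theta>) q)"
    unfolding D_add[OF BO q(3) \<theta>q] q(5) D_act[OF \<theta>(1) qh] ..
  also have "\<dots> = addT (subT (actT (actT \<xi> p) q) (actT (D (n - 1) \<theta>) q)) (actT (D (n - 1) \<theta>) q)"
    unfolding act_sub[OF \<xi>p T_D_pred[OF \<theta>(1)] qh] ..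
  also have "\<dots> = actT (actT \<xi> p) q"
    by (rule sub_add[OF BO T_actT[OF \<xi>p qh] T_actT[OF T_D_pred[OF \<theta>(1)] qh]])
  also have "\<dots> = actT \<xi> (p \<bullet> q)" by (rule act_act[OF \<xi> ph qh])
  finally have Dq: "D (n - 1) (addT \<theta>' (actT \<theta> q)) = actT \<xi> (p \<bullet> q)" .
  have "neg_part (n - 1) ?B (addT \<theta>' (actT \<theta> q)) = addT (zeroT (n - 1) ?B) (zeroT (n - 1) ?B)"
    unfolding neg_add[OF BO q(3) \<theta>q] q(4) neg_act[OF O(1) \<theta>(1) qh] \<theta>(2) act_zero[OF O(1) qh] ..
  also have "\<dots> = zeroT (n - 1) ?B" using BO by (simp add: addT_def zeroT_def)
  finally have "neg_part (n - 1) ?B (addT \<theta>' (actT \<theta> q)) = zeroT (n - 1) ?B" .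
  then show ?thesis unfolding local_coboundary_def
    using Dq T_addT[OF BO q(3) \<theta>q] comp_epi[OF q(1) p(1)] q(2) p qh ph
    by (intro exI[of _ "p \<bullet> q"] exI[of _ "addT \<theta>' (actT \<theta> q)"]) simp
qed

section \<open>Local exactness in nonnegative degrees\<close>

lemma exact_diff: "exact_at C (diff X (i - 1)) (diff X i)" "exact_at C (diff Y (i - 1)) (diff Y i)" "exact_at C (diff Z (i - 1)) (diff Z i)"
  using coresolution_facts(2)[OF X, of "i - 1"] coresolution_facts(2)[OF Y, of "i - 1"] coresolution_facts(2)[OF Z, of "i - 1"] by simp_all

lemma coaug_kernel: "is_kernel C (coaug X) (diff X 0)" "is_kernel C (coaug Y) (diff Y 0)" "is_kernel C (coaug Z) (diff Z 0)"
  using exact_mono_kernel[OF coresolution_facts(9,8)[OF X]] exact_mono_kernel[OF coresolution_facts(9,8)[OF Y]]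
    exact_mono_kernel[OF coresolution_facts(9,8)[OF Z]] .

lemma coaug_mono: "is_mono C (coaug X)" "is_mono C (coaug Y)" "is_mono C (coaug Z)"
  using coaug_kernel kernel_mono by auto

text \<open>Last of the three reductions. For \<open>n \<ge> 2\<close> it is exactness of
  \<open>Z\<close>; for \<open>n = 1\<close> a primitive has to come from \<open>Y\<close>, and the
  epimorphism \<open>g\<close> provides it; for \<open>n = 0\<close> the coordinate \<open>z\<close>
  has negative degree and is zero.\<close>

lemma local_z:
  assumes c: "pos_cocycle n A (\<zero> A (obj X (n + 1)), \<zero> A (obj Y n), z)" and n: "n \<ge> 0"
  shows "local_coboundary n A (\<zero> A (obj X (n + 1)), \<zero> A (obj Y n), z)" (is "local_coboundary n A ?\<xi>")
proof -
  have z: "z \<in> Arr C" "Dom C z = A" "Cod C z = obj Z (n - 1)" using c by (auto simp: pos_cocycle_def T_def)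
  have A: "A \<in> Ob C" using z by auto
  have "(\<zero> A (obj Z n) \<setminus> \<zero> A (obj Z n)) \<uplus> diff Z (n - 1) \<bullet> z = \<zero> A (obj Z n)"
    using c A unfolding pos_cocycle_def D_def zeroT_def by simp
  then have dz: "diff Z (n - 1) \<bullet> z = \<zero> A (obj Z n)" using z A by simp
  consider "n = 0" | "n = 1" | "n \<ge> 2" using n by linarith
  then show ?thesis
  proof cases
    case 1
    have "neg_part n A ?\<xi> = zeroT n A" using c by (simp add: pos_cocycle_def)
    then have "?\<xi> = zeroT n A" using 1 by (simp add: neg_part_def zeroT_def)
    then show ?thesis using local_coboundary_zero[OF A] by simp
  next
    \<comment> \<open>The cocycle \<open>z\<close> in degree 0 comes from an arrow \<open>b\<close>
      into \<open>Cod C g\<close>. After pulling back along an epimorphism, \<open>b\<close> lifts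
      through \<open>g\<close>.\<close>
    case 2
    obtain b where b: "b \<in> Arr C" "Dom C b = A" "Cod C b = Cod C g" "coaug Z \<bullet> b = z"
      using kernel_lift[OF coaug_kernel(3), of z] z dz 2 by auto
    obtain p a where p: "is_epi C p" "Cod C p = A" "a \<in> homs C (Dom C p) (Dom C g)" "g \<bullet> a = b \<bullet> p"
      using epi_pullback[OF kg(8), of b] b by metis
    let ?B = "Dom C p"
    have BO: "?B \<in> Ob C" using epi_arr[OF p(1)] by simp
    have pa: "p \<in> Arr C" using p by simp
    \<comment> \<open>The sign compensates the minus sign in front of \<open>\<beta>\<close> in
      \<open>D\<close>.\<close>
    define y where "y = \<zero> ?B (obj Y 0) \<setminus> coaug Y \<bullet> a"
    have y: "y \<in> Arr C" "Dom C y = ?B" "Cod C y = obj Y 0" using p(3) BO by (auto simp: y_def)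
    have dy: "diff Y 0 \<bullet> y = \<zero> ?B (obj Y 1)" unfolding y_def using p(3) BO aug_diff(4)[of a] by simp
    have "\<beta> 0 \<bullet> y = \<zero> ?B (obj Z 0) \<setminus> coaug Z \<bullet> (g \<bullet> a)" unfolding y_def using p(3) BO aug_chain(4)[of a] by simp
    also have "coaug Z \<bullet> (g \<bullet> a) = z \<bullet> p" unfolding p(4) by (rule comp_reduce[OF b(4)]) (use b p pa in auto)
    finally have \<beta>y: "\<zero> ?B (obj Z 0) \<setminus> \<beta> 0 \<bullet> y = z \<bullet> p"
      using z 2 pa p(2) BO sum_cancel(3)[of "\<zero> ?B (obj Z 0)" "z \<bullet> p" "z \<bullet> p"] by simp
    let ?\<theta> = "(\<zero> ?B (obj X 1), y, \<zero> ?B (obj Z (-1)))"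
    have D\<theta>: "D (n - 1) ?\<theta> = (\<zero> ?B (obj X 2), \<zero> ?B (obj Y 1), z \<bullet> p)"
      unfolding D_def using 2 dy \<beta>y y BO z pa p(2) by simp
    show ?thesis
    proof (rule local_coboundary_step[OF c p(1,2), of ?\<theta>])
      show "?\<theta> \<in> T (n - 1) ?B" using y BO 2 by (simp add: T_def)
      show "neg_part (n - 1) ?B ?\<theta> = zeroT (n - 1) ?B" using 2 by (simp add: neg_part_def zeroT_def)
      have "subT (actT ?\<xi> p) (D (n - 1) ?\<theta>) = zeroT n ?B"
        unfolding D\<theta> using z pa p(2) BO 2 by (simp add: subT_def actT_def zeroT_def)
      then show "local_coboundary n ?B (subT (actT ?\<xi> p) (D (n - 1) ?\<theta>))" using local_coboundary_zero[OF BO] by simp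
    qed
  next
    case 3
    obtain p v where p: "is_epi C p" "Cod C p = A" "v \<in> homs C (Dom C p) (obj Z (n - 1 - 1))" "diff Z (n - 1 - 1) \<bullet> v = z \<bullet> p"
      using exact_local_lift[OF exact_diff(3)[of "n - 1"], of z] z dz by auto
    let ?B = "Dom C p"
    have BO: "?B \<in> Ob C" using epi_arr[OF p(1)] by simp
    have pa: "p \<in> Arr C" using p by simp
    let ?\<theta> = "(\<zero> ?B (obj X n), \<zero> ?B (obj Y (n - 1)), v)"
    have D\<theta>: "D (n - 1) ?\<theta> = (\<zero> ?B (obj X (n + 1)), \<zero> ?B (obj Y n), z \<bullet> p)"
      unfolding D_def using p(3,4) BO z pa p(2) by simp
    show ?thesis
    proof (rule local_coboundary_step[OF c p(1,2), of ?\<theta>])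
      show "?\<theta> \<in> T (n - 1) ?B" using p(3) BO by (simp add: T_def)
      show "neg_part (n - 1) ?B ?\<theta> = zeroT (n - 1) ?B" using 3 by (simp add: neg_part_def zeroT_def)
      have "subT (actT ?\<xi> p) (D (n - 1) ?\<theta>) = zeroT n ?B"
        unfolding D\<theta> using z pa p(2) BO by (simp add: subT_def actT_def zeroT_def)
      then show "local_coboundary n ?B (subT (actT ?\<xi> p) (D (n - 1) ?\<theta>))" using local_coboundary_zero[OF BO] by simp
    qed
  qed
qed

text \<open>For \<open>n \<ge> 1\<close> exactness of \<open>Y\<close> removes \<open>y\<close> and
  leaves a case of \<open>local_z\<close>. For \<open>n = 0\<close> exactness of the given sequence
  at \<open>Dom C g\<close> takes over.\<close>

lemma local_yz:
  assumes c: "pos_cocycle n A (\<zero> A (obj X (n + 1)), y, z)" and n: "n \<ge> 0"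
  shows "local_coboundary n A (\<zero> A (obj X (n + 1)), y, z)" (is "local_coboundary n A ?\<xi>")
proof -
  have z: "z \<in> Arr C" "Dom C z = A" "Cod C z = obj Z (n - 1)" and y: "y \<in> Arr C" "Dom C y = A" "Cod C y = obj Y n"
    using c by (auto simp: pos_cocycle_def T_def)
  have A: "A \<in> Ob C" using z by auto
  have e: "\<zero> A (obj Y (n + 1)) \<setminus> diff Y n \<bullet> y = \<zero> A (obj Y (n + 1))"
    "(\<zero> A (obj Z n) \<setminus> \<beta> n \<bullet> y) \<uplus> diff Z (n - 1) \<bullet> z = \<zero> A (obj Z n)"
    using c A unfolding pos_cocycle_def D_def zeroT_def by simp_all
  have dy: "diff Y n \<bullet> y = \<zero> A (obj Y (n + 1))"
    using minus_eq_zero[of "\<zero> A (obj Y (n + 1))" "diff Y n \<bullet> y"] e(1) y A by simp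
  show ?thesis
  proof (cases "n = 0")
    \<comment> \<open>The cocycle \<open>y\<close> comes from an arrow \<open>b\<close> that
      \<open>g\<close> kills, because the coaugmentation of \<open>Z\<close> is mono. So
      \<open>b\<close> factors through \<open>k\<close>, and the coaugmentation of \<open>X\<close>
      yields a primitive on \<open>A\<close> itself; \<open>s 0 = 0\<close> keeps its third
      coordinate zero.\<close>
    case True
    have "neg_part n A ?\<xi> = zeroT n A" using c by (simp add: pos_cocycle_def)
    then have z0: "z = \<zero> A (obj Z (-1))" using True by (simp add: neg_part_def zeroT_def)
    have \<beta>y: "\<beta> 0 \<bullet> y = \<zero> A (obj Z 0)"
      using e(2) y A True minus_eq_zero[of "\<zero> A (obj Z 0)" "\<beta> 0 \<bullet> y"] unfolding z0 by simp
    obtain b where b: "b \<in> Arr C" "Dom C b = A" "Cod C b = Dom C g" "coaug Y \<bullet> b = y"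
      using kernel_lift[OF coaug_kernel(2), of y] y dy True by auto
    have "coaug Z \<bullet> (g \<bullet> b) = \<zero> A (obj Z 0)" using aug_chain(4)[of b] b(1-3) \<beta>y by (simp add: b(4))
    then have "g \<bullet> b = \<zero> A (Cod C g)" using mono_zero[OF coaug_mono(3), of "g \<bullet> b"] b(1-3) kg by simp
    then obtain \<kappa> where \<kappa>: "\<kappa> \<in> Arr C" "Dom C \<kappa> = A" "Cod C \<kappa> = Dom C k" "k \<bullet> \<kappa> = b"
      using kernel_lift[OF kg(9), of b] b(1-3) by auto
    define x where "x = coaug X \<bullet> \<kappa>"
    have x: "x \<in> Arr C" "Dom C x = A" "Cod C x = obj X 0" using \<kappa>(1-3) by (auto simp: x_def)
    have dx: "diff X 0 \<bullet> x = \<zero> A (obj X 1)" unfolding x_def using aug_diff(3)[of \<kappa>] \<kappa>(1-3) by simp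
    have \<alpha>x: "\<alpha> 0 \<bullet> x = y" unfolding x_def using aug_chain(3)[of \<kappa>] \<kappa>(1-3) by (simp add: \<kappa>(4) b(4))
    let ?\<theta> = "(x, \<zero> A (obj Y (-1)), \<zero> A (obj Z (-2)))"
    have D\<theta>: "D (n - 1) ?\<theta> = ?\<xi>" unfolding D_def z0 using True dx \<alpha>x x A s0 y by simp
    show ?thesis unfolding local_coboundary_def
    proof (intro exI[of _ "Id C A"] exI[of _ ?\<theta>] conjI)
      show "D (n - 1) ?\<theta> = actT ?\<xi> (Id C A)" unfolding D\<theta> using act_Id[of ?\<xi> n A] c by (simp add: pos_cocycle_def)
      show "?\<theta> \<in> T (n - 1) (Dom C (Id C A))" using x A True by (simp add: T_def)
      show "neg_part (n - 1) (Dom C (Id C A)) ?\<theta> = zeroT (n - 1) (Dom C (Id C A))"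
        using True A by (simp add: neg_part_def zeroT_def)
    qed (use A Id_epi in auto)
  next
    case False
    obtain p v where p: "is_epi C p" "Cod C p = A" "v \<in> homs C (Dom C p) (obj Y (n - 1))" "diff Y (n - 1) \<bullet> v = y \<bullet> p"
      using exact_local_lift[OF exact_diff(2)[of n], of y] y dy by auto
    let ?B = "Dom C p"
    have BO: "?B \<in> Ob C" using epi_arr[OF p(1)] by simp
    have pa: "p \<in> Arr C" using p by simp
    \<comment> \<open>The differential of \<open>Y\<close> enters \<open>D\<close> with a minus
      sign.\<close>
    define v' where "v' = \<zero> ?B (obj Y (n - 1)) \<setminus> v"
    have v': "v' \<in> Arr C" "Dom C v' = ?B" "Cod C v' = obj Y (n - 1)" using p(3) BO by (auto simp: v'_def)
    have "diff Y (n - 1) \<bullet> v' = \<zero> ?B (obj Y n) \<setminus> y \<bullet> p" unfolding v'_def p(4)[symmetric] using p(3) BO by simp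
    then have yv: "\<zero> ?B (obj Y n) \<setminus> diff Y (n - 1) \<bullet> v' = y \<bullet> p"
      using y pa p(2) BO sum_cancel(3)[of "\<zero> ?B (obj Y n)" "y \<bullet> p" "y \<bullet> p"] by simp
    let ?\<theta> = "(\<zero> ?B (obj X n), v', \<zero> ?B (obj Z (n - 2)))"
    have D\<theta>: "D (n - 1) ?\<theta> = (\<zero> ?B (obj X (n + 1)), y \<bullet> p, \<zero> ?B (obj Z (n - 1)) \<setminus> \<beta> (n - 1) \<bullet> v')"
      unfolding D_pred using yv BO v' by simp
    show ?thesis
    proof (rule local_coboundary_step[OF c p(1,2), of ?\<theta>])
      show "?\<theta> \<in> T (n - 1) ?B" using v' BO by (simp add: T_def)
      show "neg_part (n - 1) ?B ?\<theta> = zeroT (n - 1) ?B" using False n by (simp add: neg_part_def zeroT_def)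
      have eq: "subT (actT ?\<xi> p) (D (n - 1) ?\<theta>) = (\<zero> ?B (obj X (n + 1)), \<zero> ?B (obj Y n), z \<bullet> p \<setminus> (\<zero> ?B (obj Z (n - 1)) \<setminus> \<beta> (n - 1) \<bullet> v'))"
        unfolding D\<theta> using y pa p(2) BO by (simp add: subT_def actT_def)
      assume "pos_cocycle n ?B (subT (actT ?\<xi> p) (D (n - 1) ?\<theta>))"
      then show "local_coboundary n ?B (subT (actT ?\<xi> p) (D (n - 1) ?\<theta>))" unfolding eq by (rule local_z) (rule n)
    qed
  qed
qed

text \<open>The coordinates are removed in the order \<open>x\<close>, \<open>y\<close>,
  \<open>z\<close>, since \<open>D\<close> maps each of them only to itself and to later ones. For
  \<open>n \<ge> 0\<close> exactness of \<open>X\<close> starts the reduction; below that the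
  cocycle is zero.\<close>

lemma pos_local_exact:
  assumes c: "pos_cocycle n A \<xi>" shows "local_coboundary n A \<xi>"
proof -
  have \<xi>: "\<xi> \<in> T n A" "neg_part n A \<xi> = zeroT n A" "D n \<xi> = zeroT (n + 1) A" using c by (auto simp: pos_cocycle_def)
  obtain x y z where xyz: "\<xi> = (x, y, z)" and t: "x \<in> Arr C" "Dom C x = A" "Cod C x = obj X (n + 1)"
    "y \<in> Arr C" "Dom C y = A" "Cod C y = obj Y n" "z \<in> Arr C" "Dom C z = A" "Cod C z = obj Z (n - 1)"
    using T_cases[OF \<xi>(1)] by metis
  have A: "A \<in> Ob C" using t by auto
  have dx: "diff X (n + 1) \<bullet> x = \<zero> A (obj X (n + 1 + 1))" and \<alpha>x: "\<alpha> (n + 1) \<bullet> x \<setminus> diff Y n \<bullet> y = \<zero> A (obj Y (n + 1))"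
    using \<xi>(3) unfolding xyz D_def zeroT_def by simp_all
  consider "n \<le> -2" | "n = -1" | "n \<ge> 0" by linarith
  then show ?thesis
  proof cases
    case 1
    then have "neg_part n A \<xi> = \<xi>" by (simp add: neg_part_def xyz)
    then have "\<xi> = zeroT n A" using \<xi>(2) by metis
    then show ?thesis using local_coboundary_zero[OF A] by simp
  next
    \<comment> \<open>Only \<open>x\<close> in degree 0 can be nonzero. It comes from an arrow into
      \<open>Dom C k\<close>, which vanishes because \<open>k\<close> and the coaugmentation of
      \<open>Y\<close> are mono.\<close>
    case 2
    have yz: "y = \<zero> A (obj Y n)" "z = \<zero> A (obj Z (n - 1))" using \<xi>(2) 2 unfolding xyz neg_part_def zeroT_def by auto
    have t': "x \<in> Arr C" "Dom C x = A" "Cod C x = obj X 0" using t 2 by auto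
    obtain \<kappa> where \<kappa>: "\<kappa> \<in> Arr C" "Dom C \<kappa> = A" "Cod C \<kappa> = Dom C k" "coaug X \<bullet> \<kappa> = x"
      using kernel_lift[OF coaug_kernel(1), of x] t' dx 2 by auto
    have "\<alpha> 0 \<bullet> x = \<zero> A (obj Y 0)" using \<alpha>x t' A unfolding yz 2 by simp
    then have "coaug Y \<bullet> (k \<bullet> \<kappa>) = \<zero> A (obj Y 0)" using aug_chain(3)[of \<kappa>] \<kappa>(1-3) by (simp add: \<kappa>(4))
    then have "k \<bullet> \<kappa> = \<zero> A (Dom C g)" using mono_zero[OF coaug_mono(2), of "k \<bullet> \<kappa>"] \<kappa>(1-3) kg by simp
    then have "\<kappa> = \<zero> A (Dom C k)" using k_zero[of \<kappa>] \<kappa>(1-3) by simp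
    then have "x = \<zero> A (obj X 0)" using \<kappa>(4)[symmetric] A by simp
    then have "\<xi> = zeroT n A" unfolding xyz yz zeroT_def using 2 by simp
    then show ?thesis using local_coboundary_zero[OF A] by simp
  next
    case 3
    obtain p u where p: "is_epi C p" "Cod C p = A" "u \<in> homs C (Dom C p) (obj X n)" "diff X n \<bullet> u = x \<bullet> p"
      using exact_local_lift[OF exact_diff(1)[of "n + 1"], of x] t dx by auto
    let ?B = "Dom C p"
    have BO: "?B \<in> Ob C" using epi_arr[OF p(1)] by simp
    have pa: "p \<in> Arr C" using p by simp
    let ?\<theta> = "(u, \<zero> ?B (obj Y (n - 1)), \<zero> ?B (obj Z (n - 2)))"
    have D\<theta>: "D (n - 1) ?\<theta> = (x \<bullet> p, \<alpha> n \<bullet> u, s n \<bullet> u)"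
      unfolding D_pred using p(3,4) BO by simp
    show ?thesis
    proof (rule local_coboundary_step[OF c p(1,2), of ?\<theta>])
      show "?\<theta> \<in> T (n - 1) ?B" using p(3) BO by (simp add: T_def)
      show "neg_part (n - 1) ?B ?\<theta> = zeroT (n - 1) ?B" using 3 by (simp add: neg_part_def zeroT_def)
      have eq: "subT (actT \<xi> p) (D (n - 1) ?\<theta>) = (\<zero> ?B (obj X (n + 1)), y \<bullet> p \<setminus> \<alpha> n \<bullet> u, z \<bullet> p \<setminus> s n \<bullet> u)"
        unfolding D\<theta> xyz using t pa p(2) BO by (simp add: subT_def actT_def)
      assume "pos_cocycle n ?B (subT (actT \<xi> p) (D (n - 1) ?\<theta>))"
      then show "local_coboundary n ?B (subT (actT \<xi> p) (D (n - 1) ?\<theta>))" unfolding eq by (rule local_yz) (rule 3)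
    qed
  qed
qed

text \<open>The coordinates of nonnegative degree take values in \<open>W \<inter> R\<close> and
  extend along a cofibration; those of negative degree are zero and are extended by zero.\<close>

lemma pos_extend:
  assumes j: "is_mono C j" "cokernel_in C j Q" and \<xi>: "\<xi> \<in> T n (Dom C j)" "neg_part n (Dom C j) \<xi> = zeroT n (Dom C j)"
  shows "\<exists>\<xi>'\<in>T n (Cod C j). neg_part n (Cod C j) \<xi>' = zeroT n (Cod C j) \<and> actT \<xi>' j = \<xi>"
proof -
  have jO: "Dom C j \<in> Ob C" "Cod C j \<in> Ob C" "j \<in> Arr C" using j by auto
  obtain x y z where xyz: "\<xi> = (x, y, z)" and t: "x \<in> homs C (Dom C j) (obj X (n + 1))"
    "y \<in> homs C (Dom C j) (obj Y n)" "z \<in> homs C (Dom C j) (obj Z (n - 1))"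
    using \<xi>(1) by (auto simp: T_def)
  have ext: "\<exists>c'\<in>homs C (Cod C j) (obj L i). (i < 0 \<longrightarrow> c' = \<zero> (Cod C j) (obj L i)) \<and> c' \<bullet> j = c"
    if L: "coresolution B L" and c: "c \<in> homs C (Dom C j) (obj L i)" and c0: "i < 0 \<longrightarrow> c = \<zero> (Dom C j) (obj L i)" for B L i c
  proof (cases "i < 0")
    case True
    then show ?thesis using c0 jO coresolution_arr(10)[OF L] by (intro bexI[of _ "\<zero> (Cod C j) (obj L i)"]) auto
  next
    case False
    then have "extension_property C Q (obj L i)" using coresolution_facts(11)[OF L, of i] by (simp flip: RW_iff)
    then show ?thesis using extension_propertyD[OF _ j c] False by metis
  qed
  have n: "n + 1 < 0 \<longrightarrow> x = \<zero> (Dom C j) (obj X (n + 1))" "n < 0 \<longrightarrow> y = \<zero> (Dom C j) (obj Y n)" "n - 1 < 0 \<longrightarrow> z = \<zero> (Dom C j) (obj Z (n - 1))"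
    using \<xi>(2) unfolding xyz neg_part_def zeroT_def by (auto split: if_splits)
  obtain x' where x': "x' \<in> homs C (Cod C j) (obj X (n + 1))" "n + 1 < 0 \<longrightarrow> x' = \<zero> (Cod C j) (obj X (n + 1))" "x' \<bullet> j = x"
    using ext[OF X t(1) n(1)] by blast
  obtain y' where y': "y' \<in> homs C (Cod C j) (obj Y n)" "n < 0 \<longrightarrow> y' = \<zero> (Cod C j) (obj Y n)" "y' \<bullet> j = y"
    using ext[OF Y t(2) n(2)] by blast
  obtain z' where z': "z' \<in> homs C (Cod C j) (obj Z (n - 1))" "n - 1 < 0 \<longrightarrow> z' = \<zero> (Cod C j) (obj Z (n - 1))" "z' \<bullet> j = z"
    using ext[OF Z t(3) n(3)] by blast
  show ?thesis
    by (rule bexI[of _ "(x', y', z')"], rule conjI)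
      (use x' y' z' in \<open>simp_all add: xyz T_def actT_def neg_part_def zeroT_def\<close>)
qed

lemma cokernel_desc_T:
  assumes p: "is_cokernel C p j" and \<eta>: "\<eta> \<in> T n (Dom C p)" "actT \<eta> j = zeroT n (Dom C j)"
  shows "\<exists>\<zeta>\<in>T n (Cod C p). actT \<zeta> p = \<eta>"
proof -
  note sp = cokernel_simps[OF p]
  obtain x y z where xyz: "\<eta> = (x, y, z)" and t: "x \<in> Arr C" "Dom C x = Dom C p" "Cod C x = obj X (n + 1)"
    "y \<in> Arr C" "Dom C y = Dom C p" "Cod C y = obj Y n" "z \<in> Arr C" "Dom C z = Dom C p" "Cod C z = obj Z (n - 1)"
    using T_cases[OF \<eta>(1)] by metis
  have n: "x \<bullet> j = \<zero> (Dom C j) (Cod C x)" "y \<bullet> j = \<zero> (Dom C j) (Cod C y)" "z \<bullet> j = \<zero> (Dom C j) (Cod C z)"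
    using \<eta>(2) t unfolding xyz actT_def zeroT_def by auto
  have d: "Dom C x = Cod C j" "Dom C y = Cod C j" "Dom C z = Cod C j" using t sp by auto
  obtain x' where x': "x' \<in> homs C (Cod C p) (Cod C x)" "x' \<bullet> p = x" using cokernel_ex[OF p t(1) d(1) n(1)] by blast
  obtain y' where y': "y' \<in> homs C (Cod C p) (Cod C y)" "y' \<bullet> p = y" using cokernel_ex[OF p t(4) d(2) n(2)] by blast
  obtain z' where z': "z' \<in> homs C (Cod C p) (Cod C z)" "z' \<bullet> p = z" using cokernel_ex[OF p t(7) d(3) n(3)] by blast
  show ?thesis by (rule bexI[of _ "(x', y', z')"]) (use x' y' z' t in \<open>simp_all add: xyz T_def actT_def\<close>)
qed

lemma pos_exact_step:
  assumes IH: "\<And>A \<xi>. A \<in> Q \<Longrightarrow> pos_cocycle (n - 1) A \<xi> \<Longrightarrow> \<exists>\<theta>\<in>T (n - 2) A. neg_part (n - 2) A \<theta> = zeroT (n - 2) A \<and> D (n - 2) \<theta> = \<xi>"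
    and A: "A \<in> Q" and c: "pos_cocycle n A \<xi>"
  shows "\<exists>\<theta>\<in>T (n - 1) A. neg_part (n - 1) A \<theta> = zeroT (n - 1) A \<and> D (n - 1) \<theta> = \<xi>"
proof -
  have \<xi>: "\<xi> \<in> T n A" "neg_part n A \<xi> = zeroT n A" "D n \<xi> = zeroT (n + 1) A" using c by (auto simp: pos_cocycle_def)
  have AO: "A \<in> Ob C" using A by simp
  obtain p1 \<theta>1 where p1: "is_epi C p1" "Cod C p1 = A" "\<theta>1 \<in> T (n - 1) (Dom C p1)"
    "neg_part (n - 1) (Dom C p1) \<theta>1 = zeroT (n - 1) (Dom C p1)" "D (n - 1) \<theta>1 = actT \<xi> p1"
    using pos_local_exact[OF c] unfolding local_coboundary_def by blast
  have A1: "Dom C p1 \<in> Ob C" "p1 \<in> Arr C" using epi_arr[OF p1(1)] by auto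
  \<comment> \<open>The cover is refined to a cofibrant one. Then \<open>p\<close> is an epimorphism
    between cofibrant objects and its kernel is cofibrant by \<open>Q_kernel\<close>, so the
    induction hypothesis applies to that kernel.\<close>
  obtain f e where e: "short_exact C f e" "Cod C e = Dom C p1" "Dom C e \<in> Q"
    using model_facts(6) A1(1) unfolding complete_pair_def by blast
  note se' = short_exact_simps[OF e(1)]
  define p where "p = p1 \<bullet> e"
  let ?A2 = "Dom C e"
  have pe: "is_epi C p" unfolding p_def by (rule comp_epi[OF se'(6) p1(1) e(2)])
  have pd: "p \<in> Arr C" "Dom C p = ?A2" "Cod C p = A" using se' e p1 A1 by (auto simp: p_def)
  have A2: "?A2 \<in> Ob C" using e by simp
  have eh: "e \<in> homs C ?A2 (Dom C p1)" using se' e by simp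
  have p1h: "p1 \<in> homs C (Dom C p1) A" using A1 p1 by simp
  obtain j where j: "is_kernel C j p" using kernels pd by blast
  have sp: "short_exact C j p" by (rule short_exactI2[OF pe j])
  note sj = short_exact_simps[OF sp]
  have jh: "j \<in> homs C (Dom C j) ?A2" "Cod C j = ?A2" using sj pd by auto
  have NQ: "Dom C j \<in> Q" by (rule Q_kernel[OF sp]) (use pd A e in auto)
  have NO: "Dom C j \<in> Ob C" using NQ by simp
  have jc: "cokernel_in C j Q" using sj(8) pd A unfolding cokernel_in_def by auto
  let ?\<theta> = "actT \<theta>1 e"
  have \<theta>: "?\<theta> \<in> T (n - 1) ?A2" by (rule T_actT[OF p1(3) eh])
  have \<theta>n: "neg_part (n - 1) ?A2 ?\<theta> = zeroT (n - 1) ?A2" unfolding neg_act[OF A1(1) p1(3) eh] p1(4) by (rule act_zero[OF A1(1) eh])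
  have D\<theta>: "D (n - 1) ?\<theta> = actT \<xi> p" unfolding D_act[OF p1(3) eh] p1(5) p_def by (rule act_act[OF \<xi>(1) p1h eh])
  have ph: "p \<in> homs C ?A2 A" using pd by simp
  have "D (n - 1) (actT ?\<theta> j) = actT \<xi> (p \<bullet> j)" unfolding D_act[OF \<theta> jh(1)] D\<theta> by (rule act_act[OF \<xi>(1) ph jh(1)])
  also have "\<dots> = zeroT n (Dom C j)" unfolding sj(4) pd(3) by (rule act_by_zero[OF \<xi>(1) NO])
  finally have "pos_cocycle (n - 1) (Dom C j) (actT ?\<theta> j)"
    unfolding pos_cocycle_def neg_act[OF A2 \<theta> jh(1)] \<theta>n act_zero[OF A2 jh(1)]
    using T_actT[OF \<theta> jh(1)] by simp
  from IH[OF NQ this] obtain \<theta>2 where \<theta>2: "\<theta>2 \<in> T (n - 2) (Dom C j)" "neg_part (n - 2) (Dom C j) \<theta>2 = zeroT (n - 2) (Dom C j)"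
    "D (n - 2) \<theta>2 = actT ?\<theta> j" by blast
  obtain \<theta>3 where \<theta>3: "\<theta>3 \<in> T (n - 2) ?A2" "neg_part (n - 2) ?A2 \<theta>3 = zeroT (n - 2) ?A2" "actT \<theta>3 j = \<theta>2"
    using pos_extend[OF sj(5) jc \<theta>2(1,2)] unfolding jh(2) by blast
  have D3: "D (n - 2) \<theta>3 \<in> T (n - 1) ?A2" using T_D[OF \<theta>3(1)] by simp
  \<comment> \<open>The restriction of \<open>?\<theta>\<close> to the kernel has a primitive
    \<open>\<theta>2\<close>, which extends to \<open>\<theta>3\<close>. Subtracting its boundary
    leaves \<open>D (n - 1)\<close> of \<open>?\<theta>\<close> unchanged and makes the result
    vanish on \<open>j\<close>, so it descends to \<open>A\<close>.\<close>
  let ?\<eta> = "subT ?\<theta> (D (n - 2) \<theta>3)"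
  have \<eta>: "?\<eta> \<in> T (n - 1) ?A2" by (rule T_subT[OF A2 \<theta> D3])
  have "actT ?\<eta> j = subT (actT ?\<theta> j) (actT (D (n - 2) \<theta>3) j)" by (rule act_sub[OF \<theta> D3 jh(1)])
  also have "actT (D (n - 2) \<theta>3) j = actT ?\<theta> j" using D_act[OF \<theta>3(1) jh(1)] \<theta>3(3) \<theta>2(3) by simp
  also have "subT (actT ?\<theta> j) (actT ?\<theta> j) = zeroT (n - 1) (Dom C j)" by (rule sub_self[OF NO T_actT[OF \<theta> jh(1)]])
  finally have "actT ?\<eta> j = zeroT (n - 1) (Dom C j)" .
  with \<eta> obtain \<zeta> where \<zeta>: "\<zeta> \<in> T (n - 1) A" "actT \<zeta> p = ?\<eta>" using cokernel_desc_T[OF sj(8), of ?\<eta> "n - 1"] unfolding pd by blast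
  have "neg_part (n - 1) ?A2 (D (n - 2) \<theta>3) = zeroT (n - 1) ?A2" using neg_part_D_zero[OF A2 \<theta>3(1,2)] by simp
  then have "neg_part (n - 1) ?A2 ?\<eta> = zeroT (n - 1) ?A2"
    unfolding neg_sub[OF A2 \<theta> D3] \<theta>n by (simp add: sub_self[OF A2 T_zero[OF A2]])
  then have "actT (neg_part (n - 1) A \<zeta>) p = actT (zeroT (n - 1) A) p"
    unfolding \<zeta>(2)[symmetric] neg_act[OF AO \<zeta>(1) ph] act_zero[OF AO ph] .
  then have \<zeta>n: "neg_part (n - 1) A \<zeta> = zeroT (n - 1) A"
    by (rule act_epi_cancel[OF pe pd(3) T_neg[OF AO \<zeta>(1)] T_zero[OF AO]])
  have DD3: "D (n - 1) (D (n - 2) \<theta>3) = zeroT n ?A2" using D_D[OF A2 \<theta>3(1)] by simp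
  have "actT (D (n - 1) \<zeta>) p = D (n - 1) ?\<eta>" using D_act[OF \<zeta>(1) ph] \<zeta>(2) by simp
  also have "\<dots> = actT \<xi> p" unfolding D_sub[OF A2 \<theta> D3] D\<theta> DD3 by (rule sub_zero[OF A2 T_actT[OF \<xi>(1) ph]])
  finally have "D (n - 1) \<zeta> = \<xi>" by (rule act_epi_cancel[OF pe pd(3) T_D_pred[OF \<zeta>(1)] \<xi>(1)])
  then show ?thesis using \<zeta>(1) \<zeta>n by blast
qed

lemma pos_exact:
  assumes "A \<in> Q" "pos_cocycle n A \<xi>"
  shows "\<exists>\<theta>\<in>T (n - 1) A. neg_part (n - 1) A \<theta> = zeroT (n - 1) A \<and> D (n - 1) \<theta> = \<xi>"
proof -
  have base: "\<exists>\<theta>\<in>T (n - 1) A. neg_part (n - 1) A \<theta> = zeroT (n - 1) A \<and> D (n - 1) \<theta> = \<xi>"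
    if n: "n \<le> -2" and A: "A \<in> Q" and c: "pos_cocycle n A \<xi>" for n A \<xi>
  proof -
    have AO: "A \<in> Ob C" using A by simp
    have \<xi>: "\<xi> \<in> T n A" "neg_part n A \<xi> = zeroT n A" using c by (auto simp: pos_cocycle_def)
    have "neg_part n A \<xi> = \<xi>" using n by (simp add: neg_part_def split: prod.splits)
    then have "\<xi> = zeroT n A" using \<xi> by simp
    then show ?thesis using T_zero[OF AO] by (intro bexI[of _ "zeroT (n - 1) A"]) (simp_all add: neg_zero D_zero_pred AO)
  qed
  \<comment> \<open>The induction starts in degree \<open>-2\<close>, where every coordinate has
    negative degree and a cocycle of the subcomplex is therefore zero.\<close>
  have "\<forall>A\<in>Q. \<forall>\<xi>. pos_cocycle (int m - 2) A \<xi> \<longrightarrow>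
      (\<exists>\<theta>\<in>T (int m - 2 - 1) A. neg_part (int m - 2 - 1) A \<theta> = zeroT (int m - 2 - 1) A \<and> D (int m - 2 - 1) \<theta> = \<xi>)" for m
  proof (induction m)
    case 0
    then show ?case using base[of "-2"] by simp
  next
    case (Suc m)
    have e: "int (Suc m) - 2 - 1 = int m - 2" "int (Suc m) - 2 - 2 = int m - 2 - 1" by auto
    show ?case using pos_exact_step[of "int (Suc m) - 2"] Suc unfolding e by blast
  qed
  note ex = this[of "nat (n + 2)"]
  show ?thesis
  proof (cases "n \<le> -2")
    case False
    then have e: "int (nat (n + 2)) - 2 = n" by simp
    show ?thesis using ex[unfolded e] assms by blast
  qed (use base assms in blast)
qed

text \<open>A primitive modulo nonnegative entries is subtracted first; the remainder is a cocycle
  of the subcomplex, where \<open>pos_exact\<close> applies.\<close>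

lemma total_complex_exact:
  assumes A: "A \<in> Q" and \<xi>: "\<xi> \<in> T n A" "D n \<xi> = zeroT (n + 1) A"
  shows "\<exists>\<theta>\<in>T (n - 1) A. D (n - 1) \<theta> = \<xi>"
proof -
  have AO: "A \<in> Ob C" using A by simp
  obtain \<theta> where \<theta>: "\<theta> \<in> T (n - 1) A" "neg_part n A (D (n - 1) \<theta>) = neg_part n A \<xi>"
    using negative_exact[OF AO \<xi>(1)] \<xi>(2) by (auto simp: neg_zero)
  let ?\<eta> = "subT \<xi> (D (n - 1) \<theta>)"
  note D1 = T_D_pred[OF \<theta>(1)]
  have "pos_cocycle n A ?\<eta>"
    unfolding pos_cocycle_def neg_sub[OF AO \<xi>(1) D1] \<theta>(2) D_sub[OF AO \<xi>(1) D1] \<xi>(2) D_D_pred[OF AO \<theta>(1)]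
    using sub_self[OF AO T_neg[OF AO \<xi>(1)]] sub_self[OF AO T_zero[OF AO]] T_subT[OF AO \<xi>(1) D1] by simp
  from pos_exact[OF A this] obtain \<theta>' where \<theta>': "\<theta>' \<in> T (n - 1) A" "D (n - 1) \<theta>' = ?\<eta>" by blast
  have "D (n - 1) (addT \<theta>' \<theta>) = \<xi>" unfolding D_add[OF AO \<theta>'(1) \<theta>(1)] \<theta>'(2) by (rule sub_add[OF AO \<xi>(1) D1])
  then show ?thesis using T_addT[OF AO \<theta>'(1) \<theta>(1)] by blast
qed

lemma hom_exact_triple:
  assumes A: "A \<in> Q"
  shows "exact_triple (Hom_cpx A X) (Hom_cpx A Y) (Hom_cpx A Z) (Hom_diff X) (Hom_diff Y) (Hom_diff Z) (\<lambda>i x. \<alpha> i \<bullet> x) (\<lambda>i y. \<beta> i \<bullet> y) (\<lambda>i x. s i \<bullet> x)"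
proof (intro exact_triple.intro exact_triple_axioms.intro hom_cochain_complex[OF X] hom_cochain_complex[OF Y] hom_cochain_complex[OF Z])
  show AO: "A \<in> Ob C" "A \<in> Ob C" "A \<in> Ob C" using A by simp_all
  fix n
  show "(\<bullet>) (\<alpha> n) \<in> hom (Hom_cpx A X n) (Hom_cpx A Y n)" "(\<bullet>) (\<beta> n) \<in> hom (Hom_cpx A Y n) (Hom_cpx A Z n)" "(\<bullet>) (s n) \<in> hom (Hom_cpx A X n) (Hom_cpx A Z (n - 1))"
    by (auto simp: hom_def hom_complex_obj_def)
  show "\<alpha> (n + 1) \<bullet> Hom_diff X n x = Hom_diff Y n (\<alpha> n \<bullet> x)" if "x \<in> carrier (Hom_cpx A X n)" for x
    using that chain(1)[of x n] by (simp add: hom_complex_obj_def hom_complex_diff_def)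
  show "\<beta> (n + 1) \<bullet> Hom_diff Y n x = Hom_diff Z n (\<beta> n \<bullet> x)" if "x \<in> carrier (Hom_cpx A Y n)" for x
    using that chain(2)[of x n] by (simp add: hom_complex_obj_def hom_complex_diff_def)
  show "\<beta> n \<bullet> (\<alpha> n \<bullet> x) = Hom_diff Z (n - 1) (s n \<bullet> x) \<otimes>\<^bsub>Hom_cpx A Z n\<^esub> (s (n + 1) \<bullet> Hom_diff X n x)" if "x \<in> carrier (Hom_cpx A X n)" for x
    using that chain(3)[of x n] by (simp add: hom_complex_obj_def hom_complex_diff_def)
next
  have AO: "A \<in> Ob C" using A by simp
  fix n x y z assume *: "x \<in> carrier (Hom_cpx A X (n + 1))" "y \<in> carrier (Hom_cpx A Y n)" "z \<in> carrier (Hom_cpx A Z (n - 1))"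
    and eq: "Hom_diff X (n + 1) x = \<one>\<^bsub>Hom_cpx A X (n + 1 + 1)\<^esub>" "\<alpha> (n + 1) \<bullet> x = Hom_diff Y n y" "\<beta> n \<bullet> y = (s (n + 1) \<bullet> x) \<otimes>\<^bsub>Hom_cpx A Z n\<^esub> Hom_diff Z (n - 1) z"
  have t: "x \<in> Arr C" "Dom C x = A" "Cod C x = obj X (n + 1)" "y \<in> Arr C" "Dom C y = A" "Cod C y = obj Y n"
    "z \<in> Arr C" "Dom C z = A" "Cod C z = obj Z (n - 1)" using * by (auto simp: hom_complex_obj_def)
  have e: "diff X (n + 1) \<bullet> x = \<zero> A (obj X (n + 1 + 1))" "\<alpha> (n + 1) \<bullet> x = diff Y n \<bullet> y" "\<beta> n \<bullet> y = s (n + 1) \<bullet> x \<uplus> diff Z (n - 1) \<bullet> z"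
    using eq by (simp_all add: hom_complex_obj_def hom_complex_diff_def)
  have "s (n + 1) \<bullet> x \<setminus> (s (n + 1) \<bullet> x \<uplus> diff Z (n - 1) \<bullet> z) \<uplus> diff Z (n - 1) \<bullet> z = \<zero> A (obj Z n)"
    using t AO sum_cancel_neg[of "s (n + 1) \<bullet> x" "diff Z (n - 1) \<bullet> z"] by simp
  \<comment> \<open>The three hypotheses of \<open>total_exact\<close> are the coordinates of this
    equation. Its conclusion is likewise the equation for the primitive, with the negative terms
    moved to the other side.\<close>
  then have "D n (x, y, z) = zeroT (n + 1) A"
    unfolding D_def zeroT_def using e t AO by simp
  then obtain x' y' z' where \<theta>: "(x', y', z') \<in> T (n - 1) A" and D: "D (n - 1) (x', y', z') = (x, y, z)"
    using total_complex_exact[OF A TI[of x A n y z]] t by auto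
  have t': "x' \<in> Arr C" "Dom C x' = A" "Cod C x' = obj X n" "y' \<in> Arr C" "Dom C y' = A" "Cod C y' = obj Y (n - 1)"
    "z' \<in> Arr C" "Dom C z' = A" "Cod C z' = obj Z (n - 2)" using \<theta> by (auto simp: T_def)
  have d: "diff X n \<bullet> x' = x" "\<alpha> n \<bullet> x' \<setminus> diff Y (n - 1) \<bullet> y' = y" "(s n \<bullet> x' \<setminus> \<beta> (n - 1) \<bullet> y') \<uplus> diff Z (n - 2) \<bullet> z' = z"
    using D unfolding D_pred by auto
  have d2: "\<alpha> n \<bullet> x' = y \<uplus> diff Y (n - 1) \<bullet> y'" unfolding d(2)[symmetric] using t' by simp
  have "z \<uplus> \<beta> (n - 1) \<bullet> y' = (s n \<bullet> x' \<setminus> \<beta> (n - 1) \<bullet> y' \<uplus> \<beta> (n - 1) \<bullet> y') \<uplus> diff Z (n - 2) \<bullet> z'"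
    unfolding d(3)[symmetric] by (rule add_right_commute) (use t' in simp_all)
  also have "\<dots> = s n \<bullet> x' \<uplus> diff Z (n - 2) \<bullet> z'" using t' by simp
  finally have d3: "s n \<bullet> x' \<uplus> diff Z (n - 2) \<bullet> z' = z \<uplus> \<beta> (n - 1) \<bullet> y'" ..
  show "\<exists>x'\<in>carrier (Hom_cpx A X n). \<exists>y'\<in>carrier (Hom_cpx A Y (n - 1)). \<exists>z'\<in>carrier (Hom_cpx A Z (n - 2)).
      x = Hom_diff X n x' \<and> \<alpha> n \<bullet> x' = y \<otimes>\<^bsub>Hom_cpx A Y n\<^esub> Hom_diff Y (n - 1) y' \<and>
      (s n \<bullet> x') \<otimes>\<^bsub>Hom_cpx A Z (n - 1)\<^esub> Hom_diff Z (n - 2) z' = z \<otimes>\<^bsub>Hom_cpx A Z (n - 1)\<^esub> (\<beta> (n - 1) \<bullet> y')"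
    by (rule bexI[of _ x'], rule bexI[of _ y'], rule bexI[of _ z'])
      (use t' d(1) d2 d3 in \<open>simp_all add: hom_complex_obj_def hom_complex_diff_def\<close>)
qed

end

context chosen_coresolutions
begin

lemma fibration_long_exact:
  assumes A: "A \<in> Q" and g: "fibration C R g" and k: "is_kernel C k g"
  shows "\<exists>\<delta>. long_exact_sequence (\<lambda>n. rExt C K n A (Dom C k)) (\<lambda>n. rExt C K n A (Dom C g)) (\<lambda>n. rExt C K n A (Cod C g))
     (\<lambda>n. rExt_cov C K n A k) (\<lambda>n. rExt_cov C K n A g) \<delta>"
proof -
  have ge: "is_epi C g" "kernel_in C g R" using g by (auto simp: fibration_def)
  have se: "short_exact C k g" by (rule short_exactI2[OF ge(1) k])
  note t = short_exact_simps[OF se]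
  have o: "Dom C k \<in> Ob C" "Dom C g \<in> Ob C" "Cod C g \<in> Ob C" and AO: "A \<in> Ob C" using t A by auto
  have kh: "k \<in> homs C (Dom C k) (Dom C g)" and gh: "g \<in> homs C (Dom C g) (Cod C g)" using t by auto
  note L = K[OF o(1)] K[OF o(2)] K[OF o(3)]
  obtain \<alpha> where \<alpha>: "extends_to C (K (Dom C k)) (K (Dom C g)) k \<alpha>" using chain_map_ex[OF kh] by blast
  obtain \<beta> where \<beta>: "extends_to C (K (Dom C g)) (K (Cod C g)) g \<beta>" using chain_map_ex[OF gh] by blast
  \<comment> \<open>The composite extends \<open>g \<bullet> k = 0\<close>, so
    \<open>null_homotopy\<close> supplies the secondary differential \<open>s\<close> with
    \<open>s 0 = 0\<close>.\<close>
  have "extends_to C (K (Dom C k)) (K (Cod C g)) (\<zero> (Dom C k) (Cod C g)) (\<lambda>i. \<beta> i \<bullet> \<alpha> i)"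
    using extends_to_comp[OF L kh gh \<alpha> \<beta>] t(4) by simp
  from null_homotopy[OF L(1,3) this] obtain s where s: "\<And>i. s i \<in> homs C (obj (K (Dom C k)) i) (obj (K (Cod C g)) (i - 1))"
    "s 0 = \<zero> (obj (K (Dom C k)) 0) (obj (K (Cod C g)) (-1))"
    "\<And>i. \<beta> i \<bullet> \<alpha> i = diff (K (Cod C g)) (i - 1) \<bullet> s i \<uplus> s (i + 1) \<bullet> diff (K (Dom C k)) i" by blast
  interpret fibration_complexes C Q W R k g "K (Dom C k)" "K (Dom C g)" "K (Cod C g)" \<alpha> \<beta> s
    by (intro fibration_complexes.intro fibration_complexes_axioms.intro model_structure_axioms se L \<alpha> \<beta> s kernel_unique_in_R[OF k ge(2)])
  from hom_long_exact[OF AO AO AO o hom_exact_triple[OF A], of "\<lambda>n. rExt_cov C K n A k" "\<lambda>n. rExt_cov C K n A g"]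
  show ?thesis using rExt_cov_class[OF AO kh \<alpha>] rExt_cov_class[OF AO gh \<beta>] by blast
qed

end

text \<open>The existence of a choice of coresolutions ensures that the quantification over
  \<open>K\<close> is not vacuous. The commutation of the two actions combines the functors in each
  variable into a bifunctor.\<close>

theorem theorem5p2:
  fixes C :: "('o, 'm) precat" and Q W R :: "'o set"
  assumes "abelian_category C" and "hereditary_abelian_model C Q W R"
  shows
    "(\<exists>K. coresolution_choice C Q W R K) \<and>
     (\<forall>K. coresolution_choice C Q W R K \<longrightarrow>
       (\<forall>n. (\<forall>A\<in>Ob C. additive_functor C (\<lambda>B. rExt C K n A B) (\<lambda>g. rExt_cov C K n A g)) \<and>
            (\<forall>B\<in>Ob C. additive_functor (op_category C) (\<lambda>A. rExt C K n A B) (\<lambda>f. rExt_con C K n f B)) \<and>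
            (\<forall>f\<in>Arr C. \<forall>g\<in>Arr C. \<forall>x\<in>carrier (rExt C K n (Cod C f) (Dom C g)).
               rExt_con C K n f (Cod C g) (rExt_cov C K n (Cod C f) g x) =
               rExt_cov C K n (Dom C f) g (rExt_con C K n f (Dom C g) x))) \<and>
       (\<forall>B\<in>R.
          (\<forall>f c. cofibration C Q f \<and> is_cokernel C c f \<longrightarrow>
             (\<exists>\<delta>. long_exact_sequence
                (\<lambda>n. rExt C K n (Cod C c) B) (\<lambda>n. rExt C K n (Cod C f) B) (\<lambda>n. rExt C K n (Dom C f) B)
                (\<lambda>n. rExt_con C K n c B) (\<lambda>n. rExt_con C K n f B) \<delta>)) \<and>
          (\<forall>n f g. right_homotopic C Q W f g \<longrightarrow>
             (\<forall>x\<in>carrier (rExt C K n (Cod C f) B). rExt_con C K n f B x = rExt_con C K n g B x)) \<and>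
          (\<forall>n. factors_via (op_category C) (op_category (stable_category C (core Q W R))) (stable_class C (core Q W R))
             (\<lambda>A. rExt C K n A B) (\<lambda>f. rExt_con C K n f B))) \<and>
       (\<forall>A\<in>Q. \<forall>g k. fibration C R g \<and> is_kernel C k g \<longrightarrow>
          (\<exists>\<delta>. long_exact_sequence
             (\<lambda>n. rExt C K n A (Dom C k)) (\<lambda>n. rExt C K n A (Dom C g)) (\<lambda>n. rExt C K n A (Cod C g))
             (\<lambda>n. rExt_cov C K n A k) (\<lambda>n. rExt_cov C K n A g) \<delta>)) \<and>
       (\<forall>A\<in>Ob C. \<forall>n. factors_via C (stable_category C (core Q W R)) (stable_class C (core Q W R))
          (\<lambda>B. rExt C K n A B) (\<lambda>g. rExt_cov C K n A g)))"
proof -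
  interpret model_structure C Q W R
    by (intro model_structure.intro model_structure_axioms.intro assms)
  show ?thesis
  proof (intro conjI allI impI ballI)
    show "\<exists>K. coresolution_choice C Q W R K" by (rule coresolution_choice_ex)
  next
    fix K assume "coresolution_choice C Q W R K"
    then interpret chosen_coresolutions C Q W R K
      by (intro chosen_coresolutions.intro chosen_coresolutions_axioms.intro model_structure_axioms)
    show "additive_functor C (\<lambda>B. rExt C K n A B) (\<lambda>g. rExt_cov C K n A g)" if "A \<in> Ob C" for n A
      by (rule rExt_cov_functor[OF that])
    show "additive_functor (op_category C) (\<lambda>A. rExt C K n A B) (\<lambda>f. rExt_con C K n f B)" if "B \<in> Ob C" for n B
      by (rule rExt_con_functor[OF that])
    show "rExt_con C K n f (Cod C g) (rExt_cov C K n (Cod C f) g x) = rExt_cov C K n (Dom C f) g (rExt_con C K n f (Dom C g) x)"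
      if "f \<in> Arr C" "g \<in> Arr C" "x \<in> carrier (rExt C K n (Cod C f) (Dom C g))" for n f g x
      by (rule rExt_bifunctor[OF that])
    show "\<exists>\<delta>. long_exact_sequence (\<lambda>n. rExt C K n (Cod C c) B) (\<lambda>n. rExt C K n (Cod C f) B) (\<lambda>n. rExt C K n (Dom C f) B)
        (\<lambda>n. rExt_con C K n c B) (\<lambda>n. rExt_con C K n f B) \<delta>"
      if "B \<in> R" "cofibration C Q f \<and> is_cokernel C c f" for B f c
      using cofibration_long_exact that by blast
    show "rExt_con C K n f B x = rExt_con C K n g B x"
      if "B \<in> R" "right_homotopic C Q W f g" "x \<in> carrier (rExt C K n (Cod C f) B)" for B n f g x
      by (rule rExt_con_right_homotopic[OF that])
    show "factors_via (op_category C) (op_category (stable_category C (core Q W R))) (stable_class C (core Q W R))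
        (\<lambda>A. rExt C K n A B) (\<lambda>f. rExt_con C K n f B)" if "B \<in> R" for B n
      by (rule rExt_con_stable[OF that])
    show "\<exists>\<delta>. long_exact_sequence (\<lambda>n. rExt C K n A (Dom C k)) (\<lambda>n. rExt C K n A (Dom C g)) (\<lambda>n. rExt C K n A (Cod C g))
        (\<lambda>n. rExt_cov C K n A k) (\<lambda>n. rExt_cov C K n A g) \<delta>"
      if "A \<in> Q" "fibration C R g \<and> is_kernel C k g" for A g k
      using fibration_long_exact that by blast
    show "factors_via C (stable_category C (core Q W R)) (stable_class C (core Q W R)) (\<lambda>B. rExt C K n A B) (\<lambda>g. rExt_cov C K n A g)"
      if "A \<in> Ob C" for A n
      by (rule rExt_cov_stable[OF that])
  qed
qed

end
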